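(* For every $M\in\mathsf{D}^b_c(R)$ and $r\in\mathbb{Z}$, $$\sum_{i,j\,(i\le r)}(-1)^{i+j}(r-i)\,h_W^{i,j}(M)=e_r(M),$$ where $$e_r(M)=\sum_j(-1)^{j-1}T^{r-1,j-r}(M)+\sum_{i,j,l\,(\lambda_{i,j,l}\le r-i)}(-1)^{i+j}(r-i-\lambda_{i,j,l}),$$ and $(\lambda_{i,j,l})_l$ is the family of slopes (with multiplicities) of the $F$-isocrystal $H^j(M)^i\otimes_WK$.
   Context: Let $k$ be a perfect field of characteristic $p>0$, $W=W(k)$, $\sigma$ its Frobenius, $K=W[1/p]$. The Raynaud ring $R$ is the graded $W$-algebra generated by $F,V$ (degree 0) and $d$ (degree 1) with $FV=VF=p$, $Fa=\sigma(a)F$, $aV=V\sigma(a)$, $d^2=0$, $FdV=d$, $ad=da$. A graded $R$-module is a complex $(M^i,d)$ of $W_\sigma[F,V]$-modules with $FdV=d$; $M\{n\}^i=M^{n+i}$. Elementary modules: (I) concentrated in degree 0, finitely generated over $W$, $V$ topologically nilpotent; (II) $U_l$ ($l\in\mathbb{Z}$) with $U_l^0=k[[V]]$, $F=0$, $U_l^1=\prod_{n\ge l}k\,dV^n$ ($dV^n:=F^{-n}d$ for $n<0$), $V=0$. Coherent modules have finite filtrations with quotients degree shifts of elementary modules; $\mathsf{D}^b_c(R)$ is the full subcategory of the derived category of graded $R$-modules of bounded complexes with coherent cohomology; a complex is a bicomplex $M^{i,j}$ and $H^j(M)$ is the graded module with $H^j(M)^i=H^j(M^{i,\bullet})$; for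 $M$ coherent, $H^j(M)^i\otimes_WK$ is an $F$-isocrystal. For a coherent graded module $M$, with $Z^i=\ker d$, $B^i=\mathrm{im}\,d$, $V^{-\infty}Z^i=\{x:V^nx\in Z^i\,\forall n\}$, $F^\infty B^i=\{x: x\in F^nB^i\text{ some }n\}$, the map $d:M^i/V^{-\infty}Z^i\to F^\infty B^{i+1}$ shifted by $\{i\}$ is a domino (finite filtration with type II elementary quotients), and $T^i(M)$ is the number of quotients in such a filtration. Set $T^{i,j}(M)=T^i(H^j(M))$, $m^{i,j}(M)=\dim_k\frac{H^j(M)^i}{H^j(M)^i_{p\text{-tors}}+VH^j(M)^i}+\dim_k\frac{H^{j+1}(M)^{i-1}}{H^{j+1}(M)^{i-1}_{p\text{-tors}}+FH^{j+1}(M)^{i-1}}$ (torsion as $W$-modules), and the Hodge–Witt numbers $h_W^{i,j}(M)=m^{i,j}(M)+T^{i,j}(M)-2T^{i-1,j+1}(M)+T^{i-2,j+2}(M)$. *)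

theory Defs
  imports
    "HOL-Library.Poly_Mapping"
    "HOL-Library.Multiset"
    "HOL-Computational_Algebra.Primes"
    "HOL-Algebra.AbelCoset"
    "HOL-Algebra.Module"
    "Jordan_Normal_Form.VS_Connect"
begin

section \<open>Witt vectors\<close>

text \<open>
  The ground field is a type \<open>'k\<close> of class \<^class>\<open>field_prime_char\<close>, and \<open>p = CHAR('k)\<close>.
  Integer polynomials in variables indexed by \<open>'v\<close> are finitely supported maps from monomials
  \<open>'v \<Rightarrow>\<^sub>0 nat\<close> to \<open>int\<close>.  In the addition and multiplication polynomials the variable \<open>Inl i\<close> is
  the \<open>i\<close>-th component of the first argument and \<open>Inr i\<close> that of the second one.
\<close>

type_synonym 'v int_poly = "('v \<Rightarrow>\<^sub>0 nat) \<Rightarrow>\<^sub>0 int"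

definition poly_var :: "'v \<Rightarrow> 'v int_poly" where
  "poly_var v = Poly_Mapping.single (Poly_Mapping.single v 1) 1"

definition poly_eval :: "('v \<Rightarrow> 'a::comm_ring_1) \<Rightarrow> 'v int_poly \<Rightarrow> 'a" where
  "poly_eval \<rho> P = (\<Sum>m\<in>Poly_Mapping.keys P. of_int (Poly_Mapping.lookup P m) *
     (\<Prod>v\<in>Poly_Mapping.keys m. \<rho> v ^ Poly_Mapping.lookup m v))"

definition ghost :: "nat \<Rightarrow> (nat \<Rightarrow> 'a::comm_ring_1) \<Rightarrow> nat \<Rightarrow> 'a" where
  "ghost p x n = (\<Sum>i\<le>n. of_nat p ^ i * x i ^ (p ^ (n - i)))"

definition witt_add_poly :: "nat \<Rightarrow> nat \<Rightarrow> (nat + nat) int_poly" where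
  "witt_add_poly p = (THE S. \<forall>n. ghost p S n =
     ghost p (\<lambda>i. poly_var (Inl i)) n + ghost p (\<lambda>i. poly_var (Inr i)) n)"

definition witt_mult_poly :: "nat \<Rightarrow> nat \<Rightarrow> (nat + nat) int_poly" where
  "witt_mult_poly p = (THE S. \<forall>n. ghost p S n =
     ghost p (\<lambda>i. poly_var (Inl i)) n * ghost p (\<lambda>i. poly_var (Inr i)) n)"

type_synonym 'k witt = "nat \<Rightarrow> 'k"

definition witt_ring :: "('k::field_prime_char) witt ring" where
  "witt_ring = \<lparr>carrier = UNIV,
     mult = (\<lambda>a b n. poly_eval (case_sum a b) (witt_mult_poly CHAR('k) n)),
     one = (\<lambda>n. if n = 0 then 1 else 0),
     zero = (\<lambda>n. 0),
     add = (\<lambda>a b n. poly_eval (case_sum a b) (witt_add_poly CHAR('k) n))\<rparr>"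

definition witt_frob :: "('k::field_prime_char) witt \<Rightarrow> 'k witt" where
  "witt_frob a = (\<lambda>n. a n ^ CHAR('k))"

definition teichmueller :: "('k::field_prime_char) \<Rightarrow> 'k witt" where
  "teichmueller c = (\<lambda>n. if n = 0 then c else 0)"


section \<open>Modules over the Dieudonne ring and over the Raynaud ring\<close>

text \<open>The \<open>mult\<close> and \<open>one\<close> fields inherited by a module record carry no meaning.\<close>

record ('a, 'm) f_module = "('a, 'm) module" +
  Frob :: "'m \<Rightarrow> 'm"

record ('a, 'm) fv_module = "('a, 'm) f_module" +
  Ver :: "'m \<Rightarrow> 'm"

locale dieudonne_module = Module.module witt_ring M
  for M :: "(('k::field_prime_char) witt, 'm) fv_module" (structure) +
  assumes Frob_hom: "Frob M \<in> hom (add_monoid M) (add_monoid M)"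
    and Ver_hom: "Ver M \<in> hom (add_monoid M) (add_monoid M)"
    and Frob_smult: "x \<in> carrier M \<Longrightarrow> Frob M (a \<odot> x) = witt_frob a \<odot> Frob M x"
    and Ver_smult: "x \<in> carrier M \<Longrightarrow> Ver M (witt_frob a \<odot> x) = a \<odot> Ver M x"
    and Frob_Ver: "x \<in> carrier M \<Longrightarrow> Frob M (Ver M x) = [CHAR('k)] \<cdot> x"
    and Ver_Frob: "x \<in> carrier M \<Longrightarrow> Ver M (Frob M x) = [CHAR('k)] \<cdot> x"

record ('a, 'm) graded_module =
  gr_comp :: "int \<Rightarrow> ('a, 'm) fv_module"
  gr_diff :: "int \<Rightarrow> 'm \<Rightarrow> 'm"    \<comment> \<open>\<open>gr_diff M i\<close> maps degree \<open>i\<close> to degree \<open>i + 1\<close>\<close>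

locale raynaud_module =
  fixes M :: "(('k::field_prime_char) witt, 'm) graded_module"
  assumes comp_dieudonne: "dieudonne_module (gr_comp M i)"
    and diff_hom: "gr_diff M i \<in> LinearCombinations.module_hom witt_ring (gr_comp M i) (gr_comp M (i + 1))"
    and diff_diff: "x \<in> carrier (gr_comp M i) \<Longrightarrow>
          gr_diff M (i + 1) (gr_diff M i x) = \<zero>\<^bsub>gr_comp M (i + 1 + 1)\<^esub>"
    and Frob_diff_Ver: "x \<in> carrier (gr_comp M i) \<Longrightarrow>
          Frob (gr_comp M (i + 1)) (gr_diff M i (Ver (gr_comp M i) x)) = gr_diff M i x"

definition shift :: "int \<Rightarrow> ('a, 'm) graded_module \<Rightarrow> ('a, 'm) graded_module" where
  "shift n M = \<lparr>gr_comp = (\<lambda>i. gr_comp M (n + i)), gr_diff = (\<lambda>i. gr_diff M (n + i))\<rparr>"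

definition graded_submodule ::
    "(int \<Rightarrow> 'm set) \<Rightarrow> (('k::field_prime_char) witt, 'm) graded_module \<Rightarrow> bool" where
  "graded_submodule N M \<longleftrightarrow> (\<forall>i.
     LinearCombinations.submodule witt_ring (N i) (gr_comp M i) \<and>
     Frob (gr_comp M i) ` N i \<subseteq> N i \<and>
     Ver (gr_comp M i) ` N i \<subseteq> N i \<and>
     gr_diff M i ` N i \<subseteq> N (i + 1))"

text \<open>
  Subquotients \<open>B / A\<close> for submodules \<open>A \<subseteq> B \<subseteq> M\<close>.  Elements are cosets of \<open>A\<close>; an operation is
  applied to all representatives, so that the unions below are unions of equal cosets.
\<close>

definition fv_subquot :: "('a, 'm) fv_module \<Rightarrow> 'm set \<Rightarrow> 'm set \<Rightarrow> ('a, 'm set) fv_module" where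
  "fv_subquot M B A = \<lparr>carrier = (\<lambda>x. A +>\<^bsub>M\<^esub> x) ` B,
     mult = undefined, one = undefined,
     zero = A,
     add = (\<lambda>X Y. X <+>\<^bsub>M\<^esub> Y),
     smult = (\<lambda>a X. \<Union>x\<in>X. A +>\<^bsub>M\<^esub> (a \<odot>\<^bsub>M\<^esub> x)),
     Frob = (\<lambda>X. \<Union>x\<in>X. A +>\<^bsub>M\<^esub> Frob M x),
     Ver = (\<lambda>X. \<Union>x\<in>X. A +>\<^bsub>M\<^esub> Ver M x)\<rparr>"

definition gr_subquot ::
    "('a, 'm) graded_module \<Rightarrow> (int \<Rightarrow> 'm set) \<Rightarrow> (int \<Rightarrow> 'm set) \<Rightarrow> ('a, 'm set) graded_module" where
  "gr_subquot M B A = \<lparr>gr_comp = (\<lambda>i. fv_subquot (gr_comp M i) (B i) (A i)),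
     gr_diff = (\<lambda>i X. \<Union>x\<in>X. A (i + 1) +>\<^bsub>gr_comp M (i + 1)\<^esub> gr_diff M i x)\<rparr>"

definition gr_isomorphic ::
    "('a, 'm) graded_module \<Rightarrow> ('a, 'n) graded_module \<Rightarrow> bool" where
  "gr_isomorphic M N \<longleftrightarrow> (\<exists>f. \<forall>i.
     bij_betw (f i) (carrier (gr_comp M i)) (carrier (gr_comp N i)) \<and>
     (\<forall>x\<in>carrier (gr_comp M i). \<forall>y\<in>carrier (gr_comp M i).
        f i (x \<oplus>\<^bsub>gr_comp M i\<^esub> y) = f i x \<oplus>\<^bsub>gr_comp N i\<^esub> f i y) \<and>
     (\<forall>x\<in>carrier (gr_comp M i).
        (\<forall>a. f i (a \<odot>\<^bsub>gr_comp M i\<^esub> x) = a \<odot>\<^bsub>gr_comp N i\<^esub> f i x) \<and>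
        f i (Frob (gr_comp M i) x) = Frob (gr_comp N i) (f i x) \<and>
        f i (Ver (gr_comp M i) x) = Ver (gr_comp N i) (f i x) \<and>
        f (i + 1) (gr_diff M i x) = gr_diff N i (f i x)))"


section \<open>Coherent modules\<close>

definition fin_gen :: "('a, 'c) ring_scheme \<Rightarrow> ('a, 'm, 'e) module_scheme \<Rightarrow> bool" where
  "fin_gen R M \<longleftrightarrow> (\<exists>S. finite S \<and> S \<subseteq> carrier M \<and> LinearCombinations.module.span R M S = carrier M)"

text \<open>The topology on a finitely generated \<open>W\<close>-module is the \<open>p\<close>-adic one.\<close>

definition Ver_top_nilpotent :: "(('k::field_prime_char) witt, 'm) fv_module \<Rightarrow> bool" where
  "Ver_top_nilpotent M \<longleftrightarrow> (\<forall>m. \<exists>n0. \<forall>n\<ge>n0.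
     (Ver M ^^ n) ` carrier M \<subseteq> (\<lambda>x. [(CHAR('k) ^ m)] \<cdot>\<^bsub>M\<^esub> x) ` carrier M)"

definition elementary_I :: "(('k::field_prime_char) witt, 'm) graded_module \<Rightarrow> bool" where
  "elementary_I M \<longleftrightarrow>
     (\<forall>i. i \<noteq> 0 \<longrightarrow> carrier (gr_comp M i) = {\<zero>\<^bsub>gr_comp M i\<^esub>}) \<and>
     fin_gen witt_ring (gr_comp M 0) \<and> Ver_top_nilpotent (gr_comp M 0)"

text \<open>
  The module \<open>U\<^sub>l\<close>: a function \<open>a\<close> stands for \<open>\<Sum>n\<ge>0. a n * V^n\<close> in degree 0, and for
  \<open>\<Sum>n\<ge>l. a n * dV^n\<close> in degree 1.  The ring \<open>W\<close> acts through its residue field, from the left.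
  From \<open>aV = V\<sigma>(a)\<close>, \<open>Fa = \<sigma>(a)F\<close> and \<open>FdV = d\<close> one gets \<open>V(a V^n) = \<sigma>^{-1}(a) V^(n+1)\<close> in
  degree 0 and \<open>F(a dV^n) = \<sigma>(a) dV^(n-1)\<close> in degree 1, where \<open>dV^n\<close> is \<open>0\<close> for \<open>n < l\<close>.
\<close>

definition U_comp :: "int \<Rightarrow> int \<Rightarrow> (('k::field_prime_char) witt, int \<Rightarrow> 'k) fv_module" where
  "U_comp l i = \<lparr>carrier =
       (if i = 0 then {a. \<forall>n<0. a n = 0} else if i = 1 then {a. \<forall>n<l. a n = 0} else {\<lambda>n. 0}),
     mult = undefined, one = undefined,
     zero = (\<lambda>n. 0),
     add = (\<lambda>a b n. a n + b n),
     smult = (\<lambda>w a n. w 0 * a n),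
     Frob = (\<lambda>a n. if i = 1 \<and> n \<ge> l then a (n + 1) ^ CHAR('k) else 0),
     Ver = (\<lambda>a n. if i = 0 then inv_into UNIV (\<lambda>c. c ^ CHAR('k)) (a (n - 1)) else 0)\<rparr>"

definition U_module :: "int \<Rightarrow> (('k::field_prime_char) witt, int \<Rightarrow> 'k) graded_module" where
  "U_module l = \<lparr>gr_comp = U_comp l,
     gr_diff = (\<lambda>i a n. if i = 0 \<and> n \<ge> l then a n else 0)\<rparr>"

definition elementary_II :: "(('k::field_prime_char) witt, 'm) graded_module \<Rightarrow> bool" where
  "elementary_II M \<longleftrightarrow> (\<exists>l. gr_isomorphic M (U_module l))"

text \<open>\<open>M\<close> has a filtration of length \<open>n\<close> whose successive quotients all satisfy \<open>P\<close>.\<close>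

definition has_filtration ::
    "((('k::field_prime_char) witt, 'm set) graded_module \<Rightarrow> bool) \<Rightarrow>
     ('k witt, 'm) graded_module \<Rightarrow> nat \<Rightarrow> bool" where
  "has_filtration P M n \<longleftrightarrow> (\<exists>Fil :: nat \<Rightarrow> int \<Rightarrow> 'm set.
     Fil 0 = (\<lambda>i. {\<zero>\<^bsub>gr_comp M i\<^esub>}) \<and>
     Fil n = (\<lambda>i. carrier (gr_comp M i)) \<and>
     (\<forall>s\<le>n. graded_submodule (Fil s) M) \<and>
     (\<forall>s<n. (\<forall>i. Fil s i \<subseteq> Fil (Suc s) i) \<and> P (gr_subquot M (Fil (Suc s)) (Fil s))))"

text \<open>A module is a degree shift of an elementary one iff some degree shift of it is elementary.\<close>

definition coherent :: "(('k::field_prime_char) witt, 'm) graded_module \<Rightarrow> bool" where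
  "coherent M \<longleftrightarrow> raynaud_module M \<and>
     (\<exists>n. has_filtration (\<lambda>Q. \<exists>e. elementary_I (shift e Q) \<or> elementary_II (shift e Q)) M n)"


section \<open>Dominoes\<close>

definition Ver_minus_infty_Z :: "('a, 'm) graded_module \<Rightarrow> int \<Rightarrow> 'm set" where
  "Ver_minus_infty_Z M i = {x \<in> carrier (gr_comp M i).
     \<forall>n. gr_diff M i ((Ver (gr_comp M i) ^^ n) x) = \<zero>\<^bsub>gr_comp M (i + 1)\<^esub>}"

text \<open>\<open>Frob_infty_B M i\<close> lies in degree \<open>i\<close> and is built from the image of \<open>d\<close> from degree \<open>i - 1\<close>.\<close>

definition Frob_infty_B :: "('a, 'm) graded_module \<Rightarrow> int \<Rightarrow> 'm set" where
  "Frob_infty_B M i = {x \<in> carrier (gr_comp M i).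
     \<exists>n. x \<in> (Frob (gr_comp M i) ^^ n) ` (gr_diff M (i - 1) ` carrier (gr_comp M (i - 1)))}"

text \<open>
  The two-term complex \<open>M\<^sup>i / V\<^sup>-\<^sup>\<infinity>Z\<^sup>i \<rightarrow> F\<^sup>\<infinity>B\<^sup>i\<^sup>+\<^sup>1\<close>, moved to degrees 0 and 1.
\<close>

definition domino_of :: "int \<Rightarrow> ('a, 'm) graded_module \<Rightarrow> ('a, 'm set) graded_module" where
  "domino_of i M = gr_subquot (shift i M)
     (\<lambda>n. if n = 0 then carrier (gr_comp M i)
          else if n = 1 then Frob_infty_B M (i + 1) else {\<zero>\<^bsub>gr_comp M (i + n)\<^esub>})
     (\<lambda>n. if n = 0 then Ver_minus_infty_Z M i else {\<zero>\<^bsub>gr_comp M (i + n)\<^esub>})"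

definition domino_num :: "int \<Rightarrow> (('k::field_prime_char) witt, 'm) graded_module \<Rightarrow> nat" where
  "domino_num i M = (THE n. has_filtration elementary_II (domino_of i M) n)"


section \<open>Slopes of F-isocrystals\<close>

text \<open>
  Inverting \<open>p\<close>: \<open>p_frac p M x n\<close> is the fraction \<open>x / p^n\<close>, as an equivalence class of pairs.
\<close>

definition p_frac :: "nat \<Rightarrow> ('m, 'e) ring_scheme \<Rightarrow> 'm \<Rightarrow> nat \<Rightarrow> ('m \<times> nat) set" where
  "p_frac p M x n = {(y, m). y \<in> carrier M \<and>
     (\<exists>c. [(p ^ (c + m))] \<cdot>\<^bsub>M\<^esub> x = [(p ^ (c + n))] \<cdot>\<^bsub>M\<^esub> y)}"

definition p_frac_carrier :: "nat \<Rightarrow> ('m, 'e) ring_scheme \<Rightarrow> ('m \<times> nat) set set" where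
  "p_frac_carrier p M = {p_frac p M x n |x n. x \<in> carrier M}"

definition p_frac_add ::
    "nat \<Rightarrow> ('m, 'e) ring_scheme \<Rightarrow> ('m \<times> nat) set \<Rightarrow> ('m \<times> nat) set \<Rightarrow> ('m \<times> nat) set" where
  "p_frac_add p M X Y = (\<Union>(x, n)\<in>X. \<Union>(y, m)\<in>Y.
     p_frac p M ([(p ^ m)] \<cdot>\<^bsub>M\<^esub> x \<oplus>\<^bsub>M\<^esub> [(p ^ n)] \<cdot>\<^bsub>M\<^esub> y) (n + m))"

text \<open>\<open>K = W[1/p]\<close>, built in the same way.\<close>

definition witt_field :: "(('k::field_prime_char) witt \<times> nat) set ring" where
  "witt_field = \<lparr>carrier = p_frac_carrier CHAR('k) (witt_ring :: 'k witt ring),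
     mult = (\<lambda>X Y. \<Union>(x, n)\<in>X. \<Union>(y, m)\<in>Y. p_frac CHAR('k) witt_ring (x \<otimes>\<^bsub>witt_ring\<^esub> y) (n + m)),
     one = p_frac CHAR('k) witt_ring \<one>\<^bsub>witt_ring\<^esub> 0,
     zero = p_frac CHAR('k) witt_ring \<zero>\<^bsub>witt_ring\<^esub> 0,
     add = p_frac_add CHAR('k) witt_ring\<rparr>"

text \<open>\<open>M \<otimes>\<^sub>W K\<close>, realised as the localization \<open>M[1/p]\<close>, with \<open>F (x / p^n) = F x / p^n\<close>.\<close>

definition isocrystal_of ::
    "(('k::field_prime_char) witt, 'm) fv_module \<Rightarrow>
     (('k witt \<times> nat) set, ('m \<times> nat) set) f_module" where
  "isocrystal_of M = \<lparr>carrier = p_frac_carrier CHAR('k) M,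
     mult = undefined, one = undefined,
     zero = p_frac CHAR('k) M \<zero>\<^bsub>M\<^esub> 0,
     add = p_frac_add CHAR('k) M,
     smult = (\<lambda>A X. \<Union>(a, n)\<in>A. \<Union>(x, m)\<in>X. p_frac CHAR('k) M (a \<odot>\<^bsub>M\<^esub> x) (n + m)),
     Frob = (\<lambda>X. \<Union>(x, n)\<in>X. p_frac CHAR('k) M (Frob M x) n)\<rparr>"

definition restrict_to_W ::
    "((('k::field_prime_char) witt \<times> nat) set, 'n) f_module \<Rightarrow> ('k witt, 'n) module" where
  "restrict_to_W N = \<lparr>carrier = carrier N, mult = mult N, one = one N, zero = zero N, add = add N,
     smult = (\<lambda>a x. p_frac CHAR('k) witt_ring a 0 \<odot>\<^bsub>N\<^esub> x)\<rparr>"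

definition W_lattice ::
    "'n set \<Rightarrow> ((('k::field_prime_char) witt \<times> nat) set, 'n) f_module \<Rightarrow> bool" where
  "W_lattice L N \<longleftrightarrow> (\<exists>S. finite S \<and> S \<subseteq> carrier N \<and>
     L = LinearCombinations.module.span witt_ring (restrict_to_W N) S \<and>
     LinearCombinations.module.span witt_field N S = carrier N)"

text \<open>
  An F-isocrystal is isoclinic of slope \<open>s/t\<close> if it contains a lattice \<open>L\<close> with \<open>F^t L = p^s L\<close>.
  Over a perfect field an F-isocrystal is the direct sum of its largest isoclinic
  subobjects \<open>N\<^sub>q\<close> of slope \<open>q\<close> (Dieudonne--Manin), and \<open>q\<close> is a slope with multiplicity \<open>dim N\<^sub>q\<close>.
\<close>

definition isoclinic ::
    "rat \<Rightarrow> ((('k::field_prime_char) witt \<times> nat) set, 'n) f_module \<Rightarrow> bool" where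
  "isoclinic q N \<longleftrightarrow> (\<exists>L s t. W_lattice L N \<and> t > 0 \<and> q = of_int s / of_nat t \<and>
     (Frob N ^^ t) ` L =
       (\<lambda>x. (([CHAR('k)] \<cdot>\<^bsub>witt_field\<^esub> \<one>\<^bsub>witt_field\<^esub>) [^]\<^bsub>witt_field\<^esub> (s::int)) \<odot>\<^bsub>N\<^esub> x) ` L)"

definition slope_part ::
    "rat \<Rightarrow> ((('k::field_prime_char) witt \<times> nat) set, 'n) f_module \<Rightarrow> 'n set" where
  "slope_part q N = \<Union>{P. LinearCombinations.submodule witt_field P N \<and> Frob N ` P \<subseteq> P \<and>
     isoclinic q (N\<lparr>carrier := P\<rparr>)}"

definition slope_mult ::
    "((('k::field_prime_char) witt \<times> nat) set, 'n) f_module \<Rightarrow> rat \<Rightarrow> nat" where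
  "slope_mult N q = vectorspace.dim witt_field (N\<lparr>carrier := slope_part q N\<rparr>)"

definition slopes ::
    "((('k::field_prime_char) witt \<times> nat) set, 'n) f_module \<Rightarrow> rat multiset" where
  "slopes N = (\<Sum>q | slope_mult N q \<noteq> 0. replicate_mset (slope_mult N q) q)"


section \<open>The category of bounded complexes with coherent cohomology\<close>

text \<open>
  \<open>gr_comp (cx_obj M j) i\<close> is the term \<open>M\<^sup>i\<^sup>,\<^sup>j\<close> of the bicomplex, and \<open>cx_diff M j i\<close> maps
  it to the term with indices \<open>i\<close> and \<open>j + 1\<close>.
\<close>

record ('a, 'm) gr_complex =
  cx_obj :: "int \<Rightarrow> ('a, 'm) graded_module"
  cx_diff :: "int \<Rightarrow> int \<Rightarrow> 'm \<Rightarrow> 'm"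

locale raynaud_complex =
  fixes M :: "(('k::field_prime_char) witt, 'm) gr_complex"
  assumes obj_raynaud: "raynaud_module (cx_obj M j)"
    and cx_diff_hom: "cx_diff M j i \<in>
          LinearCombinations.module_hom witt_ring (gr_comp (cx_obj M j) i) (gr_comp (cx_obj M (j + 1)) i)"
    and cx_diff_Frob: "x \<in> carrier (gr_comp (cx_obj M j) i) \<Longrightarrow>
          cx_diff M j i (Frob (gr_comp (cx_obj M j) i) x) =
          Frob (gr_comp (cx_obj M (j + 1)) i) (cx_diff M j i x)"
    and cx_diff_Ver: "x \<in> carrier (gr_comp (cx_obj M j) i) \<Longrightarrow>
          cx_diff M j i (Ver (gr_comp (cx_obj M j) i) x) =
          Ver (gr_comp (cx_obj M (j + 1)) i) (cx_diff M j i x)"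
    and cx_diff_gr_diff: "x \<in> carrier (gr_comp (cx_obj M j) i) \<Longrightarrow>
          cx_diff M j (i + 1) (gr_diff (cx_obj M j) i x) =
          gr_diff (cx_obj M (j + 1)) i (cx_diff M j i x)"
    and cx_diff_cx_diff: "x \<in> carrier (gr_comp (cx_obj M j) i) \<Longrightarrow>
          cx_diff M (j + 1) i (cx_diff M j i x) = \<zero>\<^bsub>gr_comp (cx_obj M (j + 1 + 1)) i\<^esub>"

definition cohomology :: "int \<Rightarrow> ('a, 'm) gr_complex \<Rightarrow> ('a, 'm set) graded_module" where
  "cohomology j M = gr_subquot (cx_obj M j)
     (\<lambda>i. {x \<in> carrier (gr_comp (cx_obj M j) i).
            cx_diff M j i x = \<zero>\<^bsub>gr_comp (cx_obj M (j + 1)) i\<^esub>})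
     (\<lambda>i. cx_diff M (j - 1) i ` carrier (gr_comp (cx_obj M (j - 1)) i))"

definition bounded_cx :: "('a, 'm) gr_complex \<Rightarrow> bool" where
  "bounded_cx M \<longleftrightarrow> (\<exists>b. \<forall>i j. \<bar>j\<bar> > b \<longrightarrow>
     carrier (gr_comp (cx_obj M j) i) = {\<zero>\<^bsub>gr_comp (cx_obj M j) i\<^esub>})"

definition in_Dbc :: "(('k::field_prime_char) witt, 'm) gr_complex \<Rightarrow> bool" where
  "in_Dbc M \<longleftrightarrow> raynaud_complex M \<and> bounded_cx M \<and> (\<forall>j. coherent (cohomology j M))"


section \<open>Hodge--Witt numbers\<close>

definition W_torsion :: "(('k::field_prime_char) witt, 'm) fv_module \<Rightarrow> 'm set" where
  "W_torsion M = {x \<in> carrier M. \<exists>a. a \<noteq> \<zero>\<^bsub>witt_ring\<^esub> \<and> a \<odot>\<^bsub>M\<^esub> x = \<zero>\<^bsub>M\<^esub>}"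

text \<open>
  A \<open>W\<close>-module killed by \<open>p\<close> is a \<open>k\<close>-vector space, where \<open>c\<close> acts by any lift of \<open>c\<close> to \<open>W\<close>,
  for instance the Teichmueller lift.
\<close>

definition k_space :: "(('k::field_prime_char) witt, 'm) fv_module \<Rightarrow> ('k, 'm) module" where
  "k_space M = \<lparr>carrier = carrier M, mult = mult M, one = one M, zero = zero M, add = add M,
     smult = (\<lambda>c x. teichmueller c \<odot>\<^bsub>M\<^esub> x)\<rparr>"

definition dim_mod_tors_Ver :: "(('k::field_prime_char) witt, 'm) fv_module \<Rightarrow> nat" where
  "dim_mod_tors_Ver M = vectorspace.dim class_ring
     (k_space (fv_subquot M (carrier M) (W_torsion M <+>\<^bsub>M\<^esub> Ver M ` carrier M)))"

definition dim_mod_tors_Frob :: "(('k::field_prime_char) witt, 'm) fv_module \<Rightarrow> nat" where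
  "dim_mod_tors_Frob M = vectorspace.dim class_ring
     (k_space (fv_subquot M (carrier M) (W_torsion M <+>\<^bsub>M\<^esub> Frob M ` carrier M)))"

definition T_num :: "int \<Rightarrow> int \<Rightarrow> (('k::field_prime_char) witt, 'm) gr_complex \<Rightarrow> int" where
  "T_num i j M = int (domino_num i (cohomology j M))"

definition m_num :: "int \<Rightarrow> int \<Rightarrow> (('k::field_prime_char) witt, 'm) gr_complex \<Rightarrow> int" where
  "m_num i j M = int (dim_mod_tors_Ver (gr_comp (cohomology j M) i)) +
     int (dim_mod_tors_Frob (gr_comp (cohomology (j + 1) M) (i - 1)))"

definition hodge_witt :: "int \<Rightarrow> int \<Rightarrow> (('k::field_prime_char) witt, 'm) gr_complex \<Rightarrow> int" where
  "hodge_witt i j M = m_num i j M + T_num i j M - 2 * T_num (i - 1) (j + 1) M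
     + T_num (i - 2) (j + 2) M"

definition cx_slopes ::
    "int \<Rightarrow> int \<Rightarrow> (('k::field_prime_char) witt, 'm) gr_complex \<Rightarrow> rat multiset" where
  "cx_slopes i j M = slopes (isocrystal_of (gr_comp (cohomology j M) i))"

text \<open>\<open>Sum_any\<close> is the sum over all indices of a finitely supported family.\<close>

definition e_num :: "int \<Rightarrow> (('k::field_prime_char) witt, 'm) gr_complex \<Rightarrow> rat" where
  "e_num r M =
     Sum_any (\<lambda>j. (-1) powi (j - 1) * of_int (T_num (r - 1) (j - r) M)) +
     Sum_any (\<lambda>(i, j). \<Sum>q\<in>#{#q \<in># cx_slopes i j M. q \<le> of_int (r - i)#}.
        (-1) powi (i + j) * (of_int (r - i) - q))"

end

theory Submission
  imports Defs "HOL-Computational_Algebra.Fraction_Field" "HOL-Library.Function_Algebras"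
begin

text \<open>
  Modulo torsion, a component \<open>N = H\<^sup>j(M)\<^sup>i\<close> has finite rank and embeds into a vector space over \<open>K\<close> as
  a \<open>W\<close>-submodule \<open>X\<close> with \<open>p X \<subseteq> F X \<subseteq> X\<close>, on which \<open>V = p F\<^sup>-\<^sup>1\<close> is topologically nilpotent; both
  properties are inherited along the filtration with elementary quotients, since type II quotients
  are killed by \<open>p\<close>.  Up to a bounded error \<open>X\<close> is the direct sum of lattices with
  \<open>F\<^sup>t L = p\<^sup>s L\<close>, and lengths of \<open>X / F X\<close> and \<open>X / p X\<close> do not see the error.  Hence all slopes lie in
  \<open>[0, 1)\<close>, their sum is the length \<open>f\<close> of \<open>X / F X\<close>, and their number is \<open>f + v\<close>, where \<open>v\<close> is the
  length of \<open>F X / p X\<close>, that is, of \<open>X / V X\<close>.  So for every integer \<open>c\<close> the sum of \<open>c - \<lambda>\<close> over the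
  slopes \<open>\<lambda> \<le> c\<close> is \<open>c\<^sup>+ v + (c - 1)\<^sup>+ f\<close>.  These are the contributions of \<open>N\<close> to the two summands of
  \<open>m\<^sup>i\<^sup>,\<^sup>j\<close>, and the domino numbers enter through the second difference of \<open>i \<mapsto> (r - i)\<^sup>+\<close>.
\<close>

section \<open>Evaluation of integer polynomials\<close>

text \<open>The components of a coherent module need not be finitely generated over
  \<open>W\<close>: type II pieces contribute torsion such as \<open>k[[V]]\<close>. Finiteness is
  therefore kept only up to a bounded power of \<open>p\<close>, and nilpotence of \<open>V\<close>
  only vectorwise and modulo torsion; both weak forms survive extensions. \<open>F\<close> is merely
  \<sigma>-semilinear, so determinants and characteristic polynomials give way to lengths of
  \<open>W\<close>-modules and to the rate at which \<open>F^N x\<close> becomes divisible by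
  \<open>p\<close>. The slope decomposition over a perfect field has to be proved: the rates of
  nonzero vectors are nonnegative with bounded denominators, so there is a least one
  \<open>s/t\<close>; the operator \<open>p^(-s) F^t\<close> then preserves a lattice, its bijective
  part is isoclinic of slope \<open>s/t\<close>, and the vectors it contracts form a smaller
  \<open>F\<close>-stable subspace, to which induction applies. The definitions use unique
  polynomials, least generating sets and classes of fractions, so a second layer of the proof
  identifies these objects with a field \<open>K\<close>, a space of \<open>K\<close>-valued
  functions and subsets of it.\<close>

definition mono_eval :: "('v \<Rightarrow> 'a::comm_ring_1) \<Rightarrow> ('v \<Rightarrow>\<^sub>0 nat) \<Rightarrow> 'a" where
  "mono_eval \<rho> m = (\<Prod>v\<in>Poly_Mapping.keys m. \<rho> v ^ Poly_Mapping.lookup m v)"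

text \<open>Reduces statements about polynomials to monomials and sums; multiplicativity of
  evaluation and the Frobenius congruence are both proved this way. It also serves for exponent
  vectors.\<close>

lemma poly_mapping_additive_induct [case_names zero single add]:
  assumes "P 0" "\<And>k v. P (Poly_Mapping.single k v)" "\<And>f g. P f \<Longrightarrow> P g \<Longrightarrow> P (f + g)"
  shows "P (f :: 'a \<Rightarrow>\<^sub>0 'b::comm_monoid_add)"
proof (induction f rule: update_induct)
  case const
  then show ?case by (rule assms(1))
next
  case (update f a b)
  have "Poly_Mapping.update a b f = f + Poly_Mapping.single a b"
    using update(1) by (intro poly_mapping_eqI) (auto simp: lookup_add lookup_update lookup_single when_def in_keys_iff)
  then show ?case using assms(2,3) update by simp
qed

text \<open>Products over \<open>keys\<close> range over sets that change under addition; a common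
  finite superset makes the two sides of an addition law comparable.\<close>

lemma mono_eval_superset:
  assumes "finite A" "Poly_Mapping.keys m \<subseteq> A"
  shows "mono_eval \<rho> m = (\<Prod>v\<in>A. \<rho> v ^ Poly_Mapping.lookup m v)"
  unfolding mono_eval_def
  by (rule prod.mono_neutral_left) (use assms in \<open>auto simp: in_keys_iff\<close>)

lemma mono_eval_add: "mono_eval \<rho> (m + m') = mono_eval \<rho> m * mono_eval \<rho> m'"
proof -
  let ?A = "Poly_Mapping.keys m \<union> Poly_Mapping.keys m'"
  have "mono_eval \<rho> (m + m') = (\<Prod>v\<in>?A. \<rho> v ^ Poly_Mapping.lookup (m + m') v)"
    by (rule mono_eval_superset) (auto simp: Poly_Mapping.keys_add)
  moreover have "mono_eval \<rho> m = (\<Prod>v\<in>?A. \<rho> v ^ Poly_Mapping.lookup m v)"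
    "mono_eval \<rho> m' = (\<Prod>v\<in>?A. \<rho> v ^ Poly_Mapping.lookup m' v)"
    by (rule mono_eval_superset; auto)+
  ultimately show ?thesis by (simp add: lookup_add power_add prod.distrib)
qed

lemma mono_eval_0 [simp]: "mono_eval \<rho> 0 = 1"
  by (simp add: mono_eval_def)

lemma poly_eval_superset:
  assumes "finite A" "Poly_Mapping.keys P \<subseteq> A"
  shows "poly_eval \<rho> P = (\<Sum>m\<in>A. of_int (Poly_Mapping.lookup P m) * mono_eval \<rho> m)"
  unfolding poly_eval_def mono_eval_def
  by (rule sum.mono_neutral_left) (use assms in \<open>auto simp: in_keys_iff\<close>)

lemma poly_eval_0 [simp]: "poly_eval \<rho> 0 = 0"
  by (simp add: poly_eval_def)

lemma poly_eval_single [simp]: "poly_eval \<rho> (Poly_Mapping.single m c) = of_int c * mono_eval \<rho> m"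
  by (subst poly_eval_superset[of "{m}"]) (auto)

lemma poly_eval_add [simp]: "poly_eval \<rho> (P + Q) = poly_eval \<rho> P + poly_eval \<rho> Q"
proof -
  let ?A = "Poly_Mapping.keys P \<union> Poly_Mapping.keys Q"
  have "poly_eval \<rho> (P + Q) = (\<Sum>m\<in>?A. of_int (Poly_Mapping.lookup (P + Q) m) * mono_eval \<rho> m)"
    by (rule poly_eval_superset) (auto simp: Poly_Mapping.keys_add)
  moreover have "poly_eval \<rho> P = (\<Sum>m\<in>?A. of_int (Poly_Mapping.lookup P m) * mono_eval \<rho> m)"
    "poly_eval \<rho> Q = (\<Sum>m\<in>?A. of_int (Poly_Mapping.lookup Q m) * mono_eval \<rho> m)"
    by (rule poly_eval_superset; auto)+
  ultimately show ?thesis by (simp add: lookup_add sum.distrib algebra_simps)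
qed

lemma poly_eval_mult [simp]: "poly_eval \<rho> (P * Q) = poly_eval \<rho> P * poly_eval \<rho> Q"
proof (induction P rule: poly_mapping_additive_induct)
  case (single k v)
  show ?case
    by (induction Q rule: poly_mapping_additive_induct)
      (simp_all add: mult_single mono_eval_add distrib_left algebra_simps)
qed (simp_all add: distrib_right)

lemma poly_eval_1 [simp]: "poly_eval \<rho> 1 = 1"
  using poly_eval_single[of \<rho> 0 1] by (simp del: poly_eval_single)

lemma poly_eval_uminus [simp]: "poly_eval \<rho> (- P) = - poly_eval \<rho> P"
  using poly_eval_add[of \<rho> P "- P"] by (simp del: poly_eval_add add: add_eq_0_iff)

lemma poly_eval_diff [simp]: "poly_eval \<rho> (P - Q) = poly_eval \<rho> P - poly_eval \<rho> Q"
  using poly_eval_add[of \<rho> P "- Q"] by (simp del: poly_eval_add)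

lemma poly_eval_power [simp]: "poly_eval \<rho> (P ^ n) = poly_eval \<rho> P ^ n"
  by (induction n) auto

lemma poly_eval_of_nat [simp]: "poly_eval \<rho> (of_nat n) = of_nat n"
  by (induction n) auto

lemma poly_eval_sum [simp]: "poly_eval \<rho> (sum f A) = (\<Sum>x\<in>A. poly_eval \<rho> (f x))"
  by (induction A rule: infinite_finite_induct) auto

lemma poly_eval_var [simp]: "poly_eval \<rho> (poly_var v) = \<rho> v"
  by (simp add: poly_var_def mono_eval_def)

text \<open>A homomorphism predicate between class-based rings, applied to evaluation of
  polynomials, to the \<open>p\<close>-th power map of \<open>'k\<close> and to the embedding of
  Witt vectors into their fraction field.\<close>

definition comm_ring_map :: "('a::comm_ring_1 \<Rightarrow> 'b::comm_ring_1) \<Rightarrow> bool" where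
  "comm_ring_map h \<longleftrightarrow> h 1 = 1 \<and> (\<forall>x y. h (x + y) = h x + h y) \<and> (\<forall>x y. h (x * y) = h x * h y)"

lemma comm_ring_map_poly_eval: "comm_ring_map (poly_eval \<rho>)"
  by (simp add: comm_ring_map_def)

context
  fixes h :: "'a::comm_ring_1 \<Rightarrow> 'b::comm_ring_1"
  assumes h: "comm_ring_map h"
begin

lemma comm_ring_map_simps:
  shows "h 1 = 1" "h (x + y) = h x + h y" "h (x * y) = h x * h y" "h 0 = 0" "h (- x) = - h x"
    "h (x ^ n) = h x ^ n" "h (of_nat n) = of_nat n" "h (of_int i) = of_int i"
    "h (sum f A) = (\<Sum>a\<in>A. h (f a))" "h (prod g B) = (\<Prod>b\<in>B. h (g b))"
proof -
  show 1: "h 1 = 1" and add: "\<And>x y. h (x + y) = h x + h y" and mult: "\<And>x y. h (x * y) = h x * h y"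
    using h by (auto simp: comm_ring_map_def)
  show 0: "h 0 = 0" using add[of 0 0] by simp
  show minus: "h (- x) = - h x" for x using add[of x "- x"] 0 by (simp add: add_eq_0_iff)
  show "h (x ^ n) = h x ^ n" by (induction n) (auto simp: 1 mult)
  show nat: "h (of_nat n) = of_nat n" for n by (induction n) (auto simp: 0 1 add)
  show "h (of_int i) = of_int i" by (cases i rule: int_cases) (simp_all add: minus nat add 1 del: of_nat_Suc)
  show "h (sum f A) = (\<Sum>a\<in>A. h (f a))" by (induction A rule: infinite_finite_induct) (auto simp: 0 add)
  show "h (prod g B) = (\<Prod>b\<in>B. h (g b))" by (induction B rule: infinite_finite_induct) (auto simp: 1 mult)
qed

lemma comm_ring_map_poly_eval_comp: "h (poly_eval \<rho> P) = poly_eval (\<lambda>v. h (\<rho> v)) P"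
  by (simp add: poly_eval_def comm_ring_map_simps)

lemma comm_ring_map_ghost: "h (ghost p x n) = ghost p (\<lambda>i. h (x i)) n"
  by (simp add: ghost_def comm_ring_map_simps)

end

section \<open>Congruences modulo powers of \<open>p\<close>\<close>

text \<open>The additive Frobenius law as a congruence, valid in characteristic zero as well: the
  inner binomial coefficients are divisible by the prime.\<close>

lemma prime_dvd_add_power:
  fixes a b :: "'a::comm_ring_1"
  assumes "prime p"
  shows "of_nat p dvd (a + b) ^ p - a ^ p - b ^ p"
proof -
  have p: "p > 0" "p \<noteq> 0" using prime_gt_0_nat[OF assms] by auto
  have "(a + b) ^ p = (\<Sum>k\<le>p. of_nat (p choose k) * a ^ k * b ^ (p - k))"
    by (rule binomial_ring)
  also have "{..p} = insert 0 (insert p {0<..<p})" using p by auto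
  also have "(\<Sum>k\<in>insert 0 (insert p {0<..<p}). of_nat (p choose k) * a ^ k * b ^ (p - k)) =
    b ^ p + a ^ p + (\<Sum>k\<in>{0<..<p}. of_nat (p choose k) * a ^ k * b ^ (p - k))"
    using p by (simp add: algebra_simps)
  finally have "(a + b) ^ p - a ^ p - b ^ p = (\<Sum>k\<in>{0<..<p}. of_nat (p choose k) * a ^ k * b ^ (p - k))"
    by simp
  moreover have "of_nat p dvd (of_nat (p choose k) * a ^ k * b ^ (p - k) :: 'a)" if "k \<in> {0<..<p}" for k
  proof -
    have "p dvd p choose k" using dvd_choose_prime[of k p] that assms p by auto
    then obtain c where "p choose k = p * c" by (auto simp: dvd_def)
    then show ?thesis by (simp add: mult.assoc)
  qed
  ultimately show ?thesis by (auto intro: dvd_sum)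
qed

text \<open>Fermat's little theorem, by induction away from 0 in both directions with the previous
  congruence for second summand 1.\<close>

lemma prime_dvd_power_diff_self:
  assumes "prime p"
  shows "int p dvd c ^ p - c"
proof (induction c rule: int_induct[of _ 0])
  case base
  then show ?case using prime_gt_0_nat[OF assms] by (simp add: power_0_left)
next
  case (step1 i)
  have "(i + 1) ^ p - (i + 1) = ((i + 1) ^ p - i ^ p - 1 ^ p) + (i ^ p - i)" by simp
  then show ?case using prime_dvd_add_power[OF assms, of i 1] step1 by (metis dvd_add of_nat_id of_int_of_nat_eq)
next
  case (step2 i)
  have "(i - 1) ^ p - (i - 1) = (i ^ p - i) - ((i - 1 + 1) ^ p - (i - 1) ^ p - 1 ^ p)" by simp
  then show ?case using prime_dvd_add_power[OF assms, of "i - 1" 1] step2 by (metis dvd_diff of_nat_id of_int_of_nat_eq)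
qed

lemma dvd_power_diff_power:
  fixes x y :: "'a::comm_ring_1"
  assumes "d dvd x - y"
  shows "d dvd x ^ n - y ^ n"
proof (cases n)
  case (Suc m)
  then show ?thesis using assms by (simp only: diff_power_eq_sum) (rule dvd_mult2)
qed auto

text \<open>In \<open>x^p - y^p = (x - y) * (sum of x^i y^(p-1-i))\<close> the second factor is
  congruent to \<open>p * y^(p-1)\<close> modulo \<open>p\<close>, so taking a \<open>p\<close>-th
  power gains one factor \<open>p\<close>.\<close>

lemma dvd_power_diff_Suc:
  fixes x y :: "'a::comm_ring_1"
  assumes "of_nat p ^ j dvd x - y" "j > 0" "p > 0"
  shows "of_nat p ^ Suc j dvd x ^ p - y ^ p"
proof -
  obtain m where m: "p = Suc m" using assms(3) by (cases p) auto
  have px: "of_nat p dvd x - y" using assms(1,2) by (meson dvd_power dvd_trans)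
  have *: "of_nat p dvd x ^ i * y ^ (m - i) - y ^ m" if "i < Suc m" for i
  proof -
    have "x ^ i * y ^ (m - i) - y ^ m = (x ^ i - y ^ i) * y ^ (m - i)"
      using that by (simp add: left_diff_distrib power_add[symmetric])
    then show ?thesis using dvd_power_diff_power[OF px, of i] by simp
  qed
  have eq: "(\<Sum>i<Suc m. x ^ i * y ^ (m - i)) = (\<Sum>i<Suc m. x ^ i * y ^ (m - i) - y ^ m) + of_nat p * y ^ m"
    unfolding m by (simp add: sum_subtractf del: sum.lessThan_Suc) 
  have dv: "of_nat p dvd (\<Sum>i<Suc m. x ^ i * y ^ (m - i) - y ^ m)"
    by (rule dvd_sum) (use * in auto)
  have "of_nat p dvd (\<Sum>i<Suc m. x ^ i * y ^ (m - i))"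
    unfolding eq by (rule dvd_add[OF dv dvd_triv_left])
  then have "of_nat p ^ j * of_nat p dvd (x - y) * (\<Sum>i<Suc m. x ^ i * y ^ (m - i))"
    using assms(1) by (rule mult_dvd_mono[rotated])
  then show ?thesis unfolding m diff_power_eq_sum by (simp add: mult.commute)
qed

lemma dvd_power_diff_prime_power:
  fixes x y :: "'a::comm_ring_1"
  assumes "of_nat p dvd x - y" "p > 0"
  shows "of_nat p ^ Suc k dvd x ^ (p ^ k) - y ^ (p ^ k)"
proof (induction k)
  case (Suc k)
  then show ?case using dvd_power_diff_Suc[of p "Suc k" "x ^ (p ^ k)" "y ^ (p ^ k)"] assms(2)
    by (simp add: power_mult[symmetric] mult.commute)
qed (use assms in simp)

section \<open>Ghost components\<close>

text \<open>Ghost components determine a sequence only in rings without \<open>p\<close>-torsion;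
  hence identities are checked over integer polynomials and not over the field.\<close>

definition p_torsion_free :: "nat \<Rightarrow> 'a::comm_ring_1 itself \<Rightarrow> bool" where
  "p_torsion_free p _ \<longleftrightarrow> (\<forall>x::'a. of_nat p * x = 0 \<longrightarrow> x = 0)"

lemma p_torsion_free_int_poly:
  assumes "p > 0"
  shows "p_torsion_free p TYPE('v int_poly)"
  unfolding p_torsion_free_def
proof (intro allI impI)
  fix x :: "'v int_poly" assume "of_nat p * x = 0"
  moreover have "Poly_Mapping.lookup (of_nat n * x) m = int n * Poly_Mapping.lookup x m" for m n
    by (induction n) (simp_all add: lookup_add algebra_simps)
  ultimately have "int p * Poly_Mapping.lookup x m = 0" for m by (metis lookup_zero)
  then show "x = 0" using assms by (intro poly_mapping_eqI) auto
qed

lemma p_torsion_free_power: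
  assumes "p_torsion_free p TYPE('a::comm_ring_1)" "of_nat p ^ n * (x::'a) = 0"
  shows "x = 0"
  using assms(2)
proof (induction n arbitrary: x)
  case (Suc n)
  then have "of_nat p * (of_nat p ^ n * x) = 0" by (simp add: mult.assoc)
  then have "of_nat p ^ n * x = 0" using assms(1) unfolding p_torsion_free_def by blast
  then show ?case by (rule Suc.IH)
qed simp

lemma p_torsion_free_dvd_cancel:
  assumes "p_torsion_free p TYPE('a::comm_ring_1)" "of_nat p ^ (n + k) dvd of_nat p ^ n * (x::'a)"
  shows "of_nat p ^ k dvd x"
proof -
  obtain y where "of_nat p ^ n * x = of_nat p ^ (n + k) * y" using assms(2) by (auto simp: dvd_def)
  then have "of_nat p ^ n * (x - of_nat p ^ k * y) = 0" by (simp add: power_add algebra_simps)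
  then have "x - of_nat p ^ k * y = 0" by (rule p_torsion_free_power[OF assms(1)])
  then show ?thesis by simp
qed

lemma ghost_split: "ghost p x n = (\<Sum>i<n. of_nat p ^ i * x i ^ (p ^ (n - i))) + of_nat p ^ n * x n"
proof -
  have "ghost p x n = (\<Sum>i<Suc n. of_nat p ^ i * x i ^ (p ^ (n - i)))"
    by (simp only: ghost_def lessThan_Suc_atMost)
  then show ?thesis by simp
qed

text \<open>The terms of index below \<open>j\<close> agree modulo \<open>p^(j+1)\<close>, because a
  congruence modulo \<open>p\<close> improves by one power with every \<open>p\<close>-th power;
  what remains is \<open>p^j (a j - b j)\<close>, and \<open>p^j\<close> cancels.\<close>

lemma ghost_cong_mod:
  fixes a b :: "nat \<Rightarrow> 'a::comm_ring_1"
  assumes tf: "p_torsion_free p TYPE('a)" and "p > 0"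
    and "\<And>i. i \<le> n \<Longrightarrow> of_nat p ^ Suc i dvd ghost p a i - ghost p b i" and "j \<le> n"
  shows "of_nat p dvd a j - b j"
  using \<open>j \<le> n\<close>
proof (induction j rule: less_induct)
  case (less j)
  have d: "of_nat p ^ Suc j dvd (\<Sum>i<j. of_nat p ^ i * (a i ^ (p ^ (j - i)) - b i ^ (p ^ (j - i))))"
  proof (rule dvd_sum)
    fix i assume i: "i \<in> {..<j}"
    then have "of_nat p dvd a i - b i" using less by auto
    then have "of_nat p ^ Suc (j - i) dvd a i ^ (p ^ (j - i)) - b i ^ (p ^ (j - i))"
      by (rule dvd_power_diff_prime_power[OF _ \<open>p > 0\<close>])
    then have "of_nat p ^ i * of_nat p ^ Suc (j - i) dvd of_nat p ^ i * (a i ^ (p ^ (j - i)) - b i ^ (p ^ (j - i)))"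
      by (rule mult_dvd_mono[OF dvd_refl])
    moreover have "i + Suc (j - i) = Suc j" using i by auto
    ultimately show "of_nat p ^ Suc j dvd of_nat p ^ i * (a i ^ (p ^ (j - i)) - b i ^ (p ^ (j - i)))"
      by (simp only: power_add[symmetric])
  qed
  have eq: "ghost p a j - ghost p b j =
    (\<Sum>i<j. of_nat p ^ i * (a i ^ (p ^ (j - i)) - b i ^ (p ^ (j - i)))) + of_nat p ^ j * (a j - b j)"
    by (simp add: ghost_split algebra_simps sum_subtractf)
  have "of_nat p ^ (j + 1) dvd of_nat p ^ j * (a j - b j)"
    using assms(3)[OF less.prems] unfolding eq dvd_add_right_iff[OF d] by simp
  from p_torsion_free_dvd_cancel[OF tf this] show ?case by simp
qed

lemma ghost_inject:
  fixes a b :: "nat \<Rightarrow> 'a::comm_ring_1"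
  assumes tf: "p_torsion_free p TYPE('a)" and "\<And>i. i \<le> n \<Longrightarrow> ghost p a i = ghost p b i" and "j \<le> n"
  shows "a j = b j"
  using \<open>j \<le> n\<close>
proof (induction j rule: less_induct)
  case (less j)
  have "(\<Sum>i<j. of_nat p ^ i * a i ^ (p ^ (j - i))) = (\<Sum>i<j. of_nat p ^ i * b i ^ (p ^ (j - i)))"
    by (rule sum.cong) (use less in auto)
  then have "of_nat p ^ j * (a j - b j) = 0"
    using assms(2)[OF less.prems] by (simp add: ghost_split algebra_simps)
  then show ?case using p_torsion_free_power[OF tf] by fastforce
qed

lemma ghost_eqI:
  fixes a b :: "nat \<Rightarrow> 'a::comm_ring_1"
  assumes "p_torsion_free p TYPE('a)" and "\<And>n. ghost p a n = ghost p b n"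
  shows "a = b"
  using ghost_inject[OF assms(1), of _ a b] assms(2) by blast

text \<open>An endomorphism of the polynomial ring that lifts the Frobenius map modulo
  \<open>p\<close>, as required in Dwork's lemma.\<close>

definition frob_lift :: "nat \<Rightarrow> 'v int_poly \<Rightarrow> 'v int_poly" where
  "frob_lift p = poly_eval (\<lambda>v. poly_var v ^ p)"

lemma mono_eval_var_power: "mono_eval (\<lambda>v. \<rho> v ^ p) m = mono_eval \<rho> m ^ p"
  by (simp add: mono_eval_def prod_power_distrib power_mult[symmetric] mult.commute)

lemma mono_eval_var: "mono_eval poly_var m = Poly_Mapping.single m 1"
proof (induction m rule: poly_mapping_additive_induct)
  case (single k n)
  have "(poly_var k :: 'a int_poly) ^ n = Poly_Mapping.single (Poly_Mapping.single k n) 1"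
    by (induction n) (simp_all add: poly_var_def mult_single single_add[symmetric])
  then show ?case by (auto simp: mono_eval_def)
qed (simp_all add: mono_eval_add mult_single)

text \<open>On a monomial with coefficient \<open>c\<close> the difference is \<open>c^p - c\<close>
  times a \<open>p\<close>-th power, hence Fermat; sums are covered by the binomial
  congruence.\<close>

lemma frob_lift_congruent:
  assumes "prime p"
  shows "of_nat p dvd x ^ p - frob_lift p x"
proof (induction x rule: poly_mapping_additive_induct)
  case zero
  then show ?case using prime_gt_0_nat[OF assms] by (simp add: frob_lift_def power_0_left)
next
  case (single m c)
  have s: "Poly_Mapping.single m c = of_int c * mono_eval poly_var m"
    unfolding mono_eval_var single_of_int[symmetric] by (simp add: mult_single)
  have e: "frob_lift p (Poly_Mapping.single m c) = of_int c * mono_eval poly_var m ^ p"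
    by (simp add: frob_lift_def mono_eval_var_power)
  have "Poly_Mapping.single m c ^ p - frob_lift p (Poly_Mapping.single m c) =
    of_int (c ^ p - c) * mono_eval poly_var m ^ p"
    unfolding e by (simp add: s power_mult_distrib algebra_simps)
  moreover have "of_nat p dvd (of_int (c ^ p - c) :: 'a int_poly)"
  proof -
    obtain d where d: "c ^ p - c = int p * d" using prime_dvd_power_diff_self[OF assms, of c] by (auto simp: dvd_def)
    show ?thesis unfolding d by simp
  qed
  ultimately show ?case by simp
next
  case (add x y)
  have eq: "(x + y) ^ p - frob_lift p (x + y) =
    ((x + y) ^ p - x ^ p - y ^ p) + (x ^ p - frob_lift p x) + (y ^ p - frob_lift p y)"
    by (simp add: frob_lift_def)
  show ?case unfolding eq by (intro dvd_add add prime_dvd_add_power[OF assms])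
qed

text \<open>Dwork's lemma: a sequence with \<open>w (n + 1) \<equiv> \<phi> (w n)\<close> modulo \<open>p ^ (n + 1)\<close> for the
  Frobenius lift \<open>\<phi>\<close> consists of the ghost components of a Witt vector.\<close>

lemma ghost_surjective:
  fixes w :: "nat \<Rightarrow> 'v int_poly"
  assumes p: "prime p" and w: "\<And>n. of_nat p ^ Suc n dvd w (Suc n) - frob_lift p (w n)"
  shows "\<exists>S. \<forall>n. ghost p S n = w n"
proof -
  have p0: "p > 0" using p by (rule prime_gt_0_nat)
  have tf: "p_torsion_free p TYPE('v int_poly)" using p0 by (rule p_torsion_free_int_poly)
  have ex: "\<exists>S. \<forall>i\<le>n. ghost p S i = w i" for n
  proof (induction n)
    case 0
    \<comment> \<open>Only component 0 matters here, and ghost component 0 is component 0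
      itself.\<close>
    show ?case by (rule exI[of _ "\<lambda>_. w 0"]) (simp add: ghost_def)
  next
    case (Suc n)
    then obtain S where S: "\<And>i. i \<le> n \<Longrightarrow> ghost p S i = w i" by auto
    let ?s = "\<Sum>i<Suc n. of_nat p ^ i * S i ^ (p ^ (Suc n - i))"
    \<comment> \<open>The part of ghost component \<open>n + 1\<close> already fixed by
      \<open>S\<close> is congruent to \<open>frob_lift p (w n)\<close>; with the hypothesis on
      \<open>w\<close> the defect of \<open>w (n + 1)\<close> is divisible by
      \<open>p^(n+1)\<close>, and the quotient becomes the new component.\<close>
    have "of_nat p ^ Suc n dvd (\<Sum>i<Suc n. of_nat p ^ i * (S i ^ (p ^ (Suc n - i)) - frob_lift p (S i) ^ (p ^ (n - i))))"
    proof (rule dvd_sum)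
      fix i assume i: "i \<in> {..<Suc n}"
      have "of_nat p ^ Suc (n - i) dvd (S i ^ p) ^ (p ^ (n - i)) - frob_lift p (S i) ^ (p ^ (n - i))"
        by (rule dvd_power_diff_prime_power[OF frob_lift_congruent[OF p] p0])
      then have "of_nat p ^ i * of_nat p ^ Suc (n - i) dvd of_nat p ^ i * ((S i ^ p) ^ (p ^ (n - i)) - frob_lift p (S i) ^ (p ^ (n - i)))"
        by (rule mult_dvd_mono[OF dvd_refl])
      moreover have "i + Suc (n - i) = Suc n" "p * p ^ (n - i) = p ^ (Suc n - i)"
        using i by (auto simp: Suc_diff_le)
      ultimately show "of_nat p ^ Suc n dvd of_nat p ^ i * (S i ^ (p ^ (Suc n - i)) - frob_lift p (S i) ^ (p ^ (n - i)))"
        by (simp only: power_add[symmetric] power_mult[symmetric])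
    qed
    moreover have "frob_lift p (w n) = (\<Sum>i<Suc n. of_nat p ^ i * frob_lift p (S i) ^ (p ^ (n - i)))"
      unfolding S[OF order_refl, symmetric] ghost_def lessThan_Suc_atMost by (simp add: frob_lift_def)
    ultimately have "of_nat p ^ Suc n dvd ?s - frob_lift p (w n)"
      by (simp only: sum_subtractf right_diff_distrib)
    with w[of n] have "of_nat p ^ Suc n dvd (w (Suc n) - frob_lift p (w n)) - (?s - frob_lift p (w n))"
      by (rule dvd_diff)
    moreover have "(w (Suc n) - frob_lift p (w n)) - (?s - frob_lift p (w n)) = w (Suc n) - ?s"
      by (simp only: diff_diff_eq2 diff_add_cancel)
    ultimately have "of_nat p ^ Suc n dvd w (Suc n) - ?s" by (simp only:)
    then obtain x where x: "w (Suc n) - ?s = of_nat p ^ Suc n * x" by (rule dvdE)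
    define S' where "S' = S(Suc n := x)"
    have "ghost p S' i = ghost p S i" if "i \<le> n" for i
      unfolding ghost_def S'_def by (rule sum.cong) (use that in auto)
    moreover have "ghost p S' (Suc n) = w (Suc n)"
    proof -
      have "(\<Sum>i<Suc n. of_nat p ^ i * S' i ^ (p ^ (Suc n - i))) = ?s"
        by (rule sum.cong) (auto simp: S'_def)
      then show ?thesis unfolding ghost_split[of p S' "Suc n"] using x by (simp add: S'_def algebra_simps)
    qed
    ultimately show ?case using S by (metis le_Suc_eq)
  qed
  then obtain S where S: "\<And>n i. i \<le> n \<Longrightarrow> ghost p (S n) i = w i" by metis
  \<comment> \<open>The partial solutions \<open>S n\<close> were chosen independently; they agree
    where they overlap because ghost components are injective, so their diagonal solves all
    equations.\<close>
  have "ghost p (\<lambda>i. S i i) n = ghost p (S n) n" for n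
    unfolding ghost_def
  proof (rule sum.cong)
    fix i assume i: "i \<in> {..n}"
    have "S i i = S n i"
      by (rule ghost_inject[OF tf, of i "S i" "S n" i]) (use i in \<open>simp_all add: S\<close>)
    then show "of_nat p ^ i * S i i ^ p ^ (n - i) = of_nat p ^ i * S n i ^ p ^ (n - i)" by simp
  qed simp
  then show ?thesis using S by auto
qed

text \<open>The variables themselves satisfy Dwork's congruence with an explicit error term, from
  which the congruence for their sums and products is read off.\<close>

lemma ghost_var_Suc:
  "ghost p (\<lambda>i. poly_var (f i)) (Suc n) =
   frob_lift p (ghost p (\<lambda>i. poly_var (f i)) n) + of_nat p ^ Suc n * poly_var (f (Suc n))"
proof -
  have "frob_lift p (ghost p (\<lambda>i. poly_var (f i)) n) =
    (\<Sum>i<Suc n. of_nat p ^ i * poly_var (f i) ^ (p ^ (Suc n - i)))"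
    unfolding ghost_def lessThan_Suc_atMost
    by (simp add: frob_lift_def power_mult[symmetric] Suc_diff_le)
  then show ?thesis unfolding ghost_split[of p _ "Suc n"] by simp
qed

text \<open>Existence for the two \<open>THE\<close> descriptions comes from Dwork's lemma and
  uniqueness from torsion-freeness.\<close>

lemma witt_poly_spec:
  assumes "prime p"
  shows "ghost p (witt_add_poly p) n = ghost p (\<lambda>i. poly_var (Inl i)) n + ghost p (\<lambda>i. poly_var (Inr i)) n"
    and "ghost p (witt_mult_poly p) n = ghost p (\<lambda>i. poly_var (Inl i)) n * ghost p (\<lambda>i. poly_var (Inr i)) n"
proof -
  have tf: "p_torsion_free p TYPE((nat + nat) int_poly)"
    using prime_gt_0_nat[OF assms] by (rule p_torsion_free_int_poly)
  have *: "\<exists>!S. \<forall>n. ghost p S n = w n"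
    if "\<And>n. of_nat p ^ Suc n dvd w (Suc n) - frob_lift p (w n)" for w :: "nat \<Rightarrow> (nat + nat) int_poly"
    using ghost_surjective[OF assms that] ghost_eqI[OF tf] by metis
  have alg: "(f + q * u) + (g + q * v) - (f + g) = q * (u + v)"
    "(f + q * u) * (g + q * v) - f * g = q * (u * g + f * v + q * u * v)"
    for f g q u v :: "(nat + nat) int_poly"
    by (simp_all add: algebra_simps)
  have frob: "frob_lift p (x + y) = frob_lift p x + frob_lift p y"
    "frob_lift p (x * y) = frob_lift p x * frob_lift p y" for x y :: "(nat + nat) int_poly"
    by (simp_all add: frob_lift_def)
  show "ghost p (witt_add_poly p) n = ghost p (\<lambda>i. poly_var (Inl i)) n + ghost p (\<lambda>i. poly_var (Inr i)) n"
  proof -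
    have "\<exists>!S. \<forall>n. ghost p S n = ghost p (\<lambda>i. poly_var (Inl i)) n + ghost p (\<lambda>i. poly_var (Inr i)) n"
      by (rule *) (simp only: ghost_var_Suc frob alg dvd_triv_left)
    from theI'[OF this] show ?thesis unfolding witt_add_poly_def by blast
  qed
  show "ghost p (witt_mult_poly p) n = ghost p (\<lambda>i. poly_var (Inl i)) n * ghost p (\<lambda>i. poly_var (Inr i)) n"
  proof -
    have "\<exists>!S. \<forall>n. ghost p S n = ghost p (\<lambda>i. poly_var (Inl i)) n * ghost p (\<lambda>i. poly_var (Inr i)) n"
      by (rule *) (simp only: ghost_var_Suc frob alg dvd_triv_left)
    from theI'[OF this] show ?thesis unfolding witt_mult_poly_def by blast
  qed
qed

section \<open>The ring of Witt vectors\<close>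

text \<open>The Witt operations over an arbitrary commutative ring, so that they can be carried out
  on lifts to polynomials before reduction to the field.\<close>

definition wadd :: "nat \<Rightarrow> (nat \<Rightarrow> 'a::comm_ring_1) \<Rightarrow> (nat \<Rightarrow> 'a) \<Rightarrow> nat \<Rightarrow> 'a" where
  "wadd p a b n = poly_eval (case_sum a b) (witt_add_poly p n)"

definition wmult :: "nat \<Rightarrow> (nat \<Rightarrow> 'a::comm_ring_1) \<Rightarrow> (nat \<Rightarrow> 'a) \<Rightarrow> nat \<Rightarrow> 'a" where
  "wmult p a b n = poly_eval (case_sum a b) (witt_mult_poly p n)"

lemma ghost_wadd:
  assumes "prime p"
  shows "ghost p (wadd p a b) n = ghost p a n + ghost p b n"
proof -
  have "poly_eval (case_sum a b) (ghost p (witt_add_poly p) n) = ghost p (wadd p a b) n"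
    by (simp add: comm_ring_map_ghost[OF comm_ring_map_poly_eval] wadd_def[abs_def])
  then show ?thesis
    unfolding witt_poly_spec(1)[OF assms] by (simp add: comm_ring_map_ghost[OF comm_ring_map_poly_eval])
qed

lemma ghost_wmult:
  assumes "prime p"
  shows "ghost p (wmult p a b) n = ghost p a n * ghost p b n"
proof -
  have "poly_eval (case_sum a b) (ghost p (witt_mult_poly p) n) = ghost p (wmult p a b) n"
    by (simp add: comm_ring_map_ghost[OF comm_ring_map_poly_eval] wmult_def[abs_def])
  then show ?thesis
    unfolding witt_poly_spec(2)[OF assms] by (simp add: comm_ring_map_ghost[OF comm_ring_map_poly_eval])
qed

lemma wadd_map:
  assumes "comm_ring_map h"
  shows "h (wadd p a b n) = wadd p (\<lambda>i. h (a i)) (\<lambda>i. h (b i)) n"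
proof -
  have "(\<lambda>v. h (case_sum a b v)) = case_sum (\<lambda>i. h (a i)) (\<lambda>i. h (b i))"
    by (auto split: sum.split)
  then show ?thesis unfolding wadd_def comm_ring_map_poly_eval_comp[OF assms] by simp
qed

lemma wmult_map:
  assumes "comm_ring_map h"
  shows "h (wmult p a b n) = wmult p (\<lambda>i. h (a i)) (\<lambda>i. h (b i)) n"
proof -
  have "(\<lambda>v. h (case_sum a b v)) = case_sum (\<lambda>i. h (a i)) (\<lambda>i. h (b i))"
    by (auto split: sum.split)
  then show ?thesis unfolding wmult_def comm_ring_map_poly_eval_comp[OF assms] by simp
qed

text \<open>A copy of the Witt vectors as a type of its own; it can be made an instance of
  \<open>idom\<close>, which gives access to \<open>fract\<close> as a model of
  \<open>K\<close>.\<close>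

typedef 'k wt = "UNIV :: (nat \<Rightarrow> 'k) set" morphisms wcoeff Wt by simp

lemma wcoeff_Wt [simp]: "wcoeff (Wt f) = f"
  by (simp add: Wt_inverse)

lemma wt_eqI: "(\<And>n. wcoeff x n = wcoeff y n) \<Longrightarrow> x = y"
  by (metis ext wcoeff_inverse)

text \<open>Identities in the Witt ring are proved on ghost components, after lifting the coefficients
  from the field to the polynomial ring in one variable per element of the field.\<close>

definition wred :: "(nat \<Rightarrow> ('k::field_prime_char) int_poly) \<Rightarrow> 'k wt" where
  "wred u = Wt (\<lambda>n. poly_eval (\<lambda>c. c) (u n))"

definition wlift :: "('k::field_prime_char) wt \<Rightarrow> nat \<Rightarrow> 'k int_poly" where
  "wlift x n = poly_var (wcoeff x n)"

lemma wred_wlift [simp]: "wred (wlift x) = x"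
  by (rule wt_eqI) (simp add: wred_def wlift_def)

lemma int_poly_tf: "p_torsion_free CHAR('k::field_prime_char) TYPE('k int_poly)"
  using prime_gt_0_nat[OF CHAR_prime] by (rule p_torsion_free_int_poly)

lemma wred_cong_ghost:
  fixes u v :: "nat \<Rightarrow> ('k::field_prime_char) int_poly"
  assumes "\<And>n. ghost CHAR('k) u n = ghost CHAR('k) v n"
  shows "wred u = wred v"
  using ghost_eqI[OF int_poly_tf assms] by simp

text \<open>Reduction to \<open>'k\<close> kills multiples of \<open>p\<close>, so a congruence of
  ghost components is enough. This serves identities with the coefficientwise Frobenius, which hold
  only after reduction.\<close>

lemma wred_cong_mod:
  fixes u v :: "nat \<Rightarrow> ('k::field_prime_char) int_poly"
  assumes "\<And>n. of_nat CHAR('k) ^ Suc n dvd ghost CHAR('k) u n - ghost CHAR('k) v n"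
  shows "wred u = wred v"
proof -
  have "of_nat CHAR('k) dvd u n - v n" for n
    by (rule ghost_cong_mod[OF int_poly_tf _ assms]) (use prime_gt_0_nat[OF CHAR_prime] in auto)
  then have "poly_eval (\<lambda>c. c) (u n - v n) = 0" for n
    by (metis dvdE mult_zero_left of_nat_CHAR poly_eval_mult poly_eval_of_nat)
  then show ?thesis by (simp add: wred_def)
qed

text \<open>Negation polynomials are not among the given data; Dwork's lemma supplies a sequence
  whose ghost components are the negatives.\<close>

definition wopp :: "('k::field_prime_char) wt \<Rightarrow> nat \<Rightarrow> 'k int_poly" where
  "wopp x = (SOME S. \<forall>n. ghost CHAR('k) S n = - ghost CHAR('k) (wlift x) n)"

lemma ghost_wopp:
  fixes x :: "('k::field_prime_char) wt"
  shows "ghost CHAR('k) (wopp x) n = - ghost CHAR('k) (wlift x) n"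
proof -
  have "\<exists>S. \<forall>n. ghost CHAR('k) S n = - ghost CHAR('k) (wlift x) n"
  proof (rule ghost_surjective[OF CHAR_prime])
    fix n
    have "- ghost CHAR('k) (wlift x) (Suc n) - frob_lift CHAR('k) (- ghost CHAR('k) (wlift x) n) =
      of_nat CHAR('k) ^ Suc n * (- wlift x (Suc n))"
      using ghost_var_Suc[of "CHAR('k)" "wcoeff x" n]
      by (simp add: wlift_def[abs_def] frob_lift_def algebra_simps del: power_Suc)
    then show "of_nat CHAR('k) ^ Suc n dvd
      - ghost CHAR('k) (wlift x) (Suc n) - frob_lift CHAR('k) (- ghost CHAR('k) (wlift x) n)"
      by (simp only: dvd_triv_left)
  qed
  then show ?thesis unfolding wopp_def by (rule someI2_ex) blast
qed

lemma ghost_0 [simp]: "p > 0 \<Longrightarrow> ghost p (\<lambda>_. 0) n = 0"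
  by (simp add: ghost_def power_0_left)

lemma ghost_1 [simp]:
  assumes "p > 0"
  shows "ghost p (\<lambda>n. if n = 0 then 1 else 0) n = 1"
proof -
  have "ghost p (\<lambda>n. if n = 0 then 1 else 0 :: 'a) n = (\<Sum>i\<le>n. if i = 0 then 1 else 0)"
    unfolding ghost_def by (rule sum.cong) (use assms in \<open>auto simp: power_0_left\<close>)
  then show ?thesis by simp
qed

instantiation wt :: (field_prime_char) comm_ring_1
begin

definition "0 = Wt (\<lambda>_. 0)"
definition "1 = Wt (\<lambda>n. if n = 0 then 1 else 0)"
definition "x + y = Wt (wadd CHAR('a) (wcoeff x) (wcoeff y))"
definition "x * y = Wt (wmult CHAR('a) (wcoeff x) (wcoeff y))"
definition "- x = wred (wopp x)"
definition "x - y = x + - (y :: 'a wt)"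

lemma wred_add: "wred u + wred v = wred (wadd CHAR('a) u v)"
  by (rule wt_eqI) (simp add: plus_wt_def wred_def wadd_map[OF comm_ring_map_poly_eval])

lemma wred_mult: "wred u * wred v = wred (wmult CHAR('a) u v)"
  by (rule wt_eqI) (simp add: times_wt_def wred_def wmult_map[OF comm_ring_map_poly_eval])

lemma wred_0: "0 = wred (\<lambda>_. 0)"
  by (rule wt_eqI) (simp add: zero_wt_def wred_def)

lemma wred_1: "1 = wred (\<lambda>n. if n = 0 then 1 else 0)"
  by (rule wt_eqI) (simp add: one_wt_def wred_def)

instance
proof
  fix x y z :: "'a wt"
  have p: "CHAR('a) > 0" using prime_gt_0_nat[OF CHAR_prime] .
  let ?L = "wlift :: 'a wt \<Rightarrow> _"
  note g = ghost_wadd[OF CHAR_prime] ghost_wmult[OF CHAR_prime] ghost_0[OF p] ghost_1[OF p] ghost_wopp algebra_simps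
  have "wred (?L x) + wred (?L y) + wred (?L z) = wred (?L x) + (wred (?L y) + wred (?L z))"
    unfolding wred_add by (rule wred_cong_ghost) (simp only: g)
  then show "x + y + z = x + (y + z)" by simp
  have "wred (?L x) + wred (?L y) = wred (?L y) + wred (?L x)"
    unfolding wred_add by (rule wred_cong_ghost) (simp only: g)
  then show "x + y = y + x" by simp
  have "0 + wred (?L x) = wred (?L x)"
    unfolding wred_add wred_0 by (rule wred_cong_ghost) (simp only: g add_0_left)
  then show "0 + x = x" by simp
  have "wred (wopp x) + wred (?L x) = 0"
    unfolding wred_add wred_0 by (rule wred_cong_ghost) (simp only: g, simp)
  then show "- x + x = 0" by (simp add: uminus_wt_def)
  show "x - y = x + - y" by (rule minus_wt_def)
  have "wred (?L x) * wred (?L y) * wred (?L z) = wred (?L x) * (wred (?L y) * wred (?L z))"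
    unfolding wred_mult by (rule wred_cong_ghost) (simp only: g)
  then show "x * y * z = x * (y * z)" by simp
  have "wred (?L x) * wred (?L y) = wred (?L y) * wred (?L x)"
    unfolding wred_mult by (rule wred_cong_ghost) (simp only: g)
  then show "x * y = y * x" by simp
  have "1 * wred (?L x) = wred (?L x)"
    unfolding wred_mult wred_1 by (rule wred_cong_ghost) (simp only: g mult_1_left)
  then show "1 * x = x" by simp
  have "(wred (?L x) + wred (?L y)) * wred (?L z) = wred (?L x) * wred (?L z) + wred (?L y) * wred (?L z)"
    unfolding wred_add wred_mult by (rule wred_cong_ghost) (simp only: g)
  then show "(x + y) * z = x * z + y * z" by simp
  have "wcoeff (0 :: 'a wt) 0 \<noteq> wcoeff 1 0" by (simp add: zero_wt_def one_wt_def)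
  then show "(0 :: 'a wt) \<noteq> 1" by (rule contrapos_nn) simp
qed

end

lemma wcoeff_0 [simp]: "wcoeff 0 n = 0"
  by (simp add: zero_wt_def)

text \<open>Component 0 is ghost component 0, hence a ring homomorphism to the residue
  field.\<close>

lemma wcoeff_mult_0: "wcoeff (x * y) 0 = wcoeff x 0 * wcoeff y 0"
  and wcoeff_add_0: "wcoeff (x + y) 0 = wcoeff x 0 + wcoeff y 0"
  using ghost_wmult[OF CHAR_prime, of "wcoeff x" "wcoeff y" 0]
    ghost_wadd[OF CHAR_prime, of "wcoeff x" "wcoeff y" 0]
  by (simp_all add: ghost_def times_wt_def plus_wt_def)

subsection \<open>Frobenius and Verschiebung\<close>

definition wshift :: "(nat \<Rightarrow> 'a::zero) \<Rightarrow> nat \<Rightarrow> 'a" where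
  "wshift u n = (case n of 0 \<Rightarrow> 0 | Suc m \<Rightarrow> u m)"

definition wV :: "'k::field_prime_char wt \<Rightarrow> 'k wt" where
  "wV x = Wt (wshift (wcoeff x))"

definition wF :: "'k::field_prime_char wt \<Rightarrow> 'k wt" where
  "wF x = Wt (\<lambda>n. wcoeff x n ^ CHAR('k))"

lemma ghost_wshift:
  "p > 0 \<Longrightarrow> ghost p (wshift u) n = (case n of 0 \<Rightarrow> 0 | Suc m \<Rightarrow> of_nat p * ghost p u m)"
  unfolding ghost_def wshift_def
  by (cases n) (simp_all add: sum.atMost_Suc_shift power_0_left sum_distrib_left mult.assoc del: sum.atMost_Suc)

lemma ghost_power:
  "ghost p (\<lambda>i. u i ^ p) n = ghost p u (Suc n) - of_nat p ^ Suc n * u (Suc n)"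
  unfolding ghost_split[of p u "Suc n"] unfolding ghost_def lessThan_Suc_atMost
  by (simp add: power_mult[symmetric] Suc_diff_le)

lemma wred_wshift: "wV (wred u) = wred (wshift u)"
  by (rule wt_eqI) (simp add: wV_def wred_def wshift_def split: nat.split)

lemma wred_power: "wF (wred u) = wred (\<lambda>n. u n ^ CHAR('k))" for u :: "nat \<Rightarrow> ('k::field_prime_char) int_poly"
  by (rule wt_eqI) (simp add: wF_def wred_def)

text \<open>The projection formula. On lifts the ghost components of the two sides differ by a
  multiple of \<open>p^(n+1)\<close>, since raising coefficients to the power \<open>p\<close>
  shifts ghost components only up to such an error.\<close>

lemma mult_wV: "x * wV y = wV (wF x * y)" for x :: "('k::field_prime_char) wt"
proof -
  have p: "CHAR('k) > 0" using prime_gt_0_nat[OF CHAR_prime] .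
  let ?x = "wlift x" and ?y = "wlift y"
  have "wred ?x * wV (wred ?y) = wV (wF (wred ?x) * wred ?y)"
    unfolding wred_mult wred_wshift wred_power
  proof (rule wred_cong_mod)
    fix n
    show "of_nat CHAR('k) ^ Suc n dvd ghost CHAR('k) (wmult CHAR('k) ?x (wshift ?y)) n -
      ghost CHAR('k) (wshift (wmult CHAR('k) (\<lambda>n. ?x n ^ CHAR('k)) ?y)) n"
    proof (cases n)
      case (Suc m)
      have "ghost CHAR('k) (wmult CHAR('k) ?x (wshift ?y)) n -
        ghost CHAR('k) (wshift (wmult CHAR('k) (\<lambda>n. ?x n ^ CHAR('k)) ?y)) n =
        of_nat CHAR('k) ^ Suc n * (?x n * ghost CHAR('k) ?y m)"
        using Suc by (simp add: ghost_wmult[OF CHAR_prime] ghost_wshift[OF p] ghost_power algebra_simps)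
      then show ?thesis by (simp only: dvd_triv_left)
    qed (simp add: ghost_wmult[OF CHAR_prime] ghost_wshift[OF p])
  qed
  then show ?thesis by simp
qed

lemma of_nat_mult_wred:
  fixes u :: "nat \<Rightarrow> ('k::field_prime_char) int_poly"
  shows "\<exists>z. of_nat m * wred u = wred z \<and> (\<forall>n. ghost CHAR('k) z n = of_nat m * ghost CHAR('k) u n)"
proof (induction m)
  case 0
  have p: "CHAR('k) > 0" using prime_gt_0_nat[OF CHAR_prime] .
  have "of_nat 0 * wred u = wred (\<lambda>_. 0)" unfolding wred_0[symmetric] by simp
  then show ?case using p by (intro exI[of _ "\<lambda>_. 0"]) simp
next
  case (Suc m)
  then obtain z where z: "of_nat m * wred u = wred z" "\<And>n. ghost CHAR('k) z n = of_nat m * ghost CHAR('k) u n" by auto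
  have "of_nat (Suc m) * wred u = wred (wadd CHAR('k) u z)"
    unfolding wred_add[symmetric] z(1)[symmetric] by (simp add: distrib_right)
  moreover have "ghost CHAR('k) (wadd CHAR('k) u z) n = of_nat (Suc m) * ghost CHAR('k) u n" for n
    by (simp add: z(2) ghost_wadd[OF CHAR_prime] distrib_right)
  ultimately show ?case by blast
qed

text \<open>\<open>p = V F\<close> in characteristic \<open>p\<close>; over integer polynomials the
  error in ghost component \<open>n\<close> is \<open>p^(n+1)\<close> times coefficient
  \<open>n\<close>.\<close>

lemma p_mult_wt: "of_nat CHAR('k) * x = wV (wF x)" for x :: "('k::field_prime_char) wt"
proof -
  have p: "CHAR('k) > 0" using prime_gt_0_nat[OF CHAR_prime] .
  let ?x = "wlift x"
  obtain z where z: "of_nat CHAR('k) * wred ?x = wred z"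
    "\<And>n. ghost CHAR('k) z n = of_nat CHAR('k) * ghost CHAR('k) ?x n"
    using of_nat_mult_wred[of "CHAR('k)" ?x] by auto
  have "wred z = wV (wF (wred ?x))"
    unfolding wred_wshift wred_power
  proof (rule wred_cong_mod)
    fix n
    have "ghost CHAR('k) z n - ghost CHAR('k) (wshift (\<lambda>n. ?x n ^ CHAR('k))) n = of_nat CHAR('k) ^ Suc n * ?x n"
      by (cases n) (simp_all add: z ghost_wshift[OF p] ghost_power algebra_simps, simp add: ghost_def)
    then show "of_nat CHAR('k) ^ Suc n dvd ghost CHAR('k) z n - ghost CHAR('k) (wshift (\<lambda>n. ?x n ^ CHAR('k))) n"
      by (simp only: dvd_triv_left)
  qed
  then show ?thesis using z by simp
qed

lemma comm_ring_map_power_CHAR: "comm_ring_map (\<lambda>x::'k::field_prime_char. x ^ CHAR('k))"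
  by (simp add: comm_ring_map_def power_mult_distrib freshmans_dream[OF CHAR_prime refl])

lemma wF_add: "wF (x + y) = wF x + wF y" and wF_mult: "wF (x * y) = wF x * wF y"
  and wF_1: "wF 1 = (1 :: 'k wt)"
  for x y :: "('k::field_prime_char) wt"
proof -
  show "wF (x + y) = wF x + wF y"
    by (rule wt_eqI) (simp add: plus_wt_def wF_def wadd_map[OF comm_ring_map_power_CHAR])
  show "wF (x * y) = wF x * wF y"
    by (rule wt_eqI) (simp add: times_wt_def wF_def wmult_map[OF comm_ring_map_power_CHAR])
  have "CHAR('k) > 0" using prime_gt_0_nat[OF CHAR_prime] .
  then show "wF 1 = (1 :: 'k wt)"
    by (intro wt_eqI) (simp add: one_wt_def wF_def power_0_left)
qed

lemma wF_inj: "wF x = wF y \<longleftrightarrow> x = y" for x y :: "('k::field_prime_char) wt"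
proof
  assume eq: "wF x = wF y"
  show "x = y"
  proof (rule wt_eqI)
    fix n
    have "wcoeff (wF x) n = wcoeff (wF y) n" using eq by simp
    then have "(wcoeff x n - wcoeff y n + wcoeff y n) ^ CHAR('k) = wcoeff y n ^ CHAR('k)"
      by (simp add: wF_def)
    then have "(wcoeff x n - wcoeff y n) ^ CHAR('k) = 0"
      unfolding freshmans_dream[OF CHAR_prime refl] by simp
    then show "wcoeff x n = wcoeff y n" by simp
  qed
qed simp

lemma wF_wV: "wF (wV x) = wV (wF x)" for x :: "('k::field_prime_char) wt"
proof -
  have "CHAR('k) > 0" using prime_gt_0_nat[OF CHAR_prime] .
  then show ?thesis
    by (intro wt_eqI) (simp add: wF_def wV_def wshift_def power_0_left split: nat.split)
qed

lemma wcoeff_wV_pow: "wcoeff ((wV ^^ n) x) i = (if i < n then 0 else wcoeff x (i - n))"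
  by (induction n arbitrary: i) (auto simp: wV_def wshift_def split: nat.split)

lemma wcoeff_wF_pow: "wcoeff ((wF ^^ n) x) i = wcoeff x i ^ (CHAR('k) ^ n)" for x :: "('k::field_prime_char) wt"
  by (induction n) (auto simp: wF_def power_mult[symmetric] mult.commute)

lemma mult_wV_pow: "x * (wV ^^ n) y = (wV ^^ n) ((wF ^^ n) x * y)"
  by (induction n arbitrary: x y) (simp_all add: mult_wV funpow_swap1)

lemma wF_wV_pow: "(wF ^^ m) ((wV ^^ n) x) = (wV ^^ n) ((wF ^^ m) x)"
proof (induction m)
  case (Suc m)
  have "wF ((wV ^^ n) y) = (wV ^^ n) (wF y)" for y :: "'a wt"
    by (induction n) (simp_all add: wF_wV)
  then show ?case using Suc by simp
qed simp

lemma wt_eq_wV_pow: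
  assumes "\<And>i. i < n \<Longrightarrow> wcoeff x i = 0"
  shows "x = (wV ^^ n) (Wt (\<lambda>i. wcoeff x (i + n)))"
  by (rule wt_eqI) (use assms in \<open>simp add: wcoeff_wV_pow\<close>)

text \<open>Each nonzero factor is a power of \<open>V\<close> applied to a vector with nonzero
  component 0. The projection formula moves these powers outside, leaving Frobenius twists, which do
  not affect whether component 0 vanishes.\<close>

instance wt :: (field_prime_char) idom
proof
  fix x y :: "'a wt"
  have lead: "\<exists>n y. x = (wV ^^ n) y \<and> wcoeff y 0 \<noteq> 0" if x0: "x \<noteq> 0" for x :: "'a wt"
  proof -
    have "\<exists>m. wcoeff x m \<noteq> 0" using x0 wt_eqI[of x 0] by auto
    then obtain n where "wcoeff x n \<noteq> 0" "\<And>i. i < n \<Longrightarrow> wcoeff x i = 0"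
      using exists_least_iff[of "\<lambda>m. wcoeff x m \<noteq> 0"] by auto
    then show ?thesis by (intro exI[of _ n] exI[of _ "Wt (\<lambda>i. wcoeff x (i + n))"]) (auto intro: wt_eq_wV_pow)
  qed
  assume "x \<noteq> 0" "y \<noteq> 0"
  then obtain m x' n y' where x: "x = (wV ^^ m) x'" "wcoeff x' 0 \<noteq> 0" and y: "y = (wV ^^ n) y'" "wcoeff y' 0 \<noteq> 0"
    using lead by meson
  have "x * y = (wV ^^ n) ((wV ^^ m) ((wF ^^ m) y' * (wF ^^ n) x'))"
    unfolding x y mult_wV_pow wF_wV_pow mult.commute[of "(wV ^^ m) ((wF ^^ n) x')"] ..
  then have "wcoeff (x * y) (m + n) = wcoeff ((wF ^^ m) y' * (wF ^^ n) x') 0"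
    by (simp add: wcoeff_wV_pow)
  also have "\<dots> \<noteq> 0" using x(2) y(2) by (simp add: wcoeff_mult_0 wcoeff_wF_pow)
  finally show "x * y \<noteq> 0" by auto
qed

section \<open>Lattices over a complete discrete valuation ring\<close>

text \<open>A complete discrete valuation ring given as a subset of its fraction field, together
  with an automorphism of the field, so that lattices become subsets of one vector space.
  \<open>p_nonunit\<close> excludes that \<open>W\<close> is the whole field, \<open>factor\<close>
  encodes the valuation, and \<open>complete\<close> states convergence of series in powers of
  \<open>p\<close>.\<close>

locale dvr_frob =
  fixes W :: "'a::field set" and p :: 'a and \<sigma> :: "'a \<Rightarrow> 'a"
  assumes W_0: "0 \<in> W" and W_1: "1 \<in> W"
    and W_add: "a \<in> W \<Longrightarrow> b \<in> W \<Longrightarrow> a + b \<in> W"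
    and W_uminus: "a \<in> W \<Longrightarrow> - a \<in> W"
    and W_mult: "a \<in> W \<Longrightarrow> b \<in> W \<Longrightarrow> a * b \<in> W"
    and p_W: "p \<in> W" and p_nz: "p \<noteq> 0" and p_nonunit: "inverse p \<notin> W"
    and factor: "a \<noteq> 0 \<Longrightarrow> \<exists>e u. u \<in> W \<and> inverse u \<in> W \<and> a = p powi e * u"
    and \<sigma>_add: "\<sigma> (a + b) = \<sigma> a + \<sigma> b" and \<sigma>_mult: "\<sigma> (a * b) = \<sigma> a * \<sigma> b" and \<sigma>_1: "\<sigma> 1 = 1"
    and \<sigma>_W: "\<sigma> a \<in> W \<longleftrightarrow> a \<in> W" and \<sigma>_p: "\<sigma> p = p" and \<sigma>_surj: "surj \<sigma>"
    and complete: "(\<And>n::nat. f n \<in> W) \<Longrightarrow> \<exists>s\<in>W. \<forall>n. \<exists>w\<in>W. s = (\<Sum>i<n. p ^ i * f i) + p ^ n * w"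
begin

lemma W_power: "a \<in> W \<Longrightarrow> a ^ n \<in> W"
  by (induction n) (auto intro: W_1 W_mult)

lemma p_powi_W: "p powi e \<in> W \<longleftrightarrow> e \<ge> 0"
proof
  assume "p powi e \<in> W"
  show "e \<ge> 0"
  proof (rule ccontr)
    assume "\<not> e \<ge> 0"
    then have "p powi e * p ^ nat (- e - 1) = p powi (- 1)"
      by (simp add: power_int_of_nat[symmetric] power_int_add[symmetric] p_nz del: power_int_of_nat)
    then have "inverse p = p powi e * p ^ nat (- e - 1)" by (simp add: power_int_minus)
    then show False using W_mult[OF \<open>p powi e \<in> W\<close> W_power[OF p_W]] p_nonunit by simp
  qed
qed (simp add: power_int_def W_power p_W)

text \<open>Unspecified at 0, hence the case \<open>a = 0\<close> in later comparisons;
  \<open>vge\<close> incorporates the convention that 0 has infinite valuation.\<close>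

definition val :: "'a \<Rightarrow> int" where
  "val a = (SOME e. \<exists>u. u \<in> W \<and> inverse u \<in> W \<and> a = p powi e * u)"

lemma val_spec:
  assumes "a \<noteq> 0"
  obtains u where "u \<in> W" "inverse u \<in> W" "u \<noteq> 0" "a = p powi val a * u"
proof -
  have "\<exists>u. u \<in> W \<and> inverse u \<in> W \<and> a = p powi val a * u"
    unfolding val_def by (rule someI_ex[OF factor[OF assms]])
  then obtain u where u: "u \<in> W" "inverse u \<in> W" "a = p powi val a * u" by blast
  then have "u \<noteq> 0" using assms by (metis mult_zero_right)
  with u show thesis using that by blast
qed

lemma pp: "p powi e * p powi f = p powi (e + f)"
  using p_nz by (simp add: power_int_add)

text \<open>Two factorizations would make both \<open>p powi (e - f)\<close> and its inverse
  integral, which forces equal exponents since \<open>1/p\<close> is not integral.\<close>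

lemma val_unique:
  assumes "u \<in> W" "inverse u \<in> W" "u \<noteq> 0" "a = p powi e * u"
  shows "val a = e"
proof -
  have "a \<noteq> 0" using assms p_nz by simp
  then obtain v where v: "v \<in> W" "inverse v \<in> W" "v \<noteq> 0" "a = p powi val a * v" by (rule val_spec)
  let ?f = "val a"
  have eq: "p powi e * u = p powi ?f * v" using assms(4) v(4) by (rule trans[OF sym])
  have "p powi (e - ?f) = v * inverse u" "p powi (?f - e) = u * inverse v"
    using eq assms(3) v(3) p_nz by (simp_all add: power_int_diff field_simps)
  then have "p powi (e - ?f) \<in> W" "p powi (?f - e) \<in> W" using assms v by (auto intro: W_mult)
  then show ?thesis unfolding p_powi_W by linarith
qed

lemma val_mult:
  assumes "a \<noteq> 0" "b \<noteq> 0"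
  shows "val (a * b) = val a + val b"
proof -
  obtain u where u: "u \<in> W" "inverse u \<in> W" "u \<noteq> 0" "a = p powi val a * u" using assms(1) by (rule val_spec)
  obtain v where v: "v \<in> W" "inverse v \<in> W" "v \<noteq> 0" "b = p powi val b * v" using assms(2) by (rule val_spec)
  have "a * b = p powi (val a + val b) * (u * v)"
    by (subst u(4), subst v(4)) (simp add: power_int_add p_nz)
  then show ?thesis by (rule val_unique[rotated 3]) (use u v in \<open>auto intro: W_mult simp: inverse_mult_distrib\<close>)
qed

lemma val_powi [simp]: "val (p powi e) = e"
  by (rule val_unique[of 1]) (simp_all add: W_1)

lemma val_1 [simp]: "val 1 = 0"
  using val_powi[of 0] by simp

lemma val_inverse: "a \<noteq> 0 \<Longrightarrow> val (inverse a) = - val a"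
  using val_mult[of a "inverse a"] by simp

lemma W_iff: "a \<in> W \<longleftrightarrow> a = 0 \<or> val a \<ge> 0"
proof (cases "a = 0")
  case False
  then obtain u where u: "u \<in> W" "inverse u \<in> W" "u \<noteq> 0" "a = p powi val a * u" by (rule val_spec)
  have "p powi val a = a * inverse u" by (subst u(4)) (use u(3) in simp)
  then show ?thesis using p_powi_W[of "val a"] u W_mult False by metis
qed (simp add: W_0)

definition vge :: "int \<Rightarrow> 'a \<Rightarrow> bool" where "vge e a \<longleftrightarrow> a = 0 \<or> e \<le> val a"

lemma vge_iff: "vge e a \<longleftrightarrow> p powi (- e) * a \<in> W"
  by (cases "a = 0") (auto simp: vge_def W_iff val_mult p_nz)

lemma vge_add: "vge e a \<Longrightarrow> vge e b \<Longrightarrow> vge e (a + b)"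
  unfolding vge_iff distrib_left by (rule W_add)
lemma vge_uminus: "vge e a \<Longrightarrow> vge e (- a)"
  unfolding vge_iff by (metis W_uminus mult_minus_right)
lemma \<sigma>_0 [simp]: "\<sigma> 0 = 0"
proof -
  have "\<sigma> 0 + \<sigma> 0 = \<sigma> 0 + 0" using \<sigma>_add[of 0 0] by simp
  then show ?thesis by (simp only: add_left_cancel)
qed

lemma \<sigma>_nz [simp]: "\<sigma> a = 0 \<longleftrightarrow> a = 0"
proof
  assume "\<sigma> a = 0"
  show "a = 0"
  proof (rule ccontr)
    assume "a \<noteq> 0"
    then have "\<sigma> a * \<sigma> (inverse a) = 1" by (simp add: \<sigma>_mult[symmetric] \<sigma>_1)
    then show False using \<open>\<sigma> a = 0\<close> by simp
  qed
qed simp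

lemma \<sigma>_inverse: "\<sigma> (inverse a) = inverse (\<sigma> a)"
proof (cases "a = 0")
  case False
  then have "\<sigma> a * \<sigma> (inverse a) = 1" by (simp add: \<sigma>_mult[symmetric] \<sigma>_1)
  then show ?thesis by (rule inverse_unique[symmetric])
qed simp

lemma \<sigma>_power: "\<sigma> (a ^ n) = \<sigma> a ^ n"
  by (induction n) (auto simp: \<sigma>_1 \<sigma>_mult)

lemma \<sigma>_powi [simp]: "\<sigma> (p powi e) = p powi e"
  by (simp add: power_int_def \<sigma>_power \<sigma>_inverse \<sigma>_p)

lemma val_\<sigma>: "val (\<sigma> a) = val a"
proof (cases "a = 0")
  case False
  then obtain u where u: "u \<in> W" "inverse u \<in> W" "u \<noteq> 0" "a = p powi val a * u" by (rule val_spec)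
  have "\<sigma> a = p powi val a * \<sigma> u" by (subst u(4)) (simp add: \<sigma>_mult)
  then show ?thesis by (rule val_unique[rotated 3]) (use u \<sigma>_W[of u] \<sigma>_W[of "inverse u"] in \<open>auto simp: \<sigma>_inverse\<close>)
qed simp

end

locale lattice_space = dvr_frob W p \<sigma> + Vector_Spaces.vector_space scale
  for W :: "'a::field set" and p :: 'a and \<sigma> :: "'a \<Rightarrow> 'a"
    and scale :: "'a \<Rightarrow> 'b::ab_group_add \<Rightarrow> 'b" (infixr \<open>*s\<close> 75)
begin

section \<open>Submodules over the valuation ring, their sums and their multiples by powers of
  \<open>p\<close>\<close>

definition wsub :: "'b set \<Rightarrow> bool" where
  "wsub Y \<longleftrightarrow> 0 \<in> Y \<and> (\<forall>x\<in>Y. \<forall>y\<in>Y. x + y \<in> Y) \<and> (\<forall>a\<in>W. \<forall>x\<in>Y. a *s x \<in> Y)"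

lemma wsubD:
  assumes "wsub Y"
  shows wsub_0: "0 \<in> Y" and wsub_add: "x \<in> Y \<Longrightarrow> y \<in> Y \<Longrightarrow> x + y \<in> Y"
    and wsub_scale: "a \<in> W \<Longrightarrow> x \<in> Y \<Longrightarrow> a *s x \<in> Y"
  using assms by (auto simp: wsub_def)

lemma wsub_uminus: "wsub Y \<Longrightarrow> x \<in> Y \<Longrightarrow> - x \<in> Y"
  using wsub_scale[of Y "- 1" x] W_uminus[OF W_1] by simp

lemma wsub_diff: "wsub Y \<Longrightarrow> x \<in> Y \<Longrightarrow> y \<in> Y \<Longrightarrow> x - y \<in> Y"
  using wsub_add[of Y x "- y"] wsub_uminus[of Y y] by simp

lemma wsub_sum: "wsub Y \<Longrightarrow> (\<And>i. i \<in> I \<Longrightarrow> f i \<in> Y) \<Longrightarrow> sum f I \<in> Y"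
  by (induction I rule: infinite_finite_induct) (auto intro: wsub_0 wsub_add)

lemma wsub_Int: "wsub Y \<Longrightarrow> wsub Z \<Longrightarrow> wsub (Y \<inter> Z)"
  by (auto simp: wsub_def)

lemma wsub_subspace: "subspace Y \<Longrightarrow> wsub Y"
  by (auto simp: wsub_def subspace_def)

definition wspan :: "'b set \<Rightarrow> 'b set" where "wspan S = \<Inter>{Y. wsub Y \<and> S \<subseteq> Y}"

lemma wsub_wspan: "wsub (wspan S)" and wspan_superset: "S \<subseteq> wspan S"
  and wspan_minimal: "S \<subseteq> Y \<Longrightarrow> wsub Y \<Longrightarrow> wspan S \<subseteq> Y"
  by (auto simp: wspan_def wsub_def)

lemma wspan_mono: "S \<subseteq> T \<Longrightarrow> wspan S \<subseteq> wspan T"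
  by (meson wspan_minimal wsub_wspan wspan_superset order_trans)

lemma wspan_base: "x \<in> S \<Longrightarrow> x \<in> wspan S"
  using wspan_superset by auto

definition ssum :: "'b set \<Rightarrow> 'b set \<Rightarrow> 'b set" where
  "ssum A B = {a + b | a b. a \<in> A \<and> b \<in> B}"

lemma ssumI: "a \<in> A \<Longrightarrow> b \<in> B \<Longrightarrow> a + b \<in> ssum A B"
  by (auto simp: ssum_def)

lemma wsub_ssum:
  assumes "wsub A" "wsub B"
  shows "wsub (ssum A B)"
  unfolding wsub_def
proof (intro conjI ballI)
  show "0 \<in> ssum A B" using ssumI[of 0 A 0 B] assms wsub_0 by auto
next
  fix x y assume "x \<in> ssum A B" "y \<in> ssum A B"
  then obtain a b a' b' where "x = a + b" "y = a' + b'" "a \<in> A" "b \<in> B" "a' \<in> A" "b' \<in> B"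
    by (auto simp: ssum_def)
  then have "x + y = (a + a') + (b + b')" "a + a' \<in> A" "b + b' \<in> B"
    using assms by (auto intro: wsub_add simp: algebra_simps)
  then show "x + y \<in> ssum A B" using ssumI by metis
next
  fix c x assume "c \<in> W" "x \<in> ssum A B"
  then obtain a b where "x = a + b" "a \<in> A" "b \<in> B" by (auto simp: ssum_def)
  then show "c *s x \<in> ssum A B" using assms \<open>c \<in> W\<close>
    by (simp add: scale_right_distrib ssumI wsub_scale)
qed

lemma ssum_upper1: "wsub B \<Longrightarrow> A \<subseteq> ssum A B"
  using wsub_0 by (force simp: ssum_def)

lemma ssum_upper2: "wsub A \<Longrightarrow> B \<subseteq> ssum A B"
  using wsub_0 by (force simp: ssum_def)

lemma ssum_least: "A \<subseteq> C \<Longrightarrow> B \<subseteq> C \<Longrightarrow> wsub C \<Longrightarrow> ssum A B \<subseteq> C"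
  by (auto simp: ssum_def intro: wsub_add)

lemma ssum_mono: "A \<subseteq> A' \<Longrightarrow> B \<subseteq> B' \<Longrightarrow> ssum A B \<subseteq> ssum A' B'"
  by (auto simp: ssum_def)

lemma wspan_empty [simp]: "wspan {} = {0}"
  using wspan_minimal[of "{}" "{0}"] wsub_0[OF wsub_wspan[of "{}"]] by (auto simp: wsub_def)

lemma wspan_Un: "wspan (S \<union> T) = ssum (wspan S) (wspan T)"
proof
  show "wspan (S \<union> T) \<subseteq> ssum (wspan S) (wspan T)"
    using ssum_upper1[OF wsub_wspan, of "wspan S" T] ssum_upper2[OF wsub_wspan, of "wspan T" S]
      wspan_superset[of S] wspan_superset[of T]
    by (intro wspan_minimal wsub_ssum wsub_wspan) auto
  show "ssum (wspan S) (wspan T) \<subseteq> wspan (S \<union> T)"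
    by (intro ssum_least wspan_mono wsub_wspan) auto
qed

lemma wspan_singleton: "wspan {x} = {a *s x | a. a \<in> W}"
proof
  have "wsub {a *s x | a. a \<in> W}"
    unfolding wsub_def
  proof (intro conjI ballI)
    show "0 \<in> {a *s x | a. a \<in> W}" using W_0 by force
  next
    fix y z assume "y \<in> {a *s x | a. a \<in> W}" "z \<in> {a *s x | a. a \<in> W}"
    then obtain a b where "y = a *s x" "z = b *s x" "a \<in> W" "b \<in> W" by auto
    then have "y + z = (a + b) *s x" "a + b \<in> W" by (auto simp: scale_left_distrib W_add)
    then show "y + z \<in> {a *s x | a. a \<in> W}" by auto
  qed (auto intro: W_mult)
  then show "wspan {x} \<subseteq> {a *s x | a. a \<in> W}"
    by (rule wspan_minimal[rotated]) (use W_1 scale_one[of x] in \<open>auto intro!: exI[of _ 1]\<close>)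
  show "{a *s x | a. a \<in> W} \<subseteq> wspan {x}"
    using wsub_scale[OF wsub_wspan] wspan_base by auto
qed

lemma wspan_insertE:
  assumes "y \<in> wspan (insert x S)"
  obtains a z where "a \<in> W" "z \<in> wspan S" "y = a *s x + z"
  using assms wspan_Un[of "{x}" S] by (auto simp: wspan_singleton ssum_def)

lemma wspan_insertI: "a \<in> W \<Longrightarrow> z \<in> wspan S \<Longrightarrow> a *s x + z \<in> wspan (insert x S)"
  using wspan_Un[of "{x}" S] by (auto simp: wspan_singleton ssum_def)

lemma wspan_sumI:
  assumes "\<And>a. a \<in> A \<Longrightarrow> c a \<in> W"
  shows "(\<Sum>a\<in>A. c a *s a) \<in> wspan A"
  by (rule wsub_sum[OF wsub_wspan]) (use assms in \<open>auto intro: wsub_scale[OF wsub_wspan] wspan_base\<close>)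

lemma wspan_finiteE:
  assumes "finite A" "y \<in> wspan A"
  obtains c where "\<And>a. c a \<in> W" "y = (\<Sum>a\<in>A. c a *s a)"
proof -
  have "\<exists>c. (\<forall>a. c a \<in> W) \<and> y = (\<Sum>a\<in>A. c a *s a)"
    using assms
  proof (induction A arbitrary: y rule: finite_induct)
    case empty
    then show ?case using W_0 by auto
  next
    case (insert x A)
    from insert.prems obtain b z where bz: "b \<in> W" "z \<in> wspan A" "y = b *s x + z" by (rule wspan_insertE)
    from insert.IH[OF bz(2)] obtain c where c: "\<forall>a. c a \<in> W" "z = (\<Sum>a\<in>A. c a *s a)" by auto
    have "(\<Sum>a\<in>A. (c(x := b)) a *s a) = (\<Sum>a\<in>A. c a *s a)"
      by (rule sum.cong) (use insert.hyps in auto)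
    then show ?case using insert.hyps bz c by (intro exI[of _ "c(x := b)"]) auto
  qed
  then show thesis using that by auto
qed

text \<open>The submodule \<open>p^e Y\<close> for any integer \<open>e\<close>, written as a
  preimage: membership is then a condition on one scaled vector, and \<open>p^e (p^f Y)\<close>
  simplifies at once.\<close>

definition pe :: "int \<Rightarrow> 'b set \<Rightarrow> 'b set" where "pe e Y = {x. p powi (- e) *s x \<in> Y}"

lemma pe_0 [simp]: "pe 0 Y = Y" by (simp add: pe_def)

lemma pp_scale: "p powi e *s p powi f *s x = p powi (e + f) *s x"
  by (simp add: pp)

lemma pe_pe [simp]: "pe e (pe f Y) = pe (e + f) Y"
  by (simp add: pe_def pp algebra_simps)

lemma pe_image: "pe e Y = (\<lambda>x. p powi e *s x) ` Y"
proof (intro subset_antisym subsetI)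
  fix x assume "x \<in> pe e Y"
  moreover have "x = p powi e *s p powi (- e) *s x" by (simp add: pp)
  ultimately show "x \<in> (\<lambda>x. p powi e *s x) ` Y" unfolding pe_def by blast
qed (auto simp: pe_def pp)

lemma peI: "x \<in> Y \<Longrightarrow> p powi e *s x \<in> pe e Y"
  unfolding pe_image by (rule imageI)

lemma pe_scale_iff: "p powi f *s x \<in> pe e Y \<longleftrightarrow> x \<in> pe (e - f) Y"
  by (simp add: pe_def pp add.commute)

lemma wsub_pe:
  assumes "wsub Y"
  shows "wsub (pe e Y)"
proof -
  have "p powi (- e) *s a *s x = a *s p powi (- e) *s x" for a x by (simp add: mult.commute)
  then show ?thesis using assms by (simp add: wsub_def pe_def scale_right_distrib del: scale_scale)
qed

lemma pe_mono: "Y \<subseteq> Z \<Longrightarrow> pe e Y \<subseteq> pe e Z"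
  by (auto simp: pe_def)

lemma pe_vge:
  assumes "wsub Y" "vge f a" "x \<in> pe e Y"
  shows "a *s x \<in> pe (f + e) Y"
proof -
  have "(p powi (- f) * a) *s p powi (- e) *s x \<in> Y"
    using assms unfolding pe_def vge_iff by (auto intro: wsub_scale simp del: scale_scale)
  moreover have "p powi (- f) * a * p powi (- e) = p powi (- (f + e)) * a"
    by (metis pp minus_add_distrib mult.commute mult.left_commute)
  ultimately show ?thesis by (simp add: pe_def)
qed

lemma pe_antimono:
  assumes "wsub Y" "e \<le> f"
  shows "pe f Y \<subseteq> pe e Y"
proof
  fix x assume "x \<in> pe f Y"
  then have "1 *s x \<in> pe (e - f + f) Y" using assms by (intro pe_vge) (auto simp: vge_def)
  then show "x \<in> pe e Y" by simp
qed

lemma pe_ssum: "pe e (ssum A B) = ssum (pe e A) (pe e B)"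
proof (intro subset_antisym subsetI)
  fix x assume "x \<in> pe e (ssum A B)"
  then obtain a b where "a \<in> A" "b \<in> B" "x = p powi e *s (a + b)" by (auto simp: pe_image ssum_def)
  then show "x \<in> ssum (pe e A) (pe e B)" by (simp add: scale_right_distrib ssumI peI)
next
  fix x assume "x \<in> ssum (pe e A) (pe e B)"
  then obtain a b where "a \<in> A" "b \<in> B" "x = p powi e *s a + p powi e *s b" by (auto simp: pe_image ssum_def)
  then show "x \<in> pe e (ssum A B)" by (simp add: scale_right_distrib[symmetric] ssumI peI)
qed

lemma pe_subspace:
  assumes "subspace P"
  shows "pe e P = P"
proof -
  have "x = p powi e *s p powi (- e) *s x" for x by (simp add: pp)
  then show ?thesis using subspace_scale[OF assms] unfolding pe_def by (metis (no_types, lifting) Collect_cong Collect_mem_eq)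
qed

text \<open>Completeness of \<open>W\<close>, applied to one generator at a time: a
  \<open>p\<close>-adic series with terms in a finitely generated module converges in that module,
  with remainders controlled by the expected powers.\<close>

lemma wspan_series:
  assumes "finite A" "\<And>i::nat. f i \<in> wspan A"
  shows "\<exists>s\<in>wspan A. \<forall>n. s - (\<Sum>i<n. p ^ i *s f i) \<in> pe (int n) (wspan A)"
  using assms
proof (induction A arbitrary: f rule: finite_induct)
  case empty
  then show ?case by (auto simp: pe_def)
next
  case (insert x A)
  have "\<exists>a z. a \<in> W \<and> z \<in> wspan A \<and> f i = a *s x + z" for i
    using insert.prems[of i] by (rule wspan_insertE) blast
  then obtain a z where az: "\<And>i. a i \<in> W" "\<And>i. z i \<in> wspan A" "\<And>i. f i = a i *s x + z i" by metis
  obtain s where s: "s \<in> W" "\<forall>n. \<exists>w\<in>W. s = (\<Sum>i<n. p ^ i * a i) + p ^ n * w" using complete[of a] az(1) by blast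
  obtain t where t: "t \<in> wspan A" "\<And>n. t - (\<Sum>i<n. p ^ i *s z i) \<in> pe (int n) (wspan A)"
    using insert.IH[of z] az(2) by blast
  show ?case
  proof (rule bexI[of _ "s *s x + t"], intro allI)
    fix n
    obtain w where w: "w \<in> W" "s = (\<Sum>i<n. p ^ i * a i) + p ^ n * w" using s(2) by blast
    have "(\<Sum>i<n. p ^ i *s f i) = (\<Sum>i<n. p ^ i * a i) *s x + (\<Sum>i<n. p ^ i *s z i)"
      by (simp add: az scale_right_distrib sum.distrib scale_sum_left)
    then have "s *s x + t - (\<Sum>i<n. p ^ i *s f i) = p ^ n *s (w *s x) + (t - (\<Sum>i<n. p ^ i *s z i))"
      unfolding w(2) by (simp add: scale_left_distrib algebra_simps)
    moreover have "p ^ n *s (w *s x) \<in> pe (int n) (wspan (insert x A))"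
      using peI[of "w *s x" "wspan (insert x A)" "int n"] wspan_insertI[OF w(1), of 0 A x] wsub_0[OF wsub_wspan]
      by simp
    moreover have "t - (\<Sum>i<n. p ^ i *s z i) \<in> pe (int n) (wspan (insert x A))"
      using t(2)[of n] pe_mono[OF wspan_mono[of A "insert x A"]] by auto
    ultimately show "s *s x + t - (\<Sum>i<n. p ^ i *s f i) \<in> pe (int n) (wspan (insert x A))"
      by (metis wsub_add wsub_pe wsub_wspan)
  qed (rule wspan_insertI[OF s(1) t(1)])
qed

definition separated :: "'b set \<Rightarrow> bool" where
  "separated Y \<longleftrightarrow> (\<forall>x. (\<forall>n::nat. x \<in> pe (int n) Y) \<longrightarrow> x = 0)"

lemma separated_subset: "separated Y \<Longrightarrow> Z \<subseteq> Y \<Longrightarrow> separated Z"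
  unfolding separated_def using pe_mono by blast

text \<open>Finite generation of \<open>Y\<close> is part of the conclusion: repeated expansion of
  \<open>y\<close> modulo \<open>pY\<close> gives a series that converges in the span of
  \<open>A\<close> because \<open>W\<close> is complete, and separatedness of \<open>Y\<close>
  identifies its limit with \<open>y\<close>.\<close>

lemma nakayama:
  assumes Y: "wsub Y" "separated Y" and A: "finite A" "A \<subseteq> Y" and gen: "Y \<subseteq> ssum (wspan A) (pe 1 Y)"
  shows "Y = wspan A"
proof
  show "wspan A \<subseteq> Y" using A Y by (intro wspan_minimal)
  show "Y \<subseteq> wspan A"
  proof
    fix y assume y: "y \<in> Y"
    have "\<exists>u v. u \<in> wspan A \<and> v \<in> Y \<and> x = u + p *s v" if "x \<in> Y" for x
      using gen that pe_image[of 1 Y] by (force simp: ssum_def)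
    then obtain u v where uv: "\<And>x. x \<in> Y \<Longrightarrow> u x \<in> wspan A \<and> v x \<in> Y \<and> x = u x + p *s v x" by metis
    define f where "f i = u ((v ^^ i) y)" for i
    have vY: "(v ^^ i) y \<in> Y" for i by (induction i) (use y uv in auto)
    have f: "f i \<in> wspan A" for i using uv vY by (auto simp: f_def)
    have sum: "y = (\<Sum>i<n. p ^ i *s f i) + p ^ n *s (v ^^ n) y" for n
    proof (induction n)
      case (Suc n)
      have "p ^ n *s (v ^^ n) y = p ^ n *s f n + p ^ Suc n *s (v ^^ Suc n) y"
        using arg_cong[OF uv[OF vY[of n], THEN conjunct2, THEN conjunct2], of "\<lambda>x. p ^ n *s x"]
        by (simp add: f_def scale_right_distrib mult.commute)
      then show ?case using Suc by (simp add: add.assoc)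
    qed simp
    obtain s where s: "s \<in> wspan A" "\<And>n. s - (\<Sum>i<n. p ^ i *s f i) \<in> pe (int n) (wspan A)"
      using wspan_series[OF A(1), of f] f by blast
    have "s - y \<in> pe (int n) Y" for n
    proof -
      have "s - (\<Sum>i<n. p ^ i *s f i) \<in> pe (int n) Y"
        using s(2)[of n] pe_mono[OF \<open>wspan A \<subseteq> Y\<close>] by auto
      moreover have "p ^ n *s (v ^^ n) y \<in> pe (int n) Y" using peI[OF vY, of "int n"] by simp
      ultimately have "s - (\<Sum>i<n. p ^ i *s f i) - p ^ n *s (v ^^ n) y \<in> pe (int n) Y"
        using wsub_diff wsub_pe Y(1) by blast
      then show ?thesis by (subst sum[of n]) (simp add: algebra_simps)
    qed
    then have "s - y = 0" using Y(2) unfolding separated_def by blast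
    then show "y \<in> wspan A" using s(1) by simp
  qed
qed

subsection \<open>Length\<close>

text \<open>Length of \<open>Z / Y\<close> is measured by strict chains of submodules between
  \<open>Y\<close> and \<open>Z\<close>; this avoids quotient modules and makes invariance under
  semilinear bijections immediate.\<close>

inductive chain :: "'b set \<Rightarrow> 'b set \<Rightarrow> nat \<Rightarrow> bool" for Y where
  chain_0: "wsub Y \<Longrightarrow> chain Y Y 0"
| chain_Suc: "chain Y Z n \<Longrightarrow> Z \<subset> Z' \<Longrightarrow> wsub Z' \<Longrightarrow> chain Y Z' (Suc n)"

definition fl :: "'b set \<Rightarrow> 'b set \<Rightarrow> bool" where "fl Y Z \<longleftrightarrow> (\<exists>N. \<forall>n. chain Y Z n \<longrightarrow> n \<le> N)"

definition len :: "'b set \<Rightarrow> 'b set \<Rightarrow> nat" where "len Y Z = Max {n. chain Y Z n}"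

lemma chain_wsub: "chain Y Z n \<Longrightarrow> Y \<subseteq> Z \<and> wsub Y \<and> wsub Z"
  by (induction rule: chain.induct) auto

lemma chain_trans:
  assumes "chain Z T n" "chain Y Z m"
  shows "chain Y T (m + n)"
  using assms(1)
proof (induction rule: chain.induct)
  case (chain_Suc T n T')
  then show ?case using chain.chain_Suc[of Y T "m + n" T'] by simp
qed (use assms(2) in simp)

lemma chain_le1: "wsub Y \<Longrightarrow> wsub Z \<Longrightarrow> Y \<subseteq> Z \<Longrightarrow> chain Y Z (if Y = Z then 0 else 1)"
  using chain_Suc[OF chain_0[of Y], of Z] chain_0[of Y] by auto

lemma len_chain:
  assumes "fl Y Z" "wsub Y" "wsub Z" "Y \<subseteq> Z"
  shows "chain Y Z (len Y Z)" and "chain Y Z n \<Longrightarrow> n \<le> len Y Z"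
proof -
  have fin: "finite {n. chain Y Z n}"
    using assms(1) unfolding fl_def by (metis (no_types, lifting) finite_nat_set_iff_bounded_le mem_Collect_eq)
  show "chain Y Z (len Y Z)" using Max_in[OF fin] chain_le1[OF assms(2-4)] unfolding len_def by auto
  show "n \<le> len Y Z" if "chain Y Z n" unfolding len_def by (rule Max_ge[OF fin]) (use that in simp)
qed

lemma len_eqI:
  assumes "chain Y Z k" "\<And>n. chain Y Z n \<Longrightarrow> n \<le> k"
  shows "fl Y Z" "len Y Z = k"
proof -
  show "fl Y Z" using assms(2) by (auto simp: fl_def)
  then show "len Y Z = k" using len_chain[of Y Z] assms chain_wsub[OF assms(1)] by (simp add: order_antisym)
qed

lemma chain_cong_len: "(\<And>n. chain Y Z n \<longleftrightarrow> chain Y' Z' n) \<Longrightarrow> len Y Z = len Y' Z' \<and> fl Y Z = fl Y' Z'"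
  by (simp add: len_def fl_def)

text \<open>A chain is cut with \<open>M\<close> and summed with \<open>M\<close>; at every strict
  step at least one of the two traces is strict, by the modular law. This gives the upper bound in
  the additivity of length.\<close>

lemma chain_split:
  assumes "chain Y Z n" "wsub M" "Y \<subseteq> M"
  shows "\<exists>a b. n \<le> a + b \<and> chain Y (Z \<inter> M) a \<and> chain M (ssum Z M) b"
  using assms(1)
proof (induction rule: chain.induct)
  case chain_0
  have "ssum Y M = M" using ssum_upper2[OF chain_0, of M] ssum_least[OF assms(3) order_refl assms(2)] by auto
  moreover have "Y \<inter> M = Y" using assms(3) by auto
  ultimately show ?case using chain.chain_0[OF chain_0] chain.chain_0[OF assms(2)] by (metis zero_le)
next
  case (chain_Suc Z n Z')
  then obtain a b where ab: "n \<le> a + b" "chain Y (Z \<inter> M) a" "chain M (ssum Z M) b" by auto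
  have wZ: "wsub Z" using chain_wsub[OF chain_Suc(1)] by auto
  have 1: "Z \<inter> M \<subseteq> Z' \<inter> M" "ssum Z M \<subseteq> ssum Z' M" using chain_Suc by (auto simp: ssum_def)
  have w: "wsub (Z' \<inter> M)" "wsub (ssum Z' M)" using chain_Suc assms wsub_Int wsub_ssum by auto
  have 2: "Z \<inter> M \<noteq> Z' \<inter> M \<or> ssum Z M \<noteq> ssum Z' M"
  proof (rule ccontr)
    assume c: "\<not> ?thesis"
    have "Z' \<subseteq> Z"
    proof
      fix z' assume z': "z' \<in> Z'"
      then have "z' \<in> ssum Z M" using c ssum_upper1[OF assms(2), of Z'] by auto
      then obtain z m where zm: "z \<in> Z" "m \<in> M" "z' = z + m" by (auto simp: ssum_def)
      then have "m \<in> Z'" using wsub_diff[OF chain_Suc(3) z', of z] chain_Suc(2) by auto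
      then show "z' \<in> Z" using c zm wsub_add[OF wZ] by blast
    qed
    then show False using chain_Suc(2) by auto
  qed
  have "chain Y (Z' \<inter> M) (a + (if Z \<inter> M = Z' \<inter> M then 0 else 1))"
    by (rule chain_trans[OF chain_le1 ab(2)]) (use 1 w wsub_Int[OF wZ assms(2)] in auto)
  moreover have "chain M (ssum Z' M) (b + (if ssum Z M = ssum Z' M then 0 else 1))"
    by (rule chain_trans[OF chain_le1 ab(3)]) (use 1 w wsub_ssum[OF wZ assms(2)] in auto)
  moreover have "Suc n \<le> (a + (if Z \<inter> M = Z' \<inter> M then 0 else 1)) + (b + (if ssum Z M = ssum Z' M then 0 else 1))"
    using ab(1) 2 by auto
  ultimately show ?case by blast
qed

lemma len_add:
  assumes w: "wsub Y" "wsub M" "wsub Z" and sub: "Y \<subseteq> M" "M \<subseteq> Z" and f: "fl Y M" "fl M Z"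
  shows "fl Y Z" "len Y Z = len Y M + len M Z"
proof -
  have "chain Y Z (len Y M + len M Z)"
    using chain_trans[OF len_chain(1)[OF f(2) w(2,3) sub(2)] len_chain(1)[OF f(1) w(1,2) sub(1)]] .
  moreover have "n \<le> len Y M + len M Z" if ch: "chain Y Z n" for n
  proof -
    have eq: "Z \<inter> M = M" "ssum Z M = Z"
      using sub ssum_upper1[OF w(2), of Z] ssum_least[OF order_refl sub(2) w(3)] by auto
    obtain a b where ab: "n \<le> a + b" "chain Y M a" "chain M Z b"
      using chain_split[OF ch w(2) sub(1)] unfolding eq by auto
    show ?thesis using ab(1) len_chain(2)[OF f(1) w(1,2) sub(1) ab(2)] len_chain(2)[OF f(2) w(2,3) sub(2) ab(3)] by simp
  qed
  ultimately show "fl Y Z" "len Y Z = len Y M + len M Z" by (auto dest: len_eqI)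
qed

lemma fl_interval:
  assumes "fl Y Z" "wsub Y" "wsub Y'" "wsub Z'" "wsub Z" "Y \<subseteq> Y'" "Z' \<subseteq> Z"
  shows "fl Y' Z'"
proof -
  obtain N where N: "\<And>n. chain Y Z n \<Longrightarrow> n \<le> N" using assms(1) by (auto simp: fl_def)
  have "n \<le> N" if "chain Y' Z' n" for n
    using N[OF chain_trans[OF chain_le1[OF assms(4,5,7)] chain_trans[OF that chain_le1[OF assms(2,3,6)]]]]
    by simp
  then show ?thesis by (auto simp: fl_def)
qed

lemma chain_image:
  assumes "chain Y Z n" "Z \<subseteq> D" "inj_on g D" "\<And>T. wsub T \<Longrightarrow> T \<subseteq> D \<Longrightarrow> wsub (g ` T)"
  shows "chain (g ` Y) (g ` Z) n"
  using assms(1,2)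
proof (induction rule: chain.induct)
  case chain_0
  then show ?case by (intro chain.chain_0 assms(4))
next
  case (chain_Suc Z n Z')
  have "g ` Z \<subset> g ` Z'"
    using chain_Suc.hyps(2) chain_Suc.prems inj_on_image_eq_iff[OF assms(3), of Z Z'] by blast
  moreover have "Z \<subseteq> D" using chain_Suc by blast
  ultimately show ?case using chain_Suc by (intro chain.chain_Suc[of "g ` Y" "g ` Z"] assms(4)) auto
qed

text \<open>Stated for maps that carry submodules to submodules in both directions, so that it
  applies to the semilinear \<open>F\<close>.\<close>

lemma len_image:
  assumes "inj_on g D" "Y \<subseteq> Z" "Z \<subseteq> D" "\<And>T. wsub T \<Longrightarrow> T \<subseteq> D \<Longrightarrow> wsub (g ` T)"
    and "\<And>T. wsub T \<Longrightarrow> T \<subseteq> g ` D \<Longrightarrow> wsub (inv_into D g ` T)"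
  shows "len (g ` Y) (g ` Z) = len Y Z" "fl (g ` Y) (g ` Z) = fl Y Z"
proof -
  have inv: "inv_into D g ` g ` T = T" if "T \<subseteq> D" for T
    using that assms(1) by (rule inv_into_image_cancel[rotated])
  have "chain (g ` Y) (g ` Z) n \<longleftrightarrow> chain Y Z n" for n
  proof
    assume "chain (g ` Y) (g ` Z) n"
    then have "chain (inv_into D g ` g ` Y) (inv_into D g ` g ` Z) n"
      by (rule chain_image[where D = "g ` D"]) (use assms inj_on_inv_into[of "g ` D" g D] in auto)
    then show "chain Y Z n" using inv assms by simp
  qed (rule chain_image[OF _ assms(3,1,4)])
  then show "len (g ` Y) (g ` Z) = len Y Z" "fl (g ` Y) (g ` Z) = fl Y Z"
    using chain_cong_len by blast+
qed

text \<open>\<open>T \<mapsto> T + B\<close> and \<open>T \<mapsto> T \<inter> A\<close> preserve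
  strict chains, the former those between \<open>A \<inter> B\<close> and \<open>A\<close>, the
  latter those between \<open>B\<close> and \<open>A + B\<close>.\<close>

lemma len_second_iso:
  assumes w: "wsub A" "wsub B"
  shows "len B (ssum A B) = len (A \<inter> B) A" "fl B (ssum A B) = fl (A \<inter> B) A"
proof -
  have up: "chain B (ssum T B) n" if "chain (A \<inter> B) T n" "T \<subseteq> A" for T n
    using that
  proof (induction rule: chain.induct)
    case chain_0
    have "ssum (A \<inter> B) B = B" using ssum_upper2[OF chain_0(1), of B] ssum_least[of "A \<inter> B" B B] w by auto
    then show ?case using chain.chain_0[OF w(2)] by simp
  next
    case (chain_Suc T n T')
    note T = chain_wsub[OF chain_Suc(1)]
    obtain t' where t': "t' \<in> T'" "t' \<notin> T" using chain_Suc(2) by auto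
    have "t' \<notin> ssum T B"
    proof
      assume "t' \<in> ssum T B"
      then obtain t b where tb: "t \<in> T" "b \<in> B" "t' = t + b" by (auto simp: ssum_def)
      then have "b \<in> A" using wsub_diff[OF w(1), of t' t] t' chain_Suc by auto
      then show False using tb t' T wsub_add by blast
    qed
    moreover have "t' \<in> ssum T' B" using t' ssum_upper1[OF w(2)] by blast
    moreover have "ssum T B \<subseteq> ssum T' B" using chain_Suc(2) by (intro ssum_mono) auto
    ultimately have "ssum T B \<subset> ssum T' B" by blast
    then show ?case using chain_Suc w by (intro chain.chain_Suc[of B "ssum T B"] wsub_ssum) auto
  qed
  have down: "chain (A \<inter> B) (T \<inter> A) n" if "chain B T n" "T \<subseteq> ssum A B" for T n
    using that
  proof (induction rule: chain.induct)
    case chain_0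
    then show ?case using chain.chain_0[OF wsub_Int[OF w]] by (simp add: Int_commute)
  next
    case (chain_Suc T n T')
    note T = chain_wsub[OF chain_Suc(1)]
    obtain t' where t': "t' \<in> T'" "t' \<notin> T" using chain_Suc(2) by auto
    then obtain a b where ab: "a \<in> A" "b \<in> B" "t' = a + b" using chain_Suc.prems by (auto simp: ssum_def)
    then have "a \<in> T'" using wsub_diff[OF chain_Suc(3) t'(1), of b] T chain_Suc(2) by auto
    moreover have "a \<notin> T" using ab t' T wsub_add by blast
    ultimately have "T \<inter> A \<subset> T' \<inter> A" using ab chain_Suc(2) by blast
    then show ?case using chain_Suc w by (intro chain.chain_Suc[of "A \<inter> B" "T \<inter> A"] wsub_Int) auto
  qed
  have A: "ssum A B \<inter> A = A" using ssum_upper1[OF w(2), of A] by auto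
  have "chain B (ssum A B) n \<longleftrightarrow> chain (A \<inter> B) A n" for n
    using up[of A n] down[of "ssum A B" n] unfolding A by auto
  then show "len B (ssum A B) = len (A \<inter> B) A" "fl B (ssum A B) = fl (A \<inter> B) A"
    using chain_cong_len by blast+
qed

text \<open>A submodule strictly above \<open>T\<close> contains some \<open>a x\<close> with
  \<open>a\<close> outside \<open>pW\<close>, as \<open>p x\<close> lies in \<open>T\<close>; then
  \<open>a\<close> is a unit and \<open>x\<close> itself belongs to it. The quotient is therefore
  simple.\<close>

lemma len_cyclic:
  assumes T: "wsub T" and x: "x \<notin> T" "p *s x \<in> T"
  shows "fl T (ssum (wspan {x}) T)" "len T (ssum (wspan {x}) T) = 1"
proof -
  let ?Z = "ssum (wspan {x}) T"
  have wZ: "wsub ?Z" by (intro wsub_ssum wsub_wspan T)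
  have xZ: "x \<in> ?Z" "T \<subseteq> ?Z"
    using ssum_upper1[OF T] ssum_upper2[OF wsub_wspan] wspan_base[of x "{x}"] by blast+
  have int: "S = T" if S: "wsub S" "T \<subseteq> S" "S \<subset> ?Z" for S
  proof (rule ccontr)
    assume "S \<noteq> T"
    then obtain s where s: "s \<in> S" "s \<notin> T" using S by auto
    then have "s \<in> ?Z" using S by blast
    then obtain a t where at: "a \<in> W" "t \<in> T" "s = a *s x + t" by (auto simp: ssum_def wspan_singleton)
    have ax: "a *s x \<in> S" using wsub_diff[OF S(1) s(1), of t] at S by auto
    have a0: "a \<noteq> 0" using at s by auto
    have "val a = 0"
    proof (rule ccontr)
      assume "val a \<noteq> 0"
      then have "vge 1 a" using at(1) a0 by (auto simp: vge_def W_iff)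
      then have "(p powi (- 1) * a) *s p *s x \<in> T" unfolding vge_iff by (rule wsub_scale[OF T _ x(2)])
      then have "a *s x \<in> T" using p_nz by (simp add: power_int_minus field_simps)
      then show False using at s wsub_add[OF T] by blast
    qed
    then have "inverse a \<in> W" using a0 by (simp add: W_iff val_inverse)
    then have "inverse a *s a *s x \<in> S" using ax wsub_scale[OF S(1)] by blast
    then have "x \<in> S" using a0 by simp
    then have "?Z \<subseteq> S" using S wspan_minimal[of "{x}" S] by (intro ssum_least) auto
    then show False using S by auto
  qed
  have "n \<le> 1" if ch: "chain T ?Z n" for n
  proof (rule ccontr)
    assume "\<not> n \<le> 1"
    then obtain m where m: "n = Suc (Suc m)" by (metis One_nat_def Suc_leI not_less_eq_eq not0_implies_Suc le0 le_Suc_eq)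
    from ch[unfolded m] obtain S where S: "chain T S (Suc m)" "S \<subset> ?Z" by (cases rule: chain.cases) auto
    from S(1) obtain R where R: "chain T R m" "R \<subset> S" by (cases rule: chain.cases) auto
    have "S = T" using int[of S] chain_wsub[OF S(1)] S(2) by auto
    then show False using R(2) chain_wsub[OF R(1)] by auto
  qed
  moreover have "chain T ?Z 1" using chain_le1[OF T wZ xZ(2)] xZ(1) x(1) by metis
  ultimately show "fl T ?Z" "len T ?Z = 1" by (auto dest: len_eqI)
qed

section \<open>Minimal generating sets modulo a submodule, and lattice bases\<close>

definition irredundant :: "'b set \<Rightarrow> 'b set \<Rightarrow> bool" where
  "irredundant Y A \<longleftrightarrow> (\<forall>x\<in>A. x \<notin> ssum (wspan (A - {x})) Y)"

lemma ssum_assoc: "ssum (ssum A B) C = ssum A (ssum B C)"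
  by (auto simp: ssum_def add.assoc) (metis add.assoc)+

text \<open>Generators are added one at a time; irredundance makes each step proper and
  \<open>p x \<in> Y\<close> makes it simple.\<close>

lemma len_irredundant:
  assumes Y: "wsub Y" and A: "finite A" and irr: "irredundant Y A" and p: "\<And>x. x \<in> A \<Longrightarrow> p *s x \<in> Y"
  shows "fl Y (ssum (wspan A) Y) \<and> len Y (ssum (wspan A) Y) = card A"
proof -
  have "fl Y (ssum (wspan C) Y) \<and> len Y (ssum (wspan C) Y) = card C" if "C \<subseteq> A" for C
    using finite_subset[OF that A] that
  proof (induction C rule: finite_induct)
    case empty
    have "ssum {0} Y = Y" by (auto simp: ssum_def)
    moreover have "n \<le> 0" if "chain Y Y n" for n
      using that by (cases rule: chain.cases) (use chain_wsub in auto)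
    ultimately show ?case using len_eqI[OF chain_0[OF Y]] by auto
  next
    case (insert x C)
    let ?T = "ssum (wspan C) Y"
    have wT: "wsub ?T" by (intro wsub_ssum wsub_wspan Y)
    have "?T \<subseteq> ssum (wspan (A - {x})) Y" using insert by (intro ssum_mono wspan_mono) auto
    then have "x \<notin> ?T" using irr insert by (auto simp: irredundant_def)
    moreover have "p *s x \<in> ?T" using p insert ssum_upper2[OF wsub_wspan, of Y C] by auto
    ultimately have 1: "fl ?T (ssum (wspan {x}) ?T)" "len ?T (ssum (wspan {x}) ?T) = 1"
      using len_cyclic[OF wT] by auto
    have eq: "ssum (wspan {x}) ?T = ssum (wspan (insert x C)) Y"
      using wspan_Un[of "{x}" C] by (simp add: ssum_assoc)
    have "Y \<subseteq> ?T" "?T \<subseteq> ssum (wspan {x}) ?T" using ssum_upper2[OF wsub_wspan] by auto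
    moreover have "fl Y ?T" "len Y ?T = card C" using insert by auto
    ultimately show ?case
      using len_add[OF Y wT _ _ _ _ 1(1)] insert.hyps 1(2) wsub_ssum[OF wsub_wspan wT, of "{x}"] unfolding eq by simp
  qed
  then show ?thesis by auto
qed

text \<open>When \<open>pZ \<subseteq> Y\<close> this is the dimension of \<open>Z / Y\<close> over
  the residue field. The form matches \<open>vectorspace.dim\<close>, which is also a least size of
  a generating set.\<close>

definition mingens :: "'b set \<Rightarrow> 'b set \<Rightarrow> nat" where
  "mingens Y Z = (LEAST n. \<exists>A. finite A \<and> card A = n \<and> A \<subseteq> Z \<and> ssum (wspan A) Y = Z)"

lemma irredundant_minimal:
  assumes A: "finite A" "A \<subseteq> Z" "ssum (wspan A) Y = Z" and Y: "wsub Y"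
    and min: "\<And>C. finite C \<Longrightarrow> C \<subseteq> Z \<Longrightarrow> ssum (wspan C) Y = Z \<Longrightarrow> card A \<le> card C"
  shows "irredundant Y A"
  unfolding irredundant_def
proof (intro ballI notI)
  fix x assume x: "x \<in> A" "x \<in> ssum (wspan (A - {x})) Y"
  let ?T = "ssum (wspan (A - {x})) Y"
  have wT: "wsub ?T" by (intro wsub_ssum wsub_wspan Y)
  have "A \<subseteq> ?T"
  proof
    fix a assume "a \<in> A"
    then show "a \<in> ?T"
      using x(2) subsetD[OF ssum_upper1[OF Y, of "wspan (A - {x})"] wspan_base[of a "A - {x}"]] by (cases "a = x") auto
  qed
  then have "ssum (wspan A) Y \<subseteq> ?T"
    using wT ssum_upper2[OF wsub_wspan, of Y "A - {x}"] by (intro ssum_least wspan_minimal)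
  moreover have "?T \<subseteq> ssum (wspan A) Y" by (intro ssum_mono wspan_mono) auto
  ultimately have "?T = Z" using A(3) by auto
  then have "card A \<le> card (A - {x})" using A by (intro min) auto
  moreover have "card (A - {x}) < card A" using A(1) x(1) by (rule card_Diff1_less)
  ultimately show False by simp
qed

lemma len_mingens:
  assumes Y: "wsub Y" and p: "pe 1 Z \<subseteq> Y" and A: "finite A" "A \<subseteq> Z" "ssum (wspan A) Y = Z"
  shows "fl Y Z" "len Y Z = mingens Y Z"
proof -
  let ?P = "\<lambda>n. \<exists>A. finite A \<and> card A = n \<and> A \<subseteq> Z \<and> ssum (wspan A) Y = Z"
  have ex: "?P (card A)" using A by auto
  have "?P (mingens Y Z)" unfolding mingens_def by (rule LeastI[of ?P, OF ex])
  then obtain C where C: "finite C" "card C = mingens Y Z" "C \<subseteq> Z" "ssum (wspan C) Y = Z" by auto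
  have "irredundant Y C"
    using C(1,3,4) Y
  proof (rule irredundant_minimal)
    fix D assume "finite D" "D \<subseteq> Z" "ssum (wspan D) Y = Z"
    then have "mingens Y Z \<le> card D" unfolding mingens_def by (intro Least_le) auto
    then show "card C \<le> card D" using C by simp
  qed
  moreover have "p *s x \<in> Y" if "x \<in> C" for x using peI[of x Z 1] that C p by auto
  ultimately show "fl Y Z" "len Y Z = mingens Y Z" using len_irredundant[OF Y C(1)] C by auto
qed

lemma irredundant_independent:
  assumes "finite A" "irredundant Y A" "wsub Y"
  shows "independent A"
proof
  assume "dependent A"
  then obtain u where u: "(\<Sum>v\<in>A. u v *s v) = 0" "\<exists>v\<in>A. u v \<noteq> 0" using dependent_finite[OF assms(1)] by auto
  let ?N = "{v\<in>A. u v \<noteq> 0}"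
  have "finite ?N" "?N \<noteq> {}" using assms(1) u by auto
  \<comment> \<open>Division by a coefficient of least valuation turns the relation over the field
    into one that expresses \<open>x\<close> by the other vectors over \<open>W\<close>.\<close>
  then obtain x where x: "x \<in> A" "u x \<noteq> 0" and min: "\<And>v. v \<in> A \<Longrightarrow> u v \<noteq> 0 \<Longrightarrow> val (u x) \<le> val (u v)"
    using ex_min_if_finite[of "(\<lambda>v. val (u v)) ` ?N"] by (auto simp: not_less)
  have "u x *s x + (\<Sum>v\<in>A - {x}. u v *s v) = 0" using u(1) sum.remove[OF assms(1) x(1), of "\<lambda>v. u v *s v"] by simp
  then have "u x *s x = - (\<Sum>v\<in>A - {x}. u v *s v)" by (simp add: eq_neg_iff_add_eq_0)
  then have "inverse (u x) *s u x *s x = (- inverse (u x)) *s (\<Sum>v\<in>A - {x}. u v *s v)"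
    by (simp del: scale_scale)
  then have "x = (- inverse (u x)) *s (\<Sum>v\<in>A - {x}. u v *s v)" using x(2) by simp
  also have "\<dots> = (\<Sum>v\<in>A - {x}. (- inverse (u x) * u v) *s v)" by (simp add: scale_sum_right)
  also have "\<dots> \<in> wspan (A - {x})"
  proof (rule wspan_sumI)
    fix v assume "v \<in> A - {x}"
    then have "inverse (u x) * u v \<in> W" using min[of v] x(2) by (cases "u v = 0") (auto simp: W_iff val_mult val_inverse)
    then show "- inverse (u x) * u v \<in> W" using W_uminus by fastforce
  qed
  finally show False using assms x(1) ssum_upper1[OF assms(3)] unfolding irredundant_def by blast
qed

text \<open>Irredundant modulo \<open>p Y\<close> implies linearly independent over the field, which bounds the size.\<close>

lemma ex_lattice_basis:
  assumes Y: "wsub Y" "Y \<subseteq> span B" "finite B"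
  obtains A where "finite A" "A \<subseteq> Y" "independent A" "ssum (wspan A) (pe 1 Y) = Y"
    "fl (pe 1 Y) Y" "len (pe 1 Y) Y = card A"
proof -
  let ?P = "\<lambda>A. finite A \<and> A \<subseteq> Y \<and> irredundant (pe 1 Y) A"
  have wp: "wsub (pe 1 Y)" by (rule wsub_pe[OF Y(1)])
  have sub: "pe 1 Y \<subseteq> Y" using pe_antimono[OF Y(1), of 0 1] by simp
  have bound: "card A \<le> card B" if "?P A" for A
    using independent_span_bound[OF Y(3) irredundant_independent[of A "pe 1 Y"]] that Y wp by auto
  have "?P {}" by (auto simp: irredundant_def)
  \<comment> \<open>A largest irredundant set exists because such sets are independent; its
    maximality will force it to generate.\<close>
  then have "\<exists>A. ?P A \<and> (\<forall>C. ?P C \<longrightarrow> card C \<le> card A)"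
    by (rule ex_has_greatest_nat[of ?P "{}" card "Suc (card B)"]) (intro allI impI le_imp_less_Suc bound)
  then obtain A where A0: "?P A \<and> (\<forall>C. ?P C \<longrightarrow> card C \<le> card A)" by (rule exE)
  note A = conjunct1[OF A0] conjunct2[OF A0]
  let ?T = "ssum (wspan A) (pe 1 Y)"
  have T: "wsub ?T" by (intro wsub_ssum wsub_wspan wp)
  have TY: "?T \<subseteq> Y" using A(1) sub Y by (intro ssum_least wspan_minimal) auto
  have "Y \<subseteq> ?T"
  proof (rule ccontr)
    assume "\<not> Y \<subseteq> ?T"
    then obtain y where y: "y \<in> Y" "y \<notin> ?T" by auto
    have yA: "y \<notin> A" using y ssum_upper1[OF wp] wspan_base by blast
    have "irredundant (pe 1 Y) (insert y A)"
      unfolding irredundant_def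
    proof (intro ballI notI)
      fix x assume x: "x \<in> insert y A" "x \<in> ssum (wspan (insert y A - {x})) (pe 1 Y)"
      show False
      proof (cases "x = y")
        case True
        then show False using x y yA by simp
      next
        case False
        then have xA: "x \<in> A" using x by auto
        have "insert y A - {x} = insert y (A - {x})" using False by auto
        with x(2) obtain w z q where w: "w \<in> W" "z \<in> wspan (A - {x})" "q \<in> pe 1 Y" "x = w *s y + z + q"
          by (auto simp: ssum_def elim!: wspan_insertE)
        show False
        \<comment> \<open>If the coefficient \<open>w\<close> of \<open>y\<close> is divisible by
          \<open>p\<close>, the term \<open>w y\<close> is absorbed by \<open>pY\<close> and
          \<open>x\<close> was already redundant in \<open>A\<close>; otherwise \<open>w\<close> is
          a unit and \<open>y\<close> was already generated.\<close>
        proof (cases "vge 1 w")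
          case True
          have "w *s y \<in> pe 1 Y" using pe_vge[OF Y(1) True, of y 0] y by simp
          then have "x \<in> ssum (wspan (A - {x})) (pe 1 Y)"
            using w ssumI[of z "wspan (A - {x})" "w *s y + q" "pe 1 Y"] wsub_add[OF wp] by (simp add: add.left_commute add.assoc)
          then show False using A(1) xA by (auto simp: irredundant_def)
        next
          case False
          then have w0: "w \<noteq> 0" "val w = 0" using w(1) by (auto simp: vge_def W_iff)
          then have iw: "inverse w \<in> W" by (simp add: W_iff val_inverse)
          have "x \<in> ?T" "z \<in> ?T" "q \<in> ?T"
            using ssum_upper1[OF wp, of "wspan A"] ssum_upper2[OF wsub_wspan, of "pe 1 Y" A] wspan_base[OF xA]
              wspan_mono[of "A - {x}" A] w by auto
          then have "x - z - q \<in> ?T" by (intro wsub_diff[OF T])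
          then have "inverse w *s (w *s y) \<in> ?T"
            using wsub_scale[OF T iw, of "x - z - q"] w(4) by (simp del: scale_scale)
          then show False using y w0 by simp
        qed
      qed
    qed
    then have "card (insert y A) \<le> card A" using A(1) y by (intro A(2)[rule_format]) auto
    then show False using yA A(1) by simp
  qed
  with TY have eq: "?T = Y" by auto
  have "p *s x \<in> pe 1 Y" if "x \<in> A" for x using peI[of x Y 1] that A(1) by auto
  then have "fl (pe 1 Y) Y \<and> len (pe 1 Y) Y = card A" using len_irredundant[OF wp, of A] A(1) eq by auto
  then show thesis using that[of A] A(1) eq irredundant_independent[of A "pe 1 Y"] wp by auto
qed

lemma span_wspan: "span (wspan A) = span A"
  by (metis span_mono span_minimal subspace_span wsub_subspace span_superset wspan_minimal wspan_superset order_antisym)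

text \<open>A separated submodule of a finite-dimensional space is free, of rank the dimension of
  its span: a basis modulo \<open>p\<close> generates by Nakayama.\<close>

lemma ex_lattice_basis_separated:
  assumes "wsub Y" "Y \<subseteq> span B" "finite B" "separated Y"
  obtains A where "finite A" "independent A" "Y = wspan A" "card A = dim (span Y)"
    "fl (pe 1 Y) Y" "len (pe 1 Y) Y = card A"
proof -
  obtain A where A: "finite A" "A \<subseteq> Y" "independent A" "ssum (wspan A) (pe 1 Y) = Y"
    "fl (pe 1 Y) Y" "len (pe 1 Y) Y = card A"
    using ex_lattice_basis[OF assms(1-3)] by metis
  have "Y = wspan A" using nakayama[OF assms(1,4) A(1,2)] A(4) by auto
  moreover have "dim (span (wspan A)) = card A"
    unfolding span_wspan by (rule dim_span_eq_card_independent[OF A(3)])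
  ultimately show thesis using that[of A] A by metis
qed

end

section \<open>The fraction field of the Witt vectors as a complete discretely valued field\<close>

lemma ghost_cong:
  assumes "\<And>i. i \<le> n \<Longrightarrow> u i = v i"
  shows "ghost p u n = ghost p v n"
  unfolding ghost_def by (rule sum.cong) (use assms in auto)

text \<open>Truncation: component \<open>i\<close> of a sum involves only components up to
  \<open>i\<close> of the summands, because this holds for the ghost components of the
  lifts.\<close>

lemma wcoeff_add_cong:
  fixes x y x' y' :: "('k::field_prime_char) wt"
  assumes "\<And>j. j \<le> i \<Longrightarrow> wcoeff x j = wcoeff x' j" "\<And>j. j \<le> i \<Longrightarrow> wcoeff y j = wcoeff y' j"
  shows "wcoeff (x + y) i = wcoeff (x' + y') i"
proof -
  have "wadd CHAR('k) (wlift x) (wlift y) i = wadd CHAR('k) (wlift x') (wlift y') i"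
  proof (rule ghost_inject[OF int_poly_tf, of i])
    fix j assume j: "j \<le> i"
    have "ghost CHAR('k) (wlift x) j = ghost CHAR('k) (wlift x') j" "ghost CHAR('k) (wlift y) j = ghost CHAR('k) (wlift y') j"
      by (rule ghost_cong; use assms j in \<open>simp add: wlift_def\<close>)+
    then show "ghost CHAR('k) (wadd CHAR('k) (wlift x) (wlift y)) j = ghost CHAR('k) (wadd CHAR('k) (wlift x') (wlift y')) j"
      by (simp add: ghost_wadd[OF CHAR_prime])
  qed simp
  moreover have "x + y = wred (wadd CHAR('k) (wlift x) (wlift y))" "x' + y' = wred (wadd CHAR('k) (wlift x') (wlift y'))"
    unfolding wred_add[symmetric] by simp_all
  ultimately show ?thesis by (simp add: wred_def)
qed

lemma p_power_mult_wt: "of_nat CHAR('k) ^ n * x = (wV ^^ n) ((wF ^^ n) x)" for x :: "('k::field_prime_char) wt"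
proof (induction n)
  case (Suc n)
  have "of_nat CHAR('k) ^ Suc n * x = of_nat CHAR('k) * (wV ^^ n) ((wF ^^ n) x)"
    unfolding Suc[symmetric] by (simp add: mult.assoc)
  also have "\<dots> = wV ((wV ^^ n) ((wF ^^ Suc n) x))"
    using wF_wV_pow[of 1 n "(wF ^^ n) x"] by (simp add: p_mult_wt)
  finally show ?case by simp
qed simp

definition wi :: "('k::field_prime_char) wt \<Rightarrow> 'k wt fract" where "wi x = Fract x 1"

lemma wi_map: "comm_ring_map wi"
  by (simp add: comm_ring_map_def wi_def One_fract_def)

lemmas wi_simps = comm_ring_map_simps[OF wi_map]

lemma wi_inject [simp]: "wi x = wi y \<longleftrightarrow> x = y"
  by (simp add: wi_def eq_fract)

lemma wF_0 [simp]: "wF 0 = (0 :: ('k::field_prime_char) wt)"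
proof -
  have "wF 0 + wF 0 = wF 0 + (0 :: 'k wt)" using wF_add[of 0 "0 :: 'k wt"] by simp
  then show ?thesis by (simp only: add_left_cancel)
qed

lemma wF_eq_0 [simp]: "wF x = 0 \<longleftrightarrow> x = (0 :: ('k::field_prime_char) wt)"
  using wF_inj[of x 0] by simp

text \<open>Frobenius on fractions through a representative; independence of the choice uses that
  the coefficientwise Frobenius is multiplicative with trivial kernel.\<close>

definition w\<sigma> :: "('k::field_prime_char) wt fract \<Rightarrow> 'k wt fract" where
  "w\<sigma> z = (SOME w. \<exists>a b. b \<noteq> 0 \<and> z = Fract a b \<and> w = Fract (wF a) (wF b))"

lemma w\<sigma>_Fract:
  fixes a b :: "('k::field_prime_char) wt"
  assumes "b \<noteq> 0"
  shows "w\<sigma> (Fract a b) = Fract (wF a) (wF b)"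
  unfolding w\<sigma>_def
proof (rule some_equality)
  show "\<exists>a' b'. b' \<noteq> 0 \<and> Fract a b = Fract a' b' \<and> Fract (wF a) (wF b) = Fract (wF a') (wF b')"
    using assms by blast
next
  fix w assume "\<exists>a' b'. b' \<noteq> 0 \<and> Fract a b = Fract a' b' \<and> w = Fract (wF a') (wF b')"
  then obtain a' b' where ab: "b' \<noteq> 0" "Fract a b = Fract a' b'" "w = Fract (wF a') (wF b')" by auto
  then have "wF (a * b') = wF (a' * b)" using assms by (simp add: eq_fract)
  then show "w = Fract (wF a) (wF b)" using ab assms by (simp add: eq_fract wF_mult)
qed

lemma w\<sigma>_wi: "w\<sigma> (wi x) = wi (wF x)" for x :: "('k::field_prime_char) wt"
  by (simp add: wi_def w\<sigma>_Fract wF_1)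

lemma wi_div: "b \<noteq> 0 \<Longrightarrow> Fract a b = wi a / wi b" for a b :: "('k::field_prime_char) wt"
  by (simp add: wi_def)

context
  assumes perfect: "surj (\<lambda>x::'k::field_prime_char. x ^ CHAR('k))"
begin

lemma wF_surj: "\<exists>y. wF y = (x :: 'k wt)"
proof -
  have "\<forall>n. \<exists>c. c ^ CHAR('k) = wcoeff x n" using perfect by (metis surjD)
  then obtain c where "\<forall>n. c n ^ CHAR('k) = wcoeff x n" by metis
  then have "wF (Wt c) = x" by (intro wt_eqI) (simp add: wF_def)
  then show ?thesis by blast
qed

lemma wF_pow_surj: "\<exists>y. (wF ^^ n) y = (x :: 'k wt)"
proof (induction n arbitrary: x)
  case (Suc n)
  obtain y where "wF y = x" using wF_surj by blast
  moreover obtain z where "(wF ^^ n) z = y" using Suc by blast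
  ultimately show ?case by auto
qed simp

text \<open>Perfectness makes the coefficientwise Frobenius surjective, so divisibility by
  \<open>p^n = V^n F^n\<close> is the same as vanishing of the first \<open>n\<close> components.
  The \<open>p\<close>-adic topology is thus the componentwise one.\<close>

lemma wcoeff_zero_iff: "(\<forall>i<n. wcoeff x i = 0) \<longleftrightarrow> (\<exists>w. x = of_nat CHAR('k) ^ n * (w :: 'k wt))"
proof
  assume "\<forall>i<n. wcoeff x i = 0"
  then have "x = (wV ^^ n) (Wt (\<lambda>i. wcoeff x (i + n)))" by (intro wt_eq_wV_pow) simp
  moreover obtain w where "(wF ^^ n) w = Wt (\<lambda>i. wcoeff x (i + n))" using wF_pow_surj by blast
  ultimately have "x = of_nat CHAR('k) ^ n * w" by (simp add: p_power_mult_wt)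
  then show "\<exists>w. x = of_nat CHAR('k) ^ n * w" ..
qed (auto simp: p_power_mult_wt wcoeff_wV_pow)

lemma wcoeff_eq_iff: "(\<forall>i<n. wcoeff x i = wcoeff y i) \<longleftrightarrow> (\<exists>w. x = y + of_nat CHAR('k) ^ n * (w :: 'k wt))"
proof
  assume eq: "\<forall>i<n. wcoeff x i = wcoeff y i"
  have "wcoeff (x + - y) i = 0" if "i < n" for i
  proof -
    have "wcoeff (x + - y) i = wcoeff (y + - y) i" by (rule wcoeff_add_cong) (use eq that in auto)
    then show ?thesis by simp
  qed
  then obtain w where "x + - y = of_nat CHAR('k) ^ n * w" using wcoeff_zero_iff[of n "x + - y"] by auto
  then show "\<exists>w. x = y + of_nat CHAR('k) ^ n * w" by (intro exI[of _ w]) (simp add: algebra_simps)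
next
  assume "\<exists>w. x = y + of_nat CHAR('k) ^ n * w"
  then obtain w where w: "x = y + of_nat CHAR('k) ^ n * w" by blast
  have z: "\<forall>i<n. wcoeff (of_nat CHAR('k) ^ n * w) i = 0" using wcoeff_zero_iff[of n "of_nat CHAR('k) ^ n * w"] by blast
  have "wcoeff (y + of_nat CHAR('k) ^ n * w) i = wcoeff (y + 0) i" if "i < n" for i
    by (rule wcoeff_add_cong) (use z that in auto)
  then show "\<forall>i<n. wcoeff x i = wcoeff y i" using w by simp
qed

lemma wt_complete: "\<exists>s. \<forall>n. \<exists>w. s = (\<Sum>i<n. of_nat CHAR('k) ^ i * f i) + of_nat CHAR('k) ^ n * (w :: 'k wt)"
proof -
  let ?S = "\<lambda>n. \<Sum>i<n. of_nat CHAR('k) ^ i * f i"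
  have step: "wcoeff (?S (i + 1 + k)) i = wcoeff (?S (i + 1)) i" for i k
  proof (induction k)
    case (Suc k)
    let ?m = "i + 1 + k"
    have "\<exists>w. ?S (Suc ?m) = ?S ?m + of_nat CHAR('k) ^ ?m * w" by (intro exI[of _ "f ?m"]) simp
    then have "wcoeff (?S (Suc ?m)) i = wcoeff (?S ?m) i"
      using wcoeff_eq_iff[of ?m "?S (Suc ?m)" "?S ?m"] by (simp del: sum.lessThan_Suc)
    then show ?case using Suc by simp
  qed simp
  \<comment> \<open>Component \<open>i\<close> of the partial sums is constant from
    \<open>i + 1\<close> terms on; the limit collects these stable values.\<close>
  define s where "s = Wt (\<lambda>i. wcoeff (?S (i + 1)) i)"
  have "\<forall>i<n. wcoeff s i = wcoeff (?S n) i" for n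
  proof (intro allI impI)
    fix i assume "i < n"
    then have "n = i + 1 + (n - i - 1)" by simp
    then have "wcoeff (?S n) i = wcoeff (?S (i + 1)) i" using step[of i "n - i - 1"] by metis
    then show "wcoeff s i = wcoeff (?S n) i" by (simp add: s_def)
  qed
  then have "\<exists>w. s = ?S n + of_nat CHAR('k) ^ n * w" for n
    by (intro iffD1[OF wcoeff_eq_iff])
  then have "\<forall>n. \<exists>w. s = ?S n + of_nat CHAR('k) ^ n * w" by (rule allI)
  then show ?thesis by (rule exI[of _ s])
qed

text \<open>An inverse modulo \<open>p\<close> is corrected by the geometric series of its error
  \<open>p c\<close>, which converges by completeness.\<close>

lemma wt_unit:
  assumes "wcoeff y 0 \<noteq> 0"
  shows "\<exists>z. y * z = (1 :: 'k wt)"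
proof -
  let ?p = "of_nat CHAR('k) :: 'k wt"
  define b where "b = Wt (\<lambda>n. if n = 0 then inverse (wcoeff y 0) else 0)"
  have "\<forall>i<1. wcoeff (y * b) i = wcoeff 1 i" using assms by (simp add: wcoeff_mult_0 b_def one_wt_def)
  then obtain c where c: "y * b = 1 + ?p * c" using wcoeff_eq_iff[of 1 "y * b" 1] by auto
  obtain s where s: "\<And>n. \<exists>w. s = (\<Sum>i<n. ?p ^ i * (- c) ^ i) + ?p ^ n * w"
    using wt_complete[of "\<lambda>i. (- c) ^ i"] by auto
  have "\<forall>i<n. wcoeff (y * b * s - 1) i = 0" for n
  proof -
    obtain w where w: "s = (\<Sum>i<n. ?p ^ i * (- c) ^ i) + ?p ^ n * w" using s by blast
    have geo: "(1 + ?p * c) * (\<Sum>i<n. ?p ^ i * (- c) ^ i) = 1 - ?p ^ n * (- c) ^ n"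
      by (induction n) (simp_all add: algebra_simps)
    have "y * b * s - 1 = ?p ^ n * ((1 + ?p * c) * w - (- c) ^ n)"
      unfolding c w distrib_left[of "1 + ?p * c"] geo by (simp add: algebra_simps)
    then show ?thesis using wcoeff_zero_iff[of n "y * b * s - 1"] by blast
  qed
  then have "y * b * s - 1 = 0" by (intro wt_eqI) auto
  then show ?thesis by (intro exI[of _ "b * s"]) (simp add: mult.assoc)
qed

lemma wt_factor:
  assumes "x \<noteq> (0 :: 'k wt)"
  obtains n u v where "x = of_nat CHAR('k) ^ n * u" "u * v = 1"
proof -
  have "\<exists>m. wcoeff x m \<noteq> 0" using assms wt_eqI[of x 0] by auto
  then obtain n where n: "wcoeff x n \<noteq> 0" "\<And>i. i < n \<Longrightarrow> wcoeff x i = 0"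
    using exists_least_iff[of "\<lambda>m. wcoeff x m \<noteq> 0"] by auto
  then obtain u where u: "x = of_nat CHAR('k) ^ n * u" using wcoeff_zero_iff[of n x] by auto
  have "wcoeff u 0 \<noteq> 0"
  proof
    assume "wcoeff u 0 = 0"
    then have "\<forall>i<1. wcoeff u i = 0" by simp
    then obtain w where "u = of_nat CHAR('k) * w" using wcoeff_zero_iff[of 1 u] by auto
    then have "x = of_nat CHAR('k) ^ Suc n * w" using u by (simp add: mult.assoc mult.left_commute)
    then have "\<forall>i<Suc n. wcoeff x i = 0" using wcoeff_zero_iff[of "Suc n" x] by blast
    then show False using n by simp
  qed
  then show thesis using wt_unit u that by blast
qed

lemma of_nat_CHAR_wt_nz: "of_nat CHAR('k) \<noteq> (0 :: 'k wt)"
proof -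
  have "wcoeff (of_nat CHAR('k) * 1 :: 'k wt) 1 = 1"
    unfolding p_mult_wt wF_1 by (simp add: wV_def wshift_def one_wt_def)
  then have "wcoeff (of_nat CHAR('k) * 1 :: 'k wt) 1 \<noteq> wcoeff (0 * 1) 1" by simp
  then show ?thesis by (rule contrapos_nn) (simp only:)
qed

lemma dvr_frob_witt: "dvr_frob (range (wi :: 'k wt \<Rightarrow> _)) (of_nat CHAR('k)) w\<sigma>"
proof -
  let ?p = "of_nat CHAR('k) :: 'k wt fract"
  have wip: "?p = wi (of_nat CHAR('k))" by (simp add: wi_simps)
  have pnz: "?p \<noteq> 0" using of_nat_CHAR_wt_nz unfolding wip wi_simps(4)[symmetric] wi_inject .
  have fr: "\<exists>a b. b \<noteq> 0 \<and> z = Fract a b" for z :: "'k wt fract"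
    by (cases z rule: Fract_cases) auto
  have \<sigma>inj: "x = y" if "w\<sigma> x = w\<sigma> y" for x y :: "'k wt fract"
  proof -
    obtain a b c d where x: "b \<noteq> 0" "x = Fract a b" and y: "d \<noteq> 0" "y = Fract c d" using fr by metis
    have "wF (a * d) = wF (c * b)" using that x y by (simp add: w\<sigma>_Fract eq_fract wF_mult)
    then show ?thesis using x y by (simp add: eq_fract wF_inj)
  qed
  show ?thesis
  proof
    show "0 \<in> range (wi :: 'k wt \<Rightarrow> _)" using wi_simps(4) by (metis rangeI)
    show "1 \<in> range (wi :: 'k wt \<Rightarrow> _)" using wi_simps(1) by (metis rangeI)
    show "?p \<in> range wi" unfolding wip by simp
    show "?p \<noteq> 0" by (rule pnz)
    show "inverse ?p \<notin> range wi"
    proof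
      assume "inverse ?p \<in> range wi"
      then obtain x where "inverse ?p = wi x" by auto
      then have "wi (of_nat CHAR('k) * x) = wi 1"
        unfolding wi_simps(3) wip[symmetric] wi_simps(1) using pnz by (metis right_inverse)
      then have "wcoeff (of_nat CHAR('k) * x) 0 = wcoeff 1 0" by simp
      then show False unfolding p_mult_wt by (simp add: wV_def wshift_def one_wt_def)
    qed
    show "w\<sigma> 1 = (1 :: 'k wt fract)" using w\<sigma>_wi[of "1 :: 'k wt"] by (simp add: wi_simps wF_1)
    show "w\<sigma> ?p = ?p"
    proof -
      have "wF (of_nat n) = (of_nat n :: 'k wt)" for n
        by (induction n) (simp_all add: wF_add wF_1)
      then show ?thesis unfolding wip w\<sigma>_wi by simp
    qed
    show "surj (w\<sigma> :: 'k wt fract \<Rightarrow> _)"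
    proof (rule surjI)
      fix z :: "'k wt fract"
      obtain a b where ab: "b \<noteq> 0" "z = Fract a b" using fr by blast
      obtain a' b' where "wF a' = a" "wF b' = b" using wF_surj by metis
      then have "w\<sigma> (Fract a' b') = z" using ab w\<sigma>_Fract[of b' a'] wF_0 by metis
      then show "w\<sigma> (SOME y. w\<sigma> y = z) = z" by (rule someI)
    qed
  next
    fix a b :: "'k wt fract"
    show "w\<sigma> (a * b) = w\<sigma> a * w\<sigma> b"
      using fr[of a] fr[of b] by (auto simp: w\<sigma>_Fract wF_mult)
    show "w\<sigma> (a + b) = w\<sigma> a + w\<sigma> b"
      using fr[of a] fr[of b] by (auto simp: w\<sigma>_Fract wF_mult wF_add)
    show "w\<sigma> a \<in> range wi \<longleftrightarrow> a \<in> range wi"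
    proof
      assume "w\<sigma> a \<in> range wi"
      then obtain x where "w\<sigma> a = wi x" by auto
      moreover obtain y where "wF y = x" using wF_surj by blast
      ultimately have "w\<sigma> a = w\<sigma> (wi y)" by (simp add: w\<sigma>_wi)
      then show "a \<in> range wi" using \<sigma>inj by blast
    qed (auto simp: w\<sigma>_wi)
    show "a \<in> range wi \<Longrightarrow> b \<in> range wi \<Longrightarrow> a + b \<in> range wi" by (auto simp: wi_simps(2)[symmetric])
    show "a \<in> range wi \<Longrightarrow> b \<in> range wi \<Longrightarrow> a * b \<in> range wi" by (auto simp: wi_simps(3)[symmetric])
    show "a \<in> range wi \<Longrightarrow> - a \<in> range wi" by (auto simp: wi_simps(5)[symmetric])
    show "\<exists>e u. u \<in> range wi \<and> inverse u \<in> range wi \<and> a = ?p powi e * u" if "a \<noteq> 0"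
    proof -
      obtain x y where xy: "y \<noteq> 0" "a = Fract x y" using fr by blast
      then have x0: "x \<noteq> 0" using that by (auto simp: Zero_fract_def eq_fract)
      obtain n u v where u: "x = of_nat CHAR('k) ^ n * u" "u * v = 1" using wt_factor[OF x0] by metis
      obtain m u' v' where u': "y = of_nat CHAR('k) ^ m * u'" "u' * v' = 1" using wt_factor[OF xy(1)] by metis
      have uv: "wi u * wi v = 1" "wi u' * wi v' = 1" using u u' by (metis wi_simps(1,3))+
      then have nz: "wi u \<noteq> 0" "wi u' \<noteq> 0" "wi v \<noteq> 0" "wi v' \<noteq> 0" by auto
      have i: "inverse (wi u) = wi v" "inverse (wi u') = wi v'" using uv inverse_unique by blast+
      have "a = (?p ^ n * wi u) / (?p ^ m * wi u')"
        using xy wi_div[OF xy(1), of x] by (simp add: u(1) u'(1) wi_simps)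
      also have "\<dots> = ?p powi (int n - int m) * (wi u * inverse (wi u'))"
        using pnz by (simp add: power_int_diff field_simps)
      finally have "a = ?p powi (int n - int m) * wi (u * v')" unfolding i wi_simps(3) .
      moreover have "inverse (wi v') = wi u'"
        using uv(2) by (intro inverse_unique) (simp add: mult.commute)
      then have "inverse (wi (u * v')) = wi (v * u')"
        unfolding wi_simps(3) inverse_mult_distrib i by simp
      ultimately show ?thesis by (intro exI[of _ "int n - int m"] exI[of _ "wi (u * v')"]) auto
    qed
  next
    fix f :: "nat \<Rightarrow> 'k wt fract" assume "\<And>n. f n \<in> range wi"
    then have "\<forall>n. \<exists>x. f n = wi x" by blast
    then obtain g where g: "\<And>n. f n = wi (g n)" by metis
    obtain s where s: "\<And>n. \<exists>w. s = (\<Sum>i<n. of_nat CHAR('k) ^ i * g i) + of_nat CHAR('k) ^ n * w"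
      using wt_complete[of g] by auto
    have "\<exists>w\<in>range wi. wi s = (\<Sum>i<n. ?p ^ i * f i) + ?p ^ n * w" for n
    proof -
      obtain w where "s = (\<Sum>i<n. of_nat CHAR('k) ^ i * g i) + of_nat CHAR('k) ^ n * w" using s by blast
      then have "wi s = (\<Sum>i<n. ?p ^ i * f i) + ?p ^ n * wi w" by (simp add: g wi_simps)
      then show ?thesis by blast
    qed
    then show "\<exists>s\<in>range wi. \<forall>n. \<exists>w\<in>range wi. s = (\<Sum>i<n. ?p ^ i * f i) + ?p ^ n * w" by blast
  qed
qed

end

section \<open>Slopes of a lattice with Frobenius\<close>

text \<open>The image \<open>X\<close> of a component in its isocrystal \<open>span B\<close>.
  \<open>X_bound\<close> says that \<open>X\<close> has bounded denominators with respect to the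
  free lattice on \<open>B\<close>, \<open>pX_FX\<close> is what remains of \<open>F V = p\<close>,
  and \<open>V_nil\<close> states that \<open>p^n F^(-n) x\<close>, that is \<open>V^n x\<close>,
  eventually lies in \<open>p^c X\<close>, with a threshold depending on \<open>x\<close>.\<close>

locale frob_lattice = lattice_space W p \<sigma> scale
  for W :: "'a::field set" and p :: 'a and \<sigma> :: "'a \<Rightarrow> 'a"
    and scale :: "'a \<Rightarrow> 'b::ab_group_add \<Rightarrow> 'b" (infixr \<open>*s\<close> 75) +
  fixes F :: "'b \<Rightarrow> 'b" and B X :: "'b set" and m0 :: nat
  assumes F_add: "F (x + y) = F x + F y" and F_scale: "F (a *s x) = \<sigma> a *s F x"
    and B_fin: "finite B" and B_ind: "independent B"
    and F_E: "x \<in> span B \<Longrightarrow> F x \<in> span B" and F_inj: "x \<in> span B \<Longrightarrow> F x = 0 \<Longrightarrow> x = 0"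
    and X_wsub: "wsub X" and B_X: "B \<subseteq> X" and X_bound: "X \<subseteq> pe (- int m0) (wspan B)"
    and F_X: "x \<in> X \<Longrightarrow> F x \<in> X" and pX_FX: "x \<in> pe 1 X \<Longrightarrow> x \<in> F ` X"
    and V_nil: "x \<in> X \<Longrightarrow> \<exists>n0. \<forall>n\<ge>n0. p powi int n *s x \<in> (F ^^ n) ` pe c X"
begin

abbreviation E :: "'b set" where "E \<equiv> span B"

lemma F_0 [simp]: "F 0 = 0"
  using F_scale[of 0 0] by simp

lemma F_uminus: "F (- x) = - F x"
  using F_add[of x "- x"] by (simp add: add_eq_0_iff)

lemma F_diff: "F (x - y) = F x - F y"
  using F_add[of x "- y"] by (simp add: F_uminus)

lemma Fn_add: "(F ^^ n) (x + y) = (F ^^ n) x + (F ^^ n) y"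
  by (induction n) (simp_all add: F_add)

lemma Fn_0 [simp]: "(F ^^ n) 0 = 0"
  by (induction n) simp_all

lemma Fn_diff: "(F ^^ n) (x - y) = (F ^^ n) x - (F ^^ n) y"
  by (induction n) (simp_all add: F_diff)

lemma Fn_scale: "(F ^^ n) (a *s x) = (\<sigma> ^^ n) a *s (F ^^ n) x"
  by (induction n) (simp_all add: F_scale)

lemma \<sigma>n_0 [simp]: "(\<sigma> ^^ n) a = 0 \<longleftrightarrow> a = 0"
  by (induction n) simp_all

lemma val_\<sigma>n: "val ((\<sigma> ^^ n) a) = val a"
  by (induction n) (simp_all add: val_\<sigma>)

lemma \<sigma>n_W: "(\<sigma> ^^ n) a \<in> W \<longleftrightarrow> a \<in> W"
  by (induction n) (simp_all add: \<sigma>_W)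

lemma \<sigma>n_surj: "\<exists>b. (\<sigma> ^^ n) b = a"
proof (induction n arbitrary: a)
  case (Suc n)
  obtain c where "\<sigma> c = a" using \<sigma>_surj by (metis surjD)
  moreover obtain b where "(\<sigma> ^^ n) b = c" using Suc by blast
  ultimately show ?case by auto
qed simp

lemma Fn_powi: "(F ^^ n) (p powi e *s x) = p powi e *s (F ^^ n) x"
  by (induction n) (simp_all add: F_scale)

lemma subspace_E: "subspace E" by (rule subspace_span)

lemma Fn_E: "x \<in> E \<Longrightarrow> (F ^^ n) x \<in> E"
  by (induction n) (simp_all add: F_E)

lemma Fn_inj: "x \<in> E \<Longrightarrow> (F ^^ n) x = 0 \<Longrightarrow> x = 0"
  by (induction n) (use F_inj Fn_E in auto)

lemma Fn_inj_on: "inj_on (F ^^ n) E"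
proof (rule inj_onI)
  fix x y assume "x \<in> E" "y \<in> E" "(F ^^ n) x = (F ^^ n) y"
  then have "(F ^^ n) (x - y) = 0" "x - y \<in> E" by (simp_all add: Fn_diff span_diff)
  then show "x = y" using Fn_inj by fastforce
qed

lemma wsub_Fn_image:
  assumes "wsub Y"
  shows "wsub ((F ^^ n) ` Y)"
  unfolding wsub_def
proof (intro conjI ballI)
  show "0 \<in> (F ^^ n) ` Y" using wsub_0[OF assms] Fn_0 by (metis imageI)
next
  fix x y assume "x \<in> (F ^^ n) ` Y" "y \<in> (F ^^ n) ` Y"
  then obtain x' y' where "x' \<in> Y" "y' \<in> Y" "x = (F ^^ n) x'" "y = (F ^^ n) y'" by auto
  then show "x + y \<in> (F ^^ n) ` Y" using wsub_add[OF assms] by (metis Fn_add imageI)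
next
  fix a x assume a: "a \<in> W" "x \<in> (F ^^ n) ` Y"
  then obtain x' where "x' \<in> Y" "x = (F ^^ n) x'" by auto
  moreover obtain b where "(\<sigma> ^^ n) b = a" using \<sigma>n_surj by blast
  ultimately have "a *s x = (F ^^ n) (b *s x')" "b *s x' \<in> Y"
    using a \<sigma>n_W[of n b] wsub_scale[OF assms] by (auto simp: Fn_scale)
  then show "a *s x \<in> (F ^^ n) ` Y" by blast
qed

lemma pe_Fn_image: "pe e ((F ^^ n) ` Y) = (F ^^ n) ` pe e Y"
  unfolding pe_image by (auto simp: image_image Fn_powi)

lemma Fn_ssum: "(F ^^ n) ` ssum A C = ssum ((F ^^ n) ` A) ((F ^^ n) ` C)"
proof (intro subset_antisym subsetI)
  fix x assume "x \<in> (F ^^ n) ` ssum A C"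
  then obtain a c where "a \<in> A" "c \<in> C" "x = (F ^^ n) (a + c)" by (auto simp: ssum_def)
  then show "x \<in> ssum ((F ^^ n) ` A) ((F ^^ n) ` C)" by (simp add: Fn_add ssumI)
next
  fix x assume "x \<in> ssum ((F ^^ n) ` A) ((F ^^ n) ` C)"
  then obtain a c where "a \<in> A" "c \<in> C" "x = (F ^^ n) a + (F ^^ n) c" by (auto simp: ssum_def)
  then show "x \<in> (F ^^ n) ` ssum A C" by (simp add: Fn_add[symmetric] ssumI)
qed

text \<open>Every nonzero scalar is a power of \<open>p\<close> times a unit, so the span over the
  field is reached by inverting \<open>p\<close>.\<close>

lemma span_wsub:
  assumes "wsub Y"
  shows "span Y = {x. \<exists>e. x \<in> pe e Y}"
proof
  have "subspace {x. \<exists>e. x \<in> pe e Y}"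
    unfolding subspace_def
  proof (intro conjI ballI allI)
    show "0 \<in> {x. \<exists>e. x \<in> pe e Y}" using wsub_0[OF assms] by (auto intro!: exI[of _ 0])
  next
    fix x y assume "x \<in> {x. \<exists>e. x \<in> pe e Y}" "y \<in> {x. \<exists>e. x \<in> pe e Y}"
    then obtain e f where "x \<in> pe e Y" "y \<in> pe f Y" by auto
    then have "x \<in> pe (min e f) Y" "y \<in> pe (min e f) Y"
      using pe_antimono[OF assms, of "min e f" e] pe_antimono[OF assms, of "min e f" f] by auto
    then show "x + y \<in> {x. \<exists>e. x \<in> pe e Y}" using wsub_add[OF wsub_pe[OF assms]] by auto
  next
    fix a x assume "x \<in> {x. \<exists>e. x \<in> pe e Y}"
    then obtain e where "x \<in> pe e Y" by auto
    moreover have "vge (if a = 0 then 0 else val a) a" by (simp add: vge_def)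
    ultimately show "a *s x \<in> {x. \<exists>e. x \<in> pe e Y}" using pe_vge[OF assms] by blast
  qed
  moreover have "Y \<subseteq> {x. \<exists>e. x \<in> pe e Y}" by (auto intro!: exI[of _ 0])
  ultimately show "span Y \<subseteq> {x. \<exists>e. x \<in> pe e Y}" by (rule span_minimal[rotated])
  show "{x. \<exists>e. x \<in> pe e Y} \<subseteq> span Y" by (auto simp: pe_image intro: span_scale span_base)
qed

lemma pe_span: "Y \<subseteq> span Z \<Longrightarrow> pe e Y \<subseteq> span Z"
  by (auto simp: pe_image intro: span_scale)

lemma X_E: "X \<subseteq> E"
proof -
  have "wspan B \<subseteq> E" using span_wspan[of B] span_superset by blast
  then show ?thesis using X_bound pe_span by blast
qed

lemma span_X: "span X = E"
  using X_E B_X by (metis span_mono span_minimal subspace_span order_antisym)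

lemma E_pe: "x \<in> E \<Longrightarrow> \<exists>e. x \<in> pe e X"
  using span_wsub[OF X_wsub] span_X by auto

lemma independent_unique:
  assumes "finite A" "independent A" "(\<Sum>a\<in>A. c a *s a) = (\<Sum>a\<in>A. d a *s a)" "a \<in> A"
  shows "c a = d a"
proof -
  have "(\<Sum>a\<in>A. (c a - d a) *s a) = 0" using assms(3) by (simp add: scale_left_diff_distrib sum_subtractf)
  then have "c a - d a = 0" using independentD[OF assms(2,1) order_refl _ assms(4), of "\<lambda>a. c a - d a"] by blast
  then show ?thesis by simp
qed

text \<open>In a basis, a nonzero coordinate of an infinitely \<open>p\<close>-divisible vector
  would have unbounded valuation.\<close>

lemma separated_wspan:
  assumes "finite A" "independent A"
  shows "separated (wspan A)"
  unfolding separated_def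
proof (intro allI impI)
  fix x assume x: "\<forall>n::nat. x \<in> pe (int n) (wspan A)"
  then have "x \<in> wspan A" by (metis of_nat_0 pe_0)
  then obtain c where c: "x = (\<Sum>a\<in>A. c a *s a)" using wspan_finiteE[OF assms(1)] by metis
  have "c a = 0" if a: "a \<in> A" for a
  proof (rule ccontr)
    assume nz: "c a \<noteq> 0"
    have vge: "vge (int n) (c a)" for n
    proof -
      have "p powi (- int n) *s x \<in> wspan A" using x by (simp add: pe_def)
      then obtain d where d: "\<And>a. d a \<in> W" "p powi (- int n) *s x = (\<Sum>a\<in>A. d a *s a)"
        using wspan_finiteE[OF assms(1)] by metis
      then have "(\<Sum>a\<in>A. (p powi (- int n) * c a) *s a) = (\<Sum>a\<in>A. d a *s a)"
        by (simp add: c scale_sum_right)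
      then have "p powi (- int n) * c a = d a" by (rule independent_unique[OF assms]) (rule a)
      then show ?thesis using d(1) unfolding vge_iff by metis
    qed
    from vge[of "nat (val (c a) + 1)"] vge[of 0] nz show False by (auto simp: vge_def)
  qed
  then show "x = 0" by (simp add: c)
qed

lemma separated_pe:
  assumes "wsub Y" "separated Y"
  shows "separated (pe e Y)"
  unfolding separated_def
proof (intro allI impI)
  fix x assume x: "\<forall>n::nat. x \<in> pe (int n) (pe e Y)"
  have "x \<in> pe (int n) Y" for n
  proof -
    have "x \<in> pe (int (n + nat \<bar>e\<bar>) + e) Y" using x by (metis pe_pe)
    moreover have "int n \<le> int (n + nat \<bar>e\<bar>) + e" by linarith
    ultimately show ?thesis using pe_antimono[OF assms(1)] by blast
  qed
  then show "x = 0" using assms(2) unfolding separated_def by blast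
qed

lemma separated_X: "separated X"
  using separated_subset[OF separated_pe[OF wsub_wspan separated_wspan[OF B_fin B_ind]] X_bound] .

text \<open>By freeness of separated submodules these are lattices in their own spans; one that is
  contained in the span of a submodule lies in that submodule up to a power of
  \<open>p\<close>.\<close>

definition bd :: "'b set \<Rightarrow> bool" where "bd Y \<longleftrightarrow> wsub Y \<and> (\<exists>c. Y \<subseteq> pe c X)"

lemma bd_wsub: "bd Y \<Longrightarrow> wsub Y" by (simp add: bd_def)

lemma bd_E: "bd Y \<Longrightarrow> Y \<subseteq> E"
  using pe_span[of X B] X_E unfolding bd_def by blast

lemma bd_X: "bd X" unfolding bd_def using X_wsub by (auto intro: exI[of _ 0])

lemma bd_subset: "bd Y \<Longrightarrow> wsub Z \<Longrightarrow> Z \<subseteq> Y \<Longrightarrow> bd Z"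
  by (auto simp: bd_def)

lemma bd_pe: "bd Y \<Longrightarrow> bd (pe e Y)"
  unfolding bd_def by (metis wsub_pe pe_mono pe_pe)

lemma bd_separated: "bd Y \<Longrightarrow> separated Y"
  unfolding bd_def using separated_subset separated_pe[OF X_wsub separated_X] by blast

lemma bd_basis:
  assumes "bd Y"
  obtains A where "finite A" "independent A" "Y = wspan A" "card A = dim (span Y)"
    "fl (pe 1 Y) Y" "len (pe 1 Y) Y = card A"
  using ex_lattice_basis_separated[OF bd_wsub[OF assms] bd_E[OF assms] B_fin bd_separated[OF assms]] by metis

lemma wspan_commensurable:
  assumes "finite A" "A \<subseteq> span Y" "wsub Y"
  shows "\<exists>c::nat. wspan A \<subseteq> pe (- int c) Y"
proof -
  have "\<exists>c::nat. A \<subseteq> pe (- int c) Y"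
    using assms(1,2)
  proof (induction A rule: finite_induct)
    case (insert x A)
    then obtain c where c: "A \<subseteq> pe (- int c) Y" by auto
    obtain e where e: "x \<in> pe e Y" using insert.prems span_wsub[OF assms(3)] by auto
    have "x \<in> pe (- int (c + nat \<bar>e\<bar>)) Y" "pe (- int c) Y \<subseteq> pe (- int (c + nat \<bar>e\<bar>)) Y"
      using subsetD[OF pe_antimono[OF assms(3), of "- int (c + nat \<bar>e\<bar>)" e] e]
        pe_antimono[OF assms(3), of "- int (c + nat \<bar>e\<bar>)" "- int c"] by auto
    then have "insert x A \<subseteq> pe (- int (c + nat \<bar>e\<bar>)) Y" using c by auto
    then show ?case by (rule exI)
  qed simp
  then show ?thesis using wspan_minimal wsub_pe[OF assms(3)] by blast
qed

lemma bd_commensurable: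
  assumes "bd Z" "Z \<subseteq> span Y" "wsub Y"
  shows "\<exists>c::nat. Z \<subseteq> pe (- int c) Y"
proof -
  obtain A where "finite A" "Z = wspan A" using bd_basis[OF assms(1)] by metis
  then show ?thesis using wspan_commensurable[of A Y] assms wspan_superset[of A] by auto
qed

lemma bd_wspan: "finite A \<Longrightarrow> A \<subseteq> E \<Longrightarrow> bd (wspan A)"
  using wspan_commensurable[of A X] span_X X_wsub wsub_wspan unfolding bd_def by auto

text \<open>\<open>X \<inter> span A\<close> is commensurable with the free lattice on
  \<open>A\<close>, so divisibility in \<open>X\<close> passes to coordinates with a constant loss
  \<open>C\<close>. This turns exact valuations of coordinates into upper bounds for the
  divisibility of vectors.\<close>

lemma coordinates_bound:
  assumes "finite A" "independent A" "A \<subseteq> E"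
  shows "\<exists>C. \<forall>c e. (\<Sum>a\<in>A. c a *s a) \<in> pe e X \<longrightarrow> (\<forall>a\<in>A. vge (e - C) (c a))"
proof -
  have "bd (X \<inter> span A)" by (rule bd_subset[OF bd_X]) (auto intro: wsub_Int X_wsub wsub_subspace)
  then obtain C where C: "X \<inter> span A \<subseteq> pe (- int C) (wspan A)"
    using bd_commensurable[of "X \<inter> span A" "wspan A"] wsub_wspan span_wspan by blast
  have "vge (e - int C) (c a)" if s: "(\<Sum>a\<in>A. c a *s a) \<in> pe e X" and a: "a \<in> A" for c e a
  proof -
    let ?y = "\<Sum>a\<in>A. c a *s a"
    have "p powi (- e) *s ?y \<in> X \<inter> span A"
      using s by (auto simp: pe_def intro: span_scale span_sum span_base)
    then have "p powi (int C) *s p powi (- e) *s ?y \<in> wspan A" using C by (auto simp: pe_def)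
    then obtain d where d: "\<And>a. d a \<in> W" "p powi (int C) *s p powi (- e) *s ?y = (\<Sum>a\<in>A. d a *s a)"
      by (rule wspan_finiteE[OF assms(1)]) blast
    then have "(\<Sum>a\<in>A. (p powi (int C - e) * c a) *s a) = (\<Sum>a\<in>A. d a *s a)"
      by (simp add: scale_sum_right mult.assoc[symmetric] pp del: power_int_of_nat)
    then have "p powi (int C - e) * c a = d a" by (rule independent_unique[OF assms(1,2)]) (rule a)
    then show ?thesis using d(1) unfolding vge_iff by (metis minus_diff_eq)
  qed
  then show ?thesis by blast
qed

lemma Fn_X: "x \<in> X \<Longrightarrow> (F ^^ n) x \<in> X"
  by (induction n) (simp_all add: F_X)

lemma Fn_pe_X: "x \<in> pe e X \<Longrightarrow> (F ^^ n) x \<in> pe e X"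
  unfolding pe_def using Fn_X[of _ n] by (simp add: Fn_powi[symmetric])

text \<open>\<open>F\<close> keeps a basis independent because scalars can be pulled back along the
  surjective \<sigma>; comparison of dimensions then gives surjectivity.\<close>

lemma subspace_F_image:
  assumes P: "subspace P" "P \<subseteq> E" "F ` P \<subseteq> P"
  shows "F ` P = P"
proof -
  obtain C where C: "C \<subseteq> P" "independent C" "P \<subseteq> span C" using basis_exists[of P] by metis
  have finC: "finite C" using independent_span_bound[OF B_fin C(2)] C(1) P(2) by auto
  have inj: "inj_on F C" using Fn_inj_on[of 1] C(1) P(2) by (auto intro: inj_on_subset)
  have ind: "independent (F ` C)"
  proof
    assume "dependent (F ` C)"
    then obtain u where u: "(\<Sum>v\<in>F ` C. u v *s v) = 0" "\<exists>v\<in>F ` C. u v \<noteq> 0"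
      unfolding dependent_finite[OF finite_imageI[OF finC]] by blast
    define w where "w v = (SOME w. \<sigma> w = u (F v))" for v
    have "\<exists>w. \<sigma> w = u (F v)" for v using \<sigma>n_surj[of 1 "u (F v)"] by simp
    then have w: "\<sigma> (w v) = u (F v)" for v unfolding w_def by (rule someI_ex)
    have "F (\<Sum>v\<in>D. w v *s v) = (\<Sum>v\<in>D. u (F v) *s F v)" for D
      by (induction D rule: infinite_finite_induct) (simp_all add: F_add F_scale w)
    then have "F (\<Sum>v\<in>C. w v *s v) = 0" using u(1) by (simp add: sum.reindex[OF inj])
    moreover have "(\<Sum>v\<in>C. w v *s v) \<in> E" using C(1) P(2) by (intro span_sum span_scale) auto
    ultimately have "(\<Sum>v\<in>C. w v *s v) = 0" by (rule F_inj[rotated])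
    then have "w v = 0" if "v \<in> C" for v using independentD[OF C(2) finC order_refl _ that] by blast
    then have "u (F v) = 0" if "v \<in> C" for v using w[of v] that by simp
    then show False using u(2) by blast
  qed
  have "P \<subseteq> span (F ` C)"
  proof (rule ccontr)
    assume "\<not> P \<subseteq> span (F ` C)"
    then obtain y where y: "y \<in> P" "y \<notin> span (F ` C)" by auto
    then have "independent (insert y (F ` C))" using ind by (simp add: independent_insert)
    then have "card (insert y (F ` C)) \<le> card C"
      using independent_span_bound[OF finC] y C P(3) by blast
    moreover have "y \<notin> F ` C" using y span_base by blast
    ultimately show False using finC by (simp add: card_image[OF inj])
  qed
  moreover have "subspace (F ` P)"
    unfolding subspace_def
  proof (intro conjI ballI allI)
    show "0 \<in> F ` P" using subspace_0[OF P(1)] F_0 by (metis imageI)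
  next
    fix x y assume "x \<in> F ` P" "y \<in> F ` P"
    then obtain x' y' where "x' \<in> P" "y' \<in> P" "x = F x'" "y = F y'" by auto
    then show "x + y \<in> F ` P" using subspace_add[OF P(1)] by (metis F_add imageI)
  next
    fix a x assume "x \<in> F ` P"
    then obtain x' where "x' \<in> P" "x = F x'" by auto
    moreover obtain b where "\<sigma> b = a" using \<sigma>_surj by (metis surjD)
    ultimately show "a *s x \<in> F ` P" using subspace_scale[OF P(1)] by (metis F_scale imageI)
  qed
  ultimately have "P \<subseteq> F ` P" using span_minimal[of "F ` C" "F ` P"] C(1) by blast
  then show ?thesis using P(3) by auto
qed

lemma subspace_Fn_image:
  assumes P: "subspace P" "P \<subseteq> E" "F ` P \<subseteq> P"
  shows "(F ^^ n) ` P = P"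
proof (induction n)
  case (Suc n)
  have "(F ^^ Suc n) ` P = F ` ((F ^^ n) ` P)" by (simp add: image_image)
  then show ?case using Suc subspace_F_image[OF assms] by simp
qed simp

subsection \<open>Growth of Frobenius orbits\<close>

text \<open>Divisibility of \<open>F^N x\<close> by \<open>p\<close> grows at least like
  \<open>\<nu> N\<close>, up to a constant. Quantifying over all integers \<open>e\<close> below the
  rational bound replaces rounding.\<close>

definition gr :: "rat \<Rightarrow> 'b \<Rightarrow> bool" where
  "gr \<nu> x \<longleftrightarrow> x \<in> E \<and> (\<exists>c. \<forall>N e. of_int e \<le> \<nu> * of_nat N - c \<longrightarrow> (F ^^ N) x \<in> pe e X)"

text \<open>Growth beyond \<open>\<nu> N\<close> by every prescribed constant; nonzero vectors of
  the slope part for \<open>\<nu>\<close> never have this property.\<close>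

definition null :: "rat \<Rightarrow> 'b \<Rightarrow> bool" where
  "null \<nu> x \<longleftrightarrow> x \<in> E \<and> (\<forall>c. \<exists>N0. \<forall>N\<ge>N0. \<forall>e. of_int e \<le> \<nu> * of_nat N + c \<longrightarrow> (F ^^ N) x \<in> pe e X)"

lemma subspace_null: "subspace {x. null \<nu> x}"
  unfolding subspace_def mem_Collect_eq
proof (intro conjI ballI allI impI)
  show "null \<nu> 0" by (auto simp: null_def span_zero wsub_0[OF wsub_pe[OF X_wsub]])
next
  fix x y assume x: "x \<in> {x. null \<nu> x}" and y: "y \<in> {x. null \<nu> x}"
  show "null \<nu> (x + y)"
    unfolding null_def
  proof (intro conjI allI)
    show "x + y \<in> E" using x y by (auto simp: null_def intro: span_add)
    fix c
    obtain N0 where N0: "\<And>N e. N \<ge> N0 \<Longrightarrow> of_int e \<le> \<nu> * of_nat N + c \<Longrightarrow> (F ^^ N) x \<in> pe e X"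
      using x by (auto simp: null_def) metis
    obtain N1 where N1: "\<And>N e. N \<ge> N1 \<Longrightarrow> of_int e \<le> \<nu> * of_nat N + c \<Longrightarrow> (F ^^ N) y \<in> pe e X"
      using y by (auto simp: null_def) metis
    show "\<exists>N0. \<forall>N\<ge>N0. \<forall>e. of_int e \<le> \<nu> * of_nat N + c \<longrightarrow> (F ^^ N) (x + y) \<in> pe e X"
      by (rule exI[of _ "max N0 N1"]) (auto simp: Fn_add intro!: wsub_add[OF wsub_pe[OF X_wsub]] N0 N1)
  qed
next
  fix a x assume x: "x \<in> {x. null \<nu> x}"
  show "null \<nu> (a *s x)"
    unfolding null_def
  proof (intro conjI allI)
    show "a *s x \<in> E" using x by (auto simp: null_def intro: span_scale)
    fix c
    obtain N0 where N0: "\<And>N e. N \<ge> N0 \<Longrightarrow> of_int e \<le> \<nu> * of_nat N + (c - of_int (val a)) \<Longrightarrow> (F ^^ N) x \<in> pe e X"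
      using x by (auto simp: null_def) metis
    have "(F ^^ N) (a *s x) \<in> pe e X" if "N \<ge> N0" "of_int e \<le> \<nu> * of_nat N + c" for N e
    proof -
      have "(F ^^ N) x \<in> pe (e - val a) X" by (rule N0) (use that in auto)
      moreover have "vge (val a) ((\<sigma> ^^ N) a)" by (simp add: vge_def val_\<sigma>n)
      ultimately have "(\<sigma> ^^ N) a *s (F ^^ N) x \<in> pe (val a + (e - val a)) X" by (rule pe_vge[OF X_wsub, rotated])
      then show ?thesis by (simp add: Fn_scale)
    qed
    then show "\<exists>N0. \<forall>N\<ge>N0. \<forall>e. of_int e \<le> \<nu> * of_nat N + c \<longrightarrow> (F ^^ N) (a *s x) \<in> pe e X" by blast
  qed
qed

lemma gr_scale:
  assumes "gr \<nu> x"
  shows "gr \<nu> (a *s x)"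
  unfolding gr_def
proof
  show "a *s x \<in> E" using assms by (auto simp: gr_def intro: span_scale)
  obtain c where c: "\<And>N e. of_int e \<le> \<nu> * of_nat N - c \<Longrightarrow> (F ^^ N) x \<in> pe e X"
    using assms by (auto simp: gr_def)
  have "(F ^^ N) (a *s x) \<in> pe e X" if "of_int e \<le> \<nu> * of_nat N - (c - of_int (val a))" for N e
  proof -
    have "(F ^^ N) x \<in> pe (e - val a) X" by (rule c) (use that in auto)
    moreover have "vge (val a) ((\<sigma> ^^ N) a)" by (simp add: vge_def val_\<sigma>n)
    ultimately have "(\<sigma> ^^ N) a *s (F ^^ N) x \<in> pe (val a + (e - val a)) X" by (rule pe_vge[OF X_wsub, rotated])
    then show ?thesis by (simp add: Fn_scale)
  qed
  then show "\<exists>c. \<forall>N e. of_int e \<le> \<nu> * of_nat N - c \<longrightarrow> (F ^^ N) (a *s x) \<in> pe e X" by blast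
qed

lemma null_F: "null \<nu> x \<Longrightarrow> null \<nu> (F x)"
  unfolding null_def
proof (elim conjE, intro conjI allI)
  assume x: "x \<in> E" "\<forall>c. \<exists>N0. \<forall>N\<ge>N0. \<forall>e. of_int e \<le> \<nu> * of_nat N + c \<longrightarrow> (F ^^ N) x \<in> pe e X"
  show "F x \<in> E" using x F_E by auto
  fix c
  obtain N0 where N0: "\<And>N e. N \<ge> N0 \<Longrightarrow> of_int e \<le> \<nu> * of_nat N + c \<Longrightarrow> (F ^^ N) x \<in> pe e X"
    using x(2) by metis
  have "(F ^^ N) (F x) \<in> pe e X" if "N \<ge> N0" "of_int e \<le> \<nu> * of_nat N + c" for N e
    using Fn_pe_X[OF N0[OF that], of 1] by (simp add: funpow_swap1)
  then show "\<exists>N0. \<forall>N\<ge>N0. \<forall>e. of_int e \<le> \<nu> * of_nat N + c \<longrightarrow> (F ^^ N) (F x) \<in> pe e X" by blast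
qed

lemma gr_mono: "gr \<mu> x \<Longrightarrow> \<nu> \<le> \<mu> \<Longrightarrow> gr \<nu> x"
  unfolding gr_def
proof (elim conjE exE, intro conjI exI allI impI)
  fix c N e
  assume c: "\<forall>N e. of_int e \<le> \<mu> * of_nat N - c \<longrightarrow> (F ^^ N) x \<in> pe e X"
    and "\<nu> \<le> \<mu>" "of_int e \<le> \<nu> * of_nat N - c"
  then have "of_int e \<le> \<mu> * of_nat N - c" by (meson diff_right_mono mult_right_mono of_nat_0_le_iff order_trans)
  then show "(F ^^ N) x \<in> pe e X" using c by blast
qed

lemma gr_null: "gr \<mu> x \<Longrightarrow> \<nu> < \<mu> \<Longrightarrow> null \<nu> x"
  unfolding gr_def null_def
proof (elim conjE exE, intro conjI allI)
  fix c d
  assume d: "\<forall>N e. of_int e \<le> \<mu> * of_nat N - d \<longrightarrow> (F ^^ N) x \<in> pe e X" and lt: "\<nu> < \<mu>"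
  obtain N0 :: nat where N0: "(c + d) / (\<mu> - \<nu>) \<le> of_nat N0" using real_arch_simple by blast
  have "of_int e \<le> \<mu> * of_nat N - d" if "N \<ge> N0" "of_int e \<le> \<nu> * of_nat N + c" for N e
  proof -
    have "(c + d) / (\<mu> - \<nu>) \<le> of_nat N" using N0 that(1) by (meson of_nat_le_iff order_trans)
    then have "c + d \<le> of_nat N * (\<mu> - \<nu>)" using lt by (simp add: pos_divide_le_eq)
    then show ?thesis using that(2) by (simp add: algebra_simps)
  qed
  then show "\<exists>N0. \<forall>N\<ge>N0. \<forall>e. of_int e \<le> \<nu> * of_nat N + c \<longrightarrow> (F ^^ N) x \<in> pe e X" using d by blast
qed

text \<open>\<open>F\<close> preserves \<open>X\<close>, so divisibility never decreases; this is
  the source of the nonnegativity of slopes.\<close>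

lemma gr_0: "x \<in> E \<Longrightarrow> gr 0 x"
proof -
  assume x: "x \<in> E"
  obtain e0 where e0: "x \<in> pe e0 X" using E_pe[OF x] by auto
  have "(F ^^ N) x \<in> pe e X" if "of_int e \<le> 0 * of_nat N - (- of_int e0 :: rat)" for N e
    using Fn_pe_X[OF e0, of N] pe_antimono[OF X_wsub, of e e0] that by auto
  then show ?thesis unfolding gr_def using x by blast
qed

end

section \<open>Ultrametric inequalities with rational bounds\<close>

context dvr_frob
begin

lemma vge_ceiling: "vge \<lceil>q\<rceil> a \<longleftrightarrow> a = 0 \<or> (q::rat) \<le> of_int (val a)"
  by (auto simp: vge_def ceiling_le_iff)

lemma vge_floor: "vge (\<lfloor>q\<rfloor> + 1) a \<longleftrightarrow> a = 0 \<or> (q::rat) < of_int (val a)"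
  by (auto simp: vge_def floor_less_iff[symmetric])

lemma rat_val_add:
  assumes "a = 0 \<or> q \<le> (of_int (val a) :: rat)" "b = 0 \<or> q \<le> of_int (val b)"
  shows "a + b = 0 \<or> q \<le> of_int (val (a + b))"
  using assms vge_add[of "\<lceil>q\<rceil>" a b] by (simp add: vge_ceiling)

lemma rat_val_add_strict:
  assumes "a = 0 \<or> q < (of_int (val a) :: rat)" "b = 0 \<or> q < of_int (val b)"
  shows "a + b = 0 \<or> q < of_int (val (a + b))"
  using assms vge_add[of "\<lfloor>q\<rfloor> + 1" a b] by (simp add: vge_floor)

text \<open>A sum has the valuation of its dominant term; otherwise that term would be a difference
  of two elements of larger valuation.\<close>

lemma rat_val_add_exact:
  assumes a: "a \<noteq> 0" "of_int (val a) = (q :: rat)" and b: "b = 0 \<or> q < of_int (val b)"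
  shows "a + b \<noteq> 0 \<and> of_int (val (a + b)) = q"
proof -
  have "\<not> (a + b = 0 \<or> q < of_int (val (a + b)))"
  proof
    assume "a + b = 0 \<or> q < of_int (val (a + b))"
    then have "vge (\<lfloor>q\<rfloor> + 1) (a + b)" by (simp add: vge_floor)
    moreover have "vge (\<lfloor>q\<rfloor> + 1) b" using b by (simp add: vge_floor)
    then have "vge (\<lfloor>q\<rfloor> + 1) (- b)" by (rule vge_uminus)
    ultimately have "vge (\<lfloor>q\<rfloor> + 1) (a + b + - b)" by (rule vge_add)
    then have "a = 0 \<or> q < of_int (val a)" by (simp add: vge_floor)
    then show False using a by simp
  qed
  moreover have "a + b = 0 \<or> q \<le> of_int (val (a + b))"
    using a b by (intro rat_val_add) auto
  ultimately show ?thesis by auto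
qed

end

context frob_lattice
begin

text \<open>Newton polygon of the minimal relation between \<open>x, F x, F\<^sup>2 x, \<dots>\<close>: its least slope \<open>\<nu>\<close> is the
  exact rate of growth of the orbit of \<open>x\<close>.\<close>

lemma minimal_relation:
  assumes x: "x \<in> E" "x \<noteq> 0"
  obtains n where "0 < n" "n \<le> card B" "inj_on (\<lambda>i. (F ^^ i) x) {..<n}"
    "independent ((\<lambda>i. (F ^^ i) x) ` {..<n})" "(F ^^ n) x \<in> span ((\<lambda>i. (F ^^ i) x) ` {..<n})"
proof -
  let ?f = "\<lambda>i. (F ^^ i) x"
  have ind: "inj_on ?f {..<n} \<and> independent (?f ` {..<n})" if "\<And>i. i < n \<Longrightarrow> ?f i \<notin> span (?f ` {..<i})" for n
    using that
  proof (induction n)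
    case (Suc n)
    then have IH: "inj_on ?f {..<n}" "independent (?f ` {..<n})" by auto
    have n: "?f n \<notin> span (?f ` {..<n})" using Suc.prems by simp
    have "?f n \<notin> ?f ` {..<n}" using n span_base[of "?f n" "?f ` {..<n}"] by (rule contrapos_nn)
    then have "inj_on ?f {..<Suc n}" using IH by (simp add: lessThan_Suc)
    moreover have "independent (insert (?f n) (?f ` {..<n}))" using IH n by (simp add: independent_insert)
    ultimately show ?case by (simp add: lessThan_Suc)
  qed (simp add: independent_empty)
  let ?P = "\<lambda>n. ?f n \<in> span (?f ` {..<n})"
  have ex: "\<exists>n. ?P n \<and> n \<le> card B"
  proof (rule ccontr)
    assume no: "\<not> ?thesis"
    then have "?f i \<notin> span (?f ` {..<i})" if "i < Suc (card B)" for i using that by auto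
    then have "inj_on ?f {..<Suc (card B)} \<and> independent (?f ` {..<Suc (card B)})" by (rule ind)
    then have *: "inj_on ?f {..<Suc (card B)}" "independent (?f ` {..<Suc (card B)})" by blast+
    have "?f ` {..<Suc (card B)} \<subseteq> E" using Fn_E x by auto
    then have "card (?f ` {..<Suc (card B)}) \<le> card B" using independent_span_bound[OF B_fin *(2)] by blast
    then show False using card_image[OF *(1)] by simp
  qed
  obtain k where k0: "?P k \<and> k \<le> card B" using ex by (rule exE)
  note k = conjunct1[OF k0] conjunct2[OF k0]
  define n where "n = (LEAST n. ?P n)"
  have "\<exists>n. ?P n" by (rule exI) (rule k(1))
  then have n: "?P n" unfolding n_def by (rule LeastI_ex)
  have less: "\<not> ?P i" if "i < n" for i using that unfolding n_def by (rule not_less_Least)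
  have "n \<le> k" unfolding n_def using k(1) by (rule Least_le)
  then have le: "n \<le> card B" using k(2) by simp
  have "0 < n"
  proof (rule ccontr)
    assume "\<not> 0 < n"
    then show False using n x by simp
  qed
  with n le ind[of n] less that show thesis by blast
qed

text \<open>The bound on the denominator \<open>t\<close> comes from the length of the minimal
  relation; it makes the set of rates discrete, so that a least rate exists later.\<close>

lemma ex_growth_rate:
  assumes x: "x \<in> E" "x \<noteq> 0"
  shows "\<exists>(s::int) t. 0 < t \<and> t \<le> card B \<and> gr (of_int s / of_nat t) x \<and> \<not> null (of_int s / of_nat t) x"
proof -
  let ?f = "\<lambda>i. (F ^^ i) x"
  obtain n where n: "0 < n" "n \<le> card B" and inj: "inj_on ?f {..<n}"
    and ind: "independent (?f ` {..<n})" and fn: "?f n \<in> span (?f ` {..<n})"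
    by (rule minimal_relation[OF assms])
  have "span (?f ` {..<n}) = range (\<lambda>u. \<Sum>v\<in>?f ` {..<n}. u v *s v)" by (rule span_finite) simp
  then obtain u where "?f n = (\<Sum>v\<in>?f ` {..<n}. u v *s v)" using fn by auto
  then have u: "?f n = (\<Sum>i<n. u (?f i) *s ?f i)" by (simp add: sum.reindex[OF inj])
  define \<alpha> where "\<alpha> i = u (?f i)" for i
  have rel: "?f n = (\<Sum>i<n. \<alpha> i *s ?f i)" using u by (simp add: \<alpha>_def)
  let ?I = "{i. i < n \<and> \<alpha> i \<noteq> 0}"
  have "?f n \<noteq> 0" using Fn_inj x by blast
  have "?I \<noteq> {}"
  proof
    assume "?I = {}"
    then have "(\<Sum>i<n. \<alpha> i *s ?f i) = 0" by (intro sum.neutral) auto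
    then show False using rel \<open>?f n \<noteq> 0\<close> by simp
  qed
  then have I: "finite ?I" "?I \<noteq> {}" by simp_all
  \<comment> \<open>Up to sign, the slopes of the segments from the points
    \<open>(i, val (\<alpha> i))\<close> of the Newton polygon to the point \<open>(n, 0)\<close> of
    the leading term.\<close>
  define sl :: "nat \<Rightarrow> rat" where "sl i = of_int (val (\<alpha> i)) / of_nat (n - i)" for i
  define \<nu> where "\<nu> = Min (sl ` ?I)"
  have "\<exists>i. i \<in> ?I \<and> sl i = \<nu>" 
  proof -
    have "\<nu> \<in> sl ` ?I" unfolding \<nu>_def by (rule Min_in) (use I in simp_all)
    then show ?thesis by (elim imageE) (intro exI conjI, assumption, rule sym)
  qed
  \<comment> \<open>The smallest index where the minimum is attained; below it the inequality for
    \<open>\<alpha>\<close> is strict, which later separates one exact coordinate from the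
    rest.\<close>
  define i0 where "i0 = (LEAST i. i \<in> ?I \<and> sl i = \<nu>)"
  have i0: "i0 < n" "\<alpha> i0 \<noteq> 0" "sl i0 = \<nu>"
    using LeastI_ex[OF \<open>\<exists>i. i \<in> ?I \<and> sl i = \<nu>\<close>] unfolding i0_def by auto
  have i0_least: "sl i \<noteq> \<nu>" if "i < i0" "\<alpha> i \<noteq> 0" for i
    using not_less_Least[of i "\<lambda>i. i \<in> ?I \<and> sl i = \<nu>"] that i0 unfolding i0_def[symmetric] by auto
  have ge: "\<alpha> i = 0 \<or> \<nu> * (of_nat n - of_nat i) \<le> of_int (val (\<alpha> i))" if "i < n" for i
  proof (cases "\<alpha> i = 0")
    case False
    then have "\<nu> \<le> sl i" unfolding \<nu>_def using I that by (intro Min_le) auto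
    then show ?thesis using that by (simp add: sl_def pos_le_divide_eq of_nat_diff)
  qed simp
  have strict: "\<alpha> i = 0 \<or> \<nu> * (of_nat n - of_nat i) < of_int (val (\<alpha> i))" if "i < i0" for i
  proof (cases "\<alpha> i = 0")
    case False
    then have "\<nu> \<le> sl i" unfolding \<nu>_def using I that i0 by (intro Min_le) auto
    then have "\<nu> < sl i" using i0_least[OF that False] by simp
    then show ?thesis using that i0 by (simp add: sl_def pos_less_divide_eq of_nat_diff)
  qed simp
  have exact: "of_int (val (\<alpha> i0)) = \<nu> * (of_nat n - of_nat i0)"
    using i0 by (auto simp: sl_def of_nat_diff field_simps)
  \<comment> \<open>Coordinates of \<open>F^N x\<close> with respect to
    \<open>x, F x, ..., F^(n-1) x\<close>; the recursion is the semilinear companion matrix of the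
    relation.\<close>
  define b :: "nat \<Rightarrow> nat \<Rightarrow> 'a" where
    "b = rec_nat (\<lambda>i. if i = 0 then 1 else 0)
      (\<lambda>N c i. (if i = 0 then 0 else \<sigma> (c (i - 1))) + \<sigma> (c (n - 1)) * \<alpha> i)"
  have b0: "b 0 i = (if i = 0 then 1 else 0)" for i by (simp add: b_def)
  have bS: "b (Suc N) i = (if i = 0 then 0 else \<sigma> (b N (i - 1))) + \<sigma> (b N (n - 1)) * \<alpha> i" for N i
    by (simp add: b_def)
  obtain n' where n': "n = Suc n'" using n by (cases n) auto
  have orbit: "?f N = (\<Sum>i<n. b N i *s ?f i)" for N
  proof (induction N)
    case 0
    have "(\<Sum>i<n. b 0 i *s ?f i) = (\<Sum>i<n. if i = 0 then x else 0)"
      by (rule sum.cong) (auto simp: b0)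
    then show ?case using n by simp
  next
    case (Suc N)
    have Fs: "F (\<Sum>i<k. c i *s ?f i) = (\<Sum>i<k. \<sigma> (c i) *s ?f (Suc i))" for c k
      by (induction k) (simp_all add: F_add F_scale)
    have "?f (Suc N) = F (?f N)" by simp
    then have 1: "?f (Suc N) = (\<Sum>i<n. \<sigma> (b N i) *s ?f (Suc i))" unfolding Suc by (simp only: Fs)
    have 2: "(\<Sum>i<n. \<sigma> (b N i) *s ?f (Suc i)) =
      (\<Sum>i<n'. \<sigma> (b N i) *s ?f (Suc i)) + \<sigma> (b N n') *s ?f n" by (simp add: n')
    have 3: "(\<Sum>i<n'. \<sigma> (b N i) *s ?f (Suc i)) = (\<Sum>i<n. (if i = 0 then 0 else \<sigma> (b N (i - 1))) *s ?f i)"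
      unfolding n' by (subst sum.lessThan_Suc_shift) simp
    have 4: "\<sigma> (b N n') *s ?f n = (\<Sum>i<n. (\<sigma> (b N (n - 1)) * \<alpha> i) *s ?f i)"
      unfolding rel scale_sum_right scale_scale by (simp add: n')
    show ?case unfolding 1 2 3 4 by (simp only: bS scale_left_distrib sum.distrib)
  qed
  have I1: "i < n \<Longrightarrow> b N i = 0 \<or> \<nu> * (of_nat N - of_nat i) \<le> of_int (val (b N i))" for N i
  proof (induction N arbitrary: i)
    case 0
    then show ?case by (simp add: b0)
  next
    case (Suc N)
    show ?case unfolding bS
    proof (rule rat_val_add)
      show "(if i = 0 then 0 else \<sigma> (b N (i - 1))) = 0 \<or>
        \<nu> * (of_nat (Suc N) - of_nat i) \<le> of_int (val (if i = 0 then 0 else \<sigma> (b N (i - 1))))"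
        using Suc.IH[of "i - 1"] Suc.prems by (auto simp: val_\<sigma> of_nat_diff algebra_simps)
      show "\<sigma> (b N (n - 1)) * \<alpha> i = 0 \<or>
        \<nu> * (of_nat (Suc N) - of_nat i) \<le> of_int (val (\<sigma> (b N (n - 1)) * \<alpha> i))"
      proof (cases "b N (n - 1) = 0 \<or> \<alpha> i = 0")
        case False
        then have "\<nu> * (of_nat N - of_nat (n - 1)) \<le> of_int (val (b N (n - 1)))"
          "\<nu> * (of_nat n - of_nat i) \<le> of_int (val (\<alpha> i))"
          using Suc.IH[of "n - 1"] ge[of i] Suc.prems n by auto
        then have "\<nu> * (of_nat N - of_nat (n - 1)) + \<nu> * (of_nat n - of_nat i) \<le>
          of_int (val (b N (n - 1))) + of_int (val (\<alpha> i))" by (rule add_mono)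
        then show ?thesis using False by (simp add: val_mult val_\<sigma> n' algebra_simps)
      qed auto
    qed
  qed
  have binit: "i < n \<Longrightarrow> N < n \<Longrightarrow> b N i = (if i = N then 1 else 0)" for N i
  proof (induction N arbitrary: i)
    case 0
    then show ?case by (simp add: b0)
  next
    case (Suc N)
    then show ?case unfolding bS by (auto simp: \<sigma>_1)
  qed
  \<comment> \<open>Invariant for the exactness of the rate: some coordinate of index at least
    \<open>i0\<close> attains the bound \<open>\<nu> (N - i)\<close>, and all coordinates below
    \<open>i0\<close> stay strictly above it.\<close>
  have I2: "(\<forall>i<i0. b N i = 0 \<or> \<nu> * (of_nat N - of_nat i) < of_int (val (b N i))) \<and>
    (\<exists>i\<ge>i0. i < n \<and> b N i \<noteq> 0 \<and> of_int (val (b N i)) = \<nu> * (of_nat N - of_nat i))" if "i0 \<le> N" for N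
    using that
  proof (induction N rule: dec_induct)
    case base
    show ?case using i0 by (auto simp: binit intro!: exI[of _ i0])
  next
    case (step N)
    have lt: "\<forall>i<i0. b N i = 0 \<or> \<nu> * (of_nat N - of_nat i) < of_int (val (b N i))" using step.IH by blast
    obtain j where j: "i0 \<le> j" "j < n" "b N j \<noteq> 0" "of_int (val (b N j)) = \<nu> * (of_nat N - of_nat j)"
      using step.IH by blast
    have last: "b N (n - 1) = 0 \<or> \<nu> * (of_nat N - of_nat (n - 1)) \<le> of_int (val (b N (n - 1)))"
      using I1[of "n - 1" N] n by simp
    have A: "b (Suc N) i = 0 \<or> \<nu> * (of_nat (Suc N) - of_nat i) < of_int (val (b (Suc N) i))" if i: "i < i0" for i
      unfolding bS
    proof (rule rat_val_add_strict)
      show "(if i = 0 then 0 else \<sigma> (b N (i - 1))) = 0 \<or>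
        \<nu> * (of_nat (Suc N) - of_nat i) < of_int (val (if i = 0 then 0 else \<sigma> (b N (i - 1))))"
        using lt[rule_format, of "i - 1"] i by (auto simp: val_\<sigma> of_nat_diff algebra_simps)
      show "\<sigma> (b N (n - 1)) * \<alpha> i = 0 \<or>
        \<nu> * (of_nat (Suc N) - of_nat i) < of_int (val (\<sigma> (b N (n - 1)) * \<alpha> i))"
      proof (cases "b N (n - 1) = 0 \<or> \<alpha> i = 0")
        case False
        then have "\<nu> * (of_nat N - of_nat (n - 1)) + \<nu> * (of_nat n - of_nat i) <
          of_int (val (b N (n - 1))) + of_int (val (\<alpha> i))"
          using last strict[OF i] by (intro add_le_less_mono) auto
        then show ?thesis using False by (simp add: val_mult val_\<sigma> n' algebra_simps)
      qed auto
    qed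
    have C: "\<exists>i\<ge>i0. i < n \<and> b (Suc N) i \<noteq> 0 \<and> of_int (val (b (Suc N) i)) = \<nu> * (of_nat (Suc N) - of_nat i)"
    \<comment> \<open>If the last coordinate attains the bound, its reduction by the relation makes
      coordinate \<open>i0\<close> exact. Otherwise the exact index \<open>j\<close> is not the last
      one and moves to \<open>j + 1\<close>, where the reduction term is strictly larger.\<close>
    proof (cases "b N (n - 1) \<noteq> 0 \<and> of_int (val (b N (n - 1))) = \<nu> * (of_nat N - of_nat (n - 1))")
      case True
      let ?u = "\<sigma> (b N (n - 1)) * \<alpha> i0" and ?v = "if i0 = 0 then 0 else \<sigma> (b N (i0 - 1))"
      have "?u \<noteq> 0" "of_int (val ?u) = \<nu> * (of_nat (Suc N) - of_nat i0)"
        using True i0 exact by (simp_all add: val_mult val_\<sigma> n' algebra_simps)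
      moreover have "?v = 0 \<or> \<nu> * (of_nat (Suc N) - of_nat i0) < of_int (val ?v)"
        using lt[rule_format, of "i0 - 1"] by (auto simp: val_\<sigma> of_nat_diff algebra_simps)
      ultimately have "?u + ?v \<noteq> 0 \<and> of_int (val (?u + ?v)) = \<nu> * (of_nat (Suc N) - of_nat i0)"
        by (rule rat_val_add_exact)
      then show ?thesis using i0 by (intro exI[of _ i0]) (simp only: bS add.commute, simp)
    next
      case False
      then have jn: "Suc j < n" using j by (cases "j = n - 1") auto
      let ?u = "\<sigma> (b N j)" and ?v = "\<sigma> (b N (n - 1)) * \<alpha> (Suc j)"
      have "?u \<noteq> 0" "of_int (val ?u) = \<nu> * (of_nat (Suc N) - of_nat (Suc j))"
        using j by (simp_all add: val_\<sigma>)
      moreover have "?v = 0 \<or> \<nu> * (of_nat (Suc N) - of_nat (Suc j)) < of_int (val ?v)"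
      proof (cases "b N (n - 1) = 0 \<or> \<alpha> (Suc j) = 0")
        case nz: False
        then have "\<nu> * (of_nat N - of_nat (n - 1)) + \<nu> * (of_nat n - of_nat (Suc j)) <
          of_int (val (b N (n - 1))) + of_int (val (\<alpha> (Suc j)))"
          using last False ge[OF jn] by (intro add_less_le_mono) auto
        then show ?thesis using nz by (simp add: val_mult val_\<sigma> n' algebra_simps)
      qed auto
      ultimately have "?u + ?v \<noteq> 0 \<and> of_int (val (?u + ?v)) = \<nu> * (of_nat (Suc N) - of_nat (Suc j))"
        by (rule rat_val_add_exact)
      then show ?thesis using j jn by (intro exI[of _ "Suc j"]) (simp add: bS)
    qed
    show ?case using A C by blast
  qed
  have lam: "\<nu> = of_int (val (\<alpha> i0)) / of_nat (n - i0)" using i0(3) by (simp add: sl_def)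
  have bound: "\<bar>\<nu> * of_nat i\<bar> \<le> \<bar>\<nu>\<bar> * of_nat n" if "i < n" for i
    using that by (simp add: abs_mult mult_left_mono)
  have "gr \<nu> x"
  proof -
    obtain e0 where e0: "x \<in> pe e0 X" using E_pe[OF x(1)] by auto
    have "?f N \<in> pe e X" if e: "of_int e \<le> \<nu> * of_nat N - (\<bar>\<nu>\<bar> * of_nat n - of_int e0)" for N e
    proof -
      have "b N i *s ?f i \<in> pe e X" if i: "i < n" for i
      proof -
        have "of_int (e - e0) \<le> \<nu> * (of_nat N - of_nat i)"
          using e bound[OF i] by (simp add: algebra_simps abs_le_iff)
        then have "vge (e - e0) (b N i)" using I1[OF i, of N] by (auto simp: vge_def of_int_le_iff[symmetric, where 'a=rat])
        then have "b N i *s ?f i \<in> pe (e - e0 + e0) X" by (rule pe_vge[OF X_wsub _ Fn_pe_X[OF e0]])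
        then show ?thesis by simp
      qed
      then have "(\<Sum>i<n. b N i *s ?f i) \<in> pe e X" by (intro wsub_sum wsub_pe X_wsub) auto
      then show ?thesis by (simp only: orbit[of N])
    qed
    then show ?thesis unfolding gr_def using x by blast
  qed
  moreover have "\<not> null \<nu> x"
  proof
    assume nu: "null \<nu> x"
    have fE: "?f ` {..<n} \<subseteq> E" using Fn_E x by auto
    obtain C where C: "\<And>c e. (\<Sum>a\<in>?f ` {..<n}. c a *s a) \<in> pe e X \<Longrightarrow> \<forall>a\<in>?f ` {..<n}. vge (e - C) (c a)"
      using coordinates_bound[OF _ ind fE] by auto
    have C': "vge (e - C) (b N i)" if "?f N \<in> pe e X" "i < n" for N e i
    proof -
      define c where "c v = b N (the_inv_into {..<n} ?f v)" for v
      have c: "c (?f i) = b N i" if "i < n" for i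
        using the_inv_into_f_f[OF inj, of i] that by (simp add: c_def)
      have "(\<Sum>a\<in>?f ` {..<n}. c a *s a) = (\<Sum>i<n. c (?f i) *s ?f i)" by (simp add: sum.reindex[OF inj])
      also have "\<dots> = ?f N" unfolding orbit[of N] by (rule sum.cong) (simp_all add: c)
      finally have "\<forall>a\<in>?f ` {..<n}. vge (e - C) (c a)" using that(1) by (intro C) simp
      then show ?thesis using c[OF that(2)] that(2) by force
    qed
    \<comment> \<open>The added constant covers the loss \<open>C\<close> of passing to coordinates,
      the shift by \<open>\<nu> i\<close> with \<open>i < n\<close>, and 1 for rounding.\<close>
    obtain N0 where N0: "\<And>N e. N \<ge> N0 \<Longrightarrow> of_int e \<le> \<nu> * of_nat N + (\<bar>\<nu>\<bar> * of_nat n + of_int C + 1) \<Longrightarrow> ?f N \<in> pe e X"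
      using nu unfolding null_def by metis
    define N where "N = max N0 i0"
    define e where "e = \<lfloor>\<nu> * of_nat N + (\<bar>\<nu>\<bar> * of_nat n + of_int C + 1)\<rfloor>"
    obtain i where i: "i < n" "b N i \<noteq> 0" "of_int (val (b N i)) = \<nu> * (of_nat N - of_nat i)"
      using I2[of N] by (auto simp: N_def)
    have "?f N \<in> pe e X" by (rule N0) (auto simp: N_def e_def)
    then have "e - C \<le> val (b N i)" using C'[OF _ i(1)] i(2) by (auto simp: vge_def)
    then have "of_int (e - C) \<le> (of_int (val (b N i)) :: rat)" by (simp only: of_int_le_iff)
    moreover have "\<nu> * of_nat N + (\<bar>\<nu>\<bar> * of_nat n + of_int C + 1) < of_int e + 1"
      unfolding e_def by linarith
    ultimately show False using i(3) bound[OF i(1)] by (simp add: algebra_simps abs_le_iff)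
  qed
  ultimately show ?thesis using i0 n unfolding lam
    by (intro exI[of _ "val (\<alpha> i0)"] exI[of _ "n - i0"]) auto
qed

end

section \<open>Splitting off the least slope\<close>

context frob_lattice
begin

lemma len_less:
  assumes "fl Y Z'" "wsub Y" "wsub Z" "wsub Z'" "Y \<subseteq> Z" "Z \<subset> Z'"
  shows "len Y Z < len Y Z'"
proof -
  have "fl Y Z" using fl_interval[OF assms(1,2,2,3,4)] assms by auto
  then have "chain Y Z (len Y Z)" using assms by (intro len_chain) auto
  then have c: "chain Y Z' (Suc (len Y Z))" using assms by (intro chain.chain_Suc[of Y Z]) auto
  have "Y \<subseteq> Z'" using assms(5,6) by blast
  then show ?thesis using len_chain(2)[OF assms(1,2,4) _ c] by simp
qed

text \<open>The Fitting decomposition for \<open>\<Phi> = p\<^sup>-\<^sup>s F\<^sup>t\<close> on the lattice \<open>L\<close> of vectors with integral orbit.\<close>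

lemma fitting:
  fixes s :: int and t :: nat
  assumes P: "subspace P" "P \<subseteq> E" "F ` P \<subseteq> P" and t: "0 < t"
    and grP: "\<And>x. x \<in> P \<Longrightarrow> gr (of_int s / of_nat t) x"
  shows "\<exists>U. bd U \<and> U \<subseteq> P \<and> (F ^^ t) ` U = pe s U \<and>
    (\<forall>x\<in>P. \<exists>u\<in>span U. \<exists>z\<in>P. null (of_int s / of_nat t) z \<and> x = u + z)"
proof -
  define \<nu> :: rat where "\<nu> = of_int s / of_nat t"
  \<comment> \<open>The \<open>k\<close>-th iterate of \<open>p^(-s) F^t\<close>; on
    \<open>P\<close> the growth hypothesis keeps its orbits bounded.\<close>
  define \<Phi> :: "nat \<Rightarrow> 'b \<Rightarrow> 'b" where "\<Phi> k x = p powi (- s * int k) *s (F ^^ (t * k)) x" for k x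
  have \<Phi>_0 [simp]: "\<Phi> 0 x = x" for x by (simp add: \<Phi>_def)
  have \<Phi>_add: "\<Phi> k (x + y) = \<Phi> k x + \<Phi> k y" for k x y by (simp add: \<Phi>_def Fn_add scale_right_distrib)
  have \<Phi>_diff: "\<Phi> k (x - y) = \<Phi> k x - \<Phi> k y" for k x y by (simp add: \<Phi>_def Fn_diff scale_right_diff_distrib)
  have \<Phi>_scale: "\<Phi> k (a *s x) = (\<sigma> ^^ (t * k)) a *s \<Phi> k x" for k a x
    by (simp add: \<Phi>_def Fn_scale mult.commute)
  have \<Phi>_powi: "\<Phi> k (p powi e *s x) = p powi e *s \<Phi> k x" for k e x
    by (simp add: \<Phi>_def Fn_powi mult.commute)
  have \<Phi>_\<Phi>: "\<Phi> j (\<Phi> k x) = \<Phi> (j + k) x" for j k x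
    unfolding \<Phi>_def by (simp add: Fn_powi pp distrib_left funpow_add add.commute algebra_simps)
  have \<Phi>_P: "\<Phi> k x \<in> P" if "x \<in> P" for k x
  proof -
    have "(F ^^ m) x \<in> P" for m using that P(3) by (induction m) auto
    then show ?thesis unfolding \<Phi>_def by (intro subspace_scale P(1))
  qed
  have \<Phi>_inj: "x = y" if "x \<in> P" "y \<in> P" "\<Phi> k x = \<Phi> k y" for k x y
  proof -
    have "(F ^^ (t * k)) x = (F ^^ (t * k)) y" using that(3) p_nz by (simp add: \<Phi>_def)
    then show ?thesis using inj_onD[OF Fn_inj_on] that P(2) by blast
  qed
  have \<Phi>_image_pe: "\<Phi> k ` pe e Y = pe e (\<Phi> k ` Y)" for k e Y
    unfolding pe_image by (simp add: image_image \<Phi>_powi)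
  have \<Phi>_ssum: "\<Phi> k ` ssum Y Z = ssum (\<Phi> k ` Y) (\<Phi> k ` Z)" for k Y Z
  proof (intro subset_antisym subsetI)
    fix x assume "x \<in> \<Phi> k ` ssum Y Z"
    then obtain a c where "a \<in> Y" "c \<in> Z" "x = \<Phi> k (a + c)" by (auto simp: ssum_def)
    then show "x \<in> ssum (\<Phi> k ` Y) (\<Phi> k ` Z)" by (simp add: \<Phi>_add ssumI)
  next
    fix x assume "x \<in> ssum (\<Phi> k ` Y) (\<Phi> k ` Z)"
    then obtain a c where "a \<in> Y" "c \<in> Z" "x = \<Phi> k a + \<Phi> k c" by (auto simp: ssum_def)
    then show "x \<in> \<Phi> k ` ssum Y Z" by (simp add: \<Phi>_add[symmetric] ssumI)
  qed
  have \<Phi>_eq: "\<Phi> k ` Y = pe (- s * int k) ((F ^^ (t * k)) ` Y)" for k Y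
    unfolding pe_image \<Phi>_def by (simp add: image_image)
  have \<Phi>_wsub: "wsub (\<Phi> k ` Y)" if "wsub Y" for k Y
    unfolding \<Phi>_eq by (intro wsub_pe wsub_Fn_image that)
  \<comment> \<open>The largest submodule of \<open>X \<inter> P\<close> stable under the iterates;
    by boundedness of orbits every vector of \<open>P\<close> enters it after scaling.\<close>
  define L where "L = {x \<in> P. \<forall>k. \<Phi> k x \<in> X}"
  have wL: "wsub L"
    unfolding wsub_def
  proof (intro conjI ballI)
    show "0 \<in> L" using wsub_0[OF X_wsub] subspace_0[OF P(1)] by (auto simp: L_def \<Phi>_def)
  next
    fix x y assume "x \<in> L" "y \<in> L"
    then show "x + y \<in> L" using wsub_add[OF X_wsub] subspace_add[OF P(1)] by (auto simp: L_def \<Phi>_add)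
  next
    fix a x assume "a \<in> W" "x \<in> L"
    then show "a *s x \<in> L" using wsub_scale[OF X_wsub] subspace_scale[OF P(1)] by (auto simp: L_def \<Phi>_scale \<sigma>n_W)
  qed
  have LX: "L \<subseteq> X" unfolding L_def using \<Phi>_0 by (metis (no_types, lifting) mem_Collect_eq subsetI)
  have LP: "L \<subseteq> P" by (auto simp: L_def)
  have bdL: "bd L" by (rule bd_subset[OF bd_X wL LX])
  have \<Phi>L: "\<Phi> k x \<in> L" if "x \<in> L" for k x using that \<Phi>_P by (auto simp: L_def \<Phi>_\<Phi>)
  have \<Phi>peL: "\<Phi> k x \<in> pe e L" if "x \<in> pe e L" for k e x
    using that \<Phi>L unfolding pe_def by (simp add: \<Phi>_powi[symmetric])
  have P_L: "\<exists>c::nat. p powi int c *s x \<in> L" if x: "x \<in> P" for x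
  proof -
    obtain c where c: "\<And>N e. of_int e \<le> \<nu> * of_nat N - c \<Longrightarrow> (F ^^ N) x \<in> pe e X"
      using grP[OF x] unfolding gr_def \<nu>_def by auto
    define d where "d = nat \<lceil>c\<rceil>"
    have "\<Phi> k (p powi int d *s x) \<in> X" for k
    proof -
      have eq: "\<nu> * of_nat (t * k) = of_int (s * int k)" using t by (simp add: \<nu>_def)
      have "c \<le> of_nat d" unfolding d_def by (rule of_nat_ceiling)
      then have "of_int (s * int k - int d) \<le> \<nu> * of_nat (t * k) - c" unfolding eq by simp
      then have "(F ^^ (t * k)) x \<in> pe (s * int k - int d) X" by (rule c)
      then have "p powi (- (s * int k - int d)) *s (F ^^ (t * k)) x \<in> X" by (simp add: pe_def)
      moreover have "\<Phi> k (p powi int d *s x) = p powi (- (s * int k - int d)) *s (F ^^ (t * k)) x"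
        unfolding \<Phi>_powi unfolding \<Phi>_def pp_scale by simp
      ultimately show ?thesis by (simp only:)
    qed
    then have "p powi int d *s x \<in> L" unfolding L_def using subspace_scale[OF P(1) x] by blast
    then show ?thesis by blast
  qed
  obtain A where A: "finite A" "L = wspan A" and flL: "fl (pe 1 L) L" using bd_basis[OF bdL] by metis
  define D where "D k = \<Phi> k ` L" for k
  have wD: "wsub (D k)" for k unfolding D_def by (rule \<Phi>_wsub[OF wL])
  have D_mono: "D j \<subseteq> D k" if "k \<le> j" for j k
  proof
    fix x assume "x \<in> D j"
    then obtain y where y: "y \<in> L" "x = \<Phi> j y" by (auto simp: D_def)
    then have "x = \<Phi> k (\<Phi> (j - k) y)" using that by (simp add: \<Phi>_\<Phi>)
    then show "x \<in> D k" unfolding D_def using \<Phi>L[OF y(1)] by blast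
  qed
  have \<Phi>D: "\<Phi> j ` D k = D (j + k)" for j k by (simp add: D_def image_image \<Phi>_\<Phi>)
  have DL: "D k \<subseteq> L" for k unfolding D_def using \<Phi>L by auto
  have peD: "pe 1 (D k) \<subseteq> D k" for k using pe_antimono[OF wD, of 0 1 k] by simp
  have wp: "wsub (pe e L)" for e by (rule wsub_pe[OF wL])
  have peL: "pe 1 L \<subseteq> L" using pe_antimono[OF wL, of 0 1] by simp
  \<comment> \<open>Images of \<open>D k\<close> modulo \<open>pL\<close>. They decrease inside a
    module of finite length, so they are constant from the index \<open>n1\<close> of least length
    on.\<close>
  define T where "T k = ssum (D k) (pe 1 L)" for k
  have wT: "wsub (T k)" for k unfolding T_def by (intro wsub_ssum wD wp)
  have TL: "T k \<subseteq> L" for k unfolding T_def by (intro ssum_least DL peL wL)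
  have pT: "pe 1 L \<subseteq> T k" for k unfolding T_def by (rule ssum_upper2[OF wD])
  obtain n1 where n1: "\<And>k. len (pe 1 L) (T n1) \<le> len (pe 1 L) (T k)"
    using ex_has_least_nat[of "\<lambda>_. True" 0 "\<lambda>k. len (pe 1 L) (T k)"] by auto
  have stab1: "T n1 \<subseteq> T m" if "n1 \<le> m" for m
  proof -
    have "T m \<subseteq> T n1" unfolding T_def using D_mono[OF that] by (intro ssum_mono) auto
    moreover have "fl (pe 1 L) (T n1)" by (rule fl_interval[OF flL wp wp wT wL order_refl TL])
    ultimately have "\<not> T m \<subset> T n1" using len_less[of "pe 1 L" "T n1" "T m"] wp wT pT n1[of m] by (auto simp: not_less)
    then show ?thesis using \<open>T m \<subseteq> T n1\<close> by auto
  qed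
  \<comment> \<open>The successor makes \<open>n0\<close> positive, so that \<open>k * n0\<close> is
    at least \<open>k\<close>, and puts \<open>D n0\<close> inside \<open>D m\<close> for the early
    \<open>m < n1\<close> too.\<close>
  define n0 where "n0 = Suc n1"
  have stab: "D n0 \<subseteq> ssum (D m) (pe 1 L)" for m
  proof (cases "n1 \<le> m")
    case True
    have "D n0 \<subseteq> D n1" by (rule D_mono) (simp add: n0_def)
    also have "\<dots> \<subseteq> T n1" unfolding T_def by (rule ssum_upper1[OF wp])
    also have "\<dots> \<subseteq> T m" by (rule stab1[OF True])
    finally show ?thesis by (simp add: T_def)
  next
    case False
    then have "D n0 \<subseteq> D m" by (intro D_mono) (simp add: n0_def)
    also have "\<dots> \<subseteq> ssum (D m) (pe 1 L)" by (rule ssum_upper1[OF wp])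
    finally show ?thesis .
  qed
  \<comment> \<open>Stability modulo \<open>p\<close> is raised to stability modulo
    \<open>p^j\<close> by applying the operator again: the error term in \<open>p D (j * n0)\<close>
    is itself expanded by the induction hypothesis.\<close>
  have stabj: "D (j * n0) \<subseteq> ssum (D m) (pe (int j) L)" for j m
  proof (induction j arbitrary: m)
    case 0
    have "D 0 \<subseteq> L" by (rule DL)
    also have "\<dots> \<subseteq> ssum (D m) L" by (rule ssum_upper2[OF wD])
    finally show ?case by simp
  next
    case (Suc j)
    have "D (Suc j * n0) = \<Phi> (j * n0) ` D n0" by (simp add: \<Phi>D add.commute)
    also have "\<dots> \<subseteq> \<Phi> (j * n0) ` ssum (D m) (pe 1 L)" by (rule image_mono[OF stab])
    also have "\<dots> = ssum (D (j * n0 + m)) (pe 1 (D (j * n0)))"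
      unfolding \<Phi>_ssum \<Phi>D \<Phi>_image_pe by (simp add: D_def)
    also have "\<dots> \<subseteq> ssum (D m) (pe 1 (ssum (D m) (pe (int j) L)))"
      by (intro ssum_mono pe_mono Suc D_mono) simp
    also have "\<dots> \<subseteq> ssum (D m) (pe (int (Suc j)) L)"
    proof (rule ssum_least)
      show "D m \<subseteq> ssum (D m) (pe (int (Suc j)) L)" by (rule ssum_upper1[OF wp])
      have "pe 1 (ssum (D m) (pe (int j) L)) = ssum (pe 1 (D m)) (pe (int (Suc j)) L)" by (simp add: pe_ssum)
      then show "pe 1 (ssum (D m) (pe (int j) L)) \<subseteq> ssum (D m) (pe (int (Suc j)) L)"
        using ssum_mono[OF peD[of m] order_refl] by simp
    qed (intro wsub_ssum wD wp)
    finally show ?case .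
  qed
  \<comment> \<open>The part of \<open>L\<close> on which the operator is bijective; the remaining
    work shows that it is large enough.\<close>
  define U where "U = (\<Inter>k. D k)"
  have wU: "wsub U" 
    unfolding wsub_def U_def using wsub_0[OF wD] wsub_add[OF wD] wsub_scale[OF wD] by auto
  have UL: "U \<subseteq> L" using DL unfolding U_def by blast
  have bdU: "bd U" by (rule bd_subset[OF bdL wU UL])
  \<comment> \<open>Surjectivity of \<open>F\<close> on \<open>P\<close> makes each
    \<open>D k\<close> span the same space as \<open>L\<close>, hence it contains some
    \<open>p^c L\<close>.\<close>
  have openD: "\<exists>c::nat. pe (int c) L \<subseteq> D k" for k
  proof -
    have "a \<in> span (D k)" if "a \<in> A" for a
    proof -
      have aP: "p powi (s * int k) *s a \<in> P" using that wspan_base[of a A] LP A by (intro subspace_scale P(1)) auto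
      then obtain a' where a': "a' \<in> P" "(F ^^ (t * k)) a' = p powi (s * int k) *s a"
        using subspace_Fn_image[OF P, of "t * k"] by (metis imageE)
      then have "\<Phi> k a' = a" by (simp add: \<Phi>_def pp)
      obtain c :: nat where "p powi int c *s a' \<in> L" using P_L[OF a'(1)] by auto
      then have "\<Phi> k (p powi int c *s a') \<in> D k" unfolding D_def by blast
      then have "p powi int c *s a \<in> D k" by (simp only: \<Phi>_powi \<open>\<Phi> k a' = a\<close>)
      then have "p powi (- int c) *s p powi int c *s a \<in> span (D k)" by (rule span_scale[OF span_base])
      then show ?thesis unfolding pp_scale by simp
    qed
    then obtain c where c: "L \<subseteq> pe (- int c) (D k)" using wspan_commensurable[OF A(1) _ wD] A(2) by blast
    have "pe (int c) L \<subseteq> pe (int c) (pe (- int c) (D k))" by (rule pe_mono[OF c])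
    then have "pe (int c) L \<subseteq> D k" by simp
    then show ?thesis by blast
  qed
  \<comment> \<open>An element is corrected successively by elements of \<open>p^(j+i) L\<close> so
    as to lie in later and later \<open>D\<close>. The corrected elements converge by completeness,
    and the limit lies in every \<open>D m\<close> because \<open>D m\<close> contains a power of
    \<open>p\<close> times \<open>L\<close>.\<close>
  have conv: "D (j * n0) \<subseteq> ssum U (pe (int j) L)" for j
  proof
    fix v assume v: "v \<in> D (j * n0)"
    have "\<exists>y. y \<in> D (Suc i * n0) \<and> x - y \<in> pe (int i) L" if "x \<in> D (i * n0)" for i x
    proof -
      have "x \<in> ssum (D (Suc i * n0)) (pe (int i) L)" using stabj[of i "Suc i * n0"] that by blast
      then obtain y z where "y \<in> D (Suc i * n0)" "z \<in> pe (int i) L" "x = y + z" unfolding ssum_def by blast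
      then show ?thesis by (intro exI[of _ y]) simp
    qed
    then have "\<And>i x. x \<in> D (i * n0) \<Longrightarrow> (SOME y. y \<in> D (Suc i * n0) \<and> x - y \<in> pe (int i) L) \<in> D (Suc i * n0) \<and>
      x - (SOME y. y \<in> D (Suc i * n0) \<and> x - y \<in> pe (int i) L) \<in> pe (int i) L"
      by (rule someI_ex)
    then obtain st where st: "\<And>i x. x \<in> D (i * n0) \<Longrightarrow> st i x \<in> D (Suc i * n0) \<and> x - st i x \<in> pe (int i) L"
      by (rule that)
    define w where "w = rec_nat v (\<lambda>i x. st (j + i) x)"
    have w0: "w 0 = v" and wS: "w (Suc i) = st (j + i) (w i)" for i by (simp_all add: w_def)
    have wD': "w i \<in> D ((j + i) * n0)" for i
      by (induction i) (use v st in \<open>auto simp: w0 wS\<close>)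
    define f where "f i = p powi (- int (j + i)) *s (w i - w (Suc i))" for i
    have f: "f i \<in> wspan A" for i
      using st[OF wD'[of i]] unfolding f_def wS A(2)[symmetric] by (simp add: pe_def)
    obtain q where q: "q \<in> L" "\<And>n. q - (\<Sum>i<n. p ^ i *s f i) \<in> pe (int n) L"
      using wspan_series[OF A(1), of f] f A(2) by blast
    have tel: "p powi int j *s (\<Sum>i<n. p ^ i *s f i) = v - w n" for n
    proof (induction n)
      case (Suc n)
      have "p powi int j *s p ^ n *s f n = w n - w (Suc n)"
        unfolding f_def power_int_of_nat[symmetric] by (simp add: pp del: power_int_of_nat)
      then show ?case using Suc by (simp add: scale_right_distrib)
    qed (simp add: w0)
    define u where "u = v - p powi int j *s q"
    have uw: "u - w n \<in> pe (int (j + n)) L" for n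
    proof -
      have "u - w n = - (p powi int j *s (q - (\<Sum>i<n. p ^ i *s f i)))"
        unfolding scale_right_diff_distrib tel by (simp add: u_def)
      moreover have "p powi int j *s (q - (\<Sum>i<n. p ^ i *s f i)) \<in> pe (int (j + n)) L"
        using q(2)[of n] unfolding pe_scale_iff by simp
      ultimately show ?thesis using wsub_uminus[OF wp] by simp
    qed
    have "u \<in> D m" for m
    proof -
      obtain c where c: "pe (int c) L \<subseteq> D m" using openD by blast
      define n where "n = max m c"
      have "m \<le> (j + n) * n0" by (rule order_trans[of _ "j + n"]) (simp_all add: n_def n0_def)
      then have "w n \<in> D m" using wD'[of n] D_mono by blast
      moreover have "int c \<le> int (j + n)" by (simp add: n_def)
      then have "u - w n \<in> D m" using uw[of n] pe_antimono[OF wL, of "int c" "int (j + n)"] c by blast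
      ultimately have "w n + (u - w n) \<in> D m" by (intro wsub_add[OF wD])
      then show ?thesis by simp
    qed
    then have "u \<in> U" by (simp add: U_def)
    from ssumI[OF this peI[OF q(1), of "int j"]] show "v \<in> ssum U (pe (int j) L)" by (simp add: u_def)
  qed
  have \<Phi>U: "\<Phi> k ` U = U" for k
  proof (intro subset_antisym subsetI)
    fix x assume "x \<in> \<Phi> k ` U"
    then obtain y where y: "\<And>j. y \<in> D j" "x = \<Phi> k y" unfolding U_def by auto
    have "x \<in> D (k + j)" for j using y \<Phi>D[of k j] by auto
    then have "x \<in> D j" for j using D_mono[of j "k + j"] by auto
    then show "x \<in> U" by (simp add: U_def)
  next
    fix x assume x: "x \<in> U"
    then have "x \<in> D k" by (simp add: U_def)
    then obtain y where y: "y \<in> L" "x = \<Phi> k y" by (auto simp: D_def)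
    have "y \<in> D j" for j
    proof -
      have "x \<in> D (k + j)" using x by (simp add: U_def)
      then obtain y' where y': "y' \<in> L" "x = \<Phi> k (\<Phi> j y')" by (auto simp: D_def \<Phi>_\<Phi>)
      then have "y = \<Phi> j y'" using \<Phi>_inj[of y "\<Phi> j y'" k] y LP \<Phi>L by auto
      then show ?thesis using y' by (auto simp: D_def)
    qed
    then show "x \<in> \<Phi> k ` U" using y by (auto simp: U_def)
  qed
  have FU: "(F ^^ t) ` U = pe s U"
  proof -
    have "pe s (\<Phi> 1 ` U) = (F ^^ t) ` U" unfolding \<Phi>_eq by simp
    then show ?thesis by (simp add: \<Phi>U)
  qed
  have "bd (L \<inter> span U)" by (rule bd_subset[OF bdL]) (auto intro: wsub_Int wL wsub_subspace)
  then obtain c where c: "L \<inter> span U \<subseteq> pe (- int c) U"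
    using bd_commensurable[of "L \<inter> span U" U] wU by blast
  \<comment> \<open>Divisibility in \<open>L\<close> implies divisibility in \<open>U\<close> with
    the fixed loss \<open>c\<close>, because \<open>L \<inter> span U\<close> and \<open>U\<close>
    are commensurable.\<close>
  have sat: "x \<in> pe (e - int c) U" if "x \<in> pe e L" "x \<in> U" for e x
  proof -
    have "p powi (- e) *s x \<in> L \<inter> span U" using that by (auto simp: pe_def intro: span_scale span_base)
    then have "p powi (- e) *s x \<in> pe (- int c) U" using c by blast
    then show ?thesis by (simp add: pe_scale_iff add.commute)
  qed
  \<comment> \<open>Up to \<open>p^j L\<close>, a late iterate of \<open>x\<close> lies in
    \<open>U\<close>, where the operator can be inverted; the preimages \<open>y j\<close> form a
    Cauchy sequence. Its limit is the isoclinic part of \<open>x\<close>, and the difference is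
    contracted to 0.\<close>
  have decL: "\<exists>u\<in>span U. \<exists>z\<in>P. null \<nu> z \<and> x = u + z" if x: "x \<in> L" for x
  proof -
    have "\<exists>y\<in>U. \<Phi> (j * n0) (x - y) \<in> pe (int j) L" for j
    proof -
      have "\<Phi> (j * n0) x \<in> D (j * n0)" using x by (simp add: D_def)
      then obtain u q where u: "u \<in> U" "q \<in> pe (int j) L" "\<Phi> (j * n0) x = u + q"
        using conv[of j] by (auto simp: ssum_def)
      obtain y where "y \<in> U" "\<Phi> (j * n0) y = u" using u(1) \<Phi>U[of "j * n0"] by (metis imageE)
      then show ?thesis using u by (intro bexI[of _ y]) (simp_all add: \<Phi>_diff)
    qed
    then obtain y where y: "\<And>j. y j \<in> U" "\<And>j. \<Phi> (j * n0) (x - y j) \<in> pe (int j) L" by metis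
    have d: "y (Suc j) - y j \<in> pe (int j - int c) U" for j
    proof -
      let ?N = "Suc j * n0"
      have U: "y (Suc j) - y j \<in> U" by (intro wsub_diff wU y)
      have 1: "\<Phi> ?N (x - y j) \<in> pe (int j) L" using \<Phi>peL[OF y(2)[of j], of n0] by (simp add: \<Phi>_\<Phi>)
      have 2: "\<Phi> ?N (x - y (Suc j)) \<in> pe (int j) L"
        using y(2)[of "Suc j"] pe_antimono[OF wL, of "int j" "int (Suc j)"] by auto
      have "\<Phi> ?N (y (Suc j) - y j) = \<Phi> ?N (x - y j) - \<Phi> ?N (x - y (Suc j))" by (simp add: \<Phi>_diff)
      then have "\<Phi> ?N (y (Suc j) - y j) \<in> pe (int j) L" using wsub_diff[OF wp 1 2] by simp
      moreover have "\<Phi> ?N (y (Suc j) - y j) \<in> U" using U \<Phi>U[of ?N] by blast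
      ultimately have "\<Phi> ?N (y (Suc j) - y j) \<in> pe (int j - int c) U" by (rule sat)
      also have "\<dots> = \<Phi> ?N ` pe (int j - int c) U" by (simp add: \<Phi>_image_pe \<Phi>U)
      finally obtain y' where y': "y' \<in> pe (int j - int c) U" "\<Phi> ?N (y (Suc j) - y j) = \<Phi> ?N y'" by auto
      have "y' \<in> P" using y'(1) UL LP pe_mono[of U P] pe_subspace[OF P(1)] by blast
      moreover have "y (Suc j) - y j \<in> P" using U UL LP by blast
      ultimately show ?thesis using \<Phi>_inj y' by metis
    qed
    have "bd (pe (- int c) U)" by (rule bd_pe[OF bdU])
    then obtain A' where A': "finite A'" "pe (- int c) U = wspan A'" using bd_basis by metis
    define f where "f i = p powi (- int i) *s (y (Suc i) - y i)" for i
    have f: "f i \<in> wspan A'" for i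
      using d[of i] unfolding A'(2)[symmetric] f_def pe_scale_iff by simp
    obtain q where q: "q \<in> pe (- int c) U" "\<And>n. q - (\<Sum>i<n. p ^ i *s f i) \<in> pe (int n) (pe (- int c) U)"
      using wspan_series[OF A'(1), of f] f A'(2) by metis
    have tel: "(\<Sum>i<n. p ^ i *s f i) = y n - y 0" for n
    proof (induction n)
      case (Suc n)
      have "p ^ n *s f n = y (Suc n) - y n"
        unfolding f_def power_int_of_nat[symmetric] by (simp add: pp del: power_int_of_nat)
      then show ?case using Suc by simp
    qed simp
    define u where "u = y 0 + q"
    define z where "z = x - u"
    have uspan: "u \<in> span U"
      unfolding u_def using y(1)[of 0] q(1) pe_span[of U U "- int c"] span_superset[of U]
      by (intro span_add) auto
    have uP: "u \<in> P" using uspan span_minimal[of U P] UL LP P(1) by blast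
    have zP: "z \<in> P" unfolding z_def using x LP uP by (intro subspace_diff P(1)) auto
    have \<Phi>z: "\<Phi> k z \<in> pe (int n - int c) L" if "n * n0 \<le> k" for n k
    proof -
      have "y n - u \<in> pe (int n - int c) U"
        using q(2)[of n] wsub_uminus[OF wsub_pe[OF wU], of "q - (y n - y 0)" "int n - int c"] unfolding tel u_def
        by (simp add: algebra_simps)
      then have "y n - u \<in> pe (int n - int c) L" using pe_mono[OF UL] by auto
      then have 1: "\<Phi> (n * n0) (y n - u) \<in> pe (int n - int c) L" by (rule \<Phi>peL)
      have 2: "\<Phi> (n * n0) (x - y n) \<in> pe (int n - int c) L"
        using y(2)[of n] pe_antimono[OF wL, of "int n - int c" "int n"] by auto
      have "\<Phi> (n * n0) z = \<Phi> (n * n0) (x - y n) + \<Phi> (n * n0) (y n - u)"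
        by (simp add: z_def \<Phi>_diff)
      then have "\<Phi> (n * n0) z \<in> pe (int n - int c) L" using wsub_add[OF wp 2 1] by simp
      from \<Phi>peL[OF this, of "k - n * n0"] show ?thesis using that by (simp add: \<Phi>_\<Phi>)
    qed
    have "null \<nu> z"
      unfolding null_def
    proof (intro conjI allI)
      show "z \<in> E" using zP P(2) by auto
      fix r :: rat
      \<comment> \<open>\<open>\<bar>s\<bar>\<close> absorbs the remainder of \<open>N\<close>
        modulo \<open>t\<close>, and \<open>c\<close> the loss from \<open>sat\<close>.\<close>
      define n where "n = nat (\<lceil>r\<rceil> + \<bar>s\<bar> + int c)"
      have "(F ^^ N) z \<in> pe e X" if N: "t * (n * n0) \<le> N" and e: "of_int e \<le> \<nu> * of_nat N + r" for N e
      proof -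
        define k where "k = N div t"
        have k: "n * n0 \<le> k" unfolding k_def using N t by (simp add: less_eq_div_iff_mult_less_eq mult.commute)
        have "\<Phi> k z \<in> pe (int n - int c) X" using \<Phi>z[OF k] pe_mono[OF LX] by auto
        then have "(F ^^ (t * k)) z \<in> pe (s * int k + (int n - int c)) X"
          unfolding \<Phi>_def pe_scale_iff by (simp add: add.commute)
        then have "(F ^^ (N mod t)) ((F ^^ (t * k)) z) \<in> pe (s * int k + (int n - int c)) X" by (rule Fn_pe_X)
        moreover have "(F ^^ (N mod t)) ((F ^^ (t * k)) z) = (F ^^ N) z"
          unfolding funpow_add[THEN fun_cong, unfolded o_apply, symmetric] k_def by (simp add: add.commute)
        moreover have "e \<le> s * int k + (int n - int c)"
        proof -
          have "of_nat N = (of_nat (t * k + N mod t) :: rat)" unfolding k_def by simp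
          then have "\<nu> * of_nat N = of_int (s * int k) + \<nu> * of_nat (N mod t)"
            using t by (simp add: \<nu>_def distrib_left)
          moreover have "\<nu> * of_nat (N mod t) \<le> of_int \<bar>s\<bar>"
          proof -
            have "\<nu> * of_nat (N mod t) \<le> \<bar>\<nu>\<bar> * of_nat t"
              using t mod_less_divisor[OF t, of N] by (intro mult_mono) auto
            then show ?thesis using t by (simp add: \<nu>_def)
          qed
          moreover have "r \<le> of_int \<lceil>r\<rceil>" by simp
          ultimately have "of_int e \<le> (of_int (s * int k + \<bar>s\<bar> + \<lceil>r\<rceil>) :: rat)"
            using e unfolding of_int_add by linarith
          then have "e \<le> s * int k + \<bar>s\<bar> + \<lceil>r\<rceil>" by (simp only: of_int_le_iff)
          then show ?thesis unfolding n_def by linarith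
        qed
        ultimately show ?thesis using pe_antimono[OF X_wsub] by auto
      qed
      then show "\<exists>N0. \<forall>N\<ge>N0. \<forall>e. of_int e \<le> \<nu> * of_nat N + r \<longrightarrow> (F ^^ N) z \<in> pe e X" by blast
    qed
    moreover have "x = u + z" by (simp add: z_def)
    ultimately show ?thesis using uspan zP by blast
  qed
  have "\<exists>u\<in>span U. \<exists>z\<in>P. null \<nu> z \<and> x = u + z" if x: "x \<in> P" for x
  proof -
    obtain d :: nat where "p powi int d *s x \<in> L" using P_L[OF x] by auto
    then obtain u z where uz: "u \<in> span U" "z \<in> P" "null \<nu> z" "p powi int d *s x = u + z" using decL by blast
    let ?c = "p powi (- int d)"
    have "x = ?c *s p powi int d *s x" by (simp only: pp_scale) simp
    also have "\<dots> = ?c *s u + ?c *s z" unfolding uz(4) by (rule scale_right_distrib)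
    finally have "x = ?c *s u + ?c *s z" .
    moreover have "null \<nu> (?c *s z)" using subspace_scale[OF subspace_null, of z \<nu>] uz(3) by simp
    ultimately show ?thesis using span_scale[OF uz(1)] subspace_scale[OF P(1) uz(2)] by blast
  qed
  then show ?thesis using bdU UL LP FU unfolding \<nu>_def by blast
qed

end

context frob_lattice
begin

subsection \<open>The slope decomposition\<close>

definition iso :: "rat \<Rightarrow> 'b set \<Rightarrow> bool" where
  "iso q U \<longleftrightarrow> bd U \<and> (\<exists>(s::int) t. 0 < t \<and> q = of_int s / of_nat t \<and> (F ^^ t) ` U = pe s U)"

text \<open>A union suffices since isoclinic lattices of one slope are closed under sums; it is the
  counterpart of \<open>slope_part\<close> inside the ambient space.\<close>

definition SP :: "rat \<Rightarrow> 'b set" where "SP q = \<Union>(span ` {U. iso q U})"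

lemma Fn_pe_mult:
  assumes "(F ^^ t) ` U = pe s U"
  shows "(F ^^ (t * k)) ` U = pe (s * int k) U"
proof (induction k)
  case (Suc k)
  have "(F ^^ (t * Suc k)) ` U = (F ^^ (t * k)) ` ((F ^^ t) ` U)"
    by (simp add: image_image add.commute[of t] funpow_add)
  also have "\<dots> = pe s ((F ^^ (t * k)) ` U)" unfolding assms pe_Fn_image ..
  finally show ?case unfolding Suc by (simp add: algebra_simps)
qed simp

lemma bd_ssum: "bd Y \<Longrightarrow> bd Z \<Longrightarrow> bd (ssum Y Z)"
proof -
  assume b: "bd Y" "bd Z"
  then obtain c d where cd: "Y \<subseteq> pe c X" "Z \<subseteq> pe d X" by (auto simp: bd_def)
  have "ssum Y Z \<subseteq> pe (min c d) X"
    using cd pe_antimono[OF X_wsub, of "min c d" c] pe_antimono[OF X_wsub, of "min c d" d]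
    by (intro ssum_least wsub_pe X_wsub) auto
  then show "bd (ssum Y Z)" using wsub_ssum b by (auto simp: bd_def)
qed

lemma iso_zero: "iso q {0}"
proof -
  obtain s t where "quotient_of q = (s, t)" by force
  then have "0 < nat t" "q = of_int s / of_nat (nat t)"
    using quotient_of_denom_pos[of q s t] quotient_of_div[of q s t] by auto
  moreover have "(F ^^ nat t) ` {0} = pe s {0}" by (simp add: pe_image)
  moreover have "bd {0}" using bd_wspan[of "{}"] by simp
  ultimately show ?thesis unfolding iso_def by blast
qed

text \<open>Two presentations \<open>s/t = s'/t'\<close> of the slope are brought to the common
  exponent \<open>t t'\<close>.\<close>

lemma iso_ssum:
  assumes "iso q U" "iso q U'"
  shows "iso q (ssum U U')"
proof -
  obtain s t where st: "0 < t" "q = of_int s / of_nat t" "(F ^^ t) ` U = pe s U" using assms(1) by (auto simp: iso_def)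
  obtain s' t' where st': "0 < t'" "q = of_int s' / of_nat t'" "(F ^^ t') ` U' = pe s' U'" using assms(2) by (auto simp: iso_def)
  have "(of_int (s * int t') :: rat) = of_int (s' * int t)"
    using st st' by (simp add: field_simps)
  then have eq: "s * int t' = s' * int t" by (simp only: of_int_eq_iff)
  have "(F ^^ (t * t')) ` U = pe (s * int t') U" by (rule Fn_pe_mult[OF st(3)])
  moreover have "(F ^^ (t * t')) ` U' = pe (s * int t') U'"
    using Fn_pe_mult[OF st'(3), of t] eq by (simp add: mult.commute)
  ultimately have "(F ^^ (t * t')) ` ssum U U' = pe (s * int t') (ssum U U')" by (simp add: Fn_ssum pe_ssum)
  moreover have "q = of_int (s * int t') / of_nat (t * t')" using st st' by simp
  moreover have "0 < t * t'" using st st' by simp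
  ultimately show ?thesis using bd_ssum assms unfolding iso_def by blast
qed

lemma iso_F: "iso q U \<Longrightarrow> iso q (F ` U)"
proof -
  assume U: "iso q U"
  then obtain s t where st: "0 < t" "q = of_int s / of_nat t" "(F ^^ t) ` U = pe s U" by (auto simp: iso_def)
  have "(F ^^ t) ` (F ` U) = F ` ((F ^^ t) ` U)" by (simp add: image_image funpow_swap1)
  also have "\<dots> = pe s (F ` U)" unfolding st(3) using pe_Fn_image[of s 1 U] by simp
  finally have "(F ^^ t) ` (F ` U) = pe s (F ` U)" .
  moreover have "bd (F ` U)"
  proof -
    obtain c where "wsub U" "U \<subseteq> pe c X" using U by (auto simp: iso_def bd_def)
    then show ?thesis unfolding bd_def using wsub_Fn_image[of U 1] Fn_pe_X[of _ c 1] by (intro conjI exI[of _ c]) auto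
  qed
  ultimately show ?thesis using st unfolding iso_def by blast
qed

lemma iso_bd: "iso q U \<Longrightarrow> bd U" by (simp add: iso_def)

lemma SP_E: "SP q \<subseteq> E"
  using span_minimal[OF bd_E[OF iso_bd] subspace_E] by (auto simp: SP_def)

lemma iso_SP: "iso q U \<Longrightarrow> span U \<subseteq> SP q"
  by (auto simp: SP_def)

lemma subspace_SP: "subspace (SP q)"
  unfolding subspace_def
proof (intro conjI ballI allI)
  show "0 \<in> SP q" using iso_SP[OF iso_zero] span_zero by blast
next
  fix x y assume "x \<in> SP q" "y \<in> SP q"
  then obtain U U' where U: "iso q U" "x \<in> span U" "iso q U'" "y \<in> span U'" by (auto simp: SP_def)
  have "U \<subseteq> ssum U U'" "U' \<subseteq> ssum U U'"
    using ssum_upper1 ssum_upper2 bd_wsub iso_bd U by blast+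
  then have "x + y \<in> span (ssum U U')" using U(2,4) span_mono by (intro span_add) blast+
  then show "x + y \<in> SP q" using iso_SP[OF iso_ssum[OF U(1,3)]] by blast
next
  fix a x assume "x \<in> SP q"
  then show "a *s x \<in> SP q" by (auto simp: SP_def intro: span_scale)
qed

text \<open>Finitely many isoclinic lattices cover a basis, and their sum is again
  isoclinic.\<close>

lemma SP_eq_span: "\<exists>U. iso q U \<and> SP q = span U"
proof -
  obtain C where C: "C \<subseteq> SP q" "independent C" "SP q \<subseteq> span C" using basis_exists[of "SP q"] by metis
  have "finite C" using independent_span_bound[OF B_fin C(2)] C(1) SP_E by blast
  then have "\<exists>U. iso q U \<and> C \<subseteq> span U" using C(1)
  proof (induction C rule: finite_induct)
    case empty
    then show ?case using iso_zero by blast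
  next
    case (insert x C)
    then obtain U where U: "iso q U" "C \<subseteq> span U" by auto
    obtain U' where U': "iso q U'" "x \<in> span U'" using insert.prems by (auto simp: SP_def)
    have "span U \<subseteq> span (ssum U U')" "span U' \<subseteq> span (ssum U U')"
      using ssum_upper1 ssum_upper2 bd_wsub iso_bd U U' by (intro span_mono; blast)+
    then show ?case using iso_ssum[OF U(1) U'(1)] U U' by blast
  qed
  then obtain U where U: "iso q U" "C \<subseteq> span U" by blast
  then have "span C \<subseteq> span U" by (intro span_minimal subspace_span)
  then show ?thesis using U C(3) iso_SP[OF U(1)] by blast
qed

lemma SP_F: "x \<in> SP q \<Longrightarrow> F x \<in> SP q"
proof -
  assume "x \<in> SP q"
  then obtain U where U: "iso q U" "x \<in> span U" by (auto simp: SP_def)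
  then obtain e where "x \<in> pe e U" using span_wsub[OF bd_wsub[OF iso_bd[OF U(1)]]] by auto
  then have "F x \<in> pe e (F ` U)" using pe_Fn_image[of e 1 U] by auto
  then have "F x \<in> span (F ` U)" using pe_span[OF span_superset] by blast
  then show ?thesis using iso_SP[OF iso_F[OF U(1)]] by blast
qed

lemma SP_gr:
  assumes "x \<in> SP q"
  shows "gr q x"
proof -
  obtain U where U: "iso q U" "x \<in> span U" using assms by (auto simp: SP_def)
  then obtain s t where st: "0 < t" "q = of_int s / of_nat t" "(F ^^ t) ` U = pe s U" by (auto simp: iso_def)
  obtain d where d: "U \<subseteq> pe d X" using U(1) by (auto simp: iso_def bd_def)
  obtain e0 where e0: "x \<in> pe e0 U" using U span_wsub[OF bd_wsub[OF iso_bd[OF U(1)]]] by auto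
  have "(F ^^ N) x \<in> pe e X" if e: "of_int e \<le> q * of_nat N - (of_int \<bar>s\<bar> - of_int (e0 + d))" for N e
  proof -
    define k where "k = N div t"
    have "(F ^^ (t * k)) x \<in> pe e0 (pe (s * int k) U)"
      using e0 unfolding Fn_pe_mult[OF st(3), symmetric] pe_Fn_image by blast
    then have "(F ^^ (t * k)) x \<in> pe (e0 + s * int k) (pe d X)" using pe_mono[OF d] by auto
    then have "(F ^^ (t * k)) x \<in> pe (e0 + s * int k + d) X" by simp
    then have "(F ^^ (N mod t)) ((F ^^ (t * k)) x) \<in> pe (e0 + s * int k + d) X" by (rule Fn_pe_X)
    moreover have "(F ^^ (N mod t)) ((F ^^ (t * k)) x) = (F ^^ N) x"
      unfolding funpow_add[THEN fun_cong, unfolded o_apply, symmetric] k_def by (simp add: add.commute)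
    moreover have "e \<le> e0 + s * int k + d"
    proof -
      have "of_nat N = (of_nat (t * k + N mod t) :: rat)" unfolding k_def by simp
      then have "q * of_nat N = of_int (s * int k) + q * of_nat (N mod t)"
        using st by (simp add: distrib_left)
      moreover have "q * of_nat (N mod t) \<le> of_int \<bar>s\<bar>"
      proof -
        have "q * of_nat (N mod t) \<le> \<bar>q\<bar> * of_nat t"
          using st(1) mod_less_divisor[OF st(1), of N] by (intro mult_mono) auto
        then show ?thesis using st by simp
      qed
      ultimately have "of_int e \<le> (of_int (e0 + s * int k + d) :: rat)" using e by simp
      then show ?thesis by (simp only: of_int_le_iff)
    qed
    ultimately show ?thesis using pe_antimono[OF X_wsub] by auto
  qed
  then show ?thesis unfolding gr_def using assms SP_E by blast
qed

lemma exact_order: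
  assumes "wsub U" "separated U" "x \<in> span U" "x \<noteq> 0"
  obtains e where "x \<in> pe e U" "x \<notin> pe (e + 1) U"
proof -
  obtain e0 where e0: "x \<in> pe e0 U" using assms span_wsub by auto
  have "\<exists>n::nat. x \<notin> pe (e0 + int n) U"
  proof (rule ccontr)
    assume "\<not> ?thesis"
    then have "x \<in> pe (int n) (pe e0 U)" for n by (simp add: add.commute)
    then have "p powi (- e0) *s x \<in> pe (int n) U" for n by (simp add: pe_scale_iff)
    then have "p powi (- e0) *s x = 0" using assms(2) unfolding separated_def by blast
    then show False using assms(4) p_nz by simp
  qed
  then obtain n where n: "x \<notin> pe (e0 + int n) U" "\<And>i. i < n \<Longrightarrow> x \<in> pe (e0 + int i) U"
    using exists_least_iff[of "\<lambda>n. x \<notin> pe (e0 + int n) U"] by auto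
  have "n \<noteq> 0" using n(1) e0 by (cases n) auto
  then obtain m where m: "n = Suc m" by (cases n) auto
  then show thesis using that[of "e0 + int m"] n by (simp add: algebra_simps)
qed

text \<open>Since \<open>F^(t k)\<close> maps \<open>U\<close> onto \<open>p^(s k) U\<close>, the
  order of divisibility by \<open>p\<close> measured in \<open>U\<close> rises by exactly
  \<open>s k\<close> and cannot outrun the rate \<open>q\<close>.\<close>

lemma SP_null:
  assumes "x \<in> SP q" "null q x"
  shows "x = 0"
proof (rule ccontr)
  assume "x \<noteq> 0"
  obtain U where U: "iso q U" "x \<in> span U" using assms by (auto simp: SP_def)
  then obtain s t where st: "0 < t" "q = of_int s / of_nat t" "(F ^^ t) ` U = pe s U" by (auto simp: iso_def)
  have wU: "wsub U" using bd_wsub[OF iso_bd[OF U(1)]] .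
  obtain e where e: "x \<in> pe e U" "x \<notin> pe (e + 1) U"
    using exact_order[OF wU bd_separated[OF iso_bd[OF U(1)]] U(2) \<open>x \<noteq> 0\<close>] by metis
  have "bd (X \<inter> span U)" by (rule bd_subset[OF bd_X]) (auto intro: wsub_Int X_wsub wsub_subspace)
  then obtain c where c: "X \<inter> span U \<subseteq> pe (- int c) U"
    using bd_commensurable[of "X \<inter> span U" U] wU by blast
  obtain N0 where N0: "\<And>N f. N \<ge> N0 \<Longrightarrow> of_int f \<le> q * of_nat N + (of_int (e + 1) + of_nat c) \<Longrightarrow> (F ^^ N) x \<in> pe f X"
    using assms(2) unfolding null_def by metis
  define f where "f = s * int N0 + (e + 1) + int c"
  have "(F ^^ (t * N0)) x \<in> pe f X"
  proof (rule N0)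
    show "N0 \<le> t * N0" using st(1) by simp
    show "of_int f \<le> q * of_nat (t * N0) + (of_int (e + 1) + of_nat c)" using st by (simp add: f_def)
  qed
  moreover have "(F ^^ (t * N0)) x \<in> pe (e + s * int N0) U"
    using e(1) pe_Fn_image[of e "t * N0" U] unfolding Fn_pe_mult[OF st(3)] by auto
  then have "(F ^^ (t * N0)) x \<in> span U" using pe_span[OF span_superset] by blast
  ultimately have "p powi (- f) *s (F ^^ (t * N0)) x \<in> X \<inter> span U" by (auto simp: pe_def intro: span_scale)
  then have "p powi (- f) *s (F ^^ (t * N0)) x \<in> pe (- int c) U" using c by blast
  then have "(F ^^ (t * N0)) x \<in> pe (e + 1) (pe (s * int N0) U)" by (simp add: pe_scale_iff f_def algebra_simps)
  then have "(F ^^ (t * N0)) x \<in> (F ^^ (t * N0)) ` pe (e + 1) U"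
    unfolding Fn_pe_mult[OF st(3), symmetric] pe_Fn_image .
  then obtain y where y: "y \<in> pe (e + 1) U" "(F ^^ (t * N0)) x = (F ^^ (t * N0)) y" by auto
  have "y \<in> E" using y(1) pe_span[OF bd_E[OF iso_bd[OF U(1)]]] by blast
  moreover have "x \<in> E" using assms SP_E by blast
  ultimately have "x = y" using inj_onD[OF Fn_inj_on y(2)] by blast
  then show False using y e by simp
qed

lemma SP_neg:
  assumes "q < 0"
  shows "SP q = {0}"
  using SP_null[of _ q] gr_null[OF gr_0 assms] SP_E subspace_0[OF subspace_SP, of q] by blast

text \<open>\<open>V = p F^(-1)\<close> acts with slope \<open>1 - q \<le> 0\<close>, so it does not
  make vectors of \<open>U\<close> arbitrarily divisible, contrary to its nilpotence on
  \<open>X\<close>.\<close>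

lemma SP_ge_1:
  assumes "1 \<le> q"
  shows "SP q = {0}"
proof -
  obtain U where U: "iso q U" "SP q = span U" using SP_eq_span by blast
  then obtain s t where st: "0 < t" "q = of_int s / of_nat t" "(F ^^ t) ` U = pe s U" by (auto simp: iso_def)
  have ts: "int t \<le> s"
  proof -
    have "(of_int (int t) :: rat) \<le> of_int s" using assms st by (simp add: le_divide_eq)
    then show ?thesis by (simp only: of_int_le_iff)
  qed
  have wU: "wsub U" using bd_wsub[OF iso_bd[OF U(1)]] .
  have "x = 0" if x: "x \<in> span U" for x
  proof (rule ccontr)
    assume "x \<noteq> 0"
    have "x \<in> E" using x U SP_E by auto
    then obtain g where "x \<in> pe g X" using E_pe by auto
    define z where "z = p powi (- g) *s x"
    have zX: "z \<in> X" using \<open>x \<in> pe g X\<close> by (simp add: z_def pe_def)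
    have z: "z \<in> span U" "z \<noteq> 0" using x \<open>x \<noteq> 0\<close> p_nz by (auto simp: z_def intro: span_scale)
    obtain e where e: "z \<in> pe e U" "z \<notin> pe (e + 1) U"
      using exact_order[OF wU bd_separated[OF iso_bd[OF U(1)]] z] by metis
    have "bd (X \<inter> span U)" by (rule bd_subset[OF bd_X]) (auto intro: wsub_Int X_wsub wsub_subspace)
    then obtain c where c: "X \<inter> span U \<subseteq> pe (- int c) U"
      using bd_commensurable[of "X \<inter> span U" U] wU by blast
    \<comment> \<open>One more than the order \<open>e\<close> of \<open>z\<close>, plus the loss
      \<open>c\<close> in passing from \<open>X\<close> to \<open>U\<close>.\<close>
    let ?h = "e + 1 + int c"
    obtain n0 where n0: "\<And>n. n \<ge> n0 \<Longrightarrow> p powi int n *s z \<in> (F ^^ n) ` pe ?h X" using V_nil[OF zX, of ?h] by blast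
    define k where "k = n0"
    have "n0 \<le> t * k" using st(1) by (simp add: k_def)
    then obtain y where y: "y \<in> pe ?h X" "p powi int (t * k) *s z = (F ^^ (t * k)) y" using n0 by blast
    have yE: "y \<in> E" using y(1) pe_span[OF X_E] by blast
    have "p powi int (t * k) *s z \<in> pe (int (t * k) + e) U" using e(1) by (simp add: pe_scale_iff)
    also have "\<dots> = pe (int (t * k) + e - s * int k) (pe (s * int k) U)" by simp
    also have "\<dots> = (F ^^ (t * k)) ` pe (int (t * k) + e - s * int k) U"
      unfolding Fn_pe_mult[OF st(3), symmetric] pe_Fn_image ..
    finally obtain y' where y': "y' \<in> pe (int (t * k) + e - s * int k) U" "(F ^^ (t * k)) y' = p powi int (t * k) *s z" by auto
    have y'U: "y' \<in> span U" using y'(1) pe_span[OF span_superset] by blast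
    have "y' \<in> E" using y'U U(2) SP_E by blast
    then have "y = y'" using inj_onD[OF Fn_inj_on _ yE, of "t * k" y'] y(2) y'(2) by simp
    then have "p powi (- ?h) *s y \<in> X \<inter> span U" using y(1) y'U by (auto simp: pe_def intro: span_scale)
    then have "p powi (- ?h) *s y \<in> pe (- int c) U" using c by blast
    then have "y \<in> pe (e + 1) U" by (simp add: pe_scale_iff)
    then have "(F ^^ (t * k)) y \<in> pe (e + 1) (pe (s * int k) U)"
      unfolding Fn_pe_mult[OF st(3), symmetric] pe_Fn_image by blast
    then have "p powi int (t * k) *s z \<in> pe (e + 1 + s * int k) U" using y(2) by simp
    then have "z \<in> pe (e + 1 + s * int k - int (t * k)) U" by (simp add: pe_scale_iff)
    moreover have "int (t * k) \<le> s * int k" using mult_right_mono[OF ts, of "int k"] by simp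
    ultimately have "z \<in> pe (e + 1) U" using pe_antimono[OF wU, of "e + 1" "e + 1 + s * int k - int (t * k)"] by auto
    then show False using e by simp
  qed
  then show ?thesis unfolding U(2) using span_zero by blast
qed

text \<open>Induction that adds the smallest slope \<open>r\<close> last: the other components grow
  faster, so the component of slope \<open>r\<close>, being minus their sum, exceeds the rate
  \<open>r\<close> by every constant and vanishes.\<close>

lemma SP_independent:
  assumes "finite Q" "\<And>q. q \<in> Q \<Longrightarrow> x q \<in> SP q" "(\<Sum>q\<in>Q. x q) = 0" "q \<in> Q"
  shows "x q = 0"
proof -
  have "\<forall>q\<in>Q. x q = 0"
    using assms(1-3)
  proof (induction Q rule: finite_linorder_min_induct)
    case (insert r Q)
    have "null r (x q)" if "q \<in> Q" for q
      by (rule gr_null[OF SP_gr[of "x q" q]]) (use insert.hyps insert.prems(1) that in auto)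
    then have "null r (- (\<Sum>q\<in>Q. x q))"
      using subspace_neg[OF subspace_null[of r]] subspace_sum[OF subspace_null[of r], of Q x] by simp
    moreover have "r \<notin> Q" using insert.hyps(2) by blast
    then have "x r + (\<Sum>q\<in>Q. x q) = 0" using insert.prems(2) insert.hyps(1) by simp
    then have "x r = - (\<Sum>q\<in>Q. x q)" by (simp add: eq_neg_iff_add_eq_0)
    ultimately have "null r (x r)" by simp
    then have "x r = 0" using insert.prems(1) by (intro SP_null[of "x r" r]) simp_all
    moreover have "\<forall>q\<in>Q. x q = 0"
      using insert.prems \<open>x r + (\<Sum>q\<in>Q. x q) = 0\<close> \<open>x r = 0\<close> by (intro insert.IH) simp_all
    ultimately show ?case by simp
  qed simp
  then show ?thesis using assms(4) by blast
qed

lemma card_slopes: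
  assumes "finite Q" "\<And>q. q \<in> Q \<Longrightarrow> SP q \<noteq> {0}"
  shows "card Q \<le> card B"
proof -
  have "\<exists>x. x \<in> SP q \<and> x \<noteq> 0" if "q \<in> Q" for q
    using assms(2)[OF that] subspace_0[OF subspace_SP, of q] by blast
  then obtain x where x: "\<And>q. q \<in> Q \<Longrightarrow> x q \<in> SP q \<and> x q \<noteq> 0" by metis
  have inj: "inj_on x Q"
  proof (rule inj_onI)
    fix q r assume qr: "q \<in> Q" "r \<in> Q" "x q = x r"
    show "q = r"
    proof (rule ccontr)
      assume ne: "q \<noteq> r"
      \<comment> \<open>An instance of independence for the family \<open>x q, - x r\<close>,
        evaluated at \<open>q\<close>; the trivial conditional keeps the shape of that
        family.\<close>
      have "(if q = q then x q else - x r) = 0"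
      proof (rule SP_independent[of "{q, r}" "\<lambda>i. if i = q then x q else - x r"])
        fix i assume i: "i \<in> {q, r}"
        show "(if i = q then x q else - x r) \<in> SP i"
        proof (cases "i = q")
          case True
          then show ?thesis using x[OF qr(1)] by simp
        next
          case False
          then show ?thesis using i x[OF qr(2)] subspace_neg[OF subspace_SP] by simp
        qed
      qed (use qr ne in auto)
      then show False using x qr by simp
    qed
  qed
  have "independent (x ` Q)"
  proof
    assume "dependent (x ` Q)"
    then obtain u where u: "(\<Sum>v\<in>x ` Q. u v *s v) = 0" "\<exists>v\<in>x ` Q. u v \<noteq> 0"
      unfolding dependent_finite[OF finite_imageI[OF assms(1)]] by blast
    then have "(\<Sum>q\<in>Q. u (x q) *s x q) = 0" by (simp add: sum.reindex[OF inj])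
    then have "u (x q) *s x q = 0" if "q \<in> Q" for q
      using that x assms(1) by (intro SP_independent[of Q "\<lambda>q. u (x q) *s x q"]) (auto intro: subspace_scale[OF subspace_SP])
    then show False using u(2) x by auto
  qed
  then have "card (x ` Q) \<le> card B" using independent_span_bound[OF B_fin] x SP_E by blast
  then show ?thesis by (simp add: card_image[OF inj])
qed

lemma finite_slopes: "finite {q. SP q \<noteq> {0}}"
proof (rule ccontr)
  assume "infinite {q. SP q \<noteq> {0}}"
  then obtain Q where "Q \<subseteq> {q. SP q \<noteq> {0}}" "finite Q" "card Q = Suc (card B)"
    using infinite_arbitrarily_large by blast
  then show False using card_slopes[of Q] by auto
qed

lemma subspace_slopes:
  assumes "subspace P" "P \<subseteq> E" "F ` P \<subseteq> P"
  shows "P \<subseteq> span (\<Union>(range SP))"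
  using assms
proof (induction "dim P" arbitrary: P rule: less_induct)
  case less
  show ?case
  proof (cases "P \<subseteq> {0}")
    case True
    then show ?thesis using span_zero by auto
  next
    case False
    let ?rate = "\<lambda>x q. \<exists>(s::int) t. 0 < t \<and> t \<le> card B \<and> q = of_int s / of_nat t \<and> gr q x \<and> \<not> null q x"
    define R where "R = {q. \<exists>x\<in>P. x \<noteq> 0 \<and> ?rate x q}"
    have rate: "\<exists>q\<in>R. gr q x" if x: "x \<in> P" "x \<noteq> 0" for x
    proof -
      obtain s t where "0 < t" "t \<le> card B" "gr (of_int s / of_nat t) x" "\<not> null (of_int s / of_nat t) x"
        using ex_growth_rate[of x] x less.prems(2) by blast
      then show ?thesis unfolding R_def using x by blast
    qed
    \<comment> \<open>A common denominator of all rates, whose denominators are at most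
      \<open>card B\<close>. Since rates are nonnegative as well, \<open>q * D\<close> is a natural
      number and a least rate exists.\<close>
    define D :: nat where "D = fact (card B)"
    have Dpos: "0 < D" by (simp add: D_def)
    have nonneg: "0 \<le> q" if "q \<in> R" for q
      using that gr_null[OF gr_0, of _ q] less.prems(2) unfolding R_def by force
    have int: "\<exists>z::int. q * of_nat D = of_int z" if q: "q \<in> R" for q
    proof -
      obtain s t where st: "0 < t" "t \<le> card B" "q = of_int s / of_nat t" using q unfolding R_def by blast
      have "t dvd D" unfolding D_def using st by (intro dvd_fact) auto
      then obtain m where "D = t * m" by (auto simp: dvd_def)
      then have "q * of_nat D = of_int (s * int m)" using st by simp
      then show ?thesis by blast
    qed
    obtain x0 where x0: "x0 \<in> P" "x0 \<noteq> 0" using False by auto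
    then obtain q0 where q0: "q0 \<in> R" using rate by blast
    define \<nu> where "\<nu> = (ARG_MIN (\<lambda>q. nat \<lfloor>q * of_nat D\<rfloor>) q. q \<in> R)"
    have \<nu>R: "\<nu> \<in> R" unfolding \<nu>_def by (rule arg_min_natI[of "\<lambda>q. q \<in> R", OF q0])
    have \<nu>min: "\<nu> \<le> q" if q: "q \<in> R" for q
    proof -
      have le: "nat \<lfloor>\<nu> * of_nat D\<rfloor> \<le> nat \<lfloor>q * of_nat D\<rfloor>"
        unfolding \<nu>_def by (rule arg_min_nat_le[of "\<lambda>q. q \<in> R", OF q])
      obtain y z where yz: "\<nu> * of_nat D = of_int y" "q * of_nat D = of_int z" using int[OF \<nu>R] int[OF q] by auto
      have "0 \<le> (of_int z :: rat)" using nonneg[OF q] unfolding yz(2)[symmetric] by simp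
      then have "0 \<le> z" by (simp only: of_int_0_le_iff)
      then have "y \<le> z" using le unfolding yz by simp
      then have "(of_int y :: rat) \<le> of_int z" by (simp only: of_int_le_iff)
      then show ?thesis unfolding yz[symmetric] using Dpos by simp
    qed
    have grP: "gr \<nu> x" if x: "x \<in> P" for x
    proof (cases "x = 0")
      case True
      then show ?thesis using gr_scale[OF gr_0[OF span_zero], of 0] SP_gr[OF subspace_0[OF subspace_SP]] by simp
    next
      case False
      then obtain q where "q \<in> R" "gr q x" using rate x by blast
      then show ?thesis using gr_mono \<nu>min by blast
    qed
    obtain x s t where x: "x \<in> P" "\<not> null \<nu> x" and st: "0 < t" "\<nu> = of_int s / of_nat t"
      using \<nu>R unfolding R_def by blast
    have "gr (of_int s / of_nat t) y" if "y \<in> P" for y using grP[OF that] st(2) by simp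
    from fitting[OF less.prems st(1) this] obtain U where U0: "bd U \<and> U \<subseteq> P \<and> (F ^^ t) ` U = pe s U \<and>
      (\<forall>x\<in>P. \<exists>u\<in>span U. \<exists>z\<in>P. null (of_int s / of_nat t) z \<and> x = u + z)" by (rule exE)
    then have U: "bd U" "(F ^^ t) ` U = pe s U" by simp_all
    have dec: "\<And>x. x \<in> P \<Longrightarrow> \<exists>u\<in>span U. \<exists>z\<in>P. null \<nu> z \<and> x = u + z"
      using U0 unfolding st(2) by simp
    have isoU: "iso \<nu> U" unfolding iso_def using U st by blast
    define Z where "Z = {z \<in> P. null \<nu> z}"
    have sZ: "subspace Z"
      using subspace_inter[OF less.prems(1) subspace_null[of \<nu>]] by (simp add: Z_def Int_def)
    have ZP: "Z \<subseteq> P" by (auto simp: Z_def)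
    \<comment> \<open>The vector \<open>x\<close> that realizes the least rate is not contracted, so
      it lies outside \<open>Z\<close>.\<close>
    have "dim Z < dim P"
    proof -
      obtain C where C: "C \<subseteq> Z" "independent C" "Z \<subseteq> span C" "card C = dim Z" using basis_exists[of Z] by metis
      obtain C' where C': "C' \<subseteq> P" "independent C'" "P \<subseteq> span C'" "card C' = dim P" using basis_exists[of P] by metis
      have fin: "finite C'" "finite C"
        using independent_span_bound[OF B_fin C'(2)] independent_span_bound[OF B_fin C(2)] C C' ZP less.prems(2) by blast+
      have "span C \<subseteq> Z" using C(1) sZ by (rule span_minimal)
      then have xC: "x \<notin> span C" using x by (auto simp: Z_def)
      then have "independent (insert x C)" using C(2) by (simp add: independent_insert)
      then have "card (insert x C) \<le> card C'"
        using independent_span_bound[OF fin(1)] C C' ZP x(1) by blast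
      moreover have "x \<notin> C" using xC span_base by blast
      ultimately show ?thesis using fin C(4) C'(4) by simp
    qed
    moreover have "F ` Z \<subseteq> Z" using less.prems(3) null_F by (auto simp: Z_def)
    ultimately have IH: "Z \<subseteq> span (\<Union>(range SP))"
      using less.hyps[of Z] sZ ZP less.prems(2) by blast
    have USP: "span U \<subseteq> span (\<Union>(range SP))" using iso_SP[OF isoU] span_superset[of "\<Union>(range SP)"] by blast
    show ?thesis
    proof
      fix y assume "y \<in> P"
      then obtain u z where "u \<in> span U" "z \<in> Z" "y = u + z" using dec unfolding Z_def by blast
      then show "y \<in> span (\<Union>(range SP))" using USP IH by (auto intro: span_add)
    qed
  qed
qed

lemma E_slopes: "E = span (\<Union>(range SP))"
proof
  show "E \<subseteq> span (\<Union>(range SP))" using F_E by (intro subspace_slopes subspace_E) auto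
  show "span (\<Union>(range SP)) \<subseteq> E" using SP_E by (intro span_minimal subspace_E) blast
qed

end

context frob_lattice
begin

subsection \<open>Counting slopes\<close>

text \<open>Common properties of the semilinear \<open>F^n\<close> and of multiplication by a power
  of \<open>p\<close>, so that the same length arguments serve \<open>X / F X\<close> and
  \<open>X / p X\<close>.\<close>

definition good :: "('b \<Rightarrow> 'b) \<Rightarrow> bool" where
  "good g \<longleftrightarrow> inj_on g E \<and> (\<forall>T. wsub T \<longrightarrow> wsub (g ` T)) \<and>
     (\<forall>T. wsub T \<longrightarrow> wsub {x \<in> E. g x \<in> T}) \<and> (\<forall>A C. g ` ssum A C = ssum (g ` A) (g ` C))"

lemma good_Fn: "good (F ^^ n)"
  unfolding good_def
proof (intro conjI allI impI)
  fix T assume T: "wsub T"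
  show "wsub {x \<in> E. (F ^^ n) x \<in> T}"
    unfolding wsub_def
    using wsub_0[OF T] wsub_add[OF T] wsub_scale[OF T]
    by (auto simp: Fn_add Fn_scale \<sigma>n_W intro: span_zero span_add span_scale)
qed (auto intro: Fn_inj_on wsub_Fn_image simp: Fn_ssum)

lemma good_p: "good (\<lambda>x. p powi e *s x)"
  unfolding good_def
proof (intro conjI allI impI)
  show "inj_on (\<lambda>x. p powi e *s x) E" by (rule inj_onI) (use p_nz in simp)
  fix T assume T: "wsub T"
  show "wsub ((\<lambda>x. p powi e *s x) ` T)" unfolding pe_image[symmetric] by (rule wsub_pe[OF T])
  have "{x \<in> E. p powi e *s x \<in> T} = E \<inter> pe (- e) T" by (auto simp: pe_def)
  then show "wsub {x \<in> E. p powi e *s x \<in> T}" using wsub_Int[OF wsub_subspace[OF subspace_E] wsub_pe[OF T]] by simp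
qed (auto simp: pe_ssum pe_image[symmetric])

lemma good_len:
  assumes "good g" "Y \<subseteq> Z" "Z \<subseteq> E"
  shows "len (g ` Y) (g ` Z) = len Y Z" "fl (g ` Y) (g ` Z) = fl Y Z"
proof -
  have "wsub (inv_into E g ` T)" if "wsub T" "T \<subseteq> g ` E" for T
  proof -
    have "inv_into E g ` T = {x \<in> E. g x \<in> T}"
    proof (intro subset_antisym subsetI)
      fix x assume "x \<in> inv_into E g ` T"
      then show "x \<in> {x \<in> E. g x \<in> T}" using that(2) inv_into_into[of _ g E] f_inv_into_f[of _ g E] by auto
    next
      fix x assume "x \<in> {x \<in> E. g x \<in> T}"
      then show "x \<in> inv_into E g ` T"
        using inv_into_f_f[of g E x] assms(1) unfolding good_def by (metis (no_types, lifting) image_eqI mem_Collect_eq)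
    qed
    then show ?thesis using assms(1) that(1) by (simp add: good_def)
  qed
  then show "len (g ` Y) (g ` Z) = len Y Z" "fl (g ` Y) (g ` Z) = fl Y Z"
    using len_image[of g E Y Z] assms by (auto simp: good_def)
qed

text \<open>The length from \<open>g Y\<close> up to \<open>Z\<close> is computed through
  \<open>Y\<close> and through \<open>g Z\<close>; the contribution of \<open>Z / Y\<close> cancels
  because \<open>g\<close> preserves lengths. The colength of the image thus does not depend on the
  lattice.\<close>

lemma len_commensurable:
  assumes g: "good g" and w: "wsub Y" "wsub Z" and sub: "Y \<subseteq> Z" "Z \<subseteq> E" "g ` Y \<subseteq> Y" "g ` Z \<subseteq> Z"
    and f: "fl Y Z" "fl (g ` Y) Y" "fl (g ` Z) Z"
  shows "len (g ` Y) Y = len (g ` Z) Z"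
proof -
  have wg: "wsub (g ` Y)" "wsub (g ` Z)" using g w by (auto simp: good_def)
  have 1: "len (g ` Y) Z = len (g ` Y) Y + len Y Z" by (rule len_add(2)[OF wg(1) w sub(3,1) f(2,1)])
  have "g ` Y \<subseteq> g ` Z" using sub by auto
  then have "len (g ` Y) Z = len (g ` Y) (g ` Z) + len (g ` Z) Z"
    using good_len[OF g sub(1,2)] f by (intro len_add(2)[OF wg w(2) _ sub(4)]) auto
  then show ?thesis using 1 good_len(1)[OF g sub(1,2)] by simp
qed

lemma len_pe:
  assumes "bd Z"
  shows "fl (pe (int k) Z) Z \<and> len (pe (int k) Z) Z = k * len (pe 1 Z) Z"
proof (induction k)
  case 0
  have w: "wsub Z" using bd_wsub[OF assms] .
  have "n \<le> 0" if "chain Z Z n" for n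
    using that by (cases rule: chain.cases) (use chain_wsub in auto)
  then show ?case using len_eqI[OF chain_0[OF w]] by auto
next
  case (Suc k)
  have w: "wsub Z" using bd_wsub[OF assms] .
  have sub: "pe 1 Z \<subseteq> Z" "pe (int (Suc k)) Z \<subseteq> pe (int k) Z" "pe (int k) Z \<subseteq> Z"
    using pe_antimono[OF w, of 0 1] pe_antimono[OF w, of "int k" "int (Suc k)"] pe_antimono[OF w, of 0 "int k"] by auto
  have fl1: "fl (pe 1 Z) Z" using bd_basis[OF assms] by metis
  have *: "len (pe (int (Suc k)) Z) (pe (int k) Z) = len (pe 1 Z) Z"
    "fl (pe (int (Suc k)) Z) (pe (int k) Z)"
    using good_len[OF good_p sub(1) bd_E[OF assms], of "int k"] fl1
    unfolding pe_image[symmetric] pe_pe by (simp_all add: add.commute)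
  show ?case using len_add[OF wsub_pe[OF w] wsub_pe[OF w] w sub(2,3) *(2)] Suc * by simp
qed

lemma fl_pe_between:
  assumes "bd Z" "wsub Y" "Y \<subseteq> Z" "pe (int k) Z \<subseteq> Y"
  shows "fl Y Z"
  using fl_interval[OF conjunct1[OF len_pe[OF assms(1), of k]]] assms wsub_pe bd_wsub by blast

lemma len_Fn:
  assumes "bd Z" "F ` Z \<subseteq> Z" "fl (F ` Z) Z"
  shows "fl ((F ^^ n) ` Z) Z \<and> len ((F ^^ n) ` Z) Z = n * len (F ` Z) Z \<and> (F ^^ n) ` Z \<subseteq> Z"
proof (induction n)
  case 0
  then show ?case using len_pe[OF assms(1), of 0] by simp
next
  case (Suc n)
  have w: "wsub Z" using bd_wsub[OF assms(1)] .
  have eq: "(F ^^ Suc n) ` Z = (F ^^ n) ` (F ` Z)" by (simp add: image_image funpow_swap1)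
  have sub: "(F ^^ n) ` (F ` Z) \<subseteq> (F ^^ n) ` Z" using assms(2) by (rule image_mono)
  have wF: "wsub (F ` Z)" using wsub_Fn_image[OF w, of 1] by simp
  have *: "len ((F ^^ n) ` (F ` Z)) ((F ^^ n) ` Z) = len (F ` Z) Z" "fl ((F ^^ n) ` (F ` Z)) ((F ^^ n) ` Z)"
    using good_len[OF good_Fn assms(2) bd_E[OF assms(1)], of n] assms(3) by auto
  show ?case unfolding eq
    using len_add[OF wsub_Fn_image[OF wF, of n] wsub_Fn_image[OF w, of n] w sub _ *(2)] Suc * sub by auto
qed

definition XS :: "rat \<Rightarrow> 'b set" where "XS q = X \<inter> SP q"

lemma bd_XS: "bd (XS q)"
  unfolding XS_def by (rule bd_subset[OF bd_X]) (auto intro: wsub_Int X_wsub wsub_subspace subspace_SP)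

lemma span_XS: "span (XS q) = SP q"
proof
  show "span (XS q) \<subseteq> SP q" by (rule span_minimal) (auto simp: XS_def subspace_SP)
  show "SP q \<subseteq> span (XS q)"
  proof
    fix x assume x: "x \<in> SP q"
    then obtain e where "x \<in> pe e X" using E_pe SP_E by blast
    then have "p powi (- e) *s x \<in> XS q" using subspace_scale[OF subspace_SP x] by (simp add: XS_def pe_def)
    then have "x \<in> pe e (XS q)" by (simp add: pe_def)
    then show "x \<in> span (XS q)" using span_wsub[OF bd_wsub[OF bd_XS]] by blast
  qed
qed

lemma F_XS: "F ` XS q \<subseteq> XS q"
  by (auto simp: XS_def F_X SP_F)

lemma pe_XS: "pe 1 (XS q) \<subseteq> F ` XS q"
proof
  fix x assume x: "x \<in> pe 1 (XS q)"
  then have "x \<in> pe 1 X" by (simp add: XS_def pe_def)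
  then obtain y where y: "y \<in> X" "x = F y" using pX_FX by blast
  have "pe 1 (XS q) \<subseteq> span (XS q)" by (rule pe_span[OF span_superset])
  then have "x \<in> SP q" using x unfolding span_XS by blast
  moreover have "F ` SP q = SP q" by (rule subspace_F_image[OF subspace_SP SP_E]) (use SP_F in blast)
  ultimately have "x \<in> F ` SP q" by simp
  then obtain y' where y': "y' \<in> SP q" "x = F y'" by (rule imageE)
  have "(F ^^ 1) y = (F ^^ 1) y'" using y y' by simp
  then have "y = y'" by (rule inj_onD[OF Fn_inj_on]) (use y y' X_E SP_E in blast)+
  then show "x \<in> F ` XS q" using y y' by (auto simp: XS_def)
qed

lemma fl_F_XS: "fl (F ` XS q) (XS q)"
  using fl_pe_between[of "XS q" "F ` XS q" 1] bd_XS F_XS pe_XS wsub_Fn_image[OF bd_wsub[OF bd_XS[of q]], of 1] by simp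

lemma len_pe_XS: "len (pe 1 (XS q)) (XS q) = dim (SP q)"
  using bd_basis[OF bd_XS[of q]] unfolding span_XS by metis

text \<open>The colength of \<open>F\<close> is compared on \<open>X \<inter> SP q\<close> and on an
  isoclinic lattice \<open>U\<close> inside it, where \<open>F^t U = p^s U\<close>: \<open>t\<close>
  times the unknown length equals \<open>s\<close> times the dimension.\<close>

lemma len_F_XS:
  assumes "0 \<le> q"
  shows "(of_nat (len (F ` XS q) (XS q)) :: rat) = q * of_nat (dim (SP q))"
proof -
  obtain U0 where U0: "iso q U0" "SP q = span U0" using SP_eq_span by blast
  then obtain s t where st: "0 < t" "q = of_int s / of_nat t" "(F ^^ t) ` U0 = pe s U0" by (auto simp: iso_def)
  obtain c where c: "U0 \<subseteq> pe c X" using U0(1) by (auto simp: iso_def bd_def)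
  define U where "U = pe (- c) U0"
  have bdU: "bd U" unfolding U_def by (rule bd_pe[OF iso_bd[OF U0(1)]])
  have wU: "wsub U" by (rule bd_wsub[OF bdU])
  have FU: "(F ^^ t) ` U = pe s U" unfolding U_def pe_Fn_image[symmetric] st(3) by (simp add: add.commute)
  have "U \<subseteq> X" unfolding U_def using pe_mono[OF c, of "- c"] by simp
  moreover have "U \<subseteq> SP q" unfolding U_def U0(2) by (rule pe_span[OF span_superset])
  ultimately have UX: "U \<subseteq> XS q" by (simp add: XS_def)
  have "U0 = pe c U" by (simp add: U_def)
  then have spU: "span U = SP q" unfolding U0(2)
    using span_minimal[of U "span U0"] span_minimal[of U0 "span U"] pe_span[of U U c] span_superset[of U]
      pe_span[of U0 U0 "- c"] span_superset[of U0] unfolding U_def[symmetric] by auto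
  have s: "0 \<le> s"
  proof -
    have "0 \<le> (of_int s :: rat)" using assms st by (simp add: zero_le_divide_iff)
    then show ?thesis by (simp only: of_int_0_le_iff)
  qed
  obtain m where "XS q \<subseteq> pe (- int m) U"
    using bd_commensurable[OF bd_XS _ wU, of q] spU by (auto simp: XS_def)
  then have "pe (int m) (XS q) \<subseteq> U" using pe_mono[of "XS q" "pe (- int m) U" "int m"] by simp
  then have fl1: "fl U (XS q)" by (rule fl_pe_between[OF bd_XS wU UX])
  have FtU: "(F ^^ t) ` U \<subseteq> U" "fl ((F ^^ t) ` U) U"
    using pe_antimono[OF wU s] len_pe[OF bdU, of "nat s"] s unfolding FU by auto
  have n: "fl ((F ^^ t) ` XS q) (XS q)" "len ((F ^^ t) ` XS q) (XS q) = t * len (F ` XS q) (XS q)"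
    "(F ^^ t) ` XS q \<subseteq> XS q"
    using len_Fn[OF bd_XS F_XS fl_F_XS, of t q] by auto
  have "len ((F ^^ t) ` U) U = len ((F ^^ t) ` XS q) (XS q)"
    by (rule len_commensurable[OF good_Fn wU bd_wsub[OF bd_XS] UX bd_E[OF bd_XS] FtU(1) n(3) fl1 FtU(2) n(1)])
  moreover have "len ((F ^^ t) ` U) U = nat s * len (pe 1 U) U"
    unfolding FU using len_pe[OF bdU, of "nat s"] s by simp
  moreover have "len (pe 1 U) U = dim (SP q)" using bd_basis[OF bdU] unfolding spU by metis
  ultimately have "t * len (F ` XS q) (XS q) = nat s * dim (SP q)" using n by simp
  then have "(of_nat (t * len (F ` XS q) (XS q)) :: rat) = of_nat (nat s * dim (SP q))" by simp
  then have "of_nat t * (of_nat (len (F ` XS q) (XS q)) :: rat) = of_int s * of_nat (dim (SP q))"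
    using s by simp
  then have "(of_nat (len (F ` XS q) (XS q)) :: rat) = of_int s / of_nat t * of_nat (dim (SP q))"
    using st(1) by (simp add: field_simps)
  then show ?thesis by (simp only: st(2)[symmetric])
qed

text \<open>The middle term \<open>A + g C\<close> splits the length into two steps, each identified
  by the second isomorphism law.\<close>

lemma len_direct_sum:
  assumes g: "good g" and w: "wsub A" "wsub C" and dis: "A \<inter> C = {0}"
    and sub: "g ` A \<subseteq> A" "g ` C \<subseteq> C" and f: "fl (g ` A) A" "fl (g ` C) C"
  shows "fl (g ` ssum A C) (ssum A C) \<and> len (g ` ssum A C) (ssum A C) = len (g ` A) A + len (g ` C) C"
proof -
  have wg: "wsub (g ` A)" "wsub (g ` C)" using g w by (auto simp: good_def)
  let ?B = "ssum (g ` A) (g ` C)" and ?M = "ssum A (g ` C)"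
  have eq: "g ` ssum A C = ?B" using g by (simp add: good_def)
  have wB: "wsub ?B" "wsub ?M" "wsub (ssum A C)" using wsub_ssum wg w by auto
  have BM: "?B \<subseteq> ?M" "?M \<subseteq> ssum A C" by (rule ssum_mono[OF sub(1) order_refl], rule ssum_mono[OF order_refl sub(2)])
  have z: "x \<in> g ` A" if "x \<in> A" "x \<in> ?B" for x
  proof -
    obtain a c where ac: "a \<in> g ` A" "c \<in> g ` C" "x = a + c" using \<open>x \<in> ?B\<close> by (auto simp: ssum_def)
    then have "c \<in> A \<inter> C" using wsub_diff[OF w(1), of x a] that sub by auto
    then show ?thesis using ac dis by auto
  qed
  have "A \<inter> ?B = g ` A" using z sub ssum_upper1[OF wg(2), of "g ` A"] by blast
  moreover have "ssum A ?B = ?M"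
    using ssum_least[OF ssum_upper1[OF wg(2), of A] BM(1) wB(2)]
      ssum_mono[OF order_refl ssum_upper2[OF wg(1), of "g ` C"], of A] by blast
  ultimately have 1: "len ?B ?M = len (g ` A) A" "fl ?B ?M"
    using len_second_iso[OF w(1) wB(1)] f by auto
  have z': "x \<in> g ` C" if "x \<in> C" "x \<in> ?M" for x
  proof -
    obtain a c where ac: "a \<in> A" "c \<in> g ` C" "x = a + c" using \<open>x \<in> ?M\<close> by (auto simp: ssum_def)
    then have "a \<in> A \<inter> C" using wsub_diff[OF w(2), of x c] that sub by auto
    then show ?thesis using ac dis by auto
  qed
  have "C \<inter> ?M = g ` C" using z' sub ssum_upper2[OF w(1), of "g ` C"] by blast
  moreover have "ssum C ?M = ssum A C"
  proof
    show "ssum C ?M \<subseteq> ssum A C" by (rule ssum_least[OF ssum_upper2[OF w(1)] BM(2) wB(3)])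
    show "ssum A C \<subseteq> ssum C ?M"
      using ssum_upper1[OF wB(2), of C] ssum_upper2[OF w(2), of ?M] ssum_upper1[OF wg(2), of A] wsub_ssum[OF w(2) wB(2)]
      by (intro ssum_least) auto
  qed
  ultimately have 2: "len ?M (ssum A C) = len (g ` C) C" "fl ?M (ssum A C)"
    using len_second_iso[OF w(2) wB(2)] f by auto
  show ?thesis unfolding eq using len_add[OF wB(1-3) BM 1(2) 2(2)] 1 2 by simp
qed

text \<open>The sum of the slope parts of \<open>X\<close>; possibly a proper submodule, but over
  all slopes of finite colength, so it may replace \<open>X\<close> in length computations.\<close>

definition YR :: "rat set \<Rightarrow> 'b set" where
  "YR R = {(\<Sum>q\<in>R. x q) | x. \<forall>q\<in>R. x q \<in> XS q}"

lemma YR_insert: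
  assumes "finite R" "q \<notin> R"
  shows "YR (insert q R) = ssum (XS q) (YR R)" "XS q \<inter> YR R = {0}"
proof -
  show "YR (insert q R) = ssum (XS q) (YR R)"
  proof (intro subset_antisym subsetI)
    fix y assume "y \<in> YR (insert q R)"
    then obtain x where "y = (\<Sum>q\<in>insert q R. x q)" "\<forall>q\<in>insert q R. x q \<in> XS q" by (auto simp: YR_def)
    then show "y \<in> ssum (XS q) (YR R)" using assms by (auto simp: YR_def intro!: ssumI)
  next
    fix y assume "y \<in> ssum (XS q) (YR R)"
    then obtain a x where ax: "y = a + (\<Sum>q\<in>R. x q)" "a \<in> XS q" "\<forall>q\<in>R. x q \<in> XS q" by (auto simp: YR_def ssum_def)
    have "(\<Sum>r\<in>R. (x(q := a)) r) = (\<Sum>r\<in>R. x r)" using assms by (intro sum.cong) auto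
    then have "y = (\<Sum>r\<in>insert q R. (x(q := a)) r)" using assms ax by simp
    then show "y \<in> YR (insert q R)" unfolding YR_def using ax by (intro CollectI exI[of _ "x(q := a)"]) auto
  qed
  have "y = 0" if y: "y \<in> XS q" "y \<in> YR R" for y
  proof -
    obtain x where x: "y = (\<Sum>q\<in>R. x q)" "\<forall>q\<in>R. x q \<in> XS q" using y by (auto simp: YR_def)
    have s: "(\<Sum>r\<in>R. (x(q := - y)) r) = y" unfolding x(1) using assms by (intro sum.cong) auto
    have "(x(q := - y)) q = 0"
    proof (rule SP_independent[of "insert q R" "x(q := - y)" q])
      show "(\<Sum>r\<in>insert q R. (x(q := - y)) r) = 0" using assms s by simp
    qed (use assms x y subspace_neg[OF subspace_SP] in \<open>auto simp: XS_def\<close>)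
    then show ?thesis by simp
  qed
  moreover have "0 \<in> XS q" "0 \<in> YR R"
    using wsub_0[OF bd_wsub[OF bd_XS]] by (auto simp: YR_def intro!: exI[of _ "\<lambda>_. 0"])
  ultimately show "XS q \<inter> YR R = {0}" by blast
qed

lemma len_YR:
  assumes g: "good g" and gX: "\<And>q. g ` XS q \<subseteq> XS q" "\<And>q. fl (g ` XS q) (XS q)" and "finite R"
  shows "wsub (YR R) \<and> YR R \<subseteq> X \<and> g ` YR R \<subseteq> YR R \<and> fl (g ` YR R) (YR R) \<and>
    len (g ` YR R) (YR R) = (\<Sum>q\<in>R. len (g ` XS q) (XS q))"
  using \<open>finite R\<close>
proof (induction R rule: finite_induct)
  case empty
  have w: "wsub {0}" using wsub_wspan[of "{}"] by simp
  have "g ` {0} = {0}"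
  proof -
    have "ssum {0} {0} = {0 :: 'b}" by (auto simp: ssum_def)
    moreover have "ssum {g 0} {g 0} = {g 0 + g 0}" by (auto simp: ssum_def)
    moreover have "g ` ssum {0} {0} = ssum (g ` {0}) (g ` {0})" using g unfolding good_def by blast
    ultimately have "g 0 + 0 = g 0 + g 0" by simp
    then show ?thesis by (simp only: add_left_cancel) simp
  qed
  moreover have "n \<le> 0" if "chain {0} {0} n" for n
    using that by (cases rule: chain.cases) (use chain_wsub in auto)
  moreover have "YR {} = {0}" by (auto simp: YR_def)
  ultimately show ?case using len_eqI[OF chain_0[OF w]] w wsub_0[OF X_wsub] by auto
next
  case (insert q R)
  note Y = YR_insert[OF insert.hyps(1,2)]
  have "fl (g ` YR (insert q R)) (YR (insert q R)) \<and>
    len (g ` YR (insert q R)) (YR (insert q R)) = len (g ` XS q) (XS q) + len (g ` YR R) (YR R)"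
    unfolding Y(1) using insert.IH by (intro len_direct_sum g bd_wsub[OF bd_XS] gX Y(2)) auto
  moreover have "wsub (YR (insert q R))" unfolding Y(1) using insert.IH by (intro wsub_ssum bd_wsub[OF bd_XS]) auto
  moreover have "YR (insert q R) \<subseteq> X" unfolding Y(1) using insert.IH by (intro ssum_least X_wsub) (auto simp: XS_def)
  moreover have "g ` YR (insert q R) \<subseteq> YR (insert q R)"
  proof -
    have "g ` YR (insert q R) = ssum (g ` XS q) (g ` YR R)" unfolding Y(1) using g by (simp add: good_def)
    then show ?thesis unfolding Y(1) using insert.IH gX by (auto intro: ssum_mono[THEN subsetD])
  qed
  ultimately show ?case using insert by simp
qed

definition slope_set :: "rat set" where "slope_set = {q. SP q \<noteq> {0}}"

lemma len_X:
  assumes g: "good g" and gX: "\<And>q. g ` XS q \<subseteq> XS q" "\<And>q. fl (g ` XS q) (XS q)" "g ` X \<subseteq> X" "fl (g ` X) X"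
  shows "len (g ` X) X = (\<Sum>q\<in>slope_set. len (g ` XS q) (XS q))"
proof -
  have fin: "finite slope_set" unfolding slope_set_def by (rule finite_slopes)
  let ?Y = "YR slope_set"
  have Y: "wsub ?Y" "?Y \<subseteq> X" "g ` ?Y \<subseteq> ?Y" "fl (g ` ?Y) ?Y" "len (g ` ?Y) ?Y = (\<Sum>q\<in>slope_set. len (g ` XS q) (XS q))"
    using len_YR[OF g gX(1,2) fin] by auto
  have "SP q \<subseteq> span ?Y" for q
  proof (cases "q \<in> slope_set")
    case True
    have "XS q \<subseteq> ?Y"
    proof
      fix x assume x: "x \<in> XS q"
      have "(\<Sum>r\<in>slope_set. if r = q then x else 0) = x" using True fin by simp
      moreover have "\<forall>r\<in>slope_set. (if r = q then x else 0) \<in> XS r"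
        using x wsub_0[OF bd_wsub[OF bd_XS]] by auto
      ultimately show "x \<in> ?Y" unfolding YR_def by (intro CollectI exI[of _ "\<lambda>r. if r = q then x else 0"]) simp
    qed
    then show ?thesis using span_mono span_XS by blast
  next
    case False
    then show ?thesis using span_zero by (auto simp: slope_set_def)
  qed
  then have "\<Union>(range SP) \<subseteq> span ?Y" by blast
  then have "E \<subseteq> span ?Y" unfolding E_slopes by (intro span_minimal subspace_span)
  then have "X \<subseteq> span ?Y" using X_E by blast
  then obtain m where "X \<subseteq> pe (- int m) ?Y" using bd_commensurable[OF bd_X _ Y(1)] by blast
  then have "pe (int m) X \<subseteq> ?Y" using pe_mono[of X "pe (- int m) ?Y" "int m"] by simp
  then have "fl ?Y X" by (rule fl_pe_between[OF bd_X Y(1,2)])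
  then have "len (g ` ?Y) ?Y = len (g ` X) X"
    by (intro len_commensurable g Y X_wsub X_E gX)
  then show ?thesis using Y by simp
qed

text \<open>The number of slopes is the length of \<open>X / pX\<close>, split at
  \<open>F X\<close>; their sum is the length of \<open>X / F X\<close>. Both are expressed by
  \<open>mingens\<close>, the form in which the residue field dimensions will appear.\<close>

theorem slope_count:
  shows "finite slope_set" and "\<And>q. q \<in> slope_set \<Longrightarrow> 0 \<le> q \<and> q < 1"
    and "(\<Sum>q\<in>slope_set. dim (SP q)) = mingens (F ` X) X + mingens (pe 1 X) (F ` X)"
    and "(\<Sum>q\<in>slope_set. q * of_nat (dim (SP q))) = of_nat (mingens (F ` X) X)"
proof -
  show "finite slope_set" unfolding slope_set_def by (rule finite_slopes)
  show range: "0 \<le> q \<and> q < 1" if "q \<in> slope_set" for q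
    using that SP_neg[of q] SP_ge_1[of q] unfolding slope_set_def by (auto simp: not_less[symmetric])
  have FX: "F ` X \<subseteq> X" "pe 1 X \<subseteq> F ` X" using F_X pX_FX by auto
  have wF: "wsub (F ` X)" using wsub_Fn_image[OF X_wsub, of 1] by simp
  have flF: "fl (F ` X) X" using fl_pe_between[OF bd_X wF FX(1), of 1] FX(2) by simp
  have "len ((F ^^ 1) ` X) X = (\<Sum>q\<in>slope_set. len ((F ^^ 1) ` XS q) (XS q))"
    using FX flF F_XS fl_F_XS by (intro len_X good_Fn) simp_all
  then have lenF: "len (F ` X) X = (\<Sum>q\<in>slope_set. len (F ` XS q) (XS q))" by simp
  have pX: "pe 1 X \<subseteq> X" "pe 1 (XS q) \<subseteq> XS q" for q
    using pe_antimono[OF X_wsub, of 0 1] pe_antimono[OF bd_wsub[OF bd_XS], of 0 1 q] by auto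
  have flp: "fl (pe 1 X) X" "fl (pe 1 (XS q)) (XS q)" for q
    using len_pe[OF bd_X, of 1] len_pe[OF bd_XS, of 1 q] by auto
  have "len (pe 1 X) X = (\<Sum>q\<in>slope_set. len (pe 1 (XS q)) (XS q))"
    using len_X[OF good_p[of 1]] pX flp unfolding pe_image[symmetric] by simp
  then have lenp: "len (pe 1 X) X = (\<Sum>q\<in>slope_set. dim (SP q))" by (simp add: len_pe_XS)
  obtain A where A: "finite A" "X = wspan A" using bd_basis[OF bd_X] by metis
  have "ssum (wspan A) (F ` X) = X"
    using ssum_least[OF order_refl FX(1) X_wsub] ssum_upper1[OF wF, of X] unfolding A(2)[symmetric] by auto
  then have g1: "len (F ` X) X = mingens (F ` X) X"
    using A wspan_superset[of A] by (intro len_mingens(2)[OF wF FX(2), of A]) auto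
  have bF: "bd (F ` X)" by (rule bd_subset[OF bd_X wF FX(1)])
  obtain C where C: "finite C" "F ` X = wspan C" using bd_basis[OF bF] by metis
  have wp: "wsub (pe 1 X)" by (rule wsub_pe[OF X_wsub])
  have "ssum (wspan C) (pe 1 X) = F ` X"
    using ssum_least[OF order_refl FX(2) wF] ssum_upper1[OF wp, of "F ` X"] unfolding C(2)[symmetric] by auto
  moreover have "pe 1 (F ` X) \<subseteq> pe 1 X" using FX(1) by (rule pe_mono)
  ultimately have g2: "len (pe 1 X) (F ` X) = mingens (pe 1 X) (F ` X)" and fl2: "fl (pe 1 X) (F ` X)"
    using C wspan_superset[of C] len_mingens[OF wp, of "F ` X" C] by auto
  have "len (pe 1 X) X = len (pe 1 X) (F ` X) + len (F ` X) X"
    by (rule len_add(2)[OF wp wF X_wsub FX(2,1) fl2 flF])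
  then show "(\<Sum>q\<in>slope_set. dim (SP q)) = mingens (F ` X) X + mingens (pe 1 X) (F ` X)"
    using lenp g1 g2 by simp
  have "(\<Sum>q\<in>slope_set. q * of_nat (dim (SP q))) = (\<Sum>q\<in>slope_set. of_nat (len (F ` XS q) (XS q)))"
    by (rule sum.cong) (use len_F_XS range in auto)
  also have "\<dots> = of_nat (mingens (F ` X) X)" using lenF g1 by simp
  finally show "(\<Sum>q\<in>slope_set. q * of_nat (dim (SP q))) = of_nat (mingens (F ` X) X)" .
qed

end

section \<open>Dieudonne modules of finite rank\<close>

definition wemb :: "('k::field_prime_char) witt \<Rightarrow> 'k wt fract" where "wemb a = wi (Wt a)"

lemma Wt_wcoeff [simp]: "Wt (wcoeff x) = x"
  by (simp add: wcoeff_inverse)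

lemma carrier_witt_ring [simp]: "carrier witt_ring = UNIV"
  by (simp add: witt_ring_def)

lemma Wt_add: "Wt (a \<oplus>\<^bsub>witt_ring\<^esub> b) = Wt a + Wt b"
  and Wt_mult: "Wt (a \<otimes>\<^bsub>witt_ring\<^esub> b) = Wt a * Wt b"
  and Wt_zero: "Wt \<zero>\<^bsub>witt_ring\<^esub> = 0" and Wt_one: "Wt \<one>\<^bsub>witt_ring\<^esub> = 1"
  by (auto simp: witt_ring_def plus_wt_def times_wt_def zero_wt_def one_wt_def wadd_def wmult_def intro!: arg_cong[of _ _ Wt])

lemma wcoeff_add: "wcoeff (x + y) = wcoeff x \<oplus>\<^bsub>witt_ring\<^esub> wcoeff y"
  and wcoeff_mult: "wcoeff (x * y) = wcoeff x \<otimes>\<^bsub>witt_ring\<^esub> wcoeff y"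
  and wcoeff_zero: "wcoeff 0 = \<zero>\<^bsub>witt_ring\<^esub>" and wcoeff_one: "wcoeff 1 = \<one>\<^bsub>witt_ring\<^esub>"
  using Wt_add[of "wcoeff x" "wcoeff y"] Wt_mult[of "wcoeff x" "wcoeff y"] Wt_zero Wt_one
  by (metis wcoeff_Wt Wt_wcoeff)+

lemma wemb_simps:
  "wemb (a \<oplus>\<^bsub>witt_ring\<^esub> b) = wemb a + wemb b" "wemb (a \<otimes>\<^bsub>witt_ring\<^esub> b) = wemb a * wemb b"
  "wemb \<zero>\<^bsub>witt_ring\<^esub> = 0" "wemb \<one>\<^bsub>witt_ring\<^esub> = 1" "wemb (wcoeff (of_nat n)) = of_nat n"
  by (simp_all add: wemb_def Wt_add Wt_mult Wt_zero Wt_one wi_simps Wt_wcoeff)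

lemma wemb_inject [simp]: "wemb a = wemb b \<longleftrightarrow> a = b"
  by (simp add: wemb_def) (metis wcoeff_Wt)

lemma wemb_0_iff [simp]: "wemb a = 0 \<longleftrightarrow> a = \<zero>\<^bsub>witt_ring\<^esub>"
  using wemb_inject[of a "\<zero>\<^bsub>witt_ring\<^esub>"] by (simp only: wemb_simps)

lemma wemb_frob: "wemb (witt_frob a) = w\<sigma> (wemb a)"
  by (simp add: wemb_def w\<sigma>_wi wF_def witt_frob_def wcoeff_Wt)

lemma range_wemb: "range wemb = range wi"
  unfolding wemb_def by (auto intro!: image_eqI[where x = "wcoeff _"] simp: Wt_wcoeff)

lemma (in Module.module) submodule_neg:
  assumes "LinearCombinations.submodule R D M" "x \<in> D"
  shows "\<ominus>\<^bsub>M\<^esub> x \<in> D"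
proof -
  interpret D: LinearCombinations.submodule R D M by fact
  have x: "x \<in> carrier M" using assms D.subset by auto
  have "\<ominus>\<^bsub>M\<^esub> x = (\<ominus>\<^bsub>R\<^esub> \<one>\<^bsub>R\<^esub>) \<odot>\<^bsub>M\<^esub> x" using x by (simp add: smult_l_minus)
  moreover have "(\<ominus>\<^bsub>R\<^esub> \<one>\<^bsub>R\<^esub>) \<odot>\<^bsub>M\<^esub> x \<in> D" using assms(2) by (intro D.smult_closed) auto
  ultimately show ?thesis by simp
qed

locale perfect_dieudonne = dieudonne_module N
  for N :: "(('k::field_prime_char) witt, 'm) fv_module" (structure) +
  assumes perfect: "surj (\<lambda>x::'k. x ^ CHAR('k))"
begin

lemma nat_smult: "x \<in> carrier N \<Longrightarrow> [(n::nat)] \<cdot> x = wcoeff (of_nat n) \<odot> x"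
proof (induction n)
  case 0
  then show ?case by (simp add: wcoeff_zero)
next
  case (Suc n)
  then show ?case by (simp add: wcoeff_add wcoeff_one smult_l_distr M.add.nat_pow_Suc add.commute[of _ "1 :: nat"] M.a_comm)
qed

lemma nat_smult_smult: "x \<in> carrier N \<Longrightarrow> [(n::nat)] \<cdot> (a \<odot> x) = a \<odot> ([n] \<cdot> x)"
  by (simp add: nat_smult smult_assoc1[symmetric] R.m_comm)

lemma nat_pow_add: "x \<in> carrier N \<Longrightarrow> y \<in> carrier N \<Longrightarrow> [(n::nat)] \<cdot> (x \<oplus> y) = [n] \<cdot> x \<oplus> [n] \<cdot> y"
  by (simp add: nat_smult smult_r_distr)

lemma p_pow_pow: "x \<in> carrier N \<Longrightarrow> [(q ^ e)] \<cdot> ([(q ^ f)] \<cdot> x) = [((q::nat) ^ (e + f))] \<cdot> x"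
  by (simp add: M.add.nat_pow_pow power_add mult.commute)

lemma Frob_closed [simp]: "x \<in> carrier N \<Longrightarrow> Frob N x \<in> carrier N"
  and Ver_closed [simp]: "x \<in> carrier N \<Longrightarrow> Ver N x \<in> carrier N"
  and Frob_add: "x \<in> carrier N \<Longrightarrow> y \<in> carrier N \<Longrightarrow> Frob N (x \<oplus> y) = Frob N x \<oplus> Frob N y"
  and Ver_add: "x \<in> carrier N \<Longrightarrow> y \<in> carrier N \<Longrightarrow> Ver N (x \<oplus> y) = Ver N x \<oplus> Ver N y"
  using Frob_hom Ver_hom by (auto simp: hom_def)

lemma Frob_zero [simp]: "Frob N \<zero> = \<zero>" and Ver_zero [simp]: "Ver N \<zero> = \<zero>"
  using Frob_add[of \<zero> \<zero>] Ver_add[of \<zero> \<zero>] M.add.l_cancel_one'[of "Frob N \<zero>" "Frob N \<zero>"]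
    M.add.l_cancel_one'[of "Ver N \<zero>" "Ver N \<zero>"] by simp_all

lemma Frob_nat: "x \<in> carrier N \<Longrightarrow> Frob N ([(n::nat)] \<cdot> x) = [n] \<cdot> Frob N x"
  and Ver_nat: "x \<in> carrier N \<Longrightarrow> Ver N ([(n::nat)] \<cdot> x) = [n] \<cdot> Ver N x"
  by (induction n) (simp_all add: M.add.nat_pow_Suc Frob_add Ver_add)

lemma Ver_pow_closed [simp]: "x \<in> carrier N \<Longrightarrow> (Ver N ^^ n) x \<in> carrier N"
  by (induction n) simp_all

lemma Frob_pow_closed [simp]: "x \<in> carrier N \<Longrightarrow> (Frob N ^^ n) x \<in> carrier N"
  by (induction n) simp_all

lemma Frob_Ver_pow: "x \<in> carrier N \<Longrightarrow> (Frob N ^^ n) ((Ver N ^^ n) x) = [(CHAR('k) ^ n)] \<cdot> x"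
proof (induction n arbitrary: x)
  case (Suc n)
  have "(Frob N ^^ Suc n) ((Ver N ^^ Suc n) x) = Frob N ((Frob N ^^ n) ((Ver N ^^ n) (Ver N x)))"
    by (simp add: funpow_swap1)
  then show ?case using Suc by (simp add: Frob_nat Frob_Ver M.add.nat_pow_pow mult.commute)
qed simp

lemma p_smult_submodule:
  assumes "LinearCombinations.submodule witt_ring D N"
  shows "LinearCombinations.submodule witt_ring {y \<in> carrier N. [(n::nat)] \<cdot> y \<in> D} N"
proof -
  interpret D: LinearCombinations.submodule witt_ring D N by fact
  show ?thesis by unfold_locales (auto simp: nat_pow_add nat_smult_smult)
qed

text \<open>A nonzero Witt vector is a power of \<open>p\<close> times a unit, so torsion over
  \<open>W\<close> is \<open>p\<close>-power torsion.\<close>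

lemma torsion_iff:
  assumes "x \<in> carrier N"
  shows "x \<in> W_torsion N \<longleftrightarrow> (\<exists>e. [(CHAR('k) ^ e)] \<cdot> x = \<zero>)"
proof
  assume "x \<in> W_torsion N"
  then obtain a where a: "a \<noteq> \<zero>\<^bsub>witt_ring\<^esub>" "a \<odot> x = \<zero>" by (auto simp: W_torsion_def)
  have "Wt a \<noteq> 0" using a(1) wcoeff_zero wcoeff_Wt by metis
  then obtain n u v where nuv: "Wt a = of_nat CHAR('k) ^ n * u" "u * v = 1"
    using wt_factor[OF perfect] by blast
  have "Wt a * v = of_nat (CHAR('k) ^ n)" using nuv by (simp add: mult.assoc)
  then have "wcoeff (of_nat (CHAR('k) ^ n)) = wcoeff v \<otimes>\<^bsub>witt_ring\<^esub> a"
    by (metis wcoeff_mult wcoeff_Wt mult.commute)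
  then have "[(CHAR('k) ^ n)] \<cdot> x = wcoeff v \<odot> (a \<odot> x)" using assms by (simp add: nat_smult smult_assoc1)
  then show "\<exists>e. [(CHAR('k) ^ e)] \<cdot> x = \<zero>" using a by auto
next
  assume "\<exists>e. [(CHAR('k) ^ e)] \<cdot> x = \<zero>"
  then obtain e where e: "[(CHAR('k) ^ e)] \<cdot> x = \<zero>" by auto
  have "(of_nat (CHAR('k) ^ e) :: 'k wt) \<noteq> 0" using of_nat_CHAR_wt_nz[OF perfect] by simp
  then have "wcoeff (of_nat (CHAR('k) ^ e)) \<noteq> \<zero>\<^bsub>witt_ring :: 'k witt ring\<^esub>"
    using wcoeff_zero Wt_wcoeff by metis
  then show "x \<in> W_torsion N" using e assms by (auto simp: W_torsion_def nat_smult)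
qed

end

lemma ex_min_card:
  assumes "P S"
  obtains S where "P S" "\<And>T. P T \<Longrightarrow> card S \<le> card T"
  using ex_has_least_nat[of P S card] assms by blast

text \<open>Weaker than finite generation: only a multiple \<open>p^m N\<close> has to lie in a
  finitely generated submodule, which leaves room for bounded torsion of infinite length. In
  \<open>Ver_nil\<close> the factor \<open>p^e\<close> on both sides expresses equality modulo
  torsion.\<close>

locale finite_dieudonne = perfect_dieudonne N
  for N :: "(('k::field_prime_char) witt, 'm) fv_module" (structure) +
  assumes finite_rank: "\<exists>S m. finite S \<and> S \<subseteq> carrier N \<and> (\<forall>x\<in>carrier N. [(CHAR('k) ^ m)] \<cdot> x \<in> span S)"
    and Ver_nil: "x \<in> carrier N \<Longrightarrow> \<exists>n0. \<forall>n\<ge>n0. \<exists>y\<in>carrier N. \<exists>e.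
      [(CHAR('k) ^ e)] \<cdot> ((Ver N ^^ n) x) = [(CHAR('k) ^ e)] \<cdot> ([(CHAR('k) ^ c)] \<cdot> y)"
begin

section \<open>Coordinates modulo torsion\<close>

definition gens :: "'m set \<Rightarrow> bool" where
  "gens S \<longleftrightarrow> finite S \<and> S \<subseteq> carrier N \<and> (\<forall>x\<in>carrier N. \<exists>e. [(CHAR('k) ^ e)] \<cdot> x \<in> span S)"

text \<open>A generating set up to powers of \<open>p\<close> of least size; minimality makes it a
  basis of the isocrystal.\<close>

definition S0 :: "'m set" where "S0 = (SOME S. gens S \<and> (\<forall>T. gens T \<longrightarrow> card S \<le> card T))"

lemma S0: "gens S0" "gens T \<Longrightarrow> card S0 \<le> card T"
proof -
  obtain S where "gens S" using finite_rank unfolding gens_def by blast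
  then obtain S' where "gens S'" "\<And>T. gens T \<Longrightarrow> card S' \<le> card T" by (rule ex_min_card[of gens]) blast
  then have "\<exists>S. gens S \<and> (\<forall>T. gens T \<longrightarrow> card S \<le> card T)" by blast
  then have "gens S0 \<and> (\<forall>T. gens T \<longrightarrow> card S0 \<le> card T)" unfolding S0_def by (rule someI_ex)
  then show "gens S0" "gens T \<Longrightarrow> card S0 \<le> card T" by auto
qed

lemma S0_fin: "finite S0" and S0_sub: "S0 \<subseteq> carrier N" and S0_car: "s \<in> S0 \<Longrightarrow> s \<in> carrier N"
  and S0_gen: "x \<in> carrier N \<Longrightarrow> \<exists>e. [(CHAR('k) ^ e)] \<cdot> x \<in> span S0"
  using S0(1) by (auto simp: gens_def)

text \<open>If the coefficient of \<open>s\<close> were nonzero, some \<open>p^n s\<close> would be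
  a combination of the others, and \<open>s\<close> could be dropped from a generating set of least
  size.\<close>

lemma lincomb_S0_0:
  assumes "lincomb c S0 = \<zero>" "s \<in> S0"
  shows "c s = \<zero>\<^bsub>witt_ring\<^esub>"
proof (rule ccontr)
  assume "c s \<noteq> \<zero>\<^bsub>witt_ring\<^esub>"
  then have "Wt (c s) \<noteq> 0" using wcoeff_zero wcoeff_Wt by metis
  then obtain n u v where nuv: "Wt (c s) = of_nat CHAR('k) ^ n * u" "u * v = 1"
    using wt_factor[OF perfect] by blast
  have "Wt (c s) * v = of_nat (CHAR('k) ^ n)" using nuv by (simp add: mult.assoc)
  then have eq: "wcoeff (of_nat (CHAR('k) ^ n)) = wcoeff v \<otimes>\<^bsub>witt_ring\<^esub> c s"
    by (metis wcoeff_mult wcoeff_Wt mult.commute)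
  let ?T = "S0 - {s}"
  have T: "finite ?T" "?T \<subseteq> carrier N" "s \<in> carrier N" using S0_fin S0_sub assms by auto
  have sp: "LinearCombinations.submodule witt_ring (span ?T) N" using T by (intro span_is_submodule)
  have l: "lincomb c ?T \<in> span ?T" using T unfolding span_def by auto
  have lc: "lincomb c ?T \<in> carrier N" using T by (intro lincomb_closed) auto
  have "lincomb c S0 = lincomb c (insert s ?T)" using assms by (simp add: insert_absorb)
  also have "\<dots> = c s \<odot> s \<oplus> lincomb c ?T"
    unfolding lincomb_def using T by (subst M.finsum_insert) auto
  finally have "c s \<odot> s = \<ominus> lincomb c ?T" using assms T lc by (metis M.minus_equality UNIV_I carrier_witt_ring smult_closed)
  then have "c s \<odot> s \<in> span ?T" using submodule_neg[OF sp l] by simp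
  then have "wcoeff v \<odot> (c s \<odot> s) \<in> span ?T" using sp by (auto simp: LinearCombinations.submodule_def)
  then have s: "[(CHAR('k) ^ n)] \<cdot> s \<in> span ?T" using T by (simp only: nat_smult eq smult_assoc1 UNIV_I carrier_witt_ring)
  let ?D = "{y \<in> carrier N. [(CHAR('k) ^ n)] \<cdot> y \<in> span ?T}"
  have D: "LinearCombinations.submodule witt_ring ?D N" using sp by (rule p_smult_submodule)
  have "t \<in> ?D" if "t \<in> S0" for t
  proof (cases "t = s")
    case False
    then have "t \<in> span ?T" "t \<in> carrier N" using in_own_span[OF T(2)] that S0_sub by auto
    then show ?thesis using sp by (auto simp: LinearCombinations.submodule_def nat_smult)
  qed (use s T in auto)
  then have sub: "span S0 \<subseteq> ?D" using D by (intro span_is_subset) auto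
  have "gens ?T"
    unfolding gens_def
  proof (intro conjI T ballI)
    fix x assume x: "x \<in> carrier N"
    then obtain e where "[(CHAR('k) ^ e)] \<cdot> x \<in> span S0" using S0_gen by blast
    then have "[(CHAR('k) ^ (n + e))] \<cdot> x \<in> span ?T" using sub x p_pow_pow by auto
    then show "\<exists>e. [(CHAR('k) ^ e)] \<cdot> x \<in> span ?T" by blast
  qed
  then have "card S0 \<le> card ?T" by (rule S0(2))
  moreover have "card ?T < card S0" using S0_fin assms(2) by (rule card_Diff1_less)
  ultimately show False by simp
qed

lemma lincomb_S0_eq:
  assumes "lincomb c S0 = lincomb d S0" "s \<in> S0"
  shows "c s = d s"
proof -
  have "lincomb (\<lambda>v. c v \<ominus>\<^bsub>witt_ring\<^esub> d v) S0 = \<zero>"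
    using assms(1) S0_fin S0_sub lincomb_closed[OF S0_sub, of d] by (subst lincomb_diff) (auto simp: M.r_neg a_minus_def)
  then have "c s \<ominus>\<^bsub>witt_ring\<^esub> d s = \<zero>\<^bsub>witt_ring\<^esub>" using assms(2) by (rule lincomb_S0_0)
  then show ?thesis by simp
qed

text \<open>The image of \<open>x\<close> in the isocrystal, as a function on \<open>S0\<close>
  extended by 0. Some multiple \<open>p^e x\<close> has integral coordinates, which are divided by
  \<open>p^e\<close>; the choice does not matter by independence of \<open>S0\<close>.\<close>

definition coord :: "'m \<Rightarrow> 'm \<Rightarrow> 'k wt fract" where
  "coord x = (SOME f. \<exists>e c. [(CHAR('k) ^ e)] \<cdot> x = lincomb c S0 \<and>
     f = (\<lambda>s. if s \<in> S0 then wemb (c s) / of_nat CHAR('k) ^ e else 0))"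

lemma p_fract_nz: "(of_nat CHAR('k) :: 'k wt fract) \<noteq> 0"
proof -
  have "wi (of_nat CHAR('k) :: 'k wt) \<noteq> wi 0" using of_nat_CHAR_wt_nz[OF perfect] by (simp only: wi_inject) simp
  then show ?thesis by (simp add: wi_simps)
qed

lemma lincomb_nat: "[(n::nat)] \<cdot> lincomb c S0 = lincomb (\<lambda>s. wcoeff (of_nat n) \<otimes>\<^bsub>witt_ring\<^esub> c s) S0"
  using S0_sub by (subst lincomb_smult) (auto simp: nat_smult)

lemma coordI:
  assumes x: "x \<in> carrier N" and e: "[(CHAR('k) ^ e)] \<cdot> x = lincomb c S0"
  shows "coord x = (\<lambda>s. if s \<in> S0 then wemb (c s) / of_nat CHAR('k) ^ e else 0)"
  unfolding coord_def
proof (rule some_equality, intro exI conjI, rule e, rule refl)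
  fix g assume "\<exists>e c. [(CHAR('k) ^ e)] \<cdot> x = lincomb c S0 \<and> g = (\<lambda>s. if s \<in> S0 then wemb (c s) / of_nat CHAR('k) ^ e else 0)"
  then obtain f d where f: "[(CHAR('k) ^ f)] \<cdot> x = lincomb d S0"
    and g: "g = (\<lambda>s. if s \<in> S0 then wemb (d s) / of_nat CHAR('k) ^ f else 0)" by auto
  have "[(CHAR('k) ^ e)] \<cdot> ([(CHAR('k) ^ f)] \<cdot> x) = [(CHAR('k) ^ f)] \<cdot> ([(CHAR('k) ^ e)] \<cdot> x)"
    using x by (simp only: p_pow_pow add.commute)
  then have eq: "lincomb (\<lambda>s. wcoeff (of_nat (CHAR('k) ^ e)) \<otimes>\<^bsub>witt_ring\<^esub> d s) S0 =
      lincomb (\<lambda>s. wcoeff (of_nat (CHAR('k) ^ f)) \<otimes>\<^bsub>witt_ring\<^esub> c s) S0"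
    unfolding e f lincomb_nat .
  have "wemb (d s) / of_nat CHAR('k) ^ f = wemb (c s) / of_nat CHAR('k) ^ e" if "s \<in> S0" for s
  proof -
    have "wemb (wcoeff (of_nat (CHAR('k) ^ e)) \<otimes>\<^bsub>witt_ring\<^esub> d s) =
        wemb (wcoeff (of_nat (CHAR('k) ^ f)) \<otimes>\<^bsub>witt_ring\<^esub> c s)"
      using lincomb_S0_eq[OF eq that] by simp
    then have "of_nat CHAR('k) ^ e * wemb (d s) = of_nat CHAR('k) ^ f * wemb (c s)" unfolding wemb_simps by simp
    then show ?thesis using p_fract_nz by (simp add: field_simps)
  qed
  then show "g = (\<lambda>s. if s \<in> S0 then wemb (c s) / of_nat CHAR('k) ^ e else 0)" unfolding g by auto
qed

lemma coordE:
  assumes "x \<in> carrier N"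
  obtains e c where "[(CHAR('k) ^ e)] \<cdot> x = lincomb c S0"
    "coord x = (\<lambda>s. if s \<in> S0 then wemb (c s) / of_nat CHAR('k) ^ e else 0)"
proof -
  obtain e where "[(CHAR('k) ^ e)] \<cdot> x \<in> span S0" using S0_gen assms by blast
  then obtain c where "[(CHAR('k) ^ e)] \<cdot> x = lincomb c S0" using finite_in_span[OF S0_fin S0_sub] by metis
  then show ?thesis using that coordI[OF assms] by blast
qed

lemma coord_add:
  assumes "x \<in> carrier N" "y \<in> carrier N"
  shows "coord (x \<oplus> y) = coord x + coord y"
proof -
  obtain e c where c: "[(CHAR('k) ^ e)] \<cdot> x = lincomb c S0"
    "coord x = (\<lambda>s. if s \<in> S0 then wemb (c s) / of_nat CHAR('k) ^ e else 0)" using coordE assms(1) .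
  obtain f d where d: "[(CHAR('k) ^ f)] \<cdot> y = lincomb d S0"
    "coord y = (\<lambda>s. if s \<in> S0 then wemb (d s) / of_nat CHAR('k) ^ f else 0)" using coordE assms(2) .
  have "[(CHAR('k) ^ (e + f))] \<cdot> (x \<oplus> y) =
      [(CHAR('k) ^ f)] \<cdot> ([(CHAR('k) ^ e)] \<cdot> x) \<oplus> [(CHAR('k) ^ e)] \<cdot> ([(CHAR('k) ^ f)] \<cdot> y)"
    using assms by (simp add: nat_pow_add p_pow_pow add.commute)
  also have "\<dots> = lincomb (\<lambda>s. wcoeff (of_nat (CHAR('k) ^ f)) \<otimes>\<^bsub>witt_ring\<^esub> c s \<oplus>\<^bsub>witt_ring\<^esub>
      wcoeff (of_nat (CHAR('k) ^ e)) \<otimes>\<^bsub>witt_ring\<^esub> d s) S0"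
    unfolding c(1) d(1) lincomb_nat using S0_fin S0_sub by (subst lincomb_sum) auto
  finally have "coord (x \<oplus> y) = (\<lambda>s. if s \<in> S0 then wemb (wcoeff (of_nat (CHAR('k) ^ f)) \<otimes>\<^bsub>witt_ring\<^esub> c s \<oplus>\<^bsub>witt_ring\<^esub>
      wcoeff (of_nat (CHAR('k) ^ e)) \<otimes>\<^bsub>witt_ring\<^esub> d s) / of_nat CHAR('k) ^ (e + f) else 0)"
    using assms by (intro coordI) auto
  then show ?thesis unfolding c(2) d(2) wemb_simps using p_fract_nz by (auto simp: fun_eq_iff field_simps power_add)
qed

lemma coord_smult:
  assumes "x \<in> carrier N"
  shows "coord (a \<odot> x) = (\<lambda>s. wemb a * coord x s)"
proof -
  obtain e c where c: "[(CHAR('k) ^ e)] \<cdot> x = lincomb c S0"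
    "coord x = (\<lambda>s. if s \<in> S0 then wemb (c s) / of_nat CHAR('k) ^ e else 0)" using coordE assms(1) .
  have "[(CHAR('k) ^ e)] \<cdot> (a \<odot> x) = lincomb (\<lambda>s. a \<otimes>\<^bsub>witt_ring\<^esub> c s) S0"
    using assms S0_sub by (subst lincomb_smult) (auto simp: nat_smult_smult c)
  then have "coord (a \<odot> x) = (\<lambda>s. if s \<in> S0 then wemb (a \<otimes>\<^bsub>witt_ring\<^esub> c s) / of_nat CHAR('k) ^ e else 0)"
    using assms by (intro coordI) auto
  then show ?thesis unfolding c(2) by (auto simp: fun_eq_iff wemb_simps)
qed

lemma coord_nat: "x \<in> carrier N \<Longrightarrow> coord ([(n::nat)] \<cdot> x) = (\<lambda>s. of_nat n * coord x s)"
  by (simp add: nat_smult coord_smult wemb_simps)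

lemma coord_0_iff:
  assumes "x \<in> carrier N"
  shows "coord x = 0 \<longleftrightarrow> x \<in> W_torsion N"
proof -
  have 0: "lincomb c S0 = \<zero>" if "\<And>s. s \<in> S0 \<Longrightarrow> c s = \<zero>\<^bsub>witt_ring\<^esub>" for c
  proof -
    have "lincomb c S0 = (\<Oplus>s\<in>S0. \<zero>)"
      unfolding lincomb_def using that S0_car by (intro M.finsum_cong') auto
    then show ?thesis by (simp add: M.finsum_zero)
  qed
  show ?thesis
  proof
    assume z: "coord x = 0"
    obtain e c where c: "[(CHAR('k) ^ e)] \<cdot> x = lincomb c S0"
      "coord x = (\<lambda>s. if s \<in> S0 then wemb (c s) / of_nat CHAR('k) ^ e else 0)" using coordE assms .
    have "c s = \<zero>\<^bsub>witt_ring\<^esub>" if "s \<in> S0" for s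
      using fun_cong[OF z, of s] that p_fract_nz unfolding c(2) by simp
    then show "x \<in> W_torsion N" using torsion_iff assms c(1) 0 by auto
  next
    assume "x \<in> W_torsion N"
    then obtain e where "[(CHAR('k) ^ e)] \<cdot> x = \<zero>" using torsion_iff assms by blast
    then have "[(CHAR('k) ^ e)] \<cdot> x = lincomb (\<lambda>s. \<zero>\<^bsub>witt_ring\<^esub>) S0" using 0[of "\<lambda>s. \<zero>\<^bsub>witt_ring\<^esub>"] by simp
    from coordI[OF assms this] show "coord x = 0" by (auto simp: fun_eq_iff wemb_simps)
  qed
qed

lemma coord_lincomb: "coord (lincomb c S0) = (\<lambda>s. if s \<in> S0 then wemb (c s) else 0)"
proof -
  have "lincomb c S0 \<in> carrier N" using S0_sub S0_fin by (intro lincomb_closed) auto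
  then have "coord (lincomb c S0) = (\<lambda>s. if s \<in> S0 then wemb (c s) / of_nat CHAR('k) ^ 0 else 0)"
    by (intro coordI) auto
  then show ?thesis by (simp add: fun_eq_iff)
qed

lemma coord_S0:
  assumes s: "s \<in> S0"
  shows "coord s = (\<lambda>t. if t = s then 1 else 0)"
proof -
  have "lincomb (\<lambda>t. if s = t then \<one>\<^bsub>witt_ring\<^esub> else \<zero>\<^bsub>witt_ring\<^esub>) S0 = (\<Oplus>t\<in>S0. if s = t then t else \<zero>)"
    unfolding lincomb_def using S0_car by (intro M.finsum_cong') auto
  also have "\<dots> = s" using s S0_fin S0_car by (intro M.add.finprod_singleton) auto
  finally show ?thesis using coord_lincomb[of "\<lambda>t. if s = t then \<one>\<^bsub>witt_ring\<^esub> else \<zero>\<^bsub>witt_ring\<^esub>"] s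
    by (auto simp: fun_eq_iff wemb_simps)
qed

lemma coord_out: "x \<in> carrier N \<Longrightarrow> t \<notin> S0 \<Longrightarrow> coord x t = 0"
  by (rule coordE[of x]) auto

definition vscale :: "'k wt fract \<Rightarrow> ('m \<Rightarrow> 'k wt fract) \<Rightarrow> 'm \<Rightarrow> 'k wt fract" where
  "vscale a f = (\<lambda>t. a * f t)"

text \<open>The \<sigma>-semilinear extension of Frobenius from its values on the basis.\<close>

definition vF :: "('m \<Rightarrow> 'k wt fract) \<Rightarrow> 'm \<Rightarrow> 'k wt fract" where
  "vF v = (\<lambda>t. \<Sum>s\<in>S0. w\<sigma> (v s) * coord (Frob N s) t)"

sublocale V: lattice_space "range wi" "of_nat CHAR('k)" w\<sigma> vscale
proof (rule lattice_space.intro, rule dvr_frob_witt[OF perfect])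
  show "vector_space vscale"
    by unfold_locales (auto simp: vscale_def fun_eq_iff algebra_simps)
qed

lemma vF_add: "vF (v + w) = vF v + vF w"
  by (simp add: vF_def fun_eq_iff V.\<sigma>_add algebra_simps sum.distrib)

lemma vF_scale: "vF (vscale a v) = vscale (w\<sigma> a) (vF v)"
  by (simp add: vF_def vscale_def fun_eq_iff V.\<sigma>_mult algebra_simps sum_distrib_left)

lemma coord_smult': "x \<in> carrier N \<Longrightarrow> coord (a \<odot> x) = vscale (wemb a) (coord x)"
  and coord_nat': "x \<in> carrier N \<Longrightarrow> coord ([(n::nat)] \<cdot> x) = vscale (of_nat n) (coord x)"
  by (simp_all add: vscale_def coord_smult coord_nat)

text \<open>Both sides are semilinear and agree on \<open>S0\<close>, hence on its span; a general
  vector enters the span after multiplication by \<open>p^e\<close>, and \<open>p\<close> is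
  invertible in the target.\<close>

lemma vF_coord:
  assumes x: "x \<in> carrier N"
  shows "vF (coord x) = coord (Frob N x)"
proof -
  let ?D = "{y \<in> carrier N. vF (coord y) = coord (Frob N y)}"
  have 0: "coord \<zero> = 0" using coord_add[of \<zero> \<zero>] by simp
  have D: "LinearCombinations.submodule witt_ring ?D N"
  proof (unfold_locales, goal_cases)
    case 3
    have "vF 0 + vF 0 = vF 0 + 0" using vF_add[of 0 0] by simp
    then have "vF 0 = 0" by (simp only: add_left_cancel)
    then show ?case using 0 by simp
  qed (auto simp: coord_add vF_add Frob_add coord_smult' vF_scale Frob_smult wemb_frob)
  have "S0 \<subseteq> ?D"
  proof
    fix s assume s: "s \<in> S0"
    have "vF (coord s) t = coord (Frob N s) t" for t
    proof -
      have "vF (coord s) t = (\<Sum>u\<in>S0. if u = s then coord (Frob N s) t else 0)"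
        unfolding vF_def coord_S0[OF s] by (rule sum.cong) (auto simp: V.\<sigma>_1)
      then show ?thesis using s S0_fin by simp
    qed
    then show "s \<in> ?D" using s S0_car by auto
  qed
  then have sub: "span S0 \<subseteq> ?D" using D by (intro span_is_subset)
  obtain e where "[(CHAR('k) ^ e)] \<cdot> x \<in> span S0" using S0_gen x by blast
  then have "vF (coord ([(CHAR('k) ^ e)] \<cdot> x)) = coord (Frob N ([(CHAR('k) ^ e)] \<cdot> x))" using sub by auto
  then have "vscale (of_nat CHAR('k) ^ e) (vF (coord x)) = vscale (of_nat CHAR('k) ^ e) (coord (Frob N x))"
    using x by (simp add: coord_nat' Frob_nat vF_scale V.\<sigma>_power V.\<sigma>_p)
  then show ?thesis using p_fract_nz by (simp add: vscale_def fun_eq_iff)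
qed

lemma sum_fun_apply: "(\<Sum>i\<in>I. f i) x = (\<Sum>i\<in>I. f i x)"
  by (induction I rule: infinite_finite_induct) auto

lemma vsum:
  fixes v :: "'m \<Rightarrow> 'k wt fract"
  shows "(\<forall>t. t \<notin> S0 \<longrightarrow> v t = 0) \<Longrightarrow> v = (\<Sum>s\<in>S0. vscale (v s) (coord s))"
proof (rule ext)
  fix t assume v: "\<forall>t. t \<notin> S0 \<longrightarrow> v t = 0"
  have "(\<Sum>s\<in>S0. vscale (v s) (coord s)) t = (\<Sum>s\<in>S0. if s = t then v t else 0)"
    unfolding sum_fun_apply by (rule sum.cong) (auto simp: coord_S0 vscale_def)
  then show "v t = (\<Sum>s\<in>S0. vscale (v s) (coord s)) t" using S0_fin v by auto
qed

lemma span_coord: "V.span (coord ` S0) = {v. \<forall>t. t \<notin> S0 \<longrightarrow> v t = 0}"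
proof (intro subset_antisym subsetI)
  fix v assume "v \<in> V.span (coord ` S0)"
  moreover have "V.subspace {v. \<forall>t. t \<notin> S0 \<longrightarrow> v t = 0}" by (auto simp: V.subspace_def vscale_def)
  moreover have "coord ` S0 \<subseteq> {v. \<forall>t. t \<notin> S0 \<longrightarrow> v t = 0}" using coord_out S0_car by auto
  ultimately show "v \<in> {v. \<forall>t. t \<notin> S0 \<longrightarrow> v t = 0}" using V.span_minimal by blast
next
  fix v :: "'m \<Rightarrow> 'k wt fract" assume "v \<in> {v. \<forall>t. t \<notin> S0 \<longrightarrow> v t = 0}"
  then have "v = (\<Sum>s\<in>S0. vscale (v s) (coord s))" using vsum by blast
  also have "\<dots> \<in> V.span (coord ` S0)" by (intro V.span_sum V.span_scale V.span_base) auto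
  finally show "v \<in> V.span (coord ` S0)" .
qed

lemma coord_denominator:
  fixes v :: "'m \<Rightarrow> 'k wt fract"
  assumes "\<forall>t. t \<notin> S0 \<longrightarrow> v t = 0"
  shows "\<exists>x\<in>carrier N. \<exists>e. coord x = vscale (of_nat CHAR('k) ^ e) v"
proof -
  have "\<exists>e c. of_nat CHAR('k) ^ e * v s = wemb c" for s
  proof (cases "v s = 0")
    case True
    then show ?thesis by (metis mult_zero_right wemb_simps(3))
  next
    case False
    then obtain e u where eu: "u \<in> range wi" "v s = of_nat CHAR('k) powi e * u" using V.factor by blast
    have "of_nat CHAR('k) ^ nat \<bar>e\<bar> * v s = of_nat CHAR('k) powi (\<bar>e\<bar> + e) * u"
      unfolding eu(2) mult.assoc[symmetric]
      by (simp add: power_int_of_nat[symmetric] power_int_add p_fract_nz del: power_int_of_nat)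
    also have "\<dots> \<in> range wi" using eu V.W_mult V.p_powi_W by auto
    finally show ?thesis unfolding range_wemb[symmetric] by blast
  qed
  then obtain e c where ec: "\<And>s. of_nat CHAR('k) ^ e s * v s = wemb (c s)" by metis
  define m where "m = (\<Sum>s\<in>S0. e s)"
  define d where "d = (\<lambda>s. wcoeff (of_nat (CHAR('k) ^ (m - e s))) \<otimes>\<^bsub>witt_ring\<^esub> c s)"
  have "wemb (d s) = of_nat CHAR('k) ^ m * v s" if "s \<in> S0" for s
  proof -
    have "e s \<le> m" unfolding m_def by (rule member_le_sum) (use S0_fin that in auto)
    then have "of_nat CHAR('k) ^ m * v s = of_nat CHAR('k) ^ (m - e s) * (of_nat CHAR('k) ^ e s * v s)"
      by (simp add: mult.assoc[symmetric] power_add[symmetric])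
    then show ?thesis unfolding d_def wemb_simps ec by simp
  qed
  then have "coord (lincomb d S0) = vscale (of_nat CHAR('k) ^ m) v"
    unfolding coord_lincomb vscale_def using assms by auto
  moreover have "lincomb d S0 \<in> carrier N" using S0_sub S0_fin by (intro lincomb_closed) auto
  ultimately show ?thesis by blast
qed

text \<open>For \<open>S0\<close> the exponent depends on the vector; the finite set from
  \<open>finite_rank\<close> gives a uniform one, after adding up the exponents of its
  elements.\<close>

lemma uniform_bound: "\<exists>m. \<forall>x\<in>carrier N. [(CHAR('k) ^ m)] \<cdot> x \<in> span S0"
proof -
  obtain T m where T: "finite T" "T \<subseteq> carrier N" "\<And>x. x \<in> carrier N \<Longrightarrow> [(CHAR('k) ^ m)] \<cdot> x \<in> span T"
    using finite_rank by blast
  have sp: "LinearCombinations.submodule witt_ring (span S0) N" using S0_sub by (intro span_is_submodule)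
  obtain e where e: "\<And>t. t \<in> carrier N \<Longrightarrow> [(CHAR('k) ^ e t)] \<cdot> t \<in> span S0" using S0_gen by metis
  define E where "E = (\<Sum>t\<in>T. e t)"
  let ?D = "{y \<in> carrier N. [(CHAR('k) ^ E)] \<cdot> y \<in> span S0}"
  have "T \<subseteq> ?D"
  proof
    fix t assume t: "t \<in> T"
    have "e t \<le> E" unfolding E_def using T(1) t by (intro member_le_sum) auto
    then have "[(CHAR('k) ^ E)] \<cdot> t = [(CHAR('k) ^ (E - e t))] \<cdot> ([(CHAR('k) ^ e t)] \<cdot> t)"
      using t T by (subst p_pow_pow) auto
    also have "\<dots> \<in> span S0" using e[of t] t T(2) sp
      by (subst nat_smult) (auto simp: LinearCombinations.submodule_def)
    finally show "t \<in> ?D" using t T by auto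
  qed
  then have "span T \<subseteq> ?D" using p_smult_submodule[OF sp] by (intro span_is_subset)
  then have "[(CHAR('k) ^ (E + m))] \<cdot> x \<in> span S0" if "x \<in> carrier N" for x
    using T(3)[OF that] p_pow_pow[OF that, of "CHAR('k)" E m] by auto
  then show ?thesis by blast
qed

lemma frob_lattice_coord:
  "\<exists>m0. frob_lattice (range wi) (of_nat CHAR('k)) w\<sigma> vscale vF (coord ` S0) (coord ` carrier N) m0"
proof -
  obtain m0 where m0: "\<And>x. x \<in> carrier N \<Longrightarrow> [(CHAR('k) ^ m0)] \<cdot> x \<in> span S0" using uniform_bound by blast
  have inj: "inj_on coord S0" by (auto simp: inj_on_def coord_S0 fun_eq_iff split: if_splits)
  show ?thesis
  proof (rule exI[of _ m0], unfold_locales)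
    show "finite (coord ` S0)" using S0_fin by simp
    show "V.independent (coord ` S0)"
    proof (rule V.independent_if_scalars_zero)
      fix f b assume f: "(\<Sum>b\<in>coord ` S0. vscale (f b) b) = 0" "b \<in> coord ` S0"
      then obtain s where s: "s \<in> S0" "b = coord s" by auto
      have "(\<Sum>t\<in>S0. vscale (f (coord t)) (coord t)) s = 0"
        using f(1) inj by (simp add: sum.reindex)
      moreover have "(\<Sum>t\<in>S0. vscale (f (coord t)) (coord t)) s = (\<Sum>t\<in>S0. if t = s then f (coord s) else 0)"
        unfolding sum_fun_apply by (rule sum.cong) (auto simp: coord_S0 vscale_def)
      ultimately show "f b = 0" using s S0_fin by simp
    qed (use S0_fin in simp)
    show E: "vF v \<in> V.span (coord ` S0)" if "v \<in> V.span (coord ` S0)" for v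
      unfolding span_coord vF_def using coord_out S0_car by auto
    show "v = 0" if "v \<in> V.span (coord ` S0)" "vF v = 0" for v
    proof -
      have "\<forall>t. t \<notin> S0 \<longrightarrow> v t = 0" using that(1) by (simp only: span_coord mem_Collect_eq)
      then obtain x e where x: "x \<in> carrier N" "coord x = vscale (of_nat CHAR('k) ^ e) v"
        using coord_denominator[of v] by auto
      have "coord (Frob N x) = vscale (of_nat CHAR('k) ^ e) (vF v)"
        unfolding vF_coord[OF x(1), symmetric] x(2) vF_scale by (simp add: V.\<sigma>_power V.\<sigma>_p)
      then have "coord (Frob N x) = 0" using that(2) by (simp add: vscale_def fun_eq_iff)
      then have "Frob N x \<in> W_torsion N" using coord_0_iff[OF Frob_closed[OF x(1)]] by simp
      then obtain f where f: "[(CHAR('k) ^ f)] \<cdot> Frob N x = \<zero>" using torsion_iff x(1) by auto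
      \<comment> \<open>Injectivity of \<open>F\<close> up to torsion comes from
        \<open>V F = p\<close>.\<close>
      have "[(CHAR('k) ^ f)] \<cdot> ([(CHAR('k) ^ 1)] \<cdot> x) = Ver N ([(CHAR('k) ^ f)] \<cdot> Frob N x)"
        using x(1) by (simp add: Ver_nat Ver_Frob)
      then have "[(CHAR('k) ^ (f + 1))] \<cdot> x = \<zero>" using f p_pow_pow[OF x(1), of "CHAR('k)" f 1] by simp
      then have "coord x = 0" using coord_0_iff torsion_iff x(1) by blast
      then show "v = 0" using x(2) p_fract_nz by (simp add: vscale_def fun_eq_iff)
    qed
    show w: "V.wsub (coord ` carrier N)"
      unfolding V.wsub_def
    proof (intro conjI ballI)
      have "coord \<zero> = 0" using coord_add[of \<zero> \<zero>] by simp
      then show "0 \<in> coord ` carrier N" by (metis M.zero_closed image_eqI)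
    next
      fix v w assume "v \<in> coord ` carrier N" "w \<in> coord ` carrier N"
      then show "v + w \<in> coord ` carrier N" by (auto simp: coord_add[symmetric])
    next
      fix a :: "'k wt fract" and v assume "a \<in> range wi" "v \<in> coord ` carrier N"
      then show "vscale a v \<in> coord ` carrier N"
        unfolding range_wemb[symmetric] by (auto simp: coord_smult'[symmetric])
    qed
    show "coord ` S0 \<subseteq> coord ` carrier N" using S0_sub by auto
    show "coord ` carrier N \<subseteq> V.pe (- int m0) (V.wspan (coord ` S0))"
    proof (rule image_subsetI)
      fix x assume x: "x \<in> carrier N"
      obtain c where c: "[(CHAR('k) ^ m0)] \<cdot> x = lincomb c S0"
        using finite_in_span[OF S0_fin S0_sub m0[OF x]] by metis
      have "vscale (of_nat CHAR('k) ^ m0) (coord x) = coord (lincomb c S0)"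
        using coord_nat'[OF x, of "CHAR('k) ^ m0"] unfolding c by simp
      also have "\<dots> = (\<Sum>s\<in>S0. vscale (coord (lincomb c S0) s) (coord s))"
        by (rule vsum) (simp add: coord_lincomb)
      also have "\<dots> = (\<Sum>s\<in>S0. vscale (wemb (c s)) (coord s))"
        by (rule sum.cong) (simp_all add: coord_lincomb)
      also have "\<dots> \<in> V.wspan (coord ` S0)"
        by (intro V.wsub_sum V.wsub_wspan V.wsub_scale V.wspan_base) (auto simp: wemb_def)
      finally show "coord x \<in> V.pe (- int m0) (V.wspan (coord ` S0))" by (simp add: V.pe_def)
    qed
    show "vF v \<in> coord ` carrier N" if "v \<in> coord ` carrier N" for v
      using that vF_coord by auto
    show "v \<in> vF ` coord ` carrier N" if v: "v \<in> V.pe 1 (coord ` carrier N)" for v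
    proof -
      obtain y where y: "y \<in> carrier N" "v = vscale (of_nat CHAR('k)) (coord y)"
        using v unfolding V.pe_image by auto
      then have "v = vF (coord (Ver N y))"
        by (simp add: vF_coord Frob_Ver coord_nat')
      then show ?thesis using y by auto
    qed
    show "\<exists>n0. \<forall>n\<ge>n0. vscale (of_nat CHAR('k) powi int n) v \<in> (vF ^^ n) ` V.pe c (coord ` carrier N)"
      if v: "v \<in> coord ` carrier N" for v c
    proof -
      obtain x where x: "v = coord x" "x \<in> carrier N" using v by (rule imageE)
      \<comment> \<open>The exponent \<open>c\<close> is an integer in the abstract setting; for
        negative \<open>c\<close> the stronger statement with \<open>nat c = 0\<close> is
        used.\<close>
      obtain n0 where n0: "\<And>n. n \<ge> n0 \<Longrightarrow> \<exists>y\<in>carrier N. \<exists>e.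
          [(CHAR('k) ^ e)] \<cdot> ((Ver N ^^ n) x) = [(CHAR('k) ^ e)] \<cdot> ([(CHAR('k) ^ nat c)] \<cdot> y)"
        using Ver_nil[OF x(2)] by blast
      have "vscale (of_nat CHAR('k) powi int n) v \<in> (vF ^^ n) ` V.pe c (coord ` carrier N)" if n: "n \<ge> n0" for n
      proof -
        obtain y e where y: "y \<in> carrier N"
          "[(CHAR('k) ^ e)] \<cdot> ((Ver N ^^ n) x) = [(CHAR('k) ^ e)] \<cdot> ([(CHAR('k) ^ nat c)] \<cdot> y)"
          using n0[OF n] by blast
        have "vscale (of_nat (CHAR('k) ^ e)) (coord ((Ver N ^^ n) x)) = vscale (of_nat (CHAR('k) ^ e)) (coord ([(CHAR('k) ^ nat c)] \<cdot> y))"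
          using x y by (simp only: coord_nat'[symmetric] Ver_pow_closed M.add.nat_pow_closed)
        then have eq: "coord ((Ver N ^^ n) x) = coord ([(CHAR('k) ^ nat c)] \<cdot> y)"
          using p_fract_nz by (simp add: vscale_def fun_eq_iff)
        have pow: "(vF ^^ n) (coord z) = coord ((Frob N ^^ n) z)" if "z \<in> carrier N" for z n
          using that by (induction n) (simp_all add: vF_coord)
        have "vscale (of_nat CHAR('k) powi int n) v = (vF ^^ n) (coord ((Ver N ^^ n) x))"
          using x by (simp add: pow Frob_Ver_pow coord_nat')
        moreover have "coord ((Ver N ^^ n) x) \<in> V.pe (int (nat c)) (coord ` carrier N)"
          using V.peI[OF imageI[OF y(1)], of "int (nat c)" coord] y(1) unfolding eq
          by (simp add: coord_nat' power_int_of_nat del: nat_0_le int_nat_eq)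
        then have "coord ((Ver N ^^ n) x) \<in> V.pe c (coord ` carrier N)"
          by (rule subsetD[OF V.pe_antimono[OF w], rotated]) simp
        ultimately show ?thesis by blast
      qed
      then show ?thesis by blast
    qed
  qed (auto simp: vF_add vF_scale)
qed

end

section \<open>Subquotients\<close>

locale dieudonne_subquotient = perfect_dieudonne N
  for N :: "(('k::field_prime_char) witt, 'm) fv_module" (structure) +
  fixes A B :: "'m set"
  assumes A_sub: "LinearCombinations.submodule witt_ring A N"
    and B_sub: "LinearCombinations.submodule witt_ring B N" and A_B: "A \<subseteq> B"
begin

abbreviation Q where "Q \<equiv> fv_subquot N B A"

lemma A_car: "x \<in> A \<Longrightarrow> x \<in> carrier N" and B_car: "x \<in> B \<Longrightarrow> x \<in> carrier N"
  using A_sub B_sub by (auto simp: LinearCombinations.submodule_def)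

lemma A_closed: "\<zero> \<in> A" "x \<in> A \<Longrightarrow> y \<in> A \<Longrightarrow> x \<oplus> y \<in> A" "x \<in> A \<Longrightarrow> a \<odot> x \<in> A" "x \<in> A \<Longrightarrow> \<ominus> x \<in> A"
  using A_sub submodule_neg[OF A_sub] by (auto simp: LinearCombinations.submodule_def)

lemma B_closed: "\<zero> \<in> B" "x \<in> B \<Longrightarrow> y \<in> B \<Longrightarrow> x \<oplus> y \<in> B" "x \<in> B \<Longrightarrow> a \<odot> x \<in> B" "x \<in> B \<Longrightarrow> \<ominus> x \<in> B"
  using B_sub submodule_neg[OF B_sub] by (auto simp: LinearCombinations.submodule_def)

sublocale A: abelian_subgroup A N
proof (rule abelian_subgroupI3)
  show "additive_subgroup A N"
    unfolding additive_subgroup_def by (rule subgroup.intro) (auto simp: A_car A_closed a_inv_def[symmetric])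
  show "abelian_group N" by (rule M.abelian_group_axioms)
qed

lemma mem_coset: "y \<in> A +> x \<longleftrightarrow> (\<exists>a\<in>A. y = a \<oplus> x)"
  by (auto simp: a_r_coset_def')

lemma coset_eq:
  assumes "x \<in> carrier N" "y \<in> carrier N"
  shows "A +> x = A +> y \<longleftrightarrow> x \<ominus> y \<in> A"
proof
  assume "A +> x = A +> y"
  then have "x \<in> A +> y" using A.a_rcos_self[OF assms(1)] by simp
  then obtain a where "a \<in> A" "x = a \<oplus> y" using mem_coset by blast
  then show "x \<ominus> y \<in> A" using assms A_car by (simp add: a_minus_def M.a_assoc M.r_neg)
next
  assume a: "x \<ominus> y \<in> A"
  have "x = (x \<ominus> y) \<oplus> y" using assms by (simp add: a_minus_def M.a_assoc M.l_neg)
  then have "x \<in> A +> y" using a mem_coset by blast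
  then show "A +> x = A +> y" using A.a_repr_independence' assms by blast
qed

lemma coset_zero:
  assumes "x \<in> carrier N"
  shows "A +> x = A \<longleftrightarrow> x \<in> A"
proof -
  have "\<ominus> \<zero> = \<zero>" by (metis M.l_zero M.r_neg M.zero_closed M.a_inv_closed)
  then have "x \<ominus> \<zero> = x" using assms by (simp add: a_minus_def)
  then show ?thesis using coset_eq[of x \<zero>] assms A.a_rcos_const[OF A_closed(1)] by simp
qed

text \<open>All representatives give the same coset, so the unions in the definition of the quotient
  operations collapse.\<close>

lemma coset_map:
  assumes "x \<in> carrier N" "\<And>a. a \<in> A \<Longrightarrow> h a \<in> A" "\<And>a. a \<in> A \<Longrightarrow> h (a \<oplus> x) = h a \<oplus> h x"
    "h x \<in> carrier N"
  shows "(\<Union>y\<in>A +> x. A +> h y) = A +> h x"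
proof -
  have "A +> h y = A +> h x" if y: "y \<in> A +> x" for y
  proof -
    obtain a where a: "a \<in> A" "y = a \<oplus> x" using y mem_coset by blast
    then have "h y = h a \<oplus> h x" using assms by simp
    then show ?thesis using assms a(1) coset_eq[of "h y" "h x"] A_car[of "h a"]
      by (simp add: a_minus_def M.a_assoc M.r_neg)
  qed
  moreover have "A +> x \<noteq> {}" using A.a_rcos_self[OF assms(1)] by auto
  ultimately show ?thesis by auto
qed

lemma Q_simps [simp]: "carrier Q = (\<lambda>x. A +> x) ` B" "\<zero>\<^bsub>Q\<^esub> = A"
  "X \<oplus>\<^bsub>Q\<^esub> Y = X <+> Y"
  by (simp_all add: fv_subquot_def)

lemma Q_add: "x \<in> B \<Longrightarrow> y \<in> B \<Longrightarrow> (A +> x) <+> (A +> y) = A +> (x \<oplus> y)"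
  using A.a_rcos_sum B_car by blast

lemma Q_add_zero: "x \<in> B \<Longrightarrow> (A +> x) <+> A = A +> x"
  using Q_add[of x \<zero>] B_closed(1) B_car A.a_rcos_const[OF A_closed(1)] by simp

lemma Q_smult: "x \<in> B \<Longrightarrow> a \<odot>\<^bsub>Q\<^esub> (A +> x) = A +> (a \<odot> x)"
  unfolding fv_subquot_def using B_car A_closed A_car
  by (simp add: coset_map smult_r_distr)

lemma Q_Ver: "(\<And>x. x \<in> A \<Longrightarrow> Ver N x \<in> A) \<Longrightarrow> x \<in> B \<Longrightarrow> Ver Q (A +> x) = A +> Ver N x"
  unfolding fv_subquot_def using B_car A_closed A_car
  by (simp add: coset_map Ver_add)

lemma Q_module: "module witt_ring Q"
proof (rule module_criteria)
  show "cring (witt_ring :: 'k witt ring)" by (rule R.cring_axioms)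
  show "\<zero>\<^bsub>Q\<^esub> \<in> carrier Q" using B_closed(1) A.a_rcos_const[OF A_closed(1)] by (auto intro!: image_eqI)
  show "\<forall>v\<in>carrier Q. \<exists>w\<in>carrier Q. v \<oplus>\<^bsub>Q\<^esub> w = \<zero>\<^bsub>Q\<^esub>"
  proof
    fix v assume "v \<in> carrier Q"
    then obtain x where x: "x \<in> B" "v = A +> x" by auto
    have "v \<oplus>\<^bsub>Q\<^esub> (A +> (\<ominus> x)) = A +> \<zero>" using x B_closed B_car by (simp add: Q_add M.r_neg)
    then show "\<exists>w\<in>carrier Q. v \<oplus>\<^bsub>Q\<^esub> w = \<zero>\<^bsub>Q\<^esub>"
      using x B_closed(4)[OF x(1)] A.a_rcos_const[OF A_closed(1)] by auto
  qed
qed (auto simp: Q_add Q_add_zero Q_smult B_closed B_car M.a_ac smult_r_distr smult_l_distr smult_assoc1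
    A_car A.a_rcos_const[OF A_closed(1)] intro!: arg_cong[of _ _ "\<lambda>x. A +> x"])

lemma Q_nat: "x \<in> B \<Longrightarrow> [(n::nat)] \<cdot>\<^bsub>Q\<^esub> (A +> x) = A +> ([n] \<cdot> x)"
proof -
  interpret Q: Module.module witt_ring Q by (rule Q_module)
  have B: "[(n::nat)] \<cdot> x \<in> B" if "x \<in> B" for n x using that B_closed by (induction n) (simp_all add: M.add.nat_pow_Suc)
  show "x \<in> B \<Longrightarrow> [(n::nat)] \<cdot>\<^bsub>Q\<^esub> (A +> x) = A +> ([n] \<cdot> x)"
    by (induction n) (simp_all add: M.add.nat_pow_Suc Q.M.add.nat_pow_Suc Q_add B A.a_rcos_const[OF A_closed(1)])
qed

end

section \<open>Residue field dimensions as least numbers of generators\<close>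

lemma Least_eqI_le:
  fixes P P' :: "nat \<Rightarrow> bool"
  assumes "\<And>n. P n \<Longrightarrow> P' n" "\<And>n. P' n \<Longrightarrow> \<exists>m\<le>n. P m"
  shows "(LEAST n. P n) = (LEAST n. P' n)"
proof (cases "\<exists>n. P n")
  case True
  then have "P (LEAST n. P n)" by (metis LeastI)
  then have le: "(LEAST n. P' n) \<le> (LEAST n. P n)" using assms(1) by (intro Least_le)
  have "P' (LEAST n. P' n)" using assms(1) True by (metis LeastI)
  then obtain m where "m \<le> (LEAST n. P' n)" "P m" using assms(2) by blast
  then have "(LEAST n. P n) \<le> (LEAST n. P' n)" using Least_le[of P m] by simp
  then show ?thesis using le by simp
next
  case False
  then have "\<And>n. P n \<longleftrightarrow> P' n" using assms by blast
  then show ?thesis by simp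
qed

lemma image_section:
  assumes "finite T" "T \<subseteq> f ` S"
  obtains T' where "finite T'" "T' \<subseteq> S" "inj_on f T'" "f ` T' = T" "card T' = card T"
proof -
  obtain T' where "T' \<subseteq> S" "inj_on f T'" "T = f ` T'" using assms(2) by (auto simp: subset_image_inj)
  moreover from this have "finite T'" "card T' = card T" using assms(1) by (auto simp: finite_image_iff card_image)
  ultimately show ?thesis using that by blast
qed

lemma class_field_prime: "field (class_ring :: ('a::field) ring)"
  using class_field.field_axioms by (simp add: class_field_def)

context finite_dieudonne
begin

text \<open>Modulo \<open>p\<close> a Witt vector is determined by component 0; hence the
  Teichmueller lift acts like a ring homomorphism on modules killed by \<open>p\<close>.\<close>

lemma teichmueller_mod_p:
  fixes a :: "'k witt" and c d :: 'k
  shows "\<exists>b. a = teichmueller (a 0) \<oplus>\<^bsub>witt_ring\<^esub> wcoeff (of_nat CHAR('k)) \<otimes>\<^bsub>witt_ring\<^esub> b"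
    and teichmueller_add_mod_p: "\<exists>b. teichmueller (c + d) =
      (teichmueller c \<oplus>\<^bsub>witt_ring\<^esub> teichmueller d) \<oplus>\<^bsub>witt_ring\<^esub> wcoeff (of_nat CHAR('k)) \<otimes>\<^bsub>witt_ring\<^esub> b"
  and teichmueller_mult_mod_p: "\<exists>b. teichmueller (c * d) =
      (teichmueller c \<otimes>\<^bsub>witt_ring\<^esub> teichmueller d) \<oplus>\<^bsub>witt_ring\<^esub> wcoeff (of_nat CHAR('k)) \<otimes>\<^bsub>witt_ring\<^esub> b"
proof -
  have *: "\<exists>b. x = y \<oplus>\<^bsub>witt_ring\<^esub> wcoeff (of_nat CHAR('k)) \<otimes>\<^bsub>witt_ring\<^esub> b" if "x 0 = y 0" for x y :: "'k witt"
  proof -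
    have "\<forall>i<1. wcoeff (Wt x) i = wcoeff (Wt y) i" using that by simp
    then obtain w where "Wt x = Wt y + of_nat CHAR('k) ^ 1 * w" using wcoeff_eq_iff[OF perfect, of 1 "Wt x" "Wt y"] by blast
    then have "wcoeff (Wt x) = wcoeff (Wt y + of_nat CHAR('k) * w)" by simp
    then show ?thesis unfolding wcoeff_add wcoeff_mult by auto
  qed
  have 0: "(x \<oplus>\<^bsub>witt_ring\<^esub> y) 0 = x 0 + y 0" "(x \<otimes>\<^bsub>witt_ring\<^esub> y) 0 = x 0 * y 0" for x y :: "'k witt"
    using wcoeff_add_0[of "Wt x" "Wt y"] wcoeff_mult_0[of "Wt x" "Wt y"] by (simp_all add: wcoeff_add wcoeff_mult)
  show "\<exists>b. a = teichmueller (a 0) \<oplus>\<^bsub>witt_ring\<^esub> wcoeff (of_nat CHAR('k)) \<otimes>\<^bsub>witt_ring\<^esub> b"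
    by (rule *) (simp add: teichmueller_def)
  show "\<exists>b. teichmueller (c + d) =
      (teichmueller c \<oplus>\<^bsub>witt_ring\<^esub> teichmueller d) \<oplus>\<^bsub>witt_ring\<^esub> wcoeff (of_nat CHAR('k)) \<otimes>\<^bsub>witt_ring\<^esub> b"
    by (rule *) (simp add: 0 teichmueller_def)
  show "\<exists>b. teichmueller (c * d) =
      (teichmueller c \<otimes>\<^bsub>witt_ring\<^esub> teichmueller d) \<oplus>\<^bsub>witt_ring\<^esub> wcoeff (of_nat CHAR('k)) \<otimes>\<^bsub>witt_ring\<^esub> b"
    by (rule *) (simp add: 0 teichmueller_def)
qed

text \<open>\<open>N / D\<close> is identified with \<open>g N / Y\<close>. The twist
  \<open>\<tau>\<close> allows \<open>g\<close> to be semilinear: least numbers of generators are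
  unaffected by an automorphism of the scalars.\<close>

lemma dim_quotient:
  assumes g_add: "\<And>x y. x \<in> carrier N \<Longrightarrow> y \<in> carrier N \<Longrightarrow> g (x \<oplus> y) = g x + g y"
    and g_smult: "\<And>a x. x \<in> carrier N \<Longrightarrow> g (a \<odot> x) = vscale (\<tau> (wemb a)) (g x)"
    and \<tau>: "\<And>a. \<tau> (wemb a) \<in> range wi" "\<And>a. a \<in> range wi \<Longrightarrow> \<exists>b. a = \<tau> (wemb b)"
    and Y: "V.wsub Y" "Y \<subseteq> g ` carrier N" and D: "D = {x \<in> carrier N. g x \<in> Y}"
    and pD: "\<And>x. x \<in> carrier N \<Longrightarrow> [CHAR('k)] \<cdot> x \<in> D"
  shows "vectorspace.dim class_ring (k_space (fv_subquot N (carrier N) D)) = V.mingens Y (g ` carrier N)"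
proof -
  have g0: "g \<zero> = 0" using g_add[of \<zero> \<zero>] by simp
  have g_neg: "g (\<ominus> x) = - g x" if "x \<in> carrier N" for x
    using g_add[of x "\<ominus> x"] that g0 by (simp add: M.r_neg add_eq_0_iff)
  have g_minus: "g (x \<ominus> y) = g x - g y" if "x \<in> carrier N" "y \<in> carrier N" for x y
    using that g_add[of x "\<ominus> y"] by (simp add: a_minus_def g_neg)
  have mem_D: "x \<in> D \<longleftrightarrow> x \<in> carrier N \<and> g x \<in> Y" for x by (simp add: D)
  have sub: "LinearCombinations.submodule witt_ring D N"
    unfolding D using Y(1) \<tau>(1)
    by unfold_locales (auto simp: g0 g_add g_smult V.wsub_0 V.wsub_add intro!: V.wsub_scale)
  have car: "LinearCombinations.submodule witt_ring (carrier N) N" by unfold_locales auto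
  have minus_D: "x \<ominus> y \<in> D" if "x \<in> carrier N" "y \<in> carrier N" "g x = g y" for x y
    using that V.wsub_0[OF Y(1)] by (simp add: mem_D g_minus)
  interpret D: dieudonne_subquotient N D "carrier N"
    using sub car by unfold_locales (auto simp: D LinearCombinations.submodule_def)
  let ?Q = "fv_subquot N (carrier N) D" and ?k = "k_space (fv_subquot N (carrier N) D) :: ('k, 'm set) module"
  have k_simps: "carrier ?k = (\<lambda>x. D +> x) ` carrier N" "\<zero>\<^bsub>?k\<^esub> = D" "X \<oplus>\<^bsub>?k\<^esub> X' = X <+> X'"
    "c \<odot>\<^bsub>?k\<^esub> X = teichmueller c \<odot>\<^bsub>?Q\<^esub> X" for X X' c by (simp_all add: k_space_def)
  interpret Q: Module.module witt_ring ?Q by (rule D.Q_module)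
  have p_act: "D +> ((a \<oplus>\<^bsub>witt_ring\<^esub> wcoeff (of_nat CHAR('k)) \<otimes>\<^bsub>witt_ring\<^esub> b) \<odot> x) = D +> (a \<odot> x)"
    if x: "x \<in> carrier N" for a b x
  proof -
    have "(wcoeff (of_nat CHAR('k)) \<otimes>\<^bsub>witt_ring\<^esub> b) \<odot> x = [CHAR('k)] \<cdot> (b \<odot> x)"
      using x by (simp add: nat_smult smult_assoc1)
    then have d: "(wcoeff (of_nat CHAR('k)) \<otimes>\<^bsub>witt_ring\<^esub> b) \<odot> x \<in> D" using pD x by simp
    have "(a \<oplus>\<^bsub>witt_ring\<^esub> wcoeff (of_nat CHAR('k)) \<otimes>\<^bsub>witt_ring\<^esub> b) \<odot> x \<ominus> a \<odot> x = (wcoeff (of_nat CHAR('k)) \<otimes>\<^bsub>witt_ring\<^esub> b) \<odot> x"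
      (is "?u \<ominus> ?v = ?w")
    proof -
      have "?u = ?w \<oplus> ?v" using x by (simp add: smult_l_distr M.a_comm)
      then show ?thesis using x by (simp add: a_minus_def M.a_assoc M.r_neg)
    qed
    then show ?thesis using d x by (subst D.coset_eq) auto
  qed
  have teich: "D +> (a \<odot> x) = D +> (teichmueller (a 0) \<odot> x)" if "x \<in> carrier N" for a x
  proof -
    obtain b where b: "a = teichmueller (a 0) \<oplus>\<^bsub>witt_ring\<^esub> wcoeff (of_nat CHAR('k)) \<otimes>\<^bsub>witt_ring\<^esub> b"
      using teichmueller_mod_p by blast
    show ?thesis by (subst b, rule p_act[OF that])
  qed
  have kmod: "module class_ring ?k"
  proof (rule module_criteria)
    show "cring (class_ring :: 'k ring)" using class_field_prime field_def domain_def by blast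
    show "\<zero>\<^bsub>?k\<^esub> \<in> carrier ?k" unfolding k_simps using Q.M.zero_closed by (simp only: D.Q_simps)
    have "\<exists>w\<in>carrier ?Q. v \<oplus>\<^bsub>?Q\<^esub> w = \<zero>\<^bsub>?Q\<^esub>" if "v \<in> carrier ?Q" for v
      using Q.M.r_neg[OF that] Q.M.a_inv_closed[OF that] by (rule bexI)
    then show "\<forall>v\<in>carrier ?k. \<exists>w\<in>carrier ?k. v \<oplus>\<^bsub>?k\<^esub> w = \<zero>\<^bsub>?k\<^esub>"
      unfolding k_simps by (simp only: D.Q_simps) simp
    show "\<forall>a b v. a \<in> carrier class_ring \<and> b \<in> carrier class_ring \<and> v \<in> carrier ?k \<longrightarrow>
        (a \<otimes>\<^bsub>class_ring\<^esub> b) \<odot>\<^bsub>?k\<^esub> v = a \<odot>\<^bsub>?k\<^esub> (b \<odot>\<^bsub>?k\<^esub> v)"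
    proof (intro allI impI)
      fix a b :: 'k and v assume "a \<in> carrier class_ring \<and> b \<in> carrier class_ring \<and> v \<in> carrier ?k"
      then obtain x where x: "x \<in> carrier N" "v = D +> x" unfolding k_simps by auto
      obtain e where e: "teichmueller (a * b) = (teichmueller a \<otimes>\<^bsub>witt_ring\<^esub> teichmueller b) \<oplus>\<^bsub>witt_ring\<^esub>
        wcoeff (of_nat CHAR('k)) \<otimes>\<^bsub>witt_ring\<^esub> e" using teichmueller_mult_mod_p by blast
      have "D +> (teichmueller (a * b) \<odot> x) = D +> ((teichmueller a \<otimes>\<^bsub>witt_ring\<^esub> teichmueller b) \<odot> x)"
        unfolding e by (rule p_act[OF x(1)])
      then show "(a \<otimes>\<^bsub>class_ring\<^esub> b) \<odot>\<^bsub>?k\<^esub> v = a \<odot>\<^bsub>?k\<^esub> (b \<odot>\<^bsub>?k\<^esub> v)"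
        using x by (simp add: k_simps D.Q_smult smult_assoc1)
    qed
    show "\<forall>a b v. a \<in> carrier class_ring \<and> b \<in> carrier class_ring \<and> v \<in> carrier ?k \<longrightarrow>
        (a \<oplus>\<^bsub>class_ring\<^esub> b) \<odot>\<^bsub>?k\<^esub> v = a \<odot>\<^bsub>?k\<^esub> v \<oplus>\<^bsub>?k\<^esub> b \<odot>\<^bsub>?k\<^esub> v"
    proof (intro allI impI)
      fix a b :: 'k and v assume "a \<in> carrier class_ring \<and> b \<in> carrier class_ring \<and> v \<in> carrier ?k"
      then obtain x where x: "x \<in> carrier N" "v = D +> x" unfolding k_simps by auto
      obtain e where e: "teichmueller (a + b) = (teichmueller a \<oplus>\<^bsub>witt_ring\<^esub> teichmueller b) \<oplus>\<^bsub>witt_ring\<^esub>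
        wcoeff (of_nat CHAR('k)) \<otimes>\<^bsub>witt_ring\<^esub> e" using teichmueller_add_mod_p by blast
      have "D +> (teichmueller (a + b) \<odot> x) = D +> ((teichmueller a \<oplus>\<^bsub>witt_ring\<^esub> teichmueller b) \<odot> x)"
        unfolding e by (rule p_act[OF x(1)])
      then show "(a \<oplus>\<^bsub>class_ring\<^esub> b) \<odot>\<^bsub>?k\<^esub> v = a \<odot>\<^bsub>?k\<^esub> v \<oplus>\<^bsub>?k\<^esub> b \<odot>\<^bsub>?k\<^esub> v"
        using x by (simp add: k_simps D.Q_smult smult_l_distr D.Q_add)
    qed
    have one: "teichmueller 1 = \<one>\<^bsub>witt_ring\<^esub>" by (simp add: teichmueller_def witt_ring_def)
    show "\<forall>v\<in>carrier ?k. \<one>\<^bsub>class_ring\<^esub> \<odot>\<^bsub>?k\<^esub> v = v"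
      by (auto simp: k_simps D.Q_smult one)
  qed (auto simp: k_simps D.Q_add D.Q_add_zero D.Q_smult M.a_ac smult_r_distr
      intro!: arg_cong[of _ _ "\<lambda>x. D +> x"])
  interpret k: vectorspace class_ring ?k
    using kmod class_field_prime by (simp add: vectorspace_def)
  let ?Z = "g ` carrier N"
  have wZ: "V.wsub ?Z"
    unfolding V.wsub_def
  proof (intro conjI ballI)
    show "0 \<in> ?Z" using g0 by (metis M.zero_closed image_eqI)
    fix v assume v: "v \<in> ?Z"
    show "v + w \<in> ?Z" if "w \<in> ?Z" for w using v that by (auto simp: g_add[symmetric])
    show "vscale a v \<in> ?Z" if "a \<in> range wi" for a
      using v \<tau>(2)[OF that] by (auto simp: g_smult[symmetric])
  qed
  \<comment> \<open>Spans over \<open>k\<close> of classes correspond to spans over \<open>W\<close>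
    of images modulo \<open>Y\<close>, for every set of representatives.\<close>
  have key: "LinearCombinations.module.span class_ring ?k ((\<lambda>x. D +> x) ` T) = carrier ?k \<longleftrightarrow> V.ssum (V.wspan (g ` T)) Y = ?Z"
    if T: "T \<subseteq> carrier N" for T
  proof
    have piT: "(\<lambda>x. D +> x) ` T \<subseteq> carrier ?k" using T unfolding k_simps by auto
    assume sp: "LinearCombinations.module.span class_ring ?k ((\<lambda>x. D +> x) ` T) = carrier ?k"
    let ?Y = "V.ssum (V.wspan (g ` T)) Y"
    have wY: "V.wsub ?Y" by (intro V.wsub_ssum V.wsub_wspan Y)
    let ?S = "(\<lambda>x. D +> x) ` {x \<in> carrier N. g x \<in> ?Y}"
    have "LinearCombinations.submodule class_ring ?S ?k"
    proof (unfold_locales, goal_cases)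
      case 2
      then show ?case by (auto simp: k_simps D.Q_add g_add intro!: imageI V.wsub_add[OF wY])
    next
      case 3
      have "g \<zero> \<in> ?Y" using g0 V.wsub_0[OF wY] by simp
      then show ?case using D.A.a_rcos_const[OF D.A_closed(1)] unfolding k_simps by (auto intro!: image_eqI[of _ _ \<zero>])
    next
      case (4 c v)
      then show ?case by (auto simp: k_simps D.Q_smult g_smult \<tau> intro!: imageI V.wsub_scale[OF wY])
    qed (auto simp: k_simps)
    moreover have "(\<lambda>x. D +> x) ` T \<subseteq> ?S"
    proof (rule image_subsetI)
      fix x assume x: "x \<in> T"
      then have "g x \<in> ?Y" by (intro subsetD[OF V.ssum_upper1[OF Y(1)]] V.wspan_base) simp
      then show "D +> x \<in> ?S" using x T by (intro imageI) auto
    qed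
    ultimately have "carrier ?k \<subseteq> ?S" unfolding sp[symmetric] by (intro k.span_is_subset)
    have "?Z \<subseteq> ?Y"
    proof
      fix z assume "z \<in> ?Z"
      then obtain x where x: "x \<in> carrier N" "z = g x" by auto
      then have "D +> x \<in> ?S" using \<open>carrier ?k \<subseteq> ?S\<close> unfolding k_simps by (elim subsetD) simp
      then obtain y where "D +> x = D +> y" "y \<in> {x \<in> carrier N. g x \<in> ?Y}" by (rule imageE)
      then have y: "y \<in> carrier N" "g y \<in> ?Y" "D +> x = D +> y" by simp_all
      then have "x \<ominus> y \<in> D" using D.coset_eq x by blast
      then have "g x - g y \<in> Y" using x(1) y(1) by (simp only: mem_D g_minus)
      then have "g x - g y \<in> ?Y" by (rule subsetD[OF V.ssum_upper2[OF V.wsub_wspan]])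
      then have "(g x - g y) + g y \<in> ?Y" using y(2) by (rule V.wsub_add[OF wY])
      then show "z \<in> ?Y" using x by simp
    qed
    moreover have "?Y \<subseteq> ?Z"
      by (rule V.ssum_least[OF V.wspan_minimal[OF image_mono[OF T] wZ] Y(2) wZ])
    ultimately show "?Y = ?Z" by auto
  next
    have piT: "(\<lambda>x. D +> x) ` T \<subseteq> carrier ?k" using T unfolding k_simps by auto
    assume eq: "V.ssum (V.wspan (g ` T)) Y = ?Z"
    let ?S = "LinearCombinations.module.span class_ring ?k ((\<lambda>x. D +> x) ` T)"
    have S: "LinearCombinations.submodule class_ring ?S ?k" using piT by (rule k.span_is_submodule)
    interpret S: LinearCombinations.submodule class_ring ?S ?k by (rule S)
    let ?Y = "g ` {x \<in> carrier N. D +> x \<in> ?S}"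
    have "V.wsub ?Y"
      unfolding V.wsub_def
    proof (intro conjI ballI)
      have "D +> \<zero> \<in> ?S" using S.zero_closed D.A.a_rcos_const[OF D.A_closed(1)] by (simp add: k_simps)
      then show "0 \<in> ?Y" using g0 by (auto intro!: image_eqI[of _ _ \<zero>])
      fix v assume "v \<in> ?Y"
      then obtain x where "v = g x" "x \<in> {x \<in> carrier N. D +> x \<in> ?S}" by (rule imageE)
      then have x: "x \<in> carrier N" "D +> x \<in> ?S" "v = g x" by simp_all
      show "v + w \<in> ?Y" if w: "w \<in> ?Y" for w
      proof -
        obtain y where "w = g y" "y \<in> {x \<in> carrier N. D +> x \<in> ?S}" using w by (rule imageE)
        then have y: "y \<in> carrier N" "D +> y \<in> ?S" "w = g y" by simp_all
        have "D +> (x \<oplus> y) \<in> ?S" using S.m_closed[OF x(2) y(2)] x y by (simp add: k_simps D.Q_add)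
        then show ?thesis using x y by (auto simp: g_add intro!: image_eqI[of _ _ "x \<oplus> y"])
      qed
      show "vscale a v \<in> ?Y" if a: "a \<in> range wi" for a
      proof -
        obtain b where b: "a = \<tau> (wemb b)" using \<tau>(2)[OF a] by blast
        have "D +> (b \<odot> x) \<in> ?S" using S.smult_closed[OF _ x(2), of "b 0"] x(1)
          by (simp add: k_simps D.Q_smult teich[of x b])
        then show ?thesis using x b by (auto simp: g_smult intro!: image_eqI[of _ _ "b \<odot> x"])
      qed
    qed
    moreover have "g ` T \<subseteq> ?Y" using T k.in_own_span[OF piT] by auto
    moreover have "Y \<subseteq> ?Y"
    proof
      fix y assume y: "y \<in> Y"
      obtain x where x: "y = g x" "x \<in> carrier N" using subsetD[OF Y(2) y] by (rule imageE)
      have "x \<in> D" using x y by (simp only: mem_D)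
      then have "D +> x = D" using D.coset_zero x(2) by blast
      then have "D +> x \<in> ?S" using S.zero_closed by (simp add: k_simps)
      then show "y \<in> ?Y" using x by auto
    qed
    ultimately have Z: "?Z \<subseteq> ?Y" unfolding eq[symmetric] by (intro V.ssum_least V.wspan_minimal)
    have "carrier ?k \<subseteq> ?S"
    proof
      fix v assume "v \<in> carrier ?k"
      then obtain x where x: "x \<in> carrier N" "v = D +> x" unfolding k_simps by auto
      then have "g x \<in> ?Y" using Z by (elim subsetD) simp
      then obtain y where "g x = g y" "y \<in> {x \<in> carrier N. D +> x \<in> ?S}" by (rule imageE)
      then have y: "y \<in> carrier N" "D +> y \<in> ?S" "g x = g y" by simp_all
      then have "x \<ominus> y \<in> D" using minus_D[OF x(1) y(1,3)] by simp
      then have "D +> x = D +> y" using D.coset_eq x y by blast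
      then show "v \<in> ?S" using x y by simp
    qed
    then show "?S = carrier ?k" using S.subset by auto
  qed
  show ?thesis
    unfolding k.dim_def V.mingens_def
  proof (rule Least_eqI_le)
    fix n
    assume "\<exists>A. finite A \<and> card A = n \<and> A \<subseteq> carrier ?k \<and> k.gen_set A"
    then obtain A where A: "finite A" "card A = n" "A \<subseteq> (\<lambda>x. D +> x) ` carrier N" "k.gen_set A" unfolding k_simps by auto
    obtain T where T: "finite T" "T \<subseteq> carrier N" "inj_on (\<lambda>x. D +> x) T" "(\<lambda>x. D +> x) ` T = A" "card T = card A"
      using image_section[OF A(1,3)] .
    have "inj_on g T"
    proof (rule inj_onI)
      fix x y assume xy: "x \<in> T" "y \<in> T" "g x = g y"
      then have "x \<ominus> y \<in> D" using T(2) by (intro minus_D) auto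
      then have "D +> x = D +> y" using xy T(2) by (subst D.coset_eq) auto
      then show "x = y" using T(3) xy by (auto simp: inj_on_def)
    qed
    then have "card (g ` T) = n" using A(2) T(5) by (simp add: card_image)
    then show "\<exists>A. finite A \<and> card A = n \<and> A \<subseteq> ?Z \<and> V.ssum (V.wspan A) Y = ?Z"
      using key[OF T(2)] A(4) T by (intro exI[of _ "g ` T"]) auto
  next
    fix n
    assume "\<exists>A. finite A \<and> card A = n \<and> A \<subseteq> ?Z \<and> V.ssum (V.wspan A) Y = ?Z"
    then obtain A where A: "finite A" "card A = n" "A \<subseteq> ?Z" "V.ssum (V.wspan A) Y = ?Z" by auto
    obtain T where T: "finite T" "T \<subseteq> carrier N" "inj_on g T" "g ` T = A" "card T = card A"
      using image_section[OF A(1,3)] .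
    \<comment> \<open>Distinct elements of \<open>T\<close> may have the same class, since
      \<open>g\<close> separates more than the quotient does; hence only an inequality in this
      direction.\<close>
    have "card ((\<lambda>x. D +> x) ` T) \<le> n" using card_image_le[OF T(1), of "\<lambda>x. D +> x"] T(5) A(2) by simp
    moreover have "k.gen_set ((\<lambda>x. D +> x) ` T)" using key[OF T(2)] A(4) T(4) by simp
    moreover have "(\<lambda>x. D +> x) ` T \<subseteq> carrier ?k" using T(2) unfolding k_simps by auto
    ultimately show "\<exists>m\<le>n. \<exists>A. finite A \<and> card A = m \<and> A \<subseteq> carrier ?k \<and> k.gen_set A"
      using T(1) by blast
  qed
qed

text \<open>For Verschiebung, the quotient \<open>X / V X\<close> is transported by the injective
  \<open>F\<close> to \<open>F X / p X\<close>, as \<open>F V = p\<close>; hence the semilinear map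
  and the twist by \<sigma> in that case.\<close>

lemma dim_mod_tors:
  shows "dim_mod_tors_Frob N = V.mingens (vF ` coord ` carrier N) (coord ` carrier N)"
    and "dim_mod_tors_Ver N = V.mingens (V.pe 1 (coord ` carrier N)) (vF ` coord ` carrier N)"
proof -
  let ?X = "coord ` carrier N"
  obtain m0 where "frob_lattice (range wi) (of_nat CHAR('k)) w\<sigma> vscale vF (coord ` S0) ?X m0"
    using frob_lattice_coord by blast
  then interpret L: frob_lattice "range wi" "of_nat CHAR('k)" w\<sigma> vscale vF "coord ` S0" ?X m0 .
  have pX: "V.pe 1 ?X = coord ` (\<lambda>x. [CHAR('k)] \<cdot> x) ` carrier N"
    unfolding V.pe_image image_image by (rule image_cong) (simp_all add: coord_nat')
  have coord_diff: "coord (x \<ominus> y) = coord x - coord y" if "x \<in> carrier N" "y \<in> carrier N" for x y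
  proof -
    have "coord (x \<ominus> y) + coord y = coord x" using that by (simp add: coord_add[symmetric] a_minus_def M.a_assoc M.l_neg)
    then show ?thesis by (simp add: algebra_simps)
  qed
  have mem: "x \<in> W_torsion N <+> h ` carrier N \<longleftrightarrow> coord x \<in> coord ` h ` carrier N"
    if x: "x \<in> carrier N" and h: "\<And>y. y \<in> carrier N \<Longrightarrow> h y \<in> carrier N" for x h
  proof
    assume "x \<in> W_torsion N <+> h ` carrier N"
    then obtain t y where "t \<in> W_torsion N" "y \<in> carrier N" "x = t \<oplus> h y" by (auto simp: set_add_def')
    then have "coord x = coord (h y)" "y \<in> carrier N" using h coord_0_iff[of t] by (auto simp: coord_add W_torsion_def)
    then show "coord x \<in> coord ` h ` carrier N" by auto
  next
    assume "coord x \<in> coord ` h ` carrier N"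
    then obtain y where y: "y \<in> carrier N" "coord x = coord (h y)" by auto
    then have "x \<ominus> h y \<in> W_torsion N" using x h coord_0_iff[of "x \<ominus> h y"] by (simp add: coord_diff)
    moreover have "x = (x \<ominus> h y) \<oplus> h y" using x y h by (simp add: a_minus_def M.a_assoc M.l_neg)
    ultimately show "x \<in> W_torsion N <+> h ` carrier N" using y by (auto simp: set_add_def')
  qed
  have sub: "W_torsion N <+> h ` carrier N \<subseteq> carrier N" if "\<And>y. y \<in> carrier N \<Longrightarrow> h y \<in> carrier N" for h
    using that by (auto simp: set_add_def' W_torsion_def)
  have FX: "vF ` ?X = coord ` Frob N ` carrier N"
    unfolding image_image by (rule image_cong) (simp_all add: vF_coord)
  have wFX: "V.wsub (vF ` ?X)" using L.wsub_Fn_image[OF L.X_wsub, of 1] by simp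
  have "W_torsion N <+> Frob N ` carrier N = {x \<in> carrier N. coord x \<in> vF ` ?X}"
    using mem[of _ "Frob N"] sub[of "Frob N"] unfolding FX by auto
  moreover have "vectorspace.dim class_ring (k_space (fv_subquot N (carrier N) {x \<in> carrier N. coord x \<in> vF ` ?X})) = V.mingens (vF ` ?X) ?X"
  proof (rule dim_quotient[where \<tau> = id])
    show "[CHAR('k)] \<cdot> x \<in> {x \<in> carrier N. coord x \<in> vF ` ?X}" if "x \<in> carrier N" for x
      using that L.pX_FX pX by auto
  qed (use wFX L.F_X in \<open>auto simp: coord_add coord_smult' wemb_def range_wemb[symmetric] intro: range_eqI\<close>)
  ultimately show "dim_mod_tors_Frob N = V.mingens (vF ` ?X) ?X" by (simp add: dim_mod_tors_Frob_def)
  have gX: "(\<lambda>x. vF (coord x)) ` carrier N = vF ` ?X" by (simp add: image_image)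
  have inj: "vF (coord x) = vF (coord y) \<longleftrightarrow> coord x = coord y" if "x \<in> carrier N" "y \<in> carrier N" for x y
    using L.F_inj[of "coord x - coord y"] L.X_E that L.subspace_E
    by (auto simp: L.F_diff V.subspace_diff subset_iff)
  have "vF (coord x) \<in> V.pe 1 ?X \<longleftrightarrow> coord x \<in> coord ` Ver N ` carrier N" if x: "x \<in> carrier N" for x
  proof -
    have "vF (coord x) \<in> V.pe 1 ?X \<longleftrightarrow> (\<exists>y\<in>carrier N. vF (coord x) = vF (coord (Ver N y)))"
      unfolding pX by (auto simp: vF_coord Frob_Ver)
    then show ?thesis using inj x by auto
  qed
  then have "W_torsion N <+> Ver N ` carrier N = {x \<in> carrier N. vF (coord x) \<in> V.pe 1 ?X}"
    using mem[of _ "Ver N"] sub[of "Ver N"] by auto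
  moreover have "vectorspace.dim class_ring (k_space (fv_subquot N (carrier N) {x \<in> carrier N. vF (coord x) \<in> V.pe 1 ?X})) =
      V.mingens (V.pe 1 ?X) ((\<lambda>x. vF (coord x)) ` carrier N)"
  proof (rule dim_quotient[where \<tau> = w\<sigma>])
    show "V.wsub (V.pe 1 ?X)" by (intro V.wsub_pe L.X_wsub)
    show "V.pe 1 ?X \<subseteq> (\<lambda>x. vF (coord x)) ` carrier N" unfolding gX using L.pX_FX by auto
    show "[CHAR('k)] \<cdot> x \<in> {x \<in> carrier N. vF (coord x) \<in> V.pe 1 ?X}" if "x \<in> carrier N" for x
      using that unfolding pX by (auto simp: vF_coord Frob_nat)
    show "w\<sigma> (wemb a) \<in> range wi" for a by (simp add: w\<sigma>_wi wemb_def)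
    show "\<exists>b. a = w\<sigma> (wemb b)" if a: "a \<in> range wi" for a :: "'k wt fract"
    proof -
      obtain b where b: "a = w\<sigma> b" using surjD[OF V.\<sigma>_surj, of a] by blast
      then have "b \<in> range wi" using a V.\<sigma>_W[of b] by simp
      then obtain c where "b = wemb c" unfolding range_wemb[symmetric] by auto
      then show ?thesis using b by auto
    qed
  qed (auto simp: coord_add coord_smult' vF_add vF_scale)
  ultimately show "dim_mod_tors_Ver N = V.mingens (V.pe 1 ?X) (vF ` ?X)"
    unfolding gX by (simp add: dim_mod_tors_Ver_def)
qed

end

section \<open>The isocrystal of a Dieudonne module\<close>

text \<open>Common setting for \<open>K = W[1/p]\<close> and for the isocrystal, both built from
  classes of fractions: \<open>\<phi>\<close> is an additive map to a vector space that identifies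
  only elements which agree after multiplication by a power of \<open>p\<close>, and the fraction
  \<open>x / p^n\<close> becomes the vector \<open>p^(-n) \<phi> x\<close>.\<close>

locale p_localization = lattice_space "range wi" "of_nat CHAR('k)" w\<sigma> scale
  for scale :: "('k::field_prime_char) wt fract \<Rightarrow> 'b::ab_group_add \<Rightarrow> 'b" (infixr \<open>*s\<close> 75) +
  fixes G :: "('g, 'e) ring_scheme" (structure) and \<phi> :: "'g \<Rightarrow> 'b"
  assumes G_zero: "\<zero> \<in> carrier G" and \<phi>_zero: "\<phi> \<zero> = 0"
    and G_add: "x \<in> carrier G \<Longrightarrow> y \<in> carrier G \<Longrightarrow> x \<oplus> y \<in> carrier G"
    and G_nat: "x \<in> carrier G \<Longrightarrow> [(n::nat)] \<cdot> x \<in> carrier G"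
    and G_nat_nat: "x \<in> carrier G \<Longrightarrow> [(n::nat)] \<cdot> ([(m::nat)] \<cdot> x) = [(n * m)] \<cdot> x"
    and \<phi>_add: "x \<in> carrier G \<Longrightarrow> y \<in> carrier G \<Longrightarrow> \<phi> (x \<oplus> y) = \<phi> x + \<phi> y"
    and \<phi>_nat: "x \<in> carrier G \<Longrightarrow> \<phi> ([(n::nat)] \<cdot> x) = of_nat n *s \<phi> x"
    and \<phi>_eq: "x \<in> carrier G \<Longrightarrow> y \<in> carrier G \<Longrightarrow> \<phi> x = \<phi> y \<Longrightarrow>
      \<exists>e. [(CHAR('k) ^ e)] \<cdot> x = [(CHAR('k) ^ e)] \<cdot> y"
begin

definition fr :: "'g \<Rightarrow> nat \<Rightarrow> 'b" where "fr x n = of_nat CHAR('k) powi (- int n) *s \<phi> x"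

text \<open>The dictionary from vectors to elements of the localization: a vector corresponds to the
  class of all fractions with that value.\<close>

definition fib :: "'b \<Rightarrow> ('g \<times> nat) set" where "fib v = {(x, n). x \<in> carrier G \<and> fr x n = v}"

definition Loc :: "'b set" where "Loc = {fr x n |x n. x \<in> carrier G}"

lemma pow_cancel: "of_nat CHAR('k) ^ n *s v = of_nat CHAR('k) ^ n *s w \<longleftrightarrow> v = w"
  using p_nz by simp

lemma fr_mult: "of_nat CHAR('k) ^ n *s fr x n = \<phi> x"
  using p_nz by (simp add: fr_def power_int_minus)

lemma fr_eq_iff: "fr x n = v \<longleftrightarrow> \<phi> x = of_nat CHAR('k) ^ n *s v"
  unfolding fr_mult[of n x, symmetric] pow_cancel ..

lemma fr_0 [simp]: "fr x 0 = \<phi> x"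
  by (simp add: fr_def)

lemma p_frac_fib:
  assumes x: "x \<in> carrier G"
  shows "p_frac CHAR('k) G x n = fib (fr x n)"
proof -
  have "(\<exists>c. [(CHAR('k) ^ (c + m))] \<cdot> x = [(CHAR('k) ^ (c + n))] \<cdot> y) \<longleftrightarrow> fr y m = fr x n"
    if y: "y \<in> carrier G" for y m
  proof -
    have "fr y m = fr x n \<longleftrightarrow> of_nat CHAR('k) ^ n *s \<phi> y = of_nat CHAR('k) ^ n *s of_nat CHAR('k) ^ m *s fr x n"
      unfolding fr_eq_iff[of y] pow_cancel ..
    also have "of_nat CHAR('k) ^ n *s of_nat CHAR('k) ^ m *s fr x n = of_nat CHAR('k) ^ m *s \<phi> x"
      unfolding fr_mult[of n x, symmetric] scale_scale by (simp add: mult.commute)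
    finally have eq: "fr y m = fr x n \<longleftrightarrow> of_nat CHAR('k) ^ n *s \<phi> y = of_nat CHAR('k) ^ m *s \<phi> x" .
    show ?thesis
    proof
      assume "\<exists>c. [(CHAR('k) ^ (c + m))] \<cdot> x = [(CHAR('k) ^ (c + n))] \<cdot> y"
      then obtain c where "[(CHAR('k) ^ (c + m))] \<cdot> x = [(CHAR('k) ^ (c + n))] \<cdot> y" by blast
      then have "of_nat (CHAR('k) ^ (c + m)) *s \<phi> x = of_nat (CHAR('k) ^ (c + n)) *s \<phi> y"
        using \<phi>_nat[OF x] \<phi>_nat[OF y] by metis
      then have "of_nat CHAR('k) ^ c *s of_nat CHAR('k) ^ m *s \<phi> x = of_nat CHAR('k) ^ c *s of_nat CHAR('k) ^ n *s \<phi> y"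
        by (simp add: power_add)
      then show "fr y m = fr x n" unfolding eq pow_cancel by simp
    next
      assume "fr y m = fr x n"
      then have "\<phi> ([(CHAR('k) ^ m)] \<cdot> x) = \<phi> ([(CHAR('k) ^ n)] \<cdot> y)"
        unfolding eq using x y by (simp add: \<phi>_nat)
      then obtain c where "[(CHAR('k) ^ c)] \<cdot> ([(CHAR('k) ^ m)] \<cdot> x) = [(CHAR('k) ^ c)] \<cdot> ([(CHAR('k) ^ n)] \<cdot> y)"
        using \<phi>_eq G_nat x y by blast
      then show "\<exists>c. [(CHAR('k) ^ (c + m))] \<cdot> x = [(CHAR('k) ^ (c + n))] \<cdot> y"
        using x y by (auto simp: G_nat_nat power_add)
    qed
  qed
  then show ?thesis unfolding p_frac_def fib_def by auto
qed

lemma p_frac_carrier_fib: "p_frac_carrier CHAR('k) G = fib ` Loc"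
  unfolding p_frac_carrier_def Loc_def using p_frac_fib by blast

lemma fib_nonempty: "v \<in> Loc \<Longrightarrow> fib v \<noteq> {}"
  by (auto simp: Loc_def fib_def)

lemma inj_fib: "inj_on fib Loc"
proof (rule inj_onI)
  fix v w assume "v \<in> Loc" "fib v = fib w"
  then show "v = w" using fib_nonempty[of v] by (auto simp: fib_def)
qed

lemma UN_fib:
  assumes "v \<in> Loc" "\<And>x n. x \<in> carrier G \<Longrightarrow> fr x n = v \<Longrightarrow> h x n = T"
  shows "(\<Union>(x, n)\<in>fib v. h x n) = T"
  using fib_nonempty[OF assms(1)] assms(2) by (auto simp: fib_def)

lemma Loc_iff: "v \<in> Loc \<longleftrightarrow> (\<exists>n. of_nat CHAR('k) ^ n *s v \<in> \<phi> ` carrier G)"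
proof
  assume "v \<in> Loc"
  then obtain x n where "v = fr x n" "x \<in> carrier G" by (auto simp: Loc_def)
  then show "\<exists>n. of_nat CHAR('k) ^ n *s v \<in> \<phi> ` carrier G" using fr_mult[of n x] by auto
next
  assume "\<exists>n. of_nat CHAR('k) ^ n *s v \<in> \<phi> ` carrier G"
  then obtain n x where "of_nat CHAR('k) ^ n *s v = \<phi> x" "x \<in> carrier G" by auto
  then have "fr x n = v" "x \<in> carrier G" unfolding fr_eq_iff by auto
  then show "v \<in> Loc" by (auto simp: Loc_def)
qed

lemma p_frac_add_fib:
  assumes v: "v \<in> Loc" and w: "w \<in> Loc"
  shows "p_frac_add CHAR('k) G (fib v) (fib w) = fib (v + w)" and "v + w \<in> Loc"
proof -
  have *: "fr ([(CHAR('k) ^ m)] \<cdot> x \<oplus> [(CHAR('k) ^ n)] \<cdot> y) (n + m) = fr x n + fr y m"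
    if "x \<in> carrier G" "y \<in> carrier G" for x y n m
    unfolding fr_eq_iff
    using that fr_mult[of n x] fr_mult[of m y]
    by (simp add: \<phi>_add \<phi>_nat G_nat scale_right_distrib power_add flip: scale_scale)
      (metis mult.commute scale_scale)
  have c: "[(CHAR('k) ^ m)] \<cdot> x \<oplus> [(CHAR('k) ^ n)] \<cdot> y \<in> carrier G" if "x \<in> carrier G" "y \<in> carrier G" for x y n m
    using that by (intro G_add G_nat)
  show "p_frac_add CHAR('k) G (fib v) (fib w) = fib (v + w)"
    unfolding p_frac_add_def by (intro UN_fib v w) (simp add: p_frac_fib c *)
  obtain x n y m where "x \<in> carrier G" "y \<in> carrier G" "v = fr x n" "w = fr y m" using v w by (auto simp: Loc_def)
  then have "v + w = fr ([(CHAR('k) ^ m)] \<cdot> x \<oplus> [(CHAR('k) ^ n)] \<cdot> y) (n + m)"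
      "[(CHAR('k) ^ m)] \<cdot> x \<oplus> [(CHAR('k) ^ n)] \<cdot> y \<in> carrier G" using c * by simp_all
  then show "v + w \<in> Loc" unfolding Loc_def by blast
qed

lemma zero_Loc: "0 \<in> Loc" and p_frac_zero: "p_frac CHAR('k) G \<zero> 0 = fib 0"
proof -
  show "0 \<in> Loc" unfolding Loc_iff using G_zero \<phi>_zero by (auto intro!: exI[of _ 0] image_eqI[of _ _ \<zero>])
  show "p_frac CHAR('k) G \<zero> 0 = fib 0" using p_frac_fib[OF G_zero, of 0] \<phi>_zero by simp
qed

end

text \<open>Transfers submodules and spans between record-based modules and subsets of a class-based
  vector space. The scalar map \<open>\<theta>\<close> lets the same setting cover the action of
  \<open>K\<close> and the action of \<open>W\<close>; \<open>\<theta>_minus\<close> provides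
  negatives.\<close>

locale module_transport = Vector_Spaces.vector_space scale
  for scale :: "'f::field \<Rightarrow> 'b::ab_group_add \<Rightarrow> 'b" (infixr \<open>*s\<close> 75) +
  fixes R :: "('r, 'e) ring_scheme" and M :: "('r, 'c, 'd) module_scheme" and f :: "'b \<Rightarrow> 'c"
    and P :: "'b set" and \<theta> :: "'r \<Rightarrow> 'f"
  assumes R_cring: "cring R" and carrier_M: "carrier M = f ` P" and inj_f: "inj_on f P"
    and zero_M: "\<zero>\<^bsub>M\<^esub> = f 0" and add_M: "v \<in> P \<Longrightarrow> w \<in> P \<Longrightarrow> f v \<oplus>\<^bsub>M\<^esub> f w = f (v + w)"
    and smult_M: "r \<in> carrier R \<Longrightarrow> v \<in> P \<Longrightarrow> r \<odot>\<^bsub>M\<^esub> f v = f (\<theta> r *s v)"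
    and \<theta>_add: "r \<in> carrier R \<Longrightarrow> s \<in> carrier R \<Longrightarrow> \<theta> (r \<oplus>\<^bsub>R\<^esub> s) = \<theta> r + \<theta> s"
    and \<theta>_mult: "r \<in> carrier R \<Longrightarrow> s \<in> carrier R \<Longrightarrow> \<theta> (r \<otimes>\<^bsub>R\<^esub> s) = \<theta> r * \<theta> s"
    and \<theta>_one: "\<theta> \<one>\<^bsub>R\<^esub> = 1" and \<theta>_minus: "- 1 \<in> \<theta> ` carrier R"
    and P_zero: "0 \<in> P" and P_add: "v \<in> P \<Longrightarrow> w \<in> P \<Longrightarrow> v + w \<in> P"
    and P_smult: "r \<in> carrier R \<Longrightarrow> v \<in> P \<Longrightarrow> \<theta> r *s v \<in> P"
begin

definition closed :: "'b set \<Rightarrow> bool" where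
  "closed Y \<longleftrightarrow> 0 \<in> Y \<and> (\<forall>v\<in>Y. \<forall>w\<in>Y. v + w \<in> Y) \<and> (\<forall>r\<in>carrier R. \<forall>v\<in>Y. \<theta> r *s v \<in> Y)"

lemma M_module: "module R M"
proof (rule module_criteria)
  show "\<forall>v\<in>carrier M. \<exists>w\<in>carrier M. v \<oplus>\<^bsub>M\<^esub> w = \<zero>\<^bsub>M\<^esub>"
  proof
    fix x assume "x \<in> carrier M"
    then obtain v where v: "v \<in> P" "x = f v" unfolding carrier_M by auto
    obtain r where "r \<in> carrier R" "\<theta> r = - 1" using \<theta>_minus by auto
    then have "- v \<in> P" using P_smult[of r v] v by simp
    then have "f (- v) \<in> carrier M" "x \<oplus>\<^bsub>M\<^esub> f (- v) = \<zero>\<^bsub>M\<^esub>" using v by (simp_all add: carrier_M add_M zero_M)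
    then show "\<exists>w\<in>carrier M. x \<oplus>\<^bsub>M\<^esub> w = \<zero>\<^bsub>M\<^esub>" by blast
  qed
qed (use R_cring in \<open>auto simp: carrier_M zero_M add_M smult_M P_zero P_add P_smult \<theta>_add \<theta>_mult \<theta>_one
    cring.cring_simprules ring.ring_simprules cring.is_cring scale_left_distrib scale_right_distrib add_ac\<close>)

lemma submodule_iff:
  assumes "Y \<subseteq> P"
  shows "LinearCombinations.submodule R (f ` Y) M \<longleftrightarrow> closed Y"
proof
  assume "LinearCombinations.submodule R (f ` Y) M"
  then interpret S: LinearCombinations.submodule R "f ` Y" M .
  have mem: "v \<in> Y" if "f v \<in> f ` Y" "v \<in> P" for v
    using that assms inj_f by (auto simp: inj_on_def)
  show "closed Y"
    unfolding closed_def
  proof (intro conjI ballI)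
    show "0 \<in> Y" using S.zero_closed P_zero by (intro mem) (simp_all add: zero_M)
    show "v + w \<in> Y" if "v \<in> Y" "w \<in> Y" for v w
    proof -
      have "v \<in> P" "w \<in> P" using that assms by auto
      moreover from this have "f (v + w) \<in> f ` Y"
        using S.m_closed[of "f v" "f w"] that by (simp add: add_M)
      ultimately show ?thesis using P_add by (intro mem)
    qed
    show "\<theta> r *s v \<in> Y" if "r \<in> carrier R" "v \<in> Y" for r v
    proof -
      have "v \<in> P" using that assms by auto
      moreover from this have "f (\<theta> r *s v) \<in> f ` Y"
        using S.smult_closed[of r "f v"] that by (simp add: smult_M)
      ultimately show ?thesis using P_smult that by (intro mem)
    qed
  qed
next
  assume c: "closed Y"
  show "LinearCombinations.submodule R (f ` Y) M"
  proof (rule LinearCombinations.submodule.intro)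
    show "module R M" by (rule M_module)
    show "f ` Y \<subseteq> carrier M" using assms carrier_M by auto
    show "\<zero>\<^bsub>M\<^esub> \<in> f ` Y" using c by (auto simp: closed_def zero_M)
    show "x \<oplus>\<^bsub>M\<^esub> y \<in> f ` Y" if xy: "x \<in> f ` Y" "y \<in> f ` Y" for x y
    proof -
      obtain v w where vw: "x = f v" "v \<in> Y" "y = f w" "w \<in> Y" using xy by (elim imageE) simp
      then have "v + w \<in> Y" "v \<in> P" "w \<in> P" using c assms by (auto simp: closed_def)
      then show ?thesis using vw by (simp add: add_M)
    qed
    show "r \<odot>\<^bsub>M\<^esub> x \<in> f ` Y" if r: "r \<in> carrier R" "x \<in> f ` Y" for r x
    proof -
      obtain v where v: "x = f v" "v \<in> Y" using r(2) by (elim imageE) simp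
      then have "\<theta> r *s v \<in> Y" "v \<in> P" using c r(1) assms by (auto simp: closed_def)
      then show ?thesis using v r(1) by (simp add: smult_M)
    qed
  qed
qed

lemma span_image:
  assumes T: "T \<subseteq> P"
  shows "LinearCombinations.module.span R M (f ` T) = f ` (\<Inter>{Y. closed Y \<and> T \<subseteq> Y})"
proof -
  interpret M: Module.module R M by (rule M_module)
  let ?H = "\<Inter>{Y. closed Y \<and> T \<subseteq> Y}" and ?S = "LinearCombinations.module.span R M (f ` T)"
  have cP: "closed P" unfolding closed_def using P_zero P_add P_smult by blast
  have H: "?H \<subseteq> P" using cP T by blast
  have cH: "closed ?H" unfolding closed_def by blast
  have fT: "f ` T \<subseteq> carrier M" using T carrier_M by auto
  have "LinearCombinations.submodule R (f ` ?H) M" using submodule_iff[OF H] cH by simp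
  then have "?S \<subseteq> f ` ?H" by (intro M.span_is_subset) blast
  define Y where "Y = {v \<in> P. f v \<in> ?S}"
  have S: "LinearCombinations.submodule R ?S M" by (rule M.span_is_submodule[OF fT])
  then have "?S \<subseteq> f ` P" unfolding LinearCombinations.submodule_def carrier_M by blast
  then have SY: "?S = f ` Y" unfolding Y_def by auto
  then have "closed Y" using S submodule_iff[of Y] by (auto simp: Y_def)
  moreover have "T \<subseteq> Y" using M.in_own_span[OF fT] T unfolding Y_def by blast
  ultimately have "?H \<subseteq> Y" by blast
  then have "f ` ?H \<subseteq> ?S" unfolding SY by blast
  then show ?thesis using \<open>?S \<subseteq> f ` ?H\<close> by blast
qed

end

section \<open>Slopes of the isocrystal read off in the ambient space\<close>

context finite_dieudonne
begin

definition m0 :: nat where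
  "m0 = (SOME m0. frob_lattice (range wi) (of_nat CHAR('k)) w\<sigma> vscale vF (coord ` S0) (coord ` carrier N) m0)"

sublocale L: frob_lattice "range wi" "of_nat CHAR('k)" w\<sigma> vscale vF "coord ` S0" "coord ` carrier N" m0
  unfolding m0_def by (rule someI_ex[OF frob_lattice_coord])

lemma witt_nat: "[(n::nat)] \<cdot>\<^bsub>witt_ring\<^esub> (a :: 'k witt) = wcoeff (of_nat n) \<otimes>\<^bsub>witt_ring\<^esub> a"
proof (induction n)
  case 0
  then show ?case by (simp add: wcoeff_zero)
next
  case (Suc n)
  then show ?case by (simp add: R.add.nat_pow_Suc wcoeff_add wcoeff_one R.l_distr R.a_comm)
qed

sublocale K: p_localization "(*)" "witt_ring :: 'k witt ring" wemb
proof unfold_locales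
  show "\<exists>e. [(CHAR('k) ^ e)] \<cdot>\<^bsub>witt_ring\<^esub> x = [(CHAR('k) ^ e)] \<cdot>\<^bsub>witt_ring\<^esub> y"
    if "wemb x = wemb y" for x y :: "'k witt" using that by simp
qed (auto simp: witt_nat wemb_simps wcoeff_mult R.m_assoc algebra_simps)

sublocale I: p_localization vscale N coord
proof unfold_locales
  show "\<exists>e. [(CHAR('k) ^ e)] \<cdot> x = [(CHAR('k) ^ e)] \<cdot> y"
    if x: "x \<in> carrier N" and y: "y \<in> carrier N" and eq: "coord x = coord y" for x y
  proof -
    have xy: "x = (x \<ominus> y) \<oplus> y" using x y by (simp add: a_minus_def M.a_assoc M.l_neg)
    have "coord (x \<ominus> y) + coord y = 0 + coord y" using coord_add[of "x \<ominus> y" y] x y xy eq by simp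
    then have "coord (x \<ominus> y) = 0" by (simp only: add_right_cancel)
    then obtain e where "[(CHAR('k) ^ e)] \<cdot> (x \<ominus> y) = \<zero>" using coord_0_iff[of "x \<ominus> y"] torsion_iff[of "x \<ominus> y"] x y by auto
    then have "[(CHAR('k) ^ e)] \<cdot> x = [(CHAR('k) ^ e)] \<cdot> y"
      using x y by (subst xy) (simp add: nat_pow_add)
    then show ?thesis by blast
  qed
next
  show "coord \<zero> = 0" using coord_0_iff[of \<zero>] torsion_iff[of \<zero>] by simp
qed (auto simp: coord_add coord_nat' M.add.nat_pow_pow mult.commute)

lemma K_Loc [simp]: "K.Loc = UNIV"
proof -
  have "a \<in> K.Loc" for a
  proof (cases "a = 0")
    case True
    then show ?thesis using K.zero_Loc by simp
  next
    case False
    then obtain e u where eu: "u \<in> range wi" "a = of_nat CHAR('k) powi e * u" using V.factor by blast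
    have "of_nat CHAR('k) ^ nat \<bar>e\<bar> * a = of_nat CHAR('k) powi (\<bar>e\<bar> + e) * u"
      unfolding eu(2) mult.assoc[symmetric]
      by (simp add: power_int_of_nat[symmetric] power_int_add p_fract_nz del: power_int_of_nat)
    also have "\<dots> \<in> range wi" using eu V.W_mult V.p_powi_W by auto
    finally show ?thesis unfolding K.Loc_iff range_wemb[symmetric] by auto
  qed
  then show ?thesis by auto
qed

text \<open>Every vector of the span has a power of \<open>p\<close> as denominator, so the
  fractions fill the whole space.\<close>

lemma I_Loc: "I.Loc = L.E"
proof (intro subset_antisym subsetI)
  fix v assume "v \<in> I.Loc"
  then obtain n where "vscale (of_nat CHAR('k) ^ n) v \<in> coord ` carrier N" unfolding I.Loc_iff by blast
  then have "v \<in> V.pe (- int n) (coord ` carrier N)" by (simp add: V.pe_def)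
  then show "v \<in> L.E" using L.span_wsub[OF L.X_wsub] L.span_X by auto
next
  fix v assume "v \<in> L.E"
  then obtain e where e: "v \<in> V.pe e (coord ` carrier N)" using L.E_pe by blast
  then have "v \<in> V.pe (- int (nat \<bar>e\<bar>)) (coord ` carrier N)"
    by (rule subsetD[OF V.pe_antimono[OF L.X_wsub], rotated]) simp
  then have "vscale (of_nat CHAR('k) ^ nat \<bar>e\<bar>) v \<in> coord ` carrier N"
    unfolding V.pe_def by (simp add: power_int_of_nat[symmetric] del: power_int_of_nat)
  then show "v \<in> I.Loc" unfolding I.Loc_iff by blast
qed

lemma powi_minus_add:
  "of_nat CHAR('k) powi (- int (n + m)) = (of_nat CHAR('k) powi (- int n) * of_nat CHAR('k) powi (- int m) :: 'k wt fract)"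
  by (simp only: V.pp of_nat_add minus_add_distrib)

lemma K_simps:
  "carrier witt_field = range K.fib" "\<zero>\<^bsub>witt_field\<^esub> = K.fib 0" "\<one>\<^bsub>witt_field\<^esub> = K.fib 1"
  "K.fib a \<oplus>\<^bsub>witt_field\<^esub> K.fib b = K.fib (a + b)"
  "K.fib a \<otimes>\<^bsub>witt_field\<^esub> K.fib b = K.fib (a * b)"
proof -
  show "carrier witt_field = range K.fib" by (simp add: witt_field_def K.p_frac_carrier_fib)
  show "\<zero>\<^bsub>witt_field\<^esub> = K.fib 0" by (simp add: witt_field_def K.p_frac_zero)
  show "\<one>\<^bsub>witt_field\<^esub> = K.fib 1" by (simp add: witt_field_def K.p_frac_fib wemb_simps)
  show "K.fib a \<oplus>\<^bsub>witt_field\<^esub> K.fib b = K.fib (a + b)"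
    by (simp add: witt_field_def K.p_frac_add_fib)
  have "K.fr (x \<otimes>\<^bsub>witt_ring\<^esub> y) (n + m) = K.fr x n * K.fr y m" for x y n m
    unfolding K.fr_def wemb_simps powi_minus_add by (simp only: mult_ac)
  then show "K.fib a \<otimes>\<^bsub>witt_field\<^esub> K.fib b = K.fib (a * b)"
    unfolding witt_field_def by (simp, intro K.UN_fib) (simp_all add: K.p_frac_fib)
qed

lemma K_fib_inject [simp]: "K.fib a = K.fib b \<longleftrightarrow> a = b"
  using K.inj_fib by (auto simp: inj_on_def)

lemma K_field: "field (witt_field :: ('k witt \<times> nat) set ring)" (is "field ?K")
proof -
  have "abelian_group ?K"
  proof (rule abelian_groupI)
    show "\<exists>y\<in>carrier ?K. y \<oplus>\<^bsub>?K\<^esub> x = \<zero>\<^bsub>?K\<^esub>" if "x \<in> carrier ?K" for x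
    proof -
      obtain a where "x = K.fib a" using \<open>x \<in> carrier ?K\<close> K_simps(1) by auto
      then show ?thesis by (intro bexI[of _ "K.fib (- a)"]) (simp_all add: K_simps)
    qed
  qed (auto simp: K_simps algebra_simps)
  moreover have "comm_monoid ?K"
  proof (rule comm_monoidI)
    show "x \<otimes>\<^bsub>?K\<^esub> y = y \<otimes>\<^bsub>?K\<^esub> x" if "x \<in> carrier ?K" "y \<in> carrier ?K" for x y
      using that unfolding K_simps(1) by (elim imageE) (simp add: K_simps mult.commute)
    show "x \<otimes>\<^bsub>?K\<^esub> y \<otimes>\<^bsub>?K\<^esub> z = x \<otimes>\<^bsub>?K\<^esub> (y \<otimes>\<^bsub>?K\<^esub> z)"
      if xyz: "x \<in> carrier ?K" "y \<in> carrier ?K" "z \<in> carrier ?K" for x y z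
    proof -
      obtain a b c where "x = K.fib a" "y = K.fib b" "z = K.fib c" using xyz unfolding K_simps(1) by blast
      then show ?thesis by (simp only: K_simps mult.assoc)
    qed
  qed (auto simp: K_simps)
  ultimately have "cring ?K"
    by (rule cringI) (auto simp: K_simps algebra_simps)
  then show ?thesis
  proof (rule cring.cring_fieldI2)
    show "\<zero>\<^bsub>?K\<^esub> \<noteq> \<one>\<^bsub>?K\<^esub>" by (simp add: K_simps)
    show "\<exists>b\<in>carrier ?K. x \<otimes>\<^bsub>?K\<^esub> b = \<one>\<^bsub>?K\<^esub>"
      if "x \<in> carrier ?K" "x \<noteq> \<zero>\<^bsub>?K\<^esub>" for x
    proof -
      obtain a where "x = K.fib a" "a \<noteq> 0" using \<open>x \<in> carrier ?K\<close> \<open>x \<noteq> \<zero>\<^bsub>?K\<^esub>\<close> by (auto simp: K_simps)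
      then show ?thesis by (intro bexI[of _ "K.fib (inverse a)"]) (simp_all add: K_simps)
    qed
  qed
qed

lemma K_nat: "[(n::nat)] \<cdot>\<^bsub>witt_field\<^esub> \<one>\<^bsub>witt_field\<^esub> = K.fib (of_nat n)"
proof -
  interpret K': field "witt_field :: ('k witt \<times> nat) set ring" by (rule K_field)
  show ?thesis by (induction n) (simp_all add: K'.add.nat_pow_Suc K_simps add.commute)
qed

lemma K_powi: "K.fib a [^]\<^bsub>witt_field\<^esub> (s::int) = K.fib (a powi s)" if a: "a \<noteq> 0"
proof -
  interpret K': field "witt_field :: ('k witt \<times> nat) set ring" by (rule K_field)
  have pow: "K.fib b [^]\<^bsub>witt_field\<^esub> (n::nat) = K.fib (b ^ n)" for b n
    by (induction n) (simp_all add: K_simps mult.commute)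
  have inv: "inv\<^bsub>witt_field\<^esub> K.fib b = K.fib (inverse b)" if "b \<noteq> 0" for b
    using that by (intro K'.comm_inv_char) (simp_all add: K_simps)
  show ?thesis using a by (simp add: int_pow_def2 pow inv power_int_def power_inverse)
qed

abbreviation Iso where "Iso \<equiv> isocrystal_of N"

lemma I_simps:
  "carrier Iso = I.fib ` L.E" "\<zero>\<^bsub>Iso\<^esub> = I.fib 0"
  "v \<in> L.E \<Longrightarrow> w \<in> L.E \<Longrightarrow> I.fib v \<oplus>\<^bsub>Iso\<^esub> I.fib w = I.fib (v + w)"
  "v \<in> L.E \<Longrightarrow> K.fib a \<odot>\<^bsub>Iso\<^esub> I.fib v = I.fib (vscale a v)"
  "v \<in> L.E \<Longrightarrow> Frob Iso (I.fib v) = I.fib (vF v)"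
proof -
  show "carrier Iso = I.fib ` L.E" by (simp add: isocrystal_of_def I.p_frac_carrier_fib I_Loc)
  show "\<zero>\<^bsub>Iso\<^esub> = I.fib 0" by (simp add: isocrystal_of_def I.p_frac_zero)
  show "v \<in> L.E \<Longrightarrow> w \<in> L.E \<Longrightarrow> I.fib v \<oplus>\<^bsub>Iso\<^esub> I.fib w = I.fib (v + w)"
    by (simp add: isocrystal_of_def I.p_frac_add_fib I_Loc)
  have "I.fr (a \<odot> x) (n + m) = vscale (K.fr a n) (I.fr x m)" if "x \<in> carrier N" for a x n m
    using that unfolding I.fr_def K.fr_def powi_minus_add by (simp only: coord_smult' V.scale_scale mult_ac)
  then show "v \<in> L.E \<Longrightarrow> K.fib a \<odot>\<^bsub>Iso\<^esub> I.fib v = I.fib (vscale a v)"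
    unfolding isocrystal_of_def by (simp, intro K.UN_fib I.UN_fib) (simp_all add: I.p_frac_fib I_Loc)
  have "I.fr (Frob N x) n = vF (I.fr x n)" if "x \<in> carrier N" for x n
    using that unfolding I.fr_def by (simp add: vF_coord[symmetric] vF_scale)
  then show "v \<in> L.E \<Longrightarrow> Frob Iso (I.fib v) = I.fib (vF v)"
    unfolding isocrystal_of_def by (simp, intro I.UN_fib) (simp_all add: I.p_frac_fib I_Loc)
qed

lemma I_fib_inj: "inj_on I.fib L.E"
  using I.inj_fib by (simp add: I_Loc)

lemma transport_K:
  assumes P: "V.subspace P" "P \<subseteq> L.E"
  shows "module_transport vscale witt_field (Iso\<lparr>carrier := I.fib ` P\<rparr>) I.fib P (inv_into UNIV K.fib)"
proof -
  have i: "inv_into UNIV K.fib (K.fib a) = a" for a by (rule inv_f_f) (simp add: inj_def)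
  have E: "\<And>v. v \<in> P \<Longrightarrow> v \<in> L.E" using P by auto
  show ?thesis
  proof (intro module_transport.intro module_transport_axioms.intro)
    show "vector_space vscale" by (rule V.vector_space_axioms)
    show "cring (witt_field :: ('k witt \<times> nat) set ring)" using K_field by (simp add: field_def domain_def)
    show "inj_on I.fib P" using I_fib_inj P(2) inj_on_subset by blast
    show "- 1 \<in> inv_into UNIV K.fib ` carrier witt_field"
      by (rule image_eqI[of _ _ "K.fib (- 1)"]) (simp_all add: i K_simps)
  qed (use P in \<open>auto simp: E I_simps K_simps i V.subspace_0 V.subspace_add V.subspace_scale\<close>)
qed

lemma transport_W:
  assumes P: "V.subspace P" "P \<subseteq> L.E"
  shows "module_transport vscale witt_ring (restrict_to_W (Iso\<lparr>carrier := I.fib ` P\<rparr>)) I.fib P wemb"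
proof -
  have E: "\<And>v. v \<in> P \<Longrightarrow> v \<in> L.E" using P by auto
  have m: "wemb (wcoeff (- 1)) = - 1" by (simp add: wemb_def wi_simps)
  show ?thesis
  proof (intro module_transport.intro module_transport_axioms.intro)
    show "vector_space vscale" by (rule V.vector_space_axioms)
    show "cring (witt_ring :: 'k witt ring)" by (rule R.cring_axioms)
    show "inj_on I.fib P" using I_fib_inj P(2) inj_on_subset by blast
    show "- 1 \<in> wemb ` carrier (witt_ring :: 'k witt ring)"
      by (rule image_eqI[of _ _ "wcoeff (- 1)"]) (simp_all add: m)
  qed (use P in \<open>auto simp: restrict_to_W_def E I_simps K.p_frac_fib wemb_simps V.subspace_0 V.subspace_add V.subspace_scale\<close>)
qed

lemma span_K:
  assumes P: "V.subspace P" "P \<subseteq> L.E" and T: "T \<subseteq> P"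
  shows "LinearCombinations.module.span witt_field (Iso\<lparr>carrier := I.fib ` P\<rparr>) (I.fib ` T) = I.fib ` V.span T"
proof -
  interpret T: module_transport vscale witt_field "Iso\<lparr>carrier := I.fib ` P\<rparr>" I.fib P "inv_into UNIV K.fib" by (rule transport_K[OF P])
  have i: "inv_into UNIV K.fib (K.fib a) = a" for a by (rule inv_f_f) (simp add: inj_def)
  have "T.closed Y \<longleftrightarrow> V.subspace Y" for Y
    by (auto simp: T.closed_def V.subspace_def K_simps i)
  then show ?thesis unfolding T.span_image[OF T] V.span_def hull_def by simp
qed

lemma span_W:
  assumes P: "V.subspace P" "P \<subseteq> L.E" and T: "T \<subseteq> P"
  shows "LinearCombinations.module.span witt_ring (restrict_to_W (Iso\<lparr>carrier := I.fib ` P\<rparr>)) (I.fib ` T) = I.fib ` V.wspan T"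
proof -
  interpret T: module_transport vscale witt_ring "restrict_to_W (Iso\<lparr>carrier := I.fib ` P\<rparr>)" I.fib P wemb by (rule transport_W[OF P])
  have "T.closed Y \<longleftrightarrow> V.wsub Y" for Y
    unfolding T.closed_def V.wsub_def unfolding range_wemb[symmetric] by auto
  then show ?thesis unfolding T.span_image[OF T] V.wspan_def by simp
qed

lemma fib_subset_iff: "Y \<subseteq> L.E \<Longrightarrow> Z \<subseteq> L.E \<Longrightarrow> I.fib ` Y = I.fib ` Z \<longleftrightarrow> Y = Z"
  using inj_on_image_eq_iff[OF I_fib_inj] .

lemma wspan_sub: "V.subspace P \<Longrightarrow> T \<subseteq> P \<Longrightarrow> V.wspan T \<subseteq> P"
  by (intro V.wspan_minimal V.wsub_subspace)

lemma W_lattice_iff: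
  assumes P: "V.subspace P" "P \<subseteq> L.E"
  shows "W_lattice J (Iso\<lparr>carrier := I.fib ` P\<rparr>) \<longleftrightarrow>
    (\<exists>T. finite T \<and> T \<subseteq> P \<and> J = I.fib ` V.wspan T \<and> V.span T = P)"
proof -
  have sp: "V.span T \<subseteq> L.E" if "T \<subseteq> P" for T using V.span_minimal[OF that P(1)] P(2) by simp
  show ?thesis
  proof
    assume "W_lattice J (Iso\<lparr>carrier := I.fib ` P\<rparr>)"
    then obtain S where S: "finite S" "S \<subseteq> I.fib ` P"
      "J = LinearCombinations.module.span witt_ring (restrict_to_W (Iso\<lparr>carrier := I.fib ` P\<rparr>)) S"
      "LinearCombinations.module.span witt_field (Iso\<lparr>carrier := I.fib ` P\<rparr>) S = I.fib ` P"
      unfolding W_lattice_def by auto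
    obtain T where T: "finite T" "T \<subseteq> P" "I.fib ` T = S" using image_section[OF S(1,2)] .
    have "I.fib ` V.span T = I.fib ` P" using S(4) span_K[OF P T(2)] T(3) by simp
    then have "V.span T = P" using fib_subset_iff sp[OF T(2)] P(2) by blast
    moreover have "J = I.fib ` V.wspan T" using S(3) span_W[OF P T(2)] T(3) by simp
    ultimately show "\<exists>T. finite T \<and> T \<subseteq> P \<and> J = I.fib ` V.wspan T \<and> V.span T = P" using T by blast
  next
    assume "\<exists>T. finite T \<and> T \<subseteq> P \<and> J = I.fib ` V.wspan T \<and> V.span T = P"
    then obtain T where T: "finite T" "T \<subseteq> P" "J = I.fib ` V.wspan T" "V.span T = P" by blast
    then show "W_lattice J (Iso\<lparr>carrier := I.fib ` P\<rparr>)"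
      unfolding W_lattice_def by (intro exI[of _ "I.fib ` T"]) (auto simp: span_K[OF P T(2)] span_W[OF P T(2)])
  qed
qed

text \<open>Lattices of the record-based isocrystal are images of finitely generated
  \<open>W\<close>-spans, and the element \<open>p^s\<close> of \<open>K\<close> acts as scaling, so
  both notions of isoclinic agree on subspaces.\<close>

lemma isoclinic_iff:
  assumes P: "V.subspace P" "P \<subseteq> L.E"
  shows "isoclinic q (Iso\<lparr>carrier := I.fib ` P\<rparr>) \<longleftrightarrow> (\<exists>U. L.iso q U \<and> V.span U = P)"
proof -
  have Fn: "(Frob Iso ^^ t) (I.fib v) = I.fib ((vF ^^ t) v)" if "v \<in> L.E" for t v
    using that by (induction t) (simp_all add: I_simps L.Fn_E)
  have eq: "(Frob (Iso\<lparr>carrier := I.fib ` P\<rparr>) ^^ t) ` I.fib ` U =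
      (\<lambda>x. (([CHAR('k)] \<cdot>\<^bsub>witt_field\<^esub> \<one>\<^bsub>witt_field\<^esub>) [^]\<^bsub>witt_field\<^esub> (s::int)) \<odot>\<^bsub>Iso\<lparr>carrier := I.fib ` P\<rparr>\<^esub> x) ` I.fib ` U \<longleftrightarrow>
      (vF ^^ t) ` U = V.pe s U" if U: "U \<subseteq> L.E" for U s t
  proof -
    have "(Frob (Iso\<lparr>carrier := I.fib ` P\<rparr>) ^^ t) ` I.fib ` U = I.fib ` (vF ^^ t) ` U"
      unfolding image_image using Fn U by (intro image_cong) auto
    moreover have "(\<lambda>x. (([CHAR('k)] \<cdot>\<^bsub>witt_field\<^esub> \<one>\<^bsub>witt_field\<^esub>) [^]\<^bsub>witt_field\<^esub> s) \<odot>\<^bsub>Iso\<lparr>carrier := I.fib ` P\<rparr>\<^esub> x) ` I.fib ` U =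
        I.fib ` V.pe s U"
      unfolding image_image V.pe_image K_nat using U by (intro image_cong) (auto simp: K_powi p_fract_nz I_simps)
    moreover have "(vF ^^ t) ` U \<subseteq> L.E" using U L.Fn_E by auto
    moreover have "V.pe s U \<subseteq> L.E" using U L.subspace_E unfolding V.pe_image by (auto intro: V.subspace_scale)
    ultimately show ?thesis using fib_subset_iff by simp
  qed
  show ?thesis
  proof
    assume "isoclinic q (Iso\<lparr>carrier := I.fib ` P\<rparr>)"
    then obtain J s t where J: "W_lattice J (Iso\<lparr>carrier := I.fib ` P\<rparr>)" "t > 0" "q = of_int s / of_nat t"
      "(Frob (Iso\<lparr>carrier := I.fib ` P\<rparr>) ^^ t) ` J =
       (\<lambda>x. (([CHAR('k)] \<cdot>\<^bsub>witt_field\<^esub> \<one>\<^bsub>witt_field\<^esub>) [^]\<^bsub>witt_field\<^esub> (s::int)) \<odot>\<^bsub>Iso\<lparr>carrier := I.fib ` P\<rparr>\<^esub> x) ` J"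
      unfolding isoclinic_def by blast
    obtain T where T: "finite T" "T \<subseteq> P" "J = I.fib ` V.wspan T" "V.span T = P" using J(1) W_lattice_iff[OF P] by blast
    have TE: "T \<subseteq> L.E" "V.wspan T \<subseteq> L.E" using T P wspan_sub[OF P(1) T(2)] by auto
    have "(vF ^^ t) ` V.wspan T = V.pe s (V.wspan T)" by (rule iffD1[OF eq[OF TE(2)] J(4)[unfolded T(3)]])
    then have "L.iso q (V.wspan T)" unfolding L.iso_def using L.bd_wspan[OF T(1) TE(1)] J(2,3) by blast
    moreover have "V.span (V.wspan T) = P" using T(4) V.span_wspan by simp
    ultimately show "\<exists>U. L.iso q U \<and> V.span U = P" by blast
  next
    assume "\<exists>U. L.iso q U \<and> V.span U = P"
    then obtain U s t where U: "L.bd U" "0 < t" "q = of_int s / of_nat t" "(vF ^^ t) ` U = V.pe s U" "V.span U = P"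
      unfolding L.iso_def by blast
    obtain T where T: "finite T" "U = V.wspan T" using L.bd_basis[OF U(1)] by metis
    have UE: "U \<subseteq> L.E" using L.bd_E U(1) .
    have "T \<subseteq> P" "V.span T = P" using U(5) V.span_superset[of U] V.wspan_superset[of T] V.span_wspan[of T] T(2) by auto
    then have "W_lattice (I.fib ` U) (Iso\<lparr>carrier := I.fib ` P\<rparr>)" unfolding W_lattice_iff[OF P] using T by blast
    then show "isoclinic q (Iso\<lparr>carrier := I.fib ` P\<rparr>)"
      unfolding isoclinic_def using U(2,3,4) eq[OF UE] by blast
  qed
qed

lemma Iso_carrier: "Iso\<lparr>carrier := I.fib ` L.E\<rparr> = Iso"
  unfolding I_simps(1)[symmetric] by simp

text \<open>Each isoclinic subobject lies in \<open>SP q\<close>, and \<open>SP q\<close> is itself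
  one by \<open>SP_eq_span\<close>, so the union in the definition is attained.\<close>

lemma slope_part_eq: "slope_part q Iso = I.fib ` L.SP q"
proof (intro subset_antisym)
  interpret T: module_transport vscale witt_field Iso I.fib L.E "inv_into UNIV K.fib"
    using transport_K[OF L.subspace_E subset_refl] unfolding Iso_carrier .
  have i: "inv_into UNIV K.fib (K.fib a) = a" for a by (rule inv_f_f) (simp add: inj_def)
  have cl: "T.closed Y \<longleftrightarrow> V.subspace Y" for Y
    by (auto simp: T.closed_def V.subspace_def K_simps i)
  show "slope_part q Iso \<subseteq> I.fib ` L.SP q"
    unfolding slope_part_def
  proof (rule Union_least, elim CollectE conjE)
    fix P assume P: "LinearCombinations.submodule witt_field P Iso" "isoclinic q (Iso\<lparr>carrier := P\<rparr>)"
    then have "P \<subseteq> I.fib ` L.E" unfolding LinearCombinations.submodule_def I_simps by blast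
    then obtain Y where Y: "Y \<subseteq> L.E" "P = I.fib ` Y" by (auto simp: subset_image_iff)
    then have sY: "V.subspace Y" using P(1) T.submodule_iff[OF Y(1)] cl by simp
    then obtain U where "L.iso q U" "V.span U = Y" using P(2) isoclinic_iff[OF sY Y(1)] Y(2) by blast
    then show "P \<subseteq> I.fib ` L.SP q" unfolding Y(2) L.SP_def by blast
  qed
  have E: "L.SP q \<subseteq> L.E" by (rule L.SP_E)
  obtain U where "L.iso q U" "L.SP q = V.span U" using L.SP_eq_span by blast
  then have "isoclinic q (Iso\<lparr>carrier := I.fib ` L.SP q\<rparr>)" unfolding isoclinic_iff[OF L.subspace_SP E] by blast
  moreover have "LinearCombinations.submodule witt_field (I.fib ` L.SP q) Iso"
    unfolding T.submodule_iff[OF E] cl by (rule L.subspace_SP)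
  moreover have "Frob Iso ` I.fib ` L.SP q \<subseteq> I.fib ` L.SP q"
  proof (intro image_subsetI)
    fix x assume "x \<in> I.fib ` L.SP q"
    then obtain v where v: "x = I.fib v" "v \<in> L.SP q" by (rule imageE)
    then show "Frob Iso x \<in> I.fib ` L.SP q" using E L.SP_F[of v q] by (auto simp: I_simps)
  qed
  ultimately show "I.fib ` L.SP q \<subseteq> slope_part q Iso" unfolding slope_part_def by blast
qed

lemma dim_transport:
  assumes P: "V.subspace P" "P \<subseteq> L.E"
  shows "vectorspace.dim witt_field (Iso\<lparr>carrier := I.fib ` P\<rparr>) = V.dim P"
proof -
  interpret T: module_transport vscale witt_field "Iso\<lparr>carrier := I.fib ` P\<rparr>" I.fib P "inv_into UNIV K.fib" by (rule transport_K[OF P])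
  interpret k: vectorspace witt_field "Iso\<lparr>carrier := I.fib ` P\<rparr>"
    unfolding vectorspace_def using T.M_module K_field by blast
  obtain B where B: "B \<subseteq> P" "V.independent B" "P \<subseteq> V.span B" "card B = V.dim P"
    using V.basis_exists by blast
  have "finite B" using V.independent_span_bound[OF L.B_fin B(2)] B(1) P(2) by auto
  have sp: "V.span B = P" using B V.span_minimal[OF B(1) P(1)] by auto
  have inj: "inj_on I.fib P" using I_fib_inj P(2) inj_on_subset by blast
  show ?thesis
    unfolding k.dim_def
  proof (rule Least_equality)
    show "\<exists>A. finite A \<and> card A = V.dim P \<and> A \<subseteq> carrier (Iso\<lparr>carrier := I.fib ` P\<rparr>) \<and> k.gen_set A"
      using \<open>finite B\<close> B sp inj_on_subset[OF inj B(1)]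
      by (intro exI[of _ "I.fib ` B"]) (auto simp: span_K[OF P B(1)] card_image)
  next
    fix n assume "\<exists>A. finite A \<and> card A = n \<and> A \<subseteq> carrier (Iso\<lparr>carrier := I.fib ` P\<rparr>) \<and> k.gen_set A"
    then obtain A where A: "finite A" "card A = n" "A \<subseteq> I.fib ` P" "k.span A = I.fib ` P" by auto
    obtain T where T: "finite T" "T \<subseteq> P" "inj_on I.fib T" "I.fib ` T = A" "card T = card A" using image_section[OF A(1,3)] .
    have "I.fib ` V.span T = I.fib ` P" using A(4) span_K[OF P T(2)] T(4) by simp
    then have "P \<subseteq> V.span T" using fib_subset_iff[of "V.span T" P] V.span_minimal[OF T(2) P(1)] P(2) by blast
    then show "V.dim P \<le> n" using V.dim_le_card[OF _ T(1)] T(5) A(2) by simp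
  qed
qed

lemma slope_mult_eq: "slope_mult Iso q = V.dim (L.SP q)"
  unfolding slope_mult_def slope_part_eq by (rule dim_transport[OF L.subspace_SP L.SP_E])

lemma slope_set_eq: "{q. slope_mult Iso q \<noteq> 0} = L.slope_set"
proof -
  have *: "V.dim P = 0 \<longleftrightarrow> P = {0}" if P: "V.subspace P" "P \<subseteq> L.E" for P
  proof
    obtain B where B: "B \<subseteq> P" "V.independent B" "P \<subseteq> V.span B" "card B = V.dim P"
      using V.basis_exists by blast
    have "finite B" using V.independent_span_bound[OF L.B_fin B(2)] B(1) P(2) by auto
    assume "V.dim P = 0"
    then have "B = {}" using B(4) \<open>finite B\<close> by simp
    then show "P = {0}" using B(3) V.subspace_0[OF P(1)] by auto
  next
    assume "P = {0}"
    then show "V.dim P = 0" using V.dim_le_card[of P "{}"] by simp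
  qed
  then show ?thesis unfolding slope_mult_eq L.slope_set_def using *[OF L.subspace_SP L.SP_E] by simp
qed

lemma slopes_eq: "slopes Iso = (\<Sum>q\<in>L.slope_set. replicate_mset (V.dim (L.SP q)) q)"
  unfolding slopes_def slope_set_eq unfolding slope_mult_eq ..

lemma sum_mset_filter_replicate:
  fixes h :: "rat \<Rightarrow> rat"
  assumes "finite A"
  shows "(\<Sum>q\<in>#filter_mset Pr (\<Sum>q\<in>A. replicate_mset (\<mu> q) q). h q) = (\<Sum>q\<in>A. if Pr q then of_nat (\<mu> q) * h q else 0)"
  using assms
proof induction
  case (insert x A)
  have "filter_mset Pr (replicate_mset n x) = (if Pr x then replicate_mset n x else {#})" for n
    by (induction n) auto
  moreover have "(\<Sum>q\<in>#replicate_mset n x. h q) = of_nat n * h x" for n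
    by (induction n) (simp_all add: algebra_simps)
  ultimately show ?case using insert by simp
qed simp

theorem slope_sum:
  "(\<Sum>q\<in>#{#q \<in># slopes Iso. q \<le> of_int c#}. of_int c - q) =
    of_int (max c 0 * int (dim_mod_tors_Ver N) + max (c - 1) 0 * int (dim_mod_tors_Frob N))"
proof -
  let ?\<mu> = "\<lambda>q. V.dim (L.SP q)"
  have "(\<Sum>q\<in>#{#q \<in># slopes Iso. q \<le> of_int c#}. of_int c - q) =
      (\<Sum>q\<in>L.slope_set. if q \<le> of_int c then of_nat (?\<mu> q) * (of_int c - q) else 0)"
    unfolding slopes_eq by (rule sum_mset_filter_replicate[OF L.slope_count(1)])
  also have "\<dots> = of_int (max c 0 * int (dim_mod_tors_Ver N) + max (c - 1) 0 * int (dim_mod_tors_Frob N))"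
  proof (cases "c \<ge> 1")
    case True
    have "q \<le> of_int c" if "q \<in> L.slope_set" for q
    proof -
      have "q \<le> 1" using L.slope_count(2)[OF that] by simp
      also have "1 \<le> (of_int c :: rat)" using True by simp
      finally show ?thesis .
    qed
    then have "(\<Sum>q\<in>L.slope_set. if q \<le> of_int c then of_nat (?\<mu> q) * (of_int c - q) else 0) =
        (\<Sum>q\<in>L.slope_set. of_int c * of_nat (?\<mu> q) - q * of_nat (?\<mu> q))"
      by (intro sum.cong) (auto simp: algebra_simps)
    also have "\<dots> = of_int c * of_nat (\<Sum>q\<in>L.slope_set. ?\<mu> q) - (\<Sum>q\<in>L.slope_set. q * of_nat (?\<mu> q))"
      by (simp add: sum_subtractf sum_distrib_left)
    also have "\<dots> = of_int c * of_nat (dim_mod_tors_Frob N + dim_mod_tors_Ver N) - of_nat (dim_mod_tors_Frob N)"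
      unfolding L.slope_count(3,4) dim_mod_tors ..
    finally show ?thesis using True by (simp add: algebra_simps)
  next
    case False
    \<comment> \<open>For \<open>c \<le> 0\<close> only the slope 0 with \<open>c = 0\<close> passes
      the condition, and its weight \<open>c - q\<close> is 0.\<close>
    have "of_nat (?\<mu> q) * (of_int c - q) = 0" if "q \<in> L.slope_set" "q \<le> of_int c" for q
    proof -
      have "(of_int c :: rat) \<le> 0" using False by simp
      then have "of_int c = q" using that L.slope_count(2)[of q] by linarith
      then show ?thesis by simp
    qed
    then have "(\<Sum>q\<in>L.slope_set. if q \<le> of_int c then of_nat (?\<mu> q) * (of_int c - q) else 0) = 0"
      by (intro sum.neutral) auto
    then show ?thesis using False by simp
  qed
  finally show ?thesis .
qed

text \<open>Ensures that the dimensions and slopes summed in the theorem have finite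
  support.\<close>

lemma slopes_trivial:
  assumes "carrier N = {\<zero>}"
  shows "dim_mod_tors_Frob N = 0" "dim_mod_tors_Ver N = 0" "slopes Iso = {#}"
proof -
  have c0: "coord \<zero> = 0" using coord_0_iff[of \<zero>] torsion_iff[of \<zero>] by simp
  have X: "coord ` carrier N = {0}" using c0 by (simp add: assms)
  have FX: "vF ` {0} = {0}" using L.F_0 by simp
  have "V.mingens {0} {0} = 0" unfolding V.mingens_def
    by (rule Least_eq_0) (auto simp: V.ssum_def intro!: exI[of _ "{}"])
  moreover have "V.pe 1 {0} = {0}" by (simp add: V.pe_image)
  ultimately show d: "dim_mod_tors_Frob N = 0" "dim_mod_tors_Ver N = 0" unfolding dim_mod_tors X FX by simp_all
  have "(\<Sum>q\<in>L.slope_set. V.dim (L.SP q)) = 0" using d L.slope_count(3) unfolding dim_mod_tors by simp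
  then have "(\<Sum>q\<in>L.slope_set. replicate_mset (V.dim (L.SP q)) q) = {#}"
    using L.slope_count(1) by (intro sum.neutral) simp
  then show "slopes Iso = {#}" unfolding slopes_eq .
qed

end

section \<open>Coherent modules have components of finite rank\<close>

context perfect_dieudonne
begin

text \<open>Like \<open>Ver_nil_sub\<close>, a version relative to a submodule, so that finiteness
  can be propagated along a filtration of a fixed component.\<close>

definition finite_rank_sub :: "'m set \<Rightarrow> bool" where
  "finite_rank_sub Z \<longleftrightarrow> (\<exists>S m. finite S \<and> S \<subseteq> Z \<and> (\<forall>x\<in>Z. [(CHAR('k) ^ m)] \<cdot> x \<in> span S))"

definition Ver_nil_sub :: "'m set \<Rightarrow> bool" where
  "Ver_nil_sub Z \<longleftrightarrow> (\<forall>x\<in>Z. \<forall>c. \<exists>n0. \<forall>n\<ge>n0. \<exists>y\<in>Z. \<exists>e.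
    [(CHAR('k) ^ e)] \<cdot> ((Ver N ^^ n) x) = [(CHAR('k) ^ e)] \<cdot> ([(CHAR('k) ^ c)] \<cdot> y))"

lemma Ver_pow_add: "x \<in> carrier N \<Longrightarrow> y \<in> carrier N \<Longrightarrow> (Ver N ^^ n) (x \<oplus> y) = (Ver N ^^ n) x \<oplus> (Ver N ^^ n) y"
  by (induction n) (simp_all add: Ver_add)

lemma Ver_pow_nat: "x \<in> carrier N \<Longrightarrow> (Ver N ^^ n) ([(m::nat)] \<cdot> x) = [m] \<cdot> (Ver N ^^ n) x"
  by (induction n) (simp_all add: Ver_nat)

lemma submodule_nat:
  assumes "LinearCombinations.submodule witt_ring Z N" "x \<in> Z"
  shows "[(n::nat)] \<cdot> x \<in> Z"
proof -
  interpret Z: LinearCombinations.submodule witt_ring Z N by fact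
  show ?thesis using assms(2) Z.subset by (subst nat_smult) auto
qed

lemma finite_dieudonneI: "finite_rank_sub (carrier N) \<Longrightarrow> Ver_nil_sub (carrier N) \<Longrightarrow> finite_dieudonne N"
  unfolding finite_rank_sub_def Ver_nil_sub_def by unfold_locales blast+

lemma finite_rank_zero: "finite_rank_sub {\<zero>}" and Ver_nil_zero: "Ver_nil_sub {\<zero>}"
proof -
  have "\<zero> \<in> span {}" using span_is_submodule[of "{}"] by (simp add: LinearCombinations.submodule_def)
  then show "finite_rank_sub {\<zero>}" unfolding finite_rank_sub_def by (intro exI[of _ "{}"]) simp
  have "(Ver N ^^ n) \<zero> = \<zero>" for n by (induction n) simp_all
  then show "Ver_nil_sub {\<zero>}" unfolding Ver_nil_sub_def by simp
qed

end

context dieudonne_subquotient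
begin

text \<open>If \<open>p B \<subseteq> A\<close>, the properties of \<open>A\<close> applied to
  \<open>p x\<close> give those of \<open>B\<close> at the cost of one more factor \<open>p\<close>;
  this handles type II quotients.\<close>

lemma devissage_killed:
  assumes p: "\<And>x. x \<in> B \<Longrightarrow> [CHAR('k)] \<cdot> x \<in> A"
  shows "finite_rank_sub A \<Longrightarrow> finite_rank_sub B" "Ver_nil_sub A \<Longrightarrow> Ver_nil_sub B"
proof -
  assume "finite_rank_sub A"
  then obtain S m where S: "finite S" "S \<subseteq> A" "\<And>x. x \<in> A \<Longrightarrow> [(CHAR('k) ^ m)] \<cdot> x \<in> span S"
    unfolding finite_rank_sub_def by blast
  have "[(CHAR('k) ^ (m + 1))] \<cdot> x \<in> span S" if x: "x \<in> B" for x
    using S(3)[OF p[OF x]] p_pow_pow[OF B_car[OF x], of "CHAR('k)" m 1] by simp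
  then show "finite_rank_sub B" unfolding finite_rank_sub_def using S A_B by blast
next
  assume A: "Ver_nil_sub A"
  show "Ver_nil_sub B"
    unfolding Ver_nil_sub_def
  proof (intro ballI allI)
    fix x c assume x: "x \<in> B"
    note xc = B_car[OF x]
    \<comment> \<open>The exponent \<open>c + 1\<close> compensates for the factor \<open>p\<close>
      in front of \<open>x\<close>.\<close>
    obtain n0 where n0: "\<And>n. n \<ge> n0 \<Longrightarrow> \<exists>y\<in>A. \<exists>e. [(CHAR('k) ^ e)] \<cdot> ((Ver N ^^ n) ([CHAR('k)] \<cdot> x)) =
        [(CHAR('k) ^ e)] \<cdot> ([(CHAR('k) ^ (c + 1))] \<cdot> y)"
      using A p[OF x] unfolding Ver_nil_sub_def by blast
    have "\<exists>y\<in>B. \<exists>e. [(CHAR('k) ^ e)] \<cdot> ((Ver N ^^ n) x) = [(CHAR('k) ^ e)] \<cdot> ([(CHAR('k) ^ c)] \<cdot> y)" if n: "n \<ge> n0" for n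
    proof -
      obtain y e where y: "y \<in> A" "[(CHAR('k) ^ e)] \<cdot> ((Ver N ^^ n) ([CHAR('k)] \<cdot> x)) =
        [(CHAR('k) ^ e)] \<cdot> ([(CHAR('k) ^ (c + 1))] \<cdot> y)" using n0[OF n] by blast
      have yc: "y \<in> carrier N" using y A_car by blast
      have "[(CHAR('k) ^ (e + 1))] \<cdot> ((Ver N ^^ n) x) = [(CHAR('k) ^ e)] \<cdot> ((Ver N ^^ n) ([CHAR('k)] \<cdot> x))"
        using xc p_pow_pow[of "(Ver N ^^ n) x" "CHAR('k)" e 1] by (simp add: Ver_pow_nat)
      also have "\<dots> = [(CHAR('k) ^ (e + 1))] \<cdot> ([(CHAR('k) ^ c)] \<cdot> y)"
        unfolding y(2) p_pow_pow[OF yc] by (simp add: add.commute add.left_commute)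
      finally show ?thesis using y(1) A_B by blast
    qed
    then show "\<exists>n0. \<forall>n\<ge>n0. \<exists>y\<in>B. \<exists>e. [(CHAR('k) ^ e)] \<cdot> ((Ver N ^^ n) x) = [(CHAR('k) ^ e)] \<cdot> ([(CHAR('k) ^ c)] \<cdot> y)"
      by blast
  qed
qed

lemma devissage_fin_gen:
  assumes S: "finite S" "S \<subseteq> B" "\<And>x. x \<in> B \<Longrightarrow> \<exists>y\<in>span S. x \<ominus> y \<in> A" and A: "finite_rank_sub A"
  shows "finite_rank_sub B"
proof -
  obtain T m where T: "finite T" "T \<subseteq> A" "\<And>x. x \<in> A \<Longrightarrow> [(CHAR('k) ^ m)] \<cdot> x \<in> span T"
    using A unfolding finite_rank_sub_def by blast
  let ?U = "span (S \<union> T)"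
  have sub: "LinearCombinations.submodule witt_ring ?U N"
    using S(2) T(2) A_car B_car by (intro span_is_submodule) auto
  interpret U: LinearCombinations.submodule witt_ring ?U N by (rule sub)
  have "[(CHAR('k) ^ m)] \<cdot> x \<in> ?U" if x: "x \<in> B" for x
  proof -
    obtain y where y: "y \<in> span S" "x \<ominus> y \<in> A" using S(3)[OF x] by blast
    have yU: "y \<in> ?U" using y(1) span_is_monotone[of S "S \<union> T"] by blast
    then have c: "y \<in> carrier N" "x \<in> carrier N" using U.subset B_car x by auto
    have "[(CHAR('k) ^ m)] \<cdot> (x \<ominus> y) \<in> ?U" using T(3)[OF y(2)] span_is_monotone[of T "S \<union> T"] by blast
    then have "[(CHAR('k) ^ m)] \<cdot> (x \<ominus> y) \<oplus> [(CHAR('k) ^ m)] \<cdot> y \<in> ?U"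
      using submodule_nat[OF sub yU] by (rule U.m_closed)
    moreover have "[(CHAR('k) ^ m)] \<cdot> (x \<ominus> y) \<oplus> [(CHAR('k) ^ m)] \<cdot> y = [(CHAR('k) ^ m)] \<cdot> x"
      using c by (subst nat_pow_add[symmetric]) (simp_all add: a_minus_def M.a_assoc M.l_neg)
    ultimately show ?thesis by simp
  qed
  then show ?thesis unfolding finite_rank_sub_def using S T A_B by (intro exI[of _ "S \<union> T"]) auto
qed

text \<open>Nilpotence on the quotient is used at a single exponent \<open>n1\<close>, where
  \<open>V^n1 x = z + p^c y\<close> with \<open>z\<close> in \<open>A\<close>. Later powers of
  \<open>V\<close> keep the second term divisible by \<open>p^c\<close>, and nilpotence on
  \<open>A\<close> takes care of \<open>z\<close>.\<close>

lemma devissage_top_nilpotent: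
  assumes V: "\<And>x. x \<in> B \<Longrightarrow> Ver N x \<in> B"
    and nil: "\<And>x c. x \<in> B \<Longrightarrow> \<exists>n. \<exists>y\<in>B. (Ver N ^^ n) x \<ominus> [(CHAR('k) ^ c)] \<cdot> y \<in> A" and A: "Ver_nil_sub A"
  shows "Ver_nil_sub B"
  unfolding Ver_nil_sub_def
proof (intro ballI allI)
  fix x c assume x: "x \<in> B"
  have Vn: "(Ver N ^^ n) y \<in> B" if "y \<in> B" for n y using that V by (induction n) simp_all
  obtain n1 y where y: "y \<in> B" "(Ver N ^^ n1) x \<ominus> [(CHAR('k) ^ c)] \<cdot> y \<in> A" using nil[OF x] by blast
  define z where "z = (Ver N ^^ n1) x \<ominus> [(CHAR('k) ^ c)] \<cdot> y"
  have zA: "z \<in> A" using y(2) by (simp only: z_def)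
  note c = B_car[OF x] B_car[OF y(1)] A_car[OF zA]
  obtain n0 where n0: "\<And>n. n \<ge> n0 \<Longrightarrow> \<exists>w\<in>A. \<exists>e. [(CHAR('k) ^ e)] \<cdot> ((Ver N ^^ n) z) =
      [(CHAR('k) ^ e)] \<cdot> ([(CHAR('k) ^ c)] \<cdot> w)"
    using A zA unfolding Ver_nil_sub_def by blast
  have "\<exists>y\<in>B. \<exists>e. [(CHAR('k) ^ e)] \<cdot> ((Ver N ^^ n) x) = [(CHAR('k) ^ e)] \<cdot> ([(CHAR('k) ^ c)] \<cdot> y)" if n: "n \<ge> n0 + n1" for n
  proof -
    define k where "k = n - n1"
    have k: "n = k + n1" "k \<ge> n0" using n by (simp_all add: k_def)
    obtain w e where w: "w \<in> A" "[(CHAR('k) ^ e)] \<cdot> ((Ver N ^^ k) z) = [(CHAR('k) ^ e)] \<cdot> ([(CHAR('k) ^ c)] \<cdot> w)"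
      using n0[OF k(2)] by blast
    have wc: "w \<in> carrier N" "w \<in> B" using w A_car A_B by auto
    have "(Ver N ^^ n1) x = z \<oplus> [(CHAR('k) ^ c)] \<cdot> y" using c by (simp add: z_def a_minus_def M.a_assoc M.l_neg)
    then have "(Ver N ^^ n) x = (Ver N ^^ k) z \<oplus> [(CHAR('k) ^ c)] \<cdot> (Ver N ^^ k) y"
      using c unfolding k(1) funpow_add comp_def by (simp only: Ver_pow_add Ver_pow_nat M.add.nat_pow_closed)
    then have "[(CHAR('k) ^ e)] \<cdot> ((Ver N ^^ n) x) = [(CHAR('k) ^ e)] \<cdot> ([(CHAR('k) ^ c)] \<cdot> w) \<oplus> [(CHAR('k) ^ e)] \<cdot> ([(CHAR('k) ^ c)] \<cdot> (Ver N ^^ k) y)"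
      using c by (simp only: nat_pow_add Ver_pow_closed M.add.nat_pow_closed w(2))
    also have "\<dots> = [(CHAR('k) ^ e)] \<cdot> ([(CHAR('k) ^ c)] \<cdot> (w \<oplus> (Ver N ^^ k) y))"
      using c wc by (simp only: nat_pow_add Ver_pow_closed M.add.nat_pow_closed)
    finally show ?thesis using B_closed(2)[OF wc(2) Vn[OF y(1), of k]] by blast
  qed
  then show "\<exists>n0. \<forall>n\<ge>n0. \<exists>y\<in>B. \<exists>e. [(CHAR('k) ^ e)] \<cdot> ((Ver N ^^ n) x) = [(CHAR('k) ^ e)] \<cdot> ([(CHAR('k) ^ c)] \<cdot> y)"
    by blast
qed

lemma fin_gen_quotient:
  assumes "fin_gen witt_ring Q"
  obtains S where "finite S" "S \<subseteq> B" "\<And>x. x \<in> B \<Longrightarrow> \<exists>y\<in>span S. x \<ominus> y \<in> A"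
proof -
  interpret Q: Module.module witt_ring Q by (rule Q_module)
  obtain S' where S': "finite S'" "S' \<subseteq> (\<lambda>x. A +> x) ` B" "Q.span S' = carrier Q"
    using assms unfolding fin_gen_def by auto
  obtain S where S: "finite S" "S \<subseteq> B" "(\<lambda>x. A +> x) ` S = S'" using image_section[OF S'(1,2)] .
  have SN: "S \<subseteq> carrier N" using S(2) B_car by auto
  interpret S: LinearCombinations.submodule witt_ring "span S" N by (rule span_is_submodule[OF SN])
  have SB: "span S \<subseteq> B" by (rule span_is_subset[OF S(2) B_sub])
  let ?D = "(\<lambda>x. A +> x) ` span S"
  have "LinearCombinations.submodule witt_ring ?D Q"
  proof (unfold_locales, goal_cases)
    case 1
    then show ?case using SB by auto
  next
    case (2 v w)
    then obtain x y where "v = A +> x" "x \<in> span S" "w = A +> y" "y \<in> span S" by (elim imageE) simp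
    then show ?case using SB S.m_closed by (auto simp: Q_add subset_iff)
  next
    case 3
    then show ?case using A.a_rcos_const[OF A_closed(1)] S.zero_closed by (auto intro!: image_eqI[of _ _ \<zero>])
  next
    case (4 c v)
    then obtain x where "v = A +> x" "x \<in> span S" by (elim imageE) simp
    then show ?case using SB S.smult_closed by (auto simp: Q_smult subset_iff)
  qed
  moreover have "S' \<subseteq> ?D" using S(3) in_own_span[OF SN] by auto
  ultimately have sp: "carrier Q \<subseteq> ?D" unfolding S'(3)[symmetric] by (intro Q.span_is_subset)
  have "\<exists>y\<in>span S. x \<ominus> y \<in> A" if x: "x \<in> B" for x
  proof -
    have "A +> x \<in> ?D" using sp x by auto
    then obtain y where y: "A +> x = A +> y" "y \<in> span S" by (rule imageE)
    then have "x \<ominus> y \<in> A" using coset_eq[of x y] B_car[OF x] B_car[of y] SB by auto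
    then show ?thesis using y(2) by blast
  qed
  then show ?thesis using that S by blast
qed

lemma top_nilpotent_quotient:
  assumes nil: "Ver_top_nilpotent Q" and V: "\<And>x. x \<in> B \<Longrightarrow> Ver N x \<in> B" "\<And>x. x \<in> A \<Longrightarrow> Ver N x \<in> A" and x: "x \<in> B"
  shows "\<exists>n. \<exists>y\<in>B. (Ver N ^^ n) x \<ominus> [(CHAR('k) ^ c)] \<cdot> y \<in> A"
proof -
  obtain n where n: "(Ver Q ^^ n) ` carrier Q \<subseteq> (\<lambda>x. [(CHAR('k) ^ c)] \<cdot>\<^bsub>Q\<^esub> x) ` carrier Q"
    using spec[OF nil[unfolded Ver_top_nilpotent_def], of c] by auto
  have Vn: "(Ver Q ^^ n) (A +> x) = A +> (Ver N ^^ n) x \<and> (Ver N ^^ n) x \<in> B" for n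
    using x by (induction n) (simp_all add: Q_Ver V)
  have "A +> x \<in> carrier Q" using x by simp
  then have "(Ver Q ^^ n) (A +> x) \<in> (\<lambda>x. [(CHAR('k) ^ c)] \<cdot>\<^bsub>Q\<^esub> x) ` carrier Q"
    by (intro subsetD[OF n] imageI)
  then obtain y where y: "y \<in> B" "A +> (Ver N ^^ n) x = [(CHAR('k) ^ c)] \<cdot>\<^bsub>Q\<^esub> (A +> y)" using Vn by auto
  then have "A +> (Ver N ^^ n) x = A +> ([(CHAR('k) ^ c)] \<cdot> y)" using Q_nat by simp
  then have "(Ver N ^^ n) x \<ominus> [(CHAR('k) ^ c)] \<cdot> y \<in> A"
    using coset_eq B_car Vn[of n] y(1) by simp
  then show ?thesis using y(1) by blast
qed

lemma trivial_quotient: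
  assumes "carrier Q \<subseteq> {X}"
  shows "B \<subseteq> A"
proof
  fix x assume x: "x \<in> B"
  have "A +> x = X" "A +> \<zero> = X" using assms x B_closed(1) by auto
  then have "A +> x = A" using A.a_rcos_const[OF A_closed(1)] by simp
  then show "x \<in> A" using coset_zero B_car[OF x] by simp
qed

text \<open>In \<open>U_l\<close> a Witt vector acts through component 0, and component 0 of
  \<open>p\<close> vanishes.\<close>

lemma killed_quotient:
  assumes inj: "inj_on f (carrier Q)" and f: "\<And>X a. X \<in> carrier Q \<Longrightarrow> f (a \<odot>\<^bsub>Q\<^esub> X) = (\<lambda>n. a 0 * f X n)" and x: "x \<in> B"
  shows "[CHAR('k)] \<cdot> x \<in> A"
proof -
  have "\<exists>w. (of_nat CHAR('k) :: 'k wt) = 0 + of_nat CHAR('k) ^ 1 * w" by (rule exI[of _ 1]) simp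
  then have "\<forall>i<1. wcoeff (of_nat CHAR('k) :: 'k wt) i = wcoeff 0 i"
    using wcoeff_eq_iff[OF perfect, of 1 "of_nat CHAR('k)" 0] by blast
  then have z: "wcoeff (of_nat CHAR('k)) 0 = (0 :: 'k)" "\<zero>\<^bsub>witt_ring\<^esub> 0 = (0 :: 'k)"
    by (simp_all add: zero_wt_def witt_ring_def)
  have Q: "A +> x \<in> carrier Q" using x by simp
  have "f (wcoeff (of_nat CHAR('k)) \<odot>\<^bsub>Q\<^esub> (A +> x)) = f (\<zero>\<^bsub>witt_ring\<^esub> \<odot>\<^bsub>Q\<^esub> (A +> x))"
    using f[OF Q] z by simp
  then have "f (A +> ([CHAR('k)] \<cdot> x)) = f (A +> \<zero>)"
    using x B_car[OF x] by (simp add: Q_smult nat_smult)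
  then have "A +> ([CHAR('k)] \<cdot> x) = A +> \<zero>"
    using x B_closed submodule_nat[OF B_sub x] by (intro inj_onD[OF inj]) auto
  then show ?thesis using coset_zero[of "[CHAR('k)] \<cdot> x"] A.a_rcos_const[OF A_closed(1)] B_car[OF x] by simp
qed

end

lemma elementary_II_E:
  fixes M :: "(('k::field_prime_char) witt, 'm) graded_module"
  assumes "elementary_II M"
  obtains l f where
    "\<And>j. bij_betw (f j) (carrier (gr_comp M j)) (carrier (U_comp l j :: ('k witt, _) fv_module))"
    "\<And>j x a. x \<in> carrier (gr_comp M j) \<Longrightarrow> f j (a \<odot>\<^bsub>gr_comp M j\<^esub> x) = (\<lambda>n. a 0 * f j x n)"
proof -
  obtain l where "gr_isomorphic M (U_module l)" using assms unfolding elementary_II_def by blast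
  then obtain f where
    f: "\<And>j. bij_betw (f j) (carrier (gr_comp M j)) (carrier (gr_comp (U_module l :: ('k witt, _) graded_module) j))"
    "\<And>j x a. x \<in> carrier (gr_comp M j) \<Longrightarrow> f j (a \<odot>\<^bsub>gr_comp M j\<^esub> x) = a \<odot>\<^bsub>gr_comp (U_module l) j\<^esub> f j x"
    unfolding gr_isomorphic_def by blast
  show ?thesis
    by (rule that[of f l]) (use f in \<open>simp_all add: U_module_def U_comp_def\<close>)
qed

context
  fixes H :: "(('k::field_prime_char) witt, 'm) graded_module"
  assumes perfect: "surj (\<lambda>x::'k. x ^ CHAR('k))" and H: "coherent H"
begin

lemma comp_perfect: "perfect_dieudonne (gr_comp H i)"
  using H raynaud_module.comp_dieudonne perfect
  unfolding coherent_def perfect_dieudonne_def perfect_dieudonne_axioms_def by blast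

text \<open>The effect of one elementary quotient living in degrees \<open>e\<close> and
  \<open>e + 1\<close>: nothing grows in other degrees, which yields finite support, and the two
  finiteness conditions are inherited.\<close>

definition step :: "(int \<Rightarrow> 'm set) \<Rightarrow> (int \<Rightarrow> 'm set) \<Rightarrow> bool" where
  "step A B \<longleftrightarrow> (\<exists>e. \<forall>i. (i \<notin> {e, e + 1} \<longrightarrow> B i \<subseteq> A i) \<and>
      (perfect_dieudonne.finite_rank_sub (gr_comp H i) (A i) \<longrightarrow> perfect_dieudonne.finite_rank_sub (gr_comp H i) (B i)) \<and>
      (perfect_dieudonne.Ver_nil_sub (gr_comp H i) (A i) \<longrightarrow> perfect_dieudonne.Ver_nil_sub (gr_comp H i) (B i)))"

lemma step_elementary:
  assumes A: "graded_submodule A H" and B: "graded_submodule B H" and AB: "\<And>i. A i \<subseteq> B i"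
    and e: "elementary_I (shift e (gr_subquot H B A)) \<or> elementary_II (shift e (gr_subquot H B A))"
  shows "step A B"
  unfolding step_def
proof (rule exI[of _ e], rule allI)
  fix i
  let ?Q = "gr_subquot H B A"
  have sub: "LinearCombinations.submodule witt_ring (A i) (gr_comp H i)" "LinearCombinations.submodule witt_ring (B i) (gr_comp H i)"
    "\<And>x. x \<in> A i \<Longrightarrow> Ver (gr_comp H i) x \<in> A i" "\<And>x. x \<in> B i \<Longrightarrow> Ver (gr_comp H i) x \<in> B i"
    using spec[OF A[unfolded graded_submodule_def], of i] spec[OF B[unfolded graded_submodule_def], of i] by auto
  interpret Q: dieudonne_subquotient "gr_comp H i" "A i" "B i"
    by (intro dieudonne_subquotient.intro comp_perfect dieudonne_subquotient_axioms.intro sub AB)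
  have comp: "gr_comp (shift e ?Q) (i - e) = Q.Q"
    by (simp add: shift_def gr_subquot_def)
  show "(i \<notin> {e, e + 1} \<longrightarrow> B i \<subseteq> A i) \<and> (Q.finite_rank_sub (A i) \<longrightarrow> Q.finite_rank_sub (B i)) \<and>
      (Q.Ver_nil_sub (A i) \<longrightarrow> Q.Ver_nil_sub (B i))"
    using e
  proof
    assume I: "elementary_I (shift e ?Q)"
    show ?thesis
    proof (cases "i = e")
      case True
      have "gr_comp (shift e ?Q) 0 = Q.Q" using comp True by simp
      then have fg: "fin_gen witt_ring Q.Q" and nil: "Ver_top_nilpotent Q.Q" using I by (simp_all add: elementary_I_def)
      obtain S where S: "finite S" "S \<subseteq> B i" "\<And>x. x \<in> B i \<Longrightarrow> \<exists>y\<in>Q.span S. x \<ominus>\<^bsub>gr_comp H i\<^esub> y \<in> A i"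
        by (rule Q.fin_gen_quotient[OF fg], rule that)
      show ?thesis
        using True Q.devissage_fin_gen[OF S] Q.devissage_top_nilpotent[OF sub(4) Q.top_nilpotent_quotient[OF nil sub(4,3)]]
        by blast
    next
      case False
      then have "i - e \<noteq> 0" by simp
      then have "carrier (gr_comp (shift e ?Q) (i - e)) = {\<zero>\<^bsub>gr_comp (shift e ?Q) (i - e)\<^esub>}"
        using I unfolding elementary_I_def by blast
      then have "B i \<subseteq> A i" unfolding comp by (intro Q.trivial_quotient[of "\<zero>\<^bsub>Q.Q\<^esub>"]) (rule equalityD1)
      then have "B i = A i" using AB by blast
      then show ?thesis by simp
    qed
  next
    assume "elementary_II (shift e ?Q)"
    then obtain l f where f: "\<And>j. bij_betw (f j) (carrier (gr_comp (shift e ?Q) j)) (carrier (U_comp l j :: ('k witt, _) fv_module))"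
      "\<And>j x a. x \<in> carrier (gr_comp (shift e ?Q) j) \<Longrightarrow> f j (a \<odot>\<^bsub>gr_comp (shift e ?Q) j\<^esub> x) = (\<lambda>n. a 0 * f j x n)"
      by (rule elementary_II_E) blast
    have bij: "bij_betw (f (i - e)) (carrier Q.Q) (carrier (U_comp l (i - e) :: ('k witt, _) fv_module))"
      using f(1)[of "i - e"] unfolding comp .
    then have inj: "inj_on (f (i - e)) (carrier Q.Q)" by (rule bij_betw_imp_inj_on)
    have "f (i - e) (a \<odot>\<^bsub>Q.Q\<^esub> X) = (\<lambda>n. a 0 * f (i - e) X n)" if "X \<in> carrier Q.Q" for X a
      using f(2)[of X "i - e" a, unfolded comp, OF that] .
    then have k: "\<And>x. x \<in> B i \<Longrightarrow> [CHAR('k)] \<cdot>\<^bsub>gr_comp H i\<^esub> x \<in> A i"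
      by (rule Q.killed_quotient[OF inj])
    have "B i \<subseteq> A i" if i: "i \<notin> {e, e + 1}"
    proof -
      have "carrier (U_comp l (i - e) :: ('k witt, _) fv_module) = {\<lambda>n. 0}"
        using i by (simp add: U_comp_def)
      then have im: "f (i - e) ` carrier Q.Q = {\<lambda>n. 0}" using bij by (simp add: bij_betw_def)
      have z: "A i \<in> carrier Q.Q" using Q.Q_module Q.Q_simps(2) by (metis Module.module_def abelian_group.axioms(1) abelian_monoid.zero_closed)
      have "X = A i" if X: "X \<in> carrier Q.Q" for X
      proof (rule inj_onD[OF inj _ X z])
        have "f (i - e) X \<in> {\<lambda>n. 0}" unfolding im[symmetric] by (rule imageI[OF X])
        moreover have "f (i - e) (A i) \<in> {\<lambda>n. 0}" unfolding im[symmetric] by (rule imageI[OF z])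
        ultimately show "f (i - e) X = f (i - e) (A i)" by simp
      qed
      then show ?thesis by (intro Q.trivial_quotient[of "A i"]) blast
    qed
    then show ?thesis using Q.devissage_killed[OF k] by blast
  qed
qed

lemma coherent_comp: "finite_dieudonne (gr_comp H i)"
  and coherent_support: "finite {i. carrier (gr_comp H i) \<noteq> {\<zero>\<^bsub>gr_comp H i\<^esub>}}"
proof -
  obtain n where "has_filtration (\<lambda>Q. \<exists>e. elementary_I (shift e Q) \<or> elementary_II (shift e Q)) H n"
    using H unfolding coherent_def by auto
  then obtain Fil where fil: "Fil 0 = (\<lambda>i. {\<zero>\<^bsub>gr_comp H i\<^esub>}) \<and> Fil n = (\<lambda>i. carrier (gr_comp H i)) \<and>
     (\<forall>s\<le>n. graded_submodule (Fil s) H) \<and>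
     (\<forall>s<n. (\<forall>i. Fil s i \<subseteq> Fil (Suc s) i) \<and> (\<exists>e. elementary_I (shift e (gr_subquot H (Fil (Suc s)) (Fil s))) \<or>
      elementary_II (shift e (gr_subquot H (Fil (Suc s)) (Fil s)))))"
    unfolding has_filtration_def by (rule exE)
  then have Fil: "Fil 0 = (\<lambda>i. {\<zero>\<^bsub>gr_comp H i\<^esub>})" "Fil n = (\<lambda>i. carrier (gr_comp H i))"
    "s \<le> n \<Longrightarrow> graded_submodule (Fil s) H" "s < n \<Longrightarrow> Fil s i \<subseteq> Fil (Suc s) i"
    "s < n \<Longrightarrow> \<exists>e. elementary_I (shift e (gr_subquot H (Fil (Suc s)) (Fil s))) \<or>
      elementary_II (shift e (gr_subquot H (Fil (Suc s)) (Fil s)))" for s i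
    by auto
  have step: "step (Fil s) (Fil (Suc s))" if s: "s < n" for s
  proof -
    obtain e where "elementary_I (shift e (gr_subquot H (Fil (Suc s)) (Fil s))) \<or>
      elementary_II (shift e (gr_subquot H (Fil (Suc s)) (Fil s)))" using Fil(5)[OF s] by blast
    then show ?thesis using s by (intro step_elementary Fil(3,4)) auto
  qed
  have "perfect_dieudonne.finite_rank_sub (gr_comp H i) (Fil s i) \<and> perfect_dieudonne.Ver_nil_sub (gr_comp H i) (Fil s i)"
    if "s \<le> n" for s
    using that
  proof (induction s)
    case 0
    interpret perfect_dieudonne "gr_comp H i" by (rule comp_perfect)
    show ?case unfolding Fil(1) using finite_rank_zero Ver_nil_zero by simp
  next
    case (Suc s)
    then show ?case using step[of s] unfolding step_def by auto
  qed
  from this[OF order_refl] show "finite_dieudonne (gr_comp H i)"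
    unfolding Fil(2) by (intro perfect_dieudonne.finite_dieudonneI comp_perfect) auto
  have "finite {i. \<not> Fil s i \<subseteq> {\<zero>\<^bsub>gr_comp H i\<^esub>}}" if "s \<le> n" for s
    using that
  proof (induction s)
    case (Suc s)
    obtain e where "\<And>i. i \<notin> {e, e + 1} \<Longrightarrow> Fil (Suc s) i \<subseteq> Fil s i"
      using step[of s] Suc.prems unfolding step_def by auto
    then have "{i. \<not> Fil (Suc s) i \<subseteq> {\<zero>\<^bsub>gr_comp H i\<^esub>}} \<subseteq> {i. \<not> Fil s i \<subseteq> {\<zero>\<^bsub>gr_comp H i\<^esub>}} \<union> {e, e + 1}" by blast
    moreover have "finite ({i. \<not> Fil s i \<subseteq> {\<zero>\<^bsub>gr_comp H i\<^esub>}} \<union> {e, e + 1})" using Suc by simp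
    ultimately show ?case by (rule finite_subset)
  qed (simp add: Fil(1))
  then have "finite {i. \<not> Fil n i \<subseteq> {\<zero>\<^bsub>gr_comp H i\<^esub>}}" by simp
  then show "finite {i. carrier (gr_comp H i) \<noteq> {\<zero>\<^bsub>gr_comp H i\<^esub>}}"
    unfolding Fil(2)
  proof (rule rev_finite_subset, intro subsetI, elim CollectE, intro CollectI notI)
    fix i assume i: "carrier (gr_comp H i) \<noteq> {\<zero>\<^bsub>gr_comp H i\<^esub>}" "carrier (gr_comp H i) \<subseteq> {\<zero>\<^bsub>gr_comp H i\<^esub>}"
    interpret perfect_dieudonne "gr_comp H i" by (rule comp_perfect)
    show False using i M.zero_closed by blast
  qed
qed

end

section \<open>The weighted sum\<close>

context
  fixes H :: "(('k::field_prime_char) witt, 'm) graded_module"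
  assumes perfect: "surj (\<lambda>x::'k. x ^ CHAR('k))" and H: "coherent H"
begin

text \<open>Both terms of the domino vanish, the second because \<open>d\<close> starts from the
  zero module. Since \<open>domino_num\<close> is a \<open>THE\<close>, longer filtrations must be
  excluded too: degree 0 of \<open>U_l\<close> has more than one element, so it is not a subquotient
  of zero.\<close>

lemma domino_num_trivial:
  assumes triv: "carrier (gr_comp H i) = {\<zero>\<^bsub>gr_comp H i\<^esub>}"
  shows "domino_num i H = 0"
proof -
  let ?z = "\<lambda>n. {\<zero>\<^bsub>gr_comp H (i + n)\<^esub>}" and ?D = "gr_subquot (shift i H) (\<lambda>n. {\<zero>\<^bsub>gr_comp H (i + n)\<^esub>}) (\<lambda>n. {\<zero>\<^bsub>gr_comp H (i + n)\<^esub>})"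
  have pd: "perfect_dieudonne (gr_comp H j)" for j by (rule comp_perfect[OF perfect H])
  have dhom: "gr_diff H j \<in> LinearCombinations.module_hom witt_ring (gr_comp H j) (gr_comp H (j + 1))" for j
    using H raynaud_module.diff_hom unfolding coherent_def by blast
  have d0: "gr_diff H j \<zero>\<^bsub>gr_comp H j\<^esub> = \<zero>\<^bsub>gr_comp H (j + 1)\<^esub>" for j
  proof -
    interpret A: perfect_dieudonne "gr_comp H j" by (rule pd)
    interpret B: perfect_dieudonne "gr_comp H (j + 1)" by (rule pd)
    interpret h: mod_hom witt_ring "gr_comp H j" "gr_comp H (j + 1)" "gr_diff H j"
      by unfold_locales (rule dhom)
    show ?thesis by (rule h.f0_is_0)
  qed
  have V0: "(Ver (gr_comp H j) ^^ n) \<zero>\<^bsub>gr_comp H j\<^esub> = \<zero>\<^bsub>gr_comp H j\<^esub>"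
    and F0: "(Frob (gr_comp H j) ^^ n) \<zero>\<^bsub>gr_comp H j\<^esub> = \<zero>\<^bsub>gr_comp H j\<^esub>" for j n
  proof -
    interpret A: perfect_dieudonne "gr_comp H j" by (rule pd)
    show "(Ver (gr_comp H j) ^^ n) \<zero>\<^bsub>gr_comp H j\<^esub> = \<zero>\<^bsub>gr_comp H j\<^esub>"
      "(Frob (gr_comp H j) ^^ n) \<zero>\<^bsub>gr_comp H j\<^esub> = \<zero>\<^bsub>gr_comp H j\<^esub>"
      by (induction n) simp_all
  qed
  have zc: "\<zero>\<^bsub>gr_comp H j\<^esub> \<in> carrier (gr_comp H j)" for j
  proof -
    interpret A: perfect_dieudonne "gr_comp H j" by (rule pd)
    show ?thesis by simp
  qed
  have "Ver_minus_infty_Z H i = {\<zero>\<^bsub>gr_comp H i\<^esub>}"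
    unfolding Ver_minus_infty_Z_def triv by (auto simp: V0 d0)
  moreover have "Frob_infty_B H (i + 1) = {\<zero>\<^bsub>gr_comp H (i + 1)\<^esub>}"
    unfolding Frob_infty_B_def using zc by (auto simp: triv d0 F0)
  ultimately have dom: "domino_of i H = ?D"
    unfolding domino_of_def using triv by (intro arg_cong2[of _ _ _ _ "gr_subquot (shift i H)"] ext) auto
  have sub0: "LinearCombinations.submodule witt_ring {\<zero>\<^bsub>gr_comp H j\<^esub>} (gr_comp H j)" for j
  proof -
    interpret A: perfect_dieudonne "gr_comp H j" by (rule pd)
    show ?thesis by unfold_locales auto
  qed
  have sq: "dieudonne_subquotient (gr_comp H j) {\<zero>\<^bsub>gr_comp H j\<^esub>} {\<zero>\<^bsub>gr_comp H j\<^esub>}" for j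
    by (intro dieudonne_subquotient.intro pd dieudonne_subquotient_axioms.intro sub0 subset_refl)
  have comp: "gr_comp ?D n = fv_subquot (gr_comp H (i + n)) (?z n) (?z n)" for n
    by (simp add: gr_subquot_def shift_def)
  have coset: "{\<zero>\<^bsub>gr_comp H j\<^esub>} +>\<^bsub>gr_comp H j\<^esub> \<zero>\<^bsub>gr_comp H j\<^esub> = {\<zero>\<^bsub>gr_comp H j\<^esub>}" for j
  proof -
    interpret A: perfect_dieudonne "gr_comp H j" by (rule pd)
    show ?thesis by (simp add: a_r_coset_def')
  qed
  have car: "carrier (gr_comp ?D n) = {\<zero>\<^bsub>gr_comp ?D n\<^esub>}" and zero: "\<zero>\<^bsub>gr_comp ?D n\<^esub> = ?z n"
    and Fr: "Frob (gr_comp ?D n) (?z n) = ?z n" and Ve: "Ver (gr_comp ?D n) (?z n) = ?z n"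
    and di: "gr_diff ?D n (?z n) = ?z (n + 1)" for n
    using F0[of 1 "i + n"] V0[of 1 "i + n"] coset[of "i + n"] coset[of "i + n + 1"] d0[of "i + n"]
    unfolding comp by (simp_all add: fv_subquot_def gr_subquot_def shift_def add.assoc)
  have "graded_submodule (\<lambda>n. {\<zero>\<^bsub>gr_comp ?D n\<^esub>}) ?D"
    unfolding graded_submodule_def
  proof (intro allI conjI)
    fix n
    interpret Q: dieudonne_subquotient "gr_comp H (i + n)" "?z n" "?z n" by (rule sq)
    interpret Qm: Module.module witt_ring "gr_comp ?D n" unfolding comp by (rule Q.Q_module)
    show "LinearCombinations.submodule witt_ring {\<zero>\<^bsub>gr_comp ?D n\<^esub>} (gr_comp ?D n)"
      by unfold_locales auto
  qed (simp_all only: zero image_insert image_empty Fr Ve di subset_refl)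
  then have "has_filtration elementary_II ?D 0"
    unfolding has_filtration_def by (intro exI[of _ "\<lambda>_ n. {\<zero>\<^bsub>gr_comp ?D n\<^esub>}"]) (simp add: car)
  moreover have "m = 0" if m: "has_filtration elementary_II ?D m" for m
  proof (rule ccontr)
    assume "m \<noteq> 0"
    then obtain Fil where Fil: "\<forall>s\<le>m. graded_submodule (Fil s) ?D"
      "elementary_II (gr_subquot ?D (Fil (Suc 0)) (Fil 0))" "Suc 0 \<le> m"
      using m unfolding has_filtration_def by force
    obtain l f where f: "\<And>j. bij_betw (f j) (carrier (gr_comp (gr_subquot ?D (Fil (Suc 0)) (Fil 0)) j)) (carrier (U_comp l j :: ('k witt, _) fv_module))"
      using elementary_II_E[OF Fil(2)] by metis
    have "graded_submodule (Fil (Suc 0)) ?D" using Fil(1,3) by blast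
    then have "LinearCombinations.submodule witt_ring (Fil (Suc 0) 0) (gr_comp ?D 0)"
      unfolding graded_submodule_def by (elim allE[of _ 0] conjE)
    then have "Fil (Suc 0) 0 \<subseteq> carrier (gr_comp ?D 0)" by (rule LinearCombinations.submodule.subset)
    then have "Fil (Suc 0) 0 \<subseteq> {\<zero>\<^bsub>gr_comp ?D 0\<^esub>}" by (simp only: car)
    then have "\<exists>X. carrier (gr_comp (gr_subquot ?D (Fil (Suc 0)) (Fil 0)) 0) \<subseteq> {X}"
      by (auto simp: gr_subquot_def fv_subquot_def)
    then obtain X where X: "carrier (gr_comp (gr_subquot ?D (Fil (Suc 0)) (Fil 0)) 0) \<subseteq> {X}" by blast
    have U: "u = f 0 X" if u: "u \<in> carrier (U_comp l 0 :: ('k witt, _) fv_module)" for u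
      using u X unfolding bij_betw_imp_surj_on[OF f[of 0], symmetric] by auto
    have "(\<lambda>n. 0) = f 0 X" "(\<lambda>n. if n = 0 then 1 else 0) = f 0 X"
      by (rule U, simp add: U_comp_def)+
    then have "(\<lambda>n. 0) = (\<lambda>n::int. if n = 0 then 1 else (0 :: 'k))" by (rule trans[OF _ sym])
    then show False by (metis zero_neq_one)
  qed
  ultimately show ?thesis unfolding domino_num_def dom by (intro the_equality)
qed

end

text \<open>Translation along an antidiagonal keeps \<open>i + j\<close> and thus the sign.\<close>

lemma sum_shift:
  fixes h :: "int \<Rightarrow> int \<Rightarrow> rat"
  shows "Sum_any (\<lambda>(i, j). h i j) = Sum_any (\<lambda>(i, j). h (i + a) (j - a))"
proof (rule Sum_any.reindex_cong)
  show "bij (\<lambda>(i::int, j::int). (i + a, j - a))"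
    by (rule bij_betw_byWitness[where f' = "\<lambda>(i, j). (i - a, j + a)"]) auto
qed auto

lemma finite_shift:
  fixes t :: "int \<Rightarrow> int \<Rightarrow> 'a::zero"
  assumes "finite {(i, j). t i j \<noteq> 0}"
  shows "finite {(i, j). t (i + a) (j + b) \<noteq> 0}"
proof -
  have "{(i, j). t (i + a) (j + b) \<noteq> 0} = (\<lambda>(i, j). (i - a, j - b)) ` {(i, j). t i j \<noteq> 0}"
    by (force simp: image_iff)
  then show ?thesis using assms by simp
qed

text \<open>Summation by parts along the antidiagonals \<open>i + j = const\<close>: the second difference of
  \<open>i \<mapsto> (r - i)\<^sup>+\<close> is supported at \<open>i = r - 1\<close>.\<close>

lemma weighted_sum:
  fixes T v f :: "int \<Rightarrow> int \<Rightarrow> int" and r :: int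
  assumes fin: "finite {(i, j). T i j \<noteq> 0}" "finite {(i, j). v i j \<noteq> 0}" "finite {(i, j). f i j \<noteq> 0}"
  shows "Sum_any (\<lambda>(i, j). if i \<le> r then (-1) powi (i + j) * of_int (r - i) *
      of_int (v i j + f (i - 1) (j + 1) + T i j - 2 * T (i - 1) (j + 1) + T (i - 2) (j + 2)) else (0 :: rat)) =
    Sum_any (\<lambda>j. (-1) powi (j - 1) * of_int (T (r - 1) (j - r))) +
    Sum_any (\<lambda>(i, j). (-1) powi (i + j) * of_int (max (r - i) 0 * v i j + max (r - i - 1) 0 * f i j))"
proof -
  define s :: "int \<Rightarrow> rat" where "s n = (-1) powi n" for n
  \<comment> \<open>The weight \<open>(r - i)^+\<close> replaces the condition
    \<open>i \<le> r\<close> and is defined for all \<open>i\<close>, so the sums can be shifted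
    freely.\<close>
  define g where "g i = max (r - i) 0" for i
  let ?S = "\<lambda>h. Sum_any (\<lambda>(i, j). (h :: int \<Rightarrow> int \<Rightarrow> rat) i j)"
  have fin_prod: "finite {ij. (case ij of (i, j) \<Rightarrow> s (i + j) * of_int (c i * t i j)) \<noteq> 0}"
    if "finite {(i, j). t i j \<noteq> 0}" for c :: "int \<Rightarrow> int" and t :: "int \<Rightarrow> int \<Rightarrow> int"
    using that by (rule rev_finite_subset) auto
  have add: "?S (\<lambda>i j. s (i + j) * of_int (c i * t i j)) + ?S (\<lambda>i j. s (i + j) * of_int (c' i * t' i j)) =
      Sum_any (\<lambda>ij. (case ij of (i, j) \<Rightarrow> s (i + j) * of_int (c i * t i j)) + (case ij of (i, j) \<Rightarrow> s (i + j) * of_int (c' i * t' i j)))"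
    if "finite {(i, j). t i j \<noteq> 0}" "finite {(i, j). t' i j \<noteq> 0}" for c c' :: "int \<Rightarrow> int" and t t' :: "int \<Rightarrow> int \<Rightarrow> int"
    using that by (intro Sum_any.distrib[symmetric] fin_prod)
  have fT: "finite {(i, j). T (i - 1) (j + 1) \<noteq> 0}" "finite {(i, j). T (i - 2) (j + 2) \<noteq> 0}"
    "finite {(i, j). f (i - 1) (j + 1) \<noteq> 0}"
    using finite_shift[OF fin(1), of "- 1" 1] finite_shift[OF fin(1), of "- 2" 2] finite_shift[OF fin(3), of "- 1" 1] by simp_all
  have sh: "?S (\<lambda>i j. s (i + j) * of_int (g i * t (i - a) (j + a))) = ?S (\<lambda>i j. s (i + j) * of_int (g (i + a) * t i j))" for t a
    using sum_shift[of "\<lambda>i j. s (i + j) * of_int (g i * t (i - a) (j + a))" a] by simp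
  have lhs: "Sum_any (\<lambda>(i, j). if i \<le> r then (-1) powi (i + j) * of_int (r - i) *
      of_int (v i j + f (i - 1) (j + 1) + T i j - 2 * T (i - 1) (j + 1) + T (i - 2) (j + 2)) else (0 :: rat)) =
    ?S (\<lambda>i j. s (i + j) * of_int (g i * v i j)) + ?S (\<lambda>i j. s (i + j) * of_int (g i * f (i - 1) (j + 1))) +
    (?S (\<lambda>i j. s (i + j) * of_int (g i * T i j)) + ?S (\<lambda>i j. s (i + j) * of_int ((- 2 * g i) * T (i - 1) (j + 1))) +
    ?S (\<lambda>i j. s (i + j) * of_int (g i * T (i - 2) (j + 2))))"
  proof -
    let ?L = "\<lambda>c t. (\<lambda>(i::int, j::int). s (i + j) * of_int (c i * (t i j :: int)))"
    have A: "Sum_any (\<lambda>ij. ?L g v ij + ?L g (\<lambda>i j. f (i - 1) (j + 1)) ij +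
        (?L g T ij + ?L (\<lambda>i. - 2 * g i) (\<lambda>i j. T (i - 1) (j + 1)) ij + ?L g (\<lambda>i j. T (i - 2) (j + 2)) ij)) =
      Sum_any (?L g v) + Sum_any (?L g (\<lambda>i j. f (i - 1) (j + 1))) +
        (Sum_any (?L g T) + Sum_any (?L (\<lambda>i. - 2 * g i) (\<lambda>i j. T (i - 1) (j + 1))) + Sum_any (?L g (\<lambda>i j. T (i - 2) (j + 2))))"
    proof -
      note fp = fin_prod[OF fin(1)] fin_prod[OF fin(2)] fin_prod[OF fin(3)] fin_prod[OF fT(1)] fin_prod[OF fT(2)] fin_prod[OF fT(3)]
      have u: "finite {ij. a ij + b ij \<noteq> 0}" if "finite {ij. a ij \<noteq> 0}" "finite {ij. b ij \<noteq> 0}" for a b :: "int \<times> int \<Rightarrow> rat"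
        by (rule finite_subset[OF _ finite_UnI[OF that]]) auto
      show ?thesis by (subst Sum_any.distrib, (intro u fp)+)+ simp
    qed
    have B: "(case ij of (i, j) \<Rightarrow> if i \<le> r then (-1) powi (i + j) * of_int (r - i) *
      of_int (v i j + f (i - 1) (j + 1) + T i j - 2 * T (i - 1) (j + 1) + T (i - 2) (j + 2)) else (0 :: rat)) =
      ?L g v ij + ?L g (\<lambda>i j. f (i - 1) (j + 1)) ij +
        (?L g T ij + ?L (\<lambda>i. - 2 * g i) (\<lambda>i j. T (i - 1) (j + 1)) ij + ?L g (\<lambda>i j. T (i - 2) (j + 2)) ij)" for ij
      by (cases ij) (simp add: s_def g_def algebra_simps)
    show ?thesis by (rule trans[OF Sum_any.cong[OF B] A])
  qed
  have sT: "?S (\<lambda>i j. s (i + j) * of_int ((- 2 * g i) * T (i - 1) (j + 1))) = ?S (\<lambda>i j. s (i + j) * of_int (g i * ((\<lambda>i j. - 2 * T i j) (i - 1) (j + 1))))"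
    by (rule Sum_any.cong) (auto simp: algebra_simps)
  have f2: "finite {(i, j). - 2 * T i j \<noteq> 0}" using fin(1) by simp
  have "?S (\<lambda>i j. s (i + j) * of_int (g i * T i j)) + ?S (\<lambda>i j. s (i + j) * of_int ((- 2 * g i) * T (i - 1) (j + 1))) +
      ?S (\<lambda>i j. s (i + j) * of_int (g i * T (i - 2) (j + 2))) =
    ?S (\<lambda>i j. s (i + j) * of_int (g i * T i j)) + ?S (\<lambda>i j. s (i + j) * of_int (g (i + 1) * (- 2 * T i j))) +
      ?S (\<lambda>i j. s (i + j) * of_int (g (i + 2) * T i j))"
    unfolding sT sh[of "\<lambda>i j. - 2 * T i j" 1] sh[of T 2] ..
  also have "\<dots> = Sum_any (\<lambda>(i, j). s (i + j) * of_int ((g i - 2 * g (i + 1) + g (i + 2)) * T i j))"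
  proof -
    let ?L = "\<lambda>c t. (\<lambda>(i::int, j::int). s (i + j) * of_int (c i * (t i j :: int)))"
    have u: "finite {ij. a ij + b ij \<noteq> 0}" if "finite {ij. a ij \<noteq> 0}" "finite {ij. b ij \<noteq> 0}" for a b :: "int \<times> int \<Rightarrow> rat"
      by (rule finite_subset[OF _ finite_UnI[OF that]]) auto
    have A: "Sum_any (\<lambda>ij. ?L g T ij + ?L (\<lambda>i. g (i + 1)) (\<lambda>i j. - 2 * T i j) ij + ?L (\<lambda>i. g (i + 2)) T ij) =
        Sum_any (?L g T) + Sum_any (?L (\<lambda>i. g (i + 1)) (\<lambda>i j. - 2 * T i j)) + Sum_any (?L (\<lambda>i. g (i + 2)) T)"
      by (subst Sum_any.distrib, (intro u fin_prod fin(1) f2)+)+ simp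
    have B: "?L g T ij + ?L (\<lambda>i. g (i + 1)) (\<lambda>i j. - 2 * T i j) ij + ?L (\<lambda>i. g (i + 2)) T ij =
      (case ij of (i, j) \<Rightarrow> s (i + j) * of_int ((g i - 2 * g (i + 1) + g (i + 2)) * T i j))" for ij
      by (cases ij) (simp add: algebra_simps)
    show ?thesis by (rule trans[OF A[symmetric] Sum_any.cong[OF B]])
  qed
  also have "\<dots> = Sum_any (\<lambda>(i, j). if i = r - 1 then s (i + j) * of_int (T i j) else 0)"
    by (rule Sum_any.cong) (auto simp: g_def max_def)
  also have "\<dots> = Sum_any (\<lambda>j. s (r - 1 + j) * of_int (T (r - 1) j))"
  proof -
    define A where "A = snd ` {(i, j). T i j \<noteq> 0}"
    have A: "finite A" unfolding A_def using fin(1) by simp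
    have T0: "j \<in> A" if "T i j \<noteq> 0" for i j using that unfolding A_def by force
    have "Sum_any (\<lambda>(i, j). if i = r - 1 then s (i + j) * of_int (T i j) else 0) =
        (\<Sum>(i, j)\<in>{r - 1} \<times> A. if i = r - 1 then s (i + j) * of_int (T i j) else 0)"
      by (rule Sum_any.expand_superset) (use A in \<open>auto intro: T0 split: if_splits\<close>)
    also have "\<dots> = (\<Sum>j\<in>A. s (r - 1 + j) * of_int (T (r - 1) j))"
      by (subst sum.cartesian_product[symmetric]) simp
    also have "\<dots> = Sum_any (\<lambda>j. s (r - 1 + j) * of_int (T (r - 1) j))"
      by (rule Sum_any.expand_superset[symmetric]) (use A in \<open>auto intro: T0\<close>)
    finally show ?thesis .
  qed
  \<comment> \<open>Substituting \<open>j - r\<close> for \<open>j\<close> turns the sign exponent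
    \<open>r - 1 + j\<close> into \<open>j - 1\<close>.\<close>
  also have "\<dots> = Sum_any (\<lambda>j. s (j - 1) * of_int (T (r - 1) (j - r)))"
  proof (rule Sum_any.reindex_cong)
    show "bij (\<lambda>j. j - r)" by (rule bij_betw_byWitness[where f' = "\<lambda>j. j + r"]) auto
  qed (auto simp: fun_eq_iff)
  finally have T: "?S (\<lambda>i j. s (i + j) * of_int (g i * T i j)) + ?S (\<lambda>i j. s (i + j) * of_int ((- 2 * g i) * T (i - 1) (j + 1))) +
      ?S (\<lambda>i j. s (i + j) * of_int (g i * T (i - 2) (j + 2))) = Sum_any (\<lambda>j. s (j - 1) * of_int (T (r - 1) (j - r)))" .
  \<comment> \<open>Moving the Frobenius contribution of degree \<open>i - 1\<close> back to degree
    \<open>i\<close> lowers its weight by one, which matches the factor \<open>max (c - 1) 0\<close>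
    in the slope sum.\<close>
  have "?S (\<lambda>i j. s (i + j) * of_int (g i * v i j)) + ?S (\<lambda>i j. s (i + j) * of_int (g i * f (i - 1) (j + 1))) =
    ?S (\<lambda>i j. s (i + j) * of_int (g i * v i j)) + ?S (\<lambda>i j. s (i + j) * of_int (g (i + 1) * f i j))"
    unfolding sh ..
  also have "\<dots> = Sum_any (\<lambda>(i, j). s (i + j) * of_int (max (r - i) 0 * v i j + max (r - i - 1) 0 * f i j))"
    unfolding add[OF fin(2,3)]
    by (rule Sum_any.cong) (auto simp: g_def algebra_simps)
  finally show ?thesis unfolding lhs T by (simp add: s_def)
qed

theorem theorem2p3:
  fixes M :: "(('k::field_prime_char) witt, 'm) gr_complex" and r :: int
  assumes perfect: "surj (\<lambda>x::'k. x ^ CHAR('k))"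
    and Dbc: "in_Dbc M"
  shows "Sum_any (\<lambda>(i, j). if i \<le> r
           then (-1) powi (i + j) * of_int (r - i) * of_int (hodge_witt i j M) else 0) = e_num r M"
proof -
  define N where "N i j = gr_comp (cohomology j M) i" for i j
  have coh: "coherent (cohomology j M)" for j using Dbc by (simp add: in_Dbc_def)
  have fd: "finite_dieudonne (N i j)" for i j unfolding N_def by (rule coherent_comp[OF perfect coh])
  define I where "I j = {i. carrier (N i j) \<noteq> {\<zero>\<^bsub>N i j\<^esub>}}" for j
  have I: "finite (I j)" for j unfolding I_def N_def by (rule coherent_support[OF perfect coh])
  obtain b where b: "\<And>i j. \<bar>j\<bar> > b \<Longrightarrow> carrier (gr_comp (cx_obj M j) i) = {\<zero>\<^bsub>gr_comp (cx_obj M j) i\<^esub>}"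
    using Dbc unfolding in_Dbc_def bounded_cx_def by blast
  have I0: "I j = {}" if "\<bar>j\<bar> > b" for j
  proof -
    have "carrier (N i j) = {\<zero>\<^bsub>N i j\<^esub>}" for i
    proof -
      let ?B = "{x \<in> carrier (gr_comp (cx_obj M j) i). cx_diff M j i x = \<zero>\<^bsub>gr_comp (cx_obj M (j + 1)) i\<^esub>}"
      let ?A = "cx_diff M (j - 1) i ` carrier (gr_comp (cx_obj M (j - 1)) i)"
      interpret N: finite_dieudonne "N i j" by (rule fd)
      have "carrier (N i j) = (\<lambda>x. ?A +>\<^bsub>gr_comp (cx_obj M j) i\<^esub> x) ` ?B"
        by (simp add: N_def cohomology_def gr_subquot_def fv_subquot_def)
      moreover have "?B \<subseteq> {\<zero>\<^bsub>gr_comp (cx_obj M j) i\<^esub>}" using b[OF that, of i] by auto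
      ultimately show ?thesis using N.M.zero_closed by auto
    qed
    then show ?thesis by (simp add: I_def)
  qed
  \<comment> \<open>The finite support: finitely many cohomological degrees by boundedness, and
    finitely many internal degrees in each of them by coherence.\<close>
  define Box where "Box = (\<Union>j\<in>{- b..b}. (\<lambda>i. (i, j)) ` I j)"
  have Box: "finite Box" unfolding Box_def using I by simp
  have out: "carrier (N i j) = {\<zero>\<^bsub>N i j\<^esub>}" if "(i, j) \<notin> Box" for i j
  proof (cases "\<bar>j\<bar> > b")
    case True
    then show ?thesis using I0 by (auto simp: I_def)
  next
    case False
    then have "(i, j) \<in> Box" if "i \<in> I j" unfolding Box_def using that by (intro UN_I[of j] imageI) auto
    then have "i \<notin> I j" using that by blast
    then show ?thesis by (simp add: I_def)
  qed
  define T where "T i j = T_num i j M" for i j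
  define v f where "v i j = int (dim_mod_tors_Ver (N i j))" and "f i j = int (dim_mod_tors_Frob (N i j))" for i j
  have "T i j = 0" if "(i, j) \<notin> Box" for i j
    using domino_num_trivial[OF perfect coh] out[OF that] by (simp add: T_def T_num_def N_def)
  then have fT: "finite {(i, j). T i j \<noteq> 0}" by (intro finite_subset[OF _ Box]) auto
  have "v i j = 0" "f i j = 0" if "(i, j) \<notin> Box" for i j
    using finite_dieudonne.slopes_trivial[OF fd out[OF that]] by (simp_all add: v_def f_def)
  then have fvf: "finite {(i, j). v i j \<noteq> 0}" "finite {(i, j). f i j \<noteq> 0}"
    by (intro finite_subset[OF _ Box]; auto)+
  \<comment> \<open>This is \<open>slope_sum\<close> for \<open>c = r - i\<close>; the sign is
    constant on each inner sum.\<close>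
  have "(\<Sum>q\<in>#{#q \<in># cx_slopes i j M. q \<le> of_int (r - i)#}. (-1) powi (i + j) * (of_int (r - i) - q)) =
      (-1) powi (i + j) * of_int (max (r - i) 0 * v i j + max (r - i - 1) 0 * f i j)" for i j
    using finite_dieudonne.slope_sum[OF fd, of "r - i" i j]
    by (simp only: cx_slopes_def N_def v_def f_def sum_mset_distrib_left[symmetric])
  then have "Sum_any (\<lambda>(i, j). \<Sum>q\<in>#{#q \<in># cx_slopes i j M. q \<le> of_int (r - i)#}.
        (-1) powi (i + j) * (of_int (r - i) - q)) =
      Sum_any (\<lambda>(i, j). (-1) powi (i + j) * of_int (max (r - i) 0 * v i j + max (r - i - 1) 0 * f i j))"
    by (intro Sum_any.cong) auto
  moreover have "hodge_witt i j M = v i j + f (i - 1) (j + 1) + T i j - 2 * T (i - 1) (j + 1) + T (i - 2) (j + 2)" for i j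
    by (simp add: hodge_witt_def m_num_def v_def f_def T_def N_def)
  ultimately show ?thesis
    unfolding e_num_def using weighted_sum[OF fT fvf, of r] by (simp only: T_def)
qed

end
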